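(* Let $U'$ be an open, relatively compact subset of $U$, let $T_0\in(0,T)$ and $s\ge2$. Then there is a constant $C>0$, depending only on $N$, the $a_i$'s, the $\alpha_i$'s, $U$, $U'$, $s$ (and in particular independent of $T$, $T_0$, $\phi$, $\mathcal R$, $\chi_*$, $M_*$, $\mathcal Z$, $u$, $\Psi$), such that for all $t\in[T_0,T]$ the quantity $\displaystyle\phi\int_{U'}|\nabla u(x,t)|^sdx$ is bounded above by $C$ times $$\begin{cases}\chi_*^{(4+a)^2}(1+T_0^{-1})^{1+a}(M_*+1)^{2(3+a)}\big\{M_*^a(M_*+1)^{2+a}\mathcal N_*+\mathcal N_0\big\}&\text{if }s=2,\\ \chi_*^{(4+a)(s+a+2)}(1+T_0^{-1})^{s+a-1}M_*^{s-2}(M_*+1)^{3s+4a+2}\mathcal N_*&\text{if }2<s\le4-a,\\ \chi_*^{(4+a)(s+a+4)}(1+T_0^{-1})^{s+a+1}M_*^{s-2}(M_*+1)^{3s+4a+10}\mathcal N_*&\text{if }4-a<s\le4,\\ \chi_*^{(4+a)(s+a+4)}(1+T_0^{-1})^{s+a+1}M_*^2(M_*+1)^{4s+4a+6}\mathcal N_*&\text{if }s>4.\end{cases}$$ Consequently, for all $s\ge2$ and $t\in[T_0,T]$, $$\phi\int_{U'}|\nabla u(x,t)|^sdx\le C\chi_*^{(4+a)(s+a+4)}(1+T_0^{-1})^{s+a+1}(M_*+1)^{4(s+a+2)}\mathcal N_*.$$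
   Context: $N\ge1$ is an integer, $0=\alpha_0<\alpha_1<\dots<\alpha_N$ are real numbers, $a_0,\dots,a_N>0$ are constants, and $g(s)=\sum_{i=0}^N a_is^{\alpha_i}$ for $s\ge0$. $\vec k\in\mathbb R^3$ is a fixed unit vector, $\mathbf J$ is the $3\times3$ matrix with $\mathbf Jx=\vec k\times x$. Constants: $0<\phi\le1$, $\mathcal G>0$, $\Omega\ge0$, $\rho_*\ge0$, and $\mathcal R=2\rho_*\Omega/\phi$. The function $F:\mathbb R^3\to\mathbb R^3$, $F(v)=g(|v|)v+\mathcal R\,\mathbf Jv$, is a $C^1$ bijection whose inverse $X=F^{-1}$ is also $C^1$. $a=\frac{\alpha_N}{1+\alpha_N}\in(0,1)$. $U\subset\mathbb R^3$ is a nonempty open bounded set with $C^1$ boundary $\Gamma$; $T>0$; $e_0:\mathbb R\to\mathbb R^3$ is smooth with $|e_0(t)|=1$, and $\mathcal Z(x,t)=-\mathcal Ge_0(t)+\Omega^2\mathbf J^2x$. Put $r_0=\max\{|x|:x\in\bar U\}$, $\Omega_*=\Omega\sqrt{r_0/\mathcal G}$, $d_*=\sqrt{\mathcal G/r_0}\,\max\{2\rho_*/\phi,\sqrt{r_0},2^{1/4}\}$ and $\chi_*=\max\{1,d_*(1+\Omega_* )\}$. $u\in C^{2,1}_{x,t}(\bar U\times(0,T])\cap C(\bar U\times[0,T])$ (not necessarily non-negative) solves $\phi u_t=\nabla\cdot(X(\nabla u+u^2\mathcal Z))$ in $U\times(0,T]$, $u(x,0)=u_0(x)$ in $U$, $u=\psi$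 on $\Gamma\times(0,T]$. $\Psi\in C^1(\bar U\times[0,T])$ is an extension of $\psi$, i.e. $\Psi=\psi$ on $\Gamma\times(0,T]$, and $\bar u_0=u_0-\Psi(\cdot,0)$. Spatial norms are over $U$. Quantities: $M_*=\sup_{U\times[0,T]}|u|$, $\mathcal E_*=\int_0^T\!\int_U(|\nabla\Psi|^2+\phi|\Psi_t|^2+\phi\Psi^2)dxdt$, $\mathcal N_0=\phi\|\bar u_0\|_{L^2}^2+TM_*^2+\mathcal E_*$, $\mathcal N_*=\phi\|\bar u_0\|_{L^2}^2+T+\mathcal E_*$. *)

theory Defs
  imports "HOL-Analysis.Analysis"
begin

subsection \<open>Differential operators and regularity classes\<close>

definition grad :: "(real^3 \<Rightarrow> real) \<Rightarrow> real^3 \<Rightarrow> real^3" where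
  "grad f x = (\<chi> i. frechet_derivative f (at x) (axis i 1))"

definition divergence :: "(real^3 \<Rightarrow> real^3) \<Rightarrow> real^3 \<Rightarrow> real" where
  "divergence V x = (\<Sum>i\<in>UNIV. frechet_derivative V (at x) (axis i 1) $ i)"

text \<open>Time derivative relative to the time interval \<open>I\<close>: two-sided in the interior of \<open>I\<close>,
  one-sided at an endpoint belonging to \<open>I\<close>.\<close>

definition time_deriv :: "real set \<Rightarrow> (real^3 \<Rightarrow> real \<Rightarrow> real) \<Rightarrow> real^3 \<Rightarrow> real \<Rightarrow> real" where
  "time_deriv I f x t = vector_derivative (\<lambda>\<tau>. f x \<tau>) (at t within I)"

text \<open>The classes \<open>C\<^sup>1\<close> and \<open>C\<^sup>2\<^sup>,\<^sup>1\<close> (in \<open>(x,t)\<close>) of \<open>closure U \<times> I\<close>: the derivatives exist in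
  \<open>U \<times> I\<close> and, together with the function, extend continuously to \<open>closure U \<times> I\<close>.
  The functions \<open>p\<close>, \<open>H\<close>, \<open>q\<close> are these extensions of the spatial gradient, the spatial Hessian
  and the time derivative.\<close>

definition C1_closure :: "(real^3) set \<Rightarrow> real set \<Rightarrow> (real^3 \<Rightarrow> real \<Rightarrow> real) \<Rightarrow> bool" where
  "C1_closure U I f \<longleftrightarrow>
     continuous_on (closure U \<times> I) (\<lambda>(x, t). f x t) \<and>
     (\<exists>(p :: real^3 \<Rightarrow> real \<Rightarrow> real^3) (q :: real^3 \<Rightarrow> real \<Rightarrow> real).
        continuous_on (closure U \<times> I) (\<lambda>(x, t). p x t) \<and>
        continuous_on (closure U \<times> I) (\<lambda>(x, t). q x t) \<and>
        (\<forall>x\<in>U. \<forall>t\<in>I.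
           ((\<lambda>y. f y t) has_derivative (\<lambda>h. p x t \<bullet> h)) (at x) \<and>
           ((\<lambda>\<tau>. f x \<tau>) has_real_derivative q x t) (at t within I)))"

definition C21_closure :: "(real^3) set \<Rightarrow> real set \<Rightarrow> (real^3 \<Rightarrow> real \<Rightarrow> real) \<Rightarrow> bool" where
  "C21_closure U I f \<longleftrightarrow>
     continuous_on (closure U \<times> I) (\<lambda>(x, t). f x t) \<and>
     (\<exists>(p :: real^3 \<Rightarrow> real \<Rightarrow> real^3) (H :: real^3 \<Rightarrow> real \<Rightarrow> real^3^3)
       (q :: real^3 \<Rightarrow> real \<Rightarrow> real).
        continuous_on (closure U \<times> I) (\<lambda>(x, t). p x t) \<and>
        continuous_on (closure U \<times> I) (\<lambda>(x, t). H x t) \<and>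
        continuous_on (closure U \<times> I) (\<lambda>(x, t). q x t) \<and>
        (\<forall>x\<in>U. \<forall>t\<in>I.
           ((\<lambda>y. f y t) has_derivative (\<lambda>h. p x t \<bullet> h)) (at x) \<and>
           ((\<lambda>y. p y t) has_derivative (\<lambda>h. H x t *v h)) (at x) \<and>
           ((\<lambda>\<tau>. f x \<tau>) has_real_derivative q x t) (at t within I)))"

definition smooth_curve :: "(real \<Rightarrow> real^3) \<Rightarrow> bool" where
  "smooth_curve e \<longleftrightarrow>
     (\<exists>D :: nat \<Rightarrow> real \<Rightarrow> real^3.
        D 0 = e \<and> (\<forall>n t. (D n has_vector_derivative D (Suc n) t) (at t)))"

text \<open>Near each boundary point, \<open>U\<close> is, in suitably rotated coordinates, the part of the ball
  above the graph of a \<open>C\<^sup>1\<close> function of two variables.\<close>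

definition C1_boundary :: "(real^3) set \<Rightarrow> bool" where
  "C1_boundary U \<longleftrightarrow>
     (\<forall>x0\<in>frontier U. \<exists>r>0. \<exists>(Q :: real^3 \<Rightarrow> real^3) (\<gamma> :: real^2 \<Rightarrow> real) (\<gamma>' :: real^2 \<Rightarrow> real^2).
        orthogonal_transformation Q \<and>
        (\<forall>y. (\<gamma> has_derivative (\<lambda>h. \<gamma>' y \<bullet> h)) (at y)) \<and>
        continuous_on UNIV \<gamma>' \<and>
        U \<inter> ball x0 r = {x \<in> ball x0 r. Q x $ 3 > \<gamma> (vector [Q x $ 1, Q x $ 2])})"


subsection \<open>The rotating Forchheimer flow\<close>

text \<open>The term with \<open>i = 0\<close> is separated because \<open>\<alpha> 0 = 0\<close> and \<open>0 powr 0 = 0\<close> in the library,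
  whereas here \<open>s\<close> to the power \<open>0\<close> is \<open>1\<close> also at \<open>s = 0\<close>.\<close>

definition forch_g :: "nat \<Rightarrow> (nat \<Rightarrow> real) \<Rightarrow> (nat \<Rightarrow> real) \<Rightarrow> real \<Rightarrow> real" where
  "forch_g N A \<alpha> s = A 0 + (\<Sum>i=1..N. A i * s powr \<alpha> i)"

definition rot_J :: "real^3 \<Rightarrow> real^3^3" where
  "rot_J k = matrix (\<lambda>x. cross3 k x)"

definition rot_R :: "real \<Rightarrow> real \<Rightarrow> real \<Rightarrow> real" where
  "rot_R \<phi> \<Omega> \<rho> = 2 * \<rho> * \<Omega> / \<phi>"

definition flow_F ::
  "nat \<Rightarrow> (nat \<Rightarrow> real) \<Rightarrow> (nat \<Rightarrow> real) \<Rightarrow> real \<Rightarrow> real^3 \<Rightarrow> real^3 \<Rightarrow> real^3" where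
  "flow_F N A \<alpha> R k v = forch_g N A \<alpha> (norm v) *\<^sub>R v + R *\<^sub>R (rot_J k *v v)"

definition flow_X ::
  "nat \<Rightarrow> (nat \<Rightarrow> real) \<Rightarrow> (nat \<Rightarrow> real) \<Rightarrow> real \<Rightarrow> real^3 \<Rightarrow> real^3 \<Rightarrow> real^3" where
  "flow_X N A \<alpha> R k = inv (flow_F N A \<alpha> R k)"

definition accel_Z ::
  "real \<Rightarrow> real \<Rightarrow> real^3 \<Rightarrow> (real \<Rightarrow> real^3) \<Rightarrow> real^3 \<Rightarrow> real \<Rightarrow> real^3" where
  "accel_Z G \<Omega> k e0 x t = - (G *\<^sub>R e0 t) + \<Omega>\<^sup>2 *\<^sub>R ((rot_J k ** rot_J k) *v x)"

definition solves_ibvp ::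
  "(real^3) set \<Rightarrow> real \<Rightarrow> real \<Rightarrow> (real^3 \<Rightarrow> real^3) \<Rightarrow> (real^3 \<Rightarrow> real \<Rightarrow> real^3)
    \<Rightarrow> (real^3 \<Rightarrow> real) \<Rightarrow> (real^3 \<Rightarrow> real \<Rightarrow> real) \<Rightarrow> (real^3 \<Rightarrow> real \<Rightarrow> real) \<Rightarrow> bool" where
  "solves_ibvp U T \<phi> X Z u0 \<psi> u \<longleftrightarrow>
     C21_closure U {0<..T} u \<and>
     continuous_on (closure U \<times> {0..T}) (\<lambda>(x, t). u x t) \<and>
     (\<forall>x\<in>U. \<forall>t\<in>{0<..T}. \<phi> * time_deriv {0<..T} u x t =
        divergence (\<lambda>y. X (grad (\<lambda>z. u z t) y + (u y t)\<^sup>2 *\<^sub>R Z y t)) x) \<and>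
     (\<forall>x\<in>U. u x 0 = u0 x) \<and>
     (\<forall>x\<in>frontier U. \<forall>t\<in>{0<..T}. u x t = \<psi> x t)"


subsection \<open>Quantities in the estimates\<close>

text \<open>For bounded nonempty \<open>U\<close> this supremum over the compact set \<open>closure U\<close> is attained.\<close>

definition r_zero :: "(real^3) set \<Rightarrow> real" where
  "r_zero U = Sup (norm ` closure U)"

definition Omega_star :: "(real^3) set \<Rightarrow> real \<Rightarrow> real \<Rightarrow> real" where
  "Omega_star U G \<Omega> = \<Omega> * sqrt (r_zero U / G)"

definition d_star :: "(real^3) set \<Rightarrow> real \<Rightarrow> real \<Rightarrow> real \<Rightarrow> real" where
  "d_star U \<phi> G \<rho> =
     sqrt (G / r_zero U) * Max {2 * \<rho> / \<phi>, sqrt (r_zero U), 2 powr (1/4)}"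

definition chi_star :: "(real^3) set \<Rightarrow> real \<Rightarrow> real \<Rightarrow> real \<Rightarrow> real \<Rightarrow> real" where
  "chi_star U \<phi> G \<Omega> \<rho> = max 1 (d_star U \<phi> G \<rho> * (1 + Omega_star U G \<Omega>))"

definition M_star :: "(real^3) set \<Rightarrow> real \<Rightarrow> (real^3 \<Rightarrow> real \<Rightarrow> real) \<Rightarrow> real" where
  "M_star U T u = (SUP (x, t)\<in>U \<times> {0..T}. \<bar>u x t\<bar>)"

definition E_star :: "(real^3) set \<Rightarrow> real \<Rightarrow> real \<Rightarrow> (real^3 \<Rightarrow> real \<Rightarrow> real) \<Rightarrow> real" where
  "E_star U T \<phi> \<Psi> =
     (LINT t:{0..T}|lborel. (LINT x:U|lborel.
        (norm (grad (\<lambda>y. \<Psi> y t) x))\<^sup>2 + \<phi> * \<bar>time_deriv {0..T} \<Psi> x t\<bar>\<^sup>2 + \<phi> * (\<Psi> x t)\<^sup>2))"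

definition L2_norm_on :: "(real^3) set \<Rightarrow> (real^3 \<Rightarrow> real) \<Rightarrow> real" where
  "L2_norm_on U f = sqrt (LINT x:U|lborel. \<bar>f x\<bar>\<^sup>2)"

definition N_zero ::
  "(real^3) set \<Rightarrow> real \<Rightarrow> real \<Rightarrow> (real^3 \<Rightarrow> real) \<Rightarrow> (real^3 \<Rightarrow> real \<Rightarrow> real)
    \<Rightarrow> (real^3 \<Rightarrow> real \<Rightarrow> real) \<Rightarrow> real" where
  "N_zero U T \<phi> u0 \<Psi> u =
     \<phi> * (L2_norm_on U (\<lambda>x. u0 x - \<Psi> x 0))\<^sup>2 + T * (M_star U T u)\<^sup>2 + E_star U T \<phi> \<Psi>"

definition N_star ::
  "(real^3) set \<Rightarrow> real \<Rightarrow> real \<Rightarrow> (real^3 \<Rightarrow> real) \<Rightarrow> (real^3 \<Rightarrow> real \<Rightarrow> real) \<Rightarrow> real" where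
  "N_star U T \<phi> u0 \<Psi> =
     \<phi> * (L2_norm_on U (\<lambda>x. u0 x - \<Psi> x 0))\<^sup>2 + T + E_star U T \<phi> \<Psi>"

end

theory Submission
  imports Defs
begin

text \<open>
  Write \<open>q = \<nabla>u\<close>, \<open>\<Phi> = q + u\<^sup>2 Z\<close> and \<open>K = (1 + |\<Phi>|) powr (- a)\<close>. The inverse \<open>X\<close> of \<open>F\<close> and its
  derivative are coercive and bounded with weight \<open>K\<close>. For the test field \<open>W = |q| powr (p - 2) q \<eta> ^ m\<close>
  with a cutoff \<open>\<eta>\<close>, convexity of \<open>|q| powr p\<close> gives
  \<open>d/dt \<integral>|q| powr p \<eta> ^ m = - p \<integral>u\<^sub>t div W\<close>, although \<open>q\<close> need not be differentiable in time. By the equation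
  this is \<open>- p/\<phi> \<integral>div X(\<Phi>) div W\<close>; two integrations by parts turn the product of divergences into the trace of
  \<open>DX(\<Phi>) D\<Phi> DW\<close>, which controls \<open>K |q| powr (p - 2) |D\<^sup>2u|\<^sup>2 \<eta> ^ m\<close>. Since \<open>|u| \<le> M\<close>, integrating
  \<open>\<integral>K |q| powr (p + 2) \<eta> ^ m\<close> by parts bounds it by \<open>M\<^sup>2\<close> times that dissipation, and Young's inequality
  absorbs every error term except a multiple of \<open>\<integral>K |q|\<^sup>2\<close>. The latter is integrable in time by the energy estimate for
  \<open>u - \<Psi>\<close>. Adding a multiple of the energy to \<open>\<integral>|q| powr p \<eta> ^ m\<close>, weighted by a power of a cutoff in time,
  gives a single bound with a factor \<open>M powr (p - 2) (M + 1) powr (p + 2) N\<^sub>0\<close>, from which all cases follow by comparing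
  exponents.
\<close>

subsection \<open>Radial vector fields\<close>

text \<open>The mobility degenerates, so the dissipation carries the weight \<open>K\<close>, which
  depends on \<open>\<Phi>\<close> and not on \<open>norm q\<close> alone. The diffusive errors
  carry \<open>K\<close> too, because the upper and the lower bound for \<open>DX\<close> share it.
  The one exception comes from the derivative of the time cutoff: \<open>norm q powr p\<close>
  without a weight costs a factor \<open>norm q powr a\<close>. This is affordable because
  \<open>p + a\<close> stays below \<open>p + 2\<close>, and it produces the largest power of
  \<open>1 + inverse T0\<close>. Since the dissipation ends up two powers of the gradient above the
  errors, \<open>p = s\<close> is treated directly, with no induction over exponents. The constants
  have to be tracked, not merely bounded: every contribution must keep a factor
  \<open>M powr (p - 2)\<close>, and the physical parameters may enter only through
  \<open>chi_star\<close>, which dominates the rotation coefficient, \<open>\<Omega>\<close> and the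
  square root of the size of \<open>Z\<close>. The case \<open>M = 0\<close> is split off because
  the absorption parameter is proportional to \<open>1 / M\<^sup>2\<close>.\<close>

text \<open>The derivative of \<open>q \<mapsto> f (norm q) *\<^sub>R q\<close> in direction \<open>h\<close>, where \<open>e r\<close> stands for \<open>r * f' r\<close>; at
  \<open>q = 0\<close> the second term vanishes because of division by zero.\<close>

definition radial_deriv :: "(real \<Rightarrow> real) \<Rightarrow> (real \<Rightarrow> real) \<Rightarrow> 'a::real_inner \<Rightarrow> 'a \<Rightarrow> 'a" where
  "radial_deriv f e q h = f (norm q) *\<^sub>R h + (e (norm q) / (norm q)\<^sup>2 * (q \<bullet> h)) *\<^sub>R q"

lemma bounded_linear_radial_deriv: "bounded_linear (radial_deriv f e q)"
  unfolding radial_deriv_def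
  by (intro bounded_linear_add bounded_linear_scaleR_right bounded_linear_scaleR_const
      bounded_linear_const_mult bounded_linear_inner_right)

text \<open>Away from the origin this is the chain rule. At the origin the field differs from its
  linear part by \<open>(f (norm h) - f 0) *\<^sub>R h\<close>, which is of smaller order than
  \<open>h\<close> by continuity of \<open>f\<close> alone; powers with infinite slope at 0 are
  therefore admissible.\<close>

lemma radial_has_derivative:
  fixes q :: "'a::real_inner"
  assumes f: "continuous_on {0..} f"
    and d: "\<And>r. r > 0 \<Longrightarrow> (f has_real_derivative e r / r) (at r)"
  shows "((\<lambda>q. f (norm q) *\<^sub>R q) has_derivative radial_deriv f e q) (at q)"
proof (cases "q = 0")
  case True
  have c: "continuous_on UNIV (\<lambda>h::'a. f (norm h))"
    by (rule continuous_on_compose2[OF f]) (auto intro!: continuous_intros)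
  then have "((\<lambda>h::'a. f (norm h)) \<longlongrightarrow> f (norm (0::'a))) (at 0)"
    using continuous_on_eq_continuous_at[OF open_UNIV] isCont_def by blast
  then have lim: "((\<lambda>h::'a. \<bar>f (norm h) - f 0\<bar>) \<longlongrightarrow> 0) (at 0)"
    using tendsto_rabs_zero LIM_zero by fastforce
  have "((\<lambda>h::'a. norm (f (norm h) *\<^sub>R h - f 0 *\<^sub>R h) / norm h) \<longlongrightarrow> 0) (at 0)"
  proof (rule Lim_transform_eventually[OF lim])
    show "\<forall>\<^sub>F h::'a in at 0. \<bar>f (norm h) - f 0\<bar> = norm (f (norm h) *\<^sub>R h - f 0 *\<^sub>R h) / norm h"
      unfolding eventually_at
      by (rule exI[of _ 1]) (auto simp: scaleR_diff_left[symmetric])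
  qed
  then show ?thesis
    using bounded_linear_radial_deriv[of f e q] True
    by (simp add: has_derivative_at radial_deriv_def)
next
  case False
  then have r: "norm q > 0" by simp
  have n: "(norm has_derivative (\<lambda>h. q \<bullet> h / norm q)) (at q)"
    using has_derivative_norm[of q] False
    by (simp add: sgn_div_norm inner_commute divide_inverse mult.commute)
  have "((\<lambda>q. f (norm q)) has_derivative (\<lambda>h. e (norm q) / norm q * (q \<bullet> h / norm q))) (at q)"
    using has_derivative_compose[OF n d[OF r, unfolded has_field_derivative_def]] .
  from has_derivative_scaleR[OF this has_derivative_ident]
  show ?thesis
    by (simp add: radial_deriv_def[abs_def] power2_eq_square)
qed

lemma norm_radial_deriv_le: "norm (radial_deriv f e q h) \<le> (\<bar>f (norm q)\<bar> + \<bar>e (norm q)\<bar>) * norm h"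
proof (cases "q = 0")
  case True
  then show ?thesis by (simp add: radial_deriv_def mult_right_mono)
next
  case False
  have "norm (radial_deriv f e q h) \<le> \<bar>f (norm q)\<bar> * norm h + \<bar>e (norm q)\<bar> / (norm q)\<^sup>2 * \<bar>q \<bullet> h\<bar> * norm q"
    unfolding radial_deriv_def by (rule norm_triangle_le) (simp add: abs_mult)
  also have "\<bar>e (norm q)\<bar> / (norm q)\<^sup>2 * \<bar>q \<bullet> h\<bar> * norm q \<le> \<bar>e (norm q)\<bar> / (norm q)\<^sup>2 * (norm q * norm h) * norm q"
    by (intro mult_right_mono mult_left_mono Cauchy_Schwarz_ineq2) auto
  also have "\<dots> = \<bar>e (norm q)\<bar> * norm h" using False by (simp add: power2_eq_square)
  finally show ?thesis by (simp add: algebra_simps)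
qed

lemma inner_radial_deriv:
  "h \<bullet> radial_deriv f e q h = f (norm q) * (norm h)\<^sup>2 + e (norm q) / (norm q)\<^sup>2 * (q \<bullet> h)\<^sup>2"
  by (simp add: radial_deriv_def inner_add_right power2_norm_eq_inner inner_commute)
    (simp add: power2_eq_square)

text \<open>The delicate points have \<open>q = 0\<close>. There the second term is dominated by
  \<open>\<bar>e (norm q)\<bar> * norm h\<close>, which tends to 0 because
  \<open>e 0 = 0\<close>.\<close>

lemma continuous_on_radial_deriv:
  fixes q h :: "'b::topological_space \<Rightarrow> 'a::real_inner"
  assumes f: "continuous_on {0..} f" and e: "continuous_on {0..} e" "e 0 = 0"
    and q: "continuous_on S q" and h: "continuous_on S h"
  shows "continuous_on S (\<lambda>x. radial_deriv f e (q x) (h x))"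
proof -
  have nf: "continuous_on UNIV (\<lambda>z::'a\<times>'a. f (norm (fst z)))"
    by (rule continuous_on_compose2[OF f]) (auto intro!: continuous_intros)
  have ne: "continuous_on UNIV (\<lambda>z::'a\<times>'a. e (norm (fst z)))"
    by (rule continuous_on_compose2[OF e(1)]) (auto intro!: continuous_intros)
  have "isCont (\<lambda>z::'a\<times>'a. (e (norm (fst z)) / (norm (fst z))\<^sup>2 * (fst z \<bullet> snd z)) *\<^sub>R fst z) z" for z
  proof (cases "fst z = 0")
    case True
    have "((\<lambda>z::'a\<times>'a. \<bar>e (norm (fst z))\<bar> * norm (snd z)) \<longlongrightarrow> \<bar>e (norm (fst z))\<bar> * norm (snd z)) (at z)"
      using ne by (intro tendsto_intros) (use continuous_on_eq_continuous_at[OF open_UNIV] isCont_def in blast)+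
    then have *: "((\<lambda>z::'a\<times>'a. \<bar>e (norm (fst z))\<bar> * norm (snd z)) \<longlongrightarrow> 0) (at z)"
      using True e(2) by simp
    have le: "norm ((e (norm q) / (norm q)\<^sup>2 * (q \<bullet> h)) *\<^sub>R q) \<le> \<bar>e (norm q)\<bar> * norm h" for q h :: 'a
    proof (cases "q = 0")
      case False
      have "norm ((e (norm q) / (norm q)\<^sup>2 * (q \<bullet> h)) *\<^sub>R q) = \<bar>e (norm q)\<bar> / (norm q)\<^sup>2 * \<bar>q \<bullet> h\<bar> * norm q"
        by (simp add: abs_mult)
      also have "\<dots> \<le> \<bar>e (norm q)\<bar> / (norm q)\<^sup>2 * (norm q * norm h) * norm q"
        by (intro mult_right_mono mult_left_mono Cauchy_Schwarz_ineq2) auto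
      also have "\<dots> = \<bar>e (norm q)\<bar> * norm h" using False by (simp add: power2_eq_square)
      finally show ?thesis .
    qed simp
    have "((\<lambda>z::'a\<times>'a. (e (norm (fst z)) / (norm (fst z))\<^sup>2 * (fst z \<bullet> snd z)) *\<^sub>R fst z) \<longlongrightarrow> 0) (at z)"
      by (rule Lim_null_comparison[OF _ *]) (rule always_eventually, intro allI le)
    then show ?thesis using True by (simp add: isCont_def)
  next
    case False
    have "isCont (\<lambda>z::'a\<times>'a. e (norm (fst z))) z"
      using ne continuous_on_eq_continuous_at[OF open_UNIV] by blast
    then show ?thesis using False by (intro continuous_intros) auto
  qed
  then have "continuous_on UNIV (\<lambda>z::'a\<times>'a. (e (norm (fst z)) / (norm (fst z))\<^sup>2 * (fst z \<bullet> snd z)) *\<^sub>R fst z)"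
    by (simp add: continuous_at_imp_continuous_on)
  from continuous_on_add[OF continuous_on_scaleR[OF nf continuous_on_snd[OF continuous_on_id]] this]
  have "continuous_on UNIV (\<lambda>z::'a\<times>'a. radial_deriv f e (fst z) (snd z))"
    by (simp add: radial_deriv_def)
  from continuous_on_compose2[OF this, of S "\<lambda>x. (q x, h x)"] q h
  show ?thesis by (auto intro!: continuous_intros)
qed

text \<open>In terms of the norms alone this is monotonicity of \<open>r * f r\<close>.
  Cauchy-Schwarz reduces to that case: passing from \<open>v \<bullet> w\<close> to
  \<open>r * s\<close> can only lower the expression, since \<open>f\<close> is nonnegative.\<close>

lemma radial_monotone:
  fixes v w :: "'a::real_inner"
  assumes mono: "\<And>r s. 0 \<le> r \<Longrightarrow> r \<le> s \<Longrightarrow> f r \<le> f s" and pos: "\<And>r. 0 \<le> r \<Longrightarrow> 0 \<le> f r"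
  shows "0 \<le> (f (norm v) *\<^sub>R v - f (norm w) *\<^sub>R w) \<bullet> (v - w)"
proof -
  define r s where "r = norm v" and "s = norm w"
  have rs: "r \<ge> 0" "s \<ge> 0" by (auto simp: r_def s_def)
  have "0 \<le> (f r * r - f s * s) * (r - s)"
  proof (cases "r \<le> s")
    case True
    then have "f r * r \<le> f s * s" using mono pos rs by (intro mult_mono) auto
    with True show ?thesis by (simp add: mult_nonpos_nonpos)
  next
    case False
    then have "f s * s \<le> f r * r" using mono pos rs by (intro mult_mono) auto
    with False show ?thesis by simp
  qed
  also have "\<dots> = f r * r\<^sup>2 + f s * s\<^sup>2 - (f r + f s) * (r * s)"
    by (simp add: algebra_simps power2_eq_square)
  also have "\<dots> \<le> f r * r\<^sup>2 + f s * s\<^sup>2 - (f r + f s) * (v \<bullet> w)"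
  proof -
    have "(f r + f s) * (v \<bullet> w) \<le> (f r + f s) * (r * s)"
      unfolding r_def s_def
      by (intro mult_left_mono norm_cauchy_schwarz add_nonneg_nonneg pos norm_ge_zero)
    then show ?thesis by linarith
  qed
  also have "\<dots> = (f (norm v) *\<^sub>R v - f (norm w) *\<^sub>R w) \<bullet> (v - w)"
    unfolding r_def s_def power2_norm_eq_inner
    by (simp add: inner_diff_left inner_diff_right inner_commute[of w v] distrib_right)
  finally show ?thesis .
qed

subsection \<open>The inverse of the momentum map\<close>

text \<open>The interface through which the later sections see the constitutive law. The constant
  \<open>C\<close> is meant to be free of \<open>R\<close>, whose influence is displayed separately:
  quadratic in the coercivity bounds, with exponent \<open>a\<close> in the upper bounds.\<close>

definition degenerate_law where
  "degenerate_law a C R X DX \<longleftrightarrow> (\<forall>y. (X has_derivative DX y) (at y)) \<and> (\<forall>h. continuous_on UNIV (\<lambda>y. DX y h)) \<and>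
    (\<forall>(y :: real^3) (h :: real^3). (1 + norm y) powr (- a) * (norm y)\<^sup>2 \<le> C * (1 + R)\<^sup>2 * (X y \<bullet> y) \<and>
       norm (X y) \<le> C * (1 + R) powr a * (1 + norm y) powr (- a) * norm y \<and>
       (1 + norm y) powr (- a) * (norm h)\<^sup>2 \<le> C * (1 + R)\<^sup>2 * (DX y h \<bullet> h) \<and>
       norm (DX y h) \<le> C * (1 + R) powr a * (1 + norm y) powr (- a) * norm h)"

section \<open>Growth of the Forchheimer polynomial\<close>

locale forchheimer =
  fixes N :: nat and A \<alpha> :: "nat \<Rightarrow> real" and a :: real
  assumes N: "N \<ge> 1"
    and \<alpha>: "\<alpha> 0 = 0" "\<And>i. i < N \<Longrightarrow> \<alpha> i < \<alpha> (Suc i)"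
    and A: "\<And>i. i \<le> N \<Longrightarrow> A i > 0"
    and a: "a = \<alpha> N / (1 + \<alpha> N)"
begin

lemma \<alpha>_mono: "i \<le> j \<Longrightarrow> j \<le> N \<Longrightarrow> \<alpha> i \<le> \<alpha> j"
proof (induction j)
  case (Suc j)
  then show ?case using \<alpha>(2)[of j] by (cases "i = Suc j") auto
qed simp

lemma \<alpha>_pos: assumes "1 \<le> i" "i \<le> N" shows "\<alpha> i > 0"
  using \<alpha>_mono[of 1 i] \<alpha>(2)[of 0] \<alpha>(1) N assms by simp

lemma A_nonneg: "i \<le> N \<Longrightarrow> 0 \<le> A i" using A[of i] by simp

lemma \<alpha>_nonneg: "i \<le> N \<Longrightarrow> 0 \<le> \<alpha> i" using \<alpha>_mono[of 0 i] \<alpha>(1) by simp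

lemma a_pos: "0 < a" and a_less_1: "a < 1"
  using \<alpha>_pos[of N] N by (auto simp: a)

text \<open>This is \<open>r\<close> times the derivative of \<open>g\<close>, the form in which
  \<open>radial_deriv\<close> expects it; unlike the derivative itself it is continuous up to
  \<open>r = 0\<close>.\<close>

definition ge :: "real \<Rightarrow> real" where "ge r = (\<Sum>i=1..N. A i * \<alpha> i * r powr \<alpha> i)"

abbreviation "g \<equiv> forch_g N A \<alpha>"

lemma g_ge_A0: "A 0 \<le> g r"
  unfolding forch_g_def using A_nonneg by (auto intro!: sum_nonneg mult_nonneg_nonneg)

lemma g_pos: "0 < g r" using g_ge_A0[of r] A[of 0] by simp

lemma g_mono: "0 \<le> r \<Longrightarrow> r \<le> s \<Longrightarrow> g r \<le> g s"
  unfolding forch_g_def using A_nonneg \<alpha>_nonneg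
  by (auto intro!: sum_mono mult_left_mono powr_mono2)

lemma ge_nonneg: "0 \<le> ge r"
  unfolding ge_def using A_nonneg \<alpha>_nonneg by (auto intro!: sum_nonneg mult_nonneg_nonneg)

lemma ge_le: "ge r \<le> \<alpha> N * g r"
proof -
  have "ge r \<le> (\<Sum>i=1..N. \<alpha> N * (A i * r powr \<alpha> i))"
    unfolding ge_def
  proof (rule sum_mono)
    fix i assume "i \<in> {1..N}"
    then have "A i * r powr \<alpha> i * \<alpha> i \<le> A i * r powr \<alpha> i * \<alpha> N"
      using A[of i] \<alpha>_mono[of i N] by (intro mult_left_mono) auto
    then show "A i * \<alpha> i * r powr \<alpha> i \<le> \<alpha> N * (A i * r powr \<alpha> i)" by (simp add: algebra_simps)
  qed
  also have "\<dots> = \<alpha> N * (g r - A 0)" by (simp add: forch_g_def sum_distrib_left)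
  also have "\<dots> \<le> \<alpha> N * g r" using A[of 0] \<alpha>_pos[of N] N by (intro mult_left_mono) auto
  finally show ?thesis .
qed

lemma ge_0: "ge 0 = 0"
  by (simp add: ge_def)

lemma g_cont: "continuous_on {0..} g" and ge_cont: "continuous_on {0..} ge"
proof -
  have "continuous_on {0..} (\<lambda>r. r powr \<alpha> i)" if "i \<in> {1..N}" for i
    using that \<alpha>_pos[of i] by (intro continuous_on_powr') (auto intro!: continuous_intros)
  then show "continuous_on {0..} g" "continuous_on {0..} ge"
    unfolding forch_g_def ge_def
    by (intro continuous_on_add continuous_on_const continuous_on_sum continuous_on_mult_left; simp)+
qed

lemma g_deriv: "r > 0 \<Longrightarrow> (g has_real_derivative ge r / r) (at r)"
proof -
  assume r: "r > 0"
  have "((\<lambda>r. A 0 + (\<Sum>i=1..N. A i * r powr \<alpha> i)) has_real_derivative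
      0 + (\<Sum>i=1..N. A i * (\<alpha> i * r powr (\<alpha> i - 1)))) (at r)"
    using r by (intro DERIV_add DERIV_const DERIV_sum DERIV_cmult has_real_derivative_powr)
  also have "0 + (\<Sum>i=1..N. A i * (\<alpha> i * r powr (\<alpha> i - 1))) = ge r / r"
    using r by (simp add: ge_def sum_divide_distrib powr_diff mult.assoc)
  finally show ?thesis by (simp add: forch_g_def[abs_def])
qed

text \<open>From below, \<open>max 1 r powr \<alpha> N\<close> is at most
  \<open>1 + r powr \<alpha> N\<close>, and these two summands are controlled by the constant and
  the leading term of \<open>g\<close>. From above, every power in \<open>g\<close> is at most the
  leading power of \<open>1 + r\<close>.\<close>

lemma g_bounds: "\<exists>c\<ge>1. \<forall>r\<ge>0. (1 + r) powr \<alpha> N \<le> c * g r \<and> g r \<le> c * (1 + r) powr \<alpha> N"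
proof -
  have p: "\<alpha> N > 0" "A 0 > 0" "A N > 0" using \<alpha>_pos[of N] N A by auto
  define c1 where "c1 = 2 powr \<alpha> N * (1 / A 0 + 1 / A N)"
  define c2 where "c2 = (\<Sum>i=0..N. A i)"
  have 1: "(1 + r) powr \<alpha> N \<le> c1 * g r" if r: "r \<ge> 0" for r
  proof -
    have gN: "A N * r powr \<alpha> N \<le> g r"
    proof -
      have "A N * r powr \<alpha> N \<le> (\<Sum>i=1..N. A i * r powr \<alpha> i)"
        using A_nonneg N by (intro member_le_sum) (auto intro!: mult_nonneg_nonneg)
      then show ?thesis using p by (simp add: forch_g_def)
    qed
    have "(1 + r) powr \<alpha> N \<le> (2 * max 1 r) powr \<alpha> N"
      using r p by (intro powr_mono2) auto
    also have "\<dots> = 2 powr \<alpha> N * (max 1 r) powr \<alpha> N" by (simp add: powr_mult)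
    also have "(max 1 r) powr \<alpha> N \<le> 1 + r powr \<alpha> N" by (auto simp: max_def)
    also have "1 + r powr \<alpha> N \<le> 1 / A 0 * g r + 1 / A N * g r"
      using g_ge_A0[of r] gN p by (intro add_mono) (auto simp: field_simps)
    finally show ?thesis by (simp add: c1_def algebra_simps)
  qed
  have 2: "g r \<le> c2 * (1 + r) powr \<alpha> N" if r: "r \<ge> 0" for r
  proof -
    have ge1: "1 \<le> (1 + r) powr \<alpha> N" using r p by (simp add: ge_one_powr_ge_zero)
    have t: "r powr \<alpha> i \<le> (1 + r) powr \<alpha> N" if "i \<in> {1..N}" for i
    proof -
      have "r powr \<alpha> i \<le> (1 + r) powr \<alpha> i" using r \<alpha>_pos[of i] that by (intro powr_mono2) auto
      also have "\<dots> \<le> (1 + r) powr \<alpha> N" using r \<alpha>_mono[of i N] that by (intro powr_mono) auto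
      finally show ?thesis .
    qed
    have "g r \<le> A 0 * (1 + r) powr \<alpha> N + (\<Sum>i=1..N. A i * (1 + r) powr \<alpha> N)"
      unfolding forch_g_def using p ge1 A t
      by (intro add_mono sum_mono mult_left_mono) (auto intro: less_imp_le)
    also have "\<dots> = c2 * (1 + r) powr \<alpha> N"
      by (simp add: c2_def sum.atLeast_Suc_atMost[of 0 N] sum_distrib_right distrib_right)
    finally show ?thesis .
  qed
  show ?thesis
  proof (intro exI[of _ "max 1 (max c1 c2)"] conjI allI impI)
    fix r :: real assume r: "r \<ge> 0"
    have "c1 * g r \<le> max 1 (max c1 c2) * g r" using g_pos[of r] by (intro mult_right_mono) auto
    with 1[OF r] show "(1 + r) powr \<alpha> N \<le> max 1 (max c1 c2) * g r" by linarith
    have "c2 * (1 + r) powr \<alpha> N \<le> max 1 (max c1 c2) * (1 + r) powr \<alpha> N" by (intro mult_right_mono) auto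
    with 2[OF r] show "g r \<le> max 1 (max c1 c2) * (1 + r) powr \<alpha> N" by linarith
  qed simp
qed

end

section \<open>Inverting the momentum map for fixed \<open>R\<close> and \<open>k\<close>\<close>

lemma rot_J_mult: "rot_J k *v v = cross3 k v"
proof -
  have "linear (cross3 k)" using bilinear_cross by (simp add: bilinear_def)
  then show ?thesis unfolding rot_J_def by (simp add: matrix_works)
qed

lemma norm_cross3_le: assumes "norm k = 1" shows "norm (cross3 k v) \<le> norm v"
proof (rule power2_le_imp_le)
  show "(norm (cross3 k v))\<^sup>2 \<le> (norm v)\<^sup>2" using norm_cross[of k v] assms by simp
qed simp

context forchheimer begin

context
  fixes R :: real and k :: "real^3"
  assumes R: "R \<ge> 0" and k: "norm k = 1"
begin

abbreviation "F \<equiv> flow_F N A \<alpha> R k"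
abbreviation "X \<equiv> flow_X N A \<alpha> R k"

definition DF :: "real^3 \<Rightarrow> real^3 \<Rightarrow> real^3" where
  "DF v h = radial_deriv g ge v h + R *\<^sub>R cross3 k h"

lemma F_eq: "F v = g (norm v) *\<^sub>R v + R *\<^sub>R cross3 k v"
  by (simp add: flow_F_def rot_J_mult)

lemma bounded_linear_cross3: "bounded_linear (cross3 k)"
  using bilinear_cross by (simp add: bilinear_def linear_linear)

lemma F_has_derivative: "(F has_derivative DF v) (at v)"
  unfolding F_eq[abs_def] DF_def[abs_def]
  by (intro has_derivative_add radial_has_derivative g_cont g_deriv has_derivative_scaleR_right
      bounded_linear_imp_has_derivative bounded_linear_cross3)

text \<open>The rotation is skew and disappears when paired with \<open>v - w\<close>, and
  subtracting \<open>A 0\<close> from \<open>g\<close> leaves a nonnegative nondecreasing radial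
  factor. The constant is therefore independent of \<open>R\<close>; it yields injectivity, closed
  range and a Lipschitz inverse.\<close>

lemma F_strong_mono: "A 0 * norm (v - w) \<le> norm (F v - F w)"
proof -
  have "0 \<le> ((g (norm v) - A 0) *\<^sub>R v - (g (norm w) - A 0) *\<^sub>R w) \<bullet> (v - w)"
    by (rule radial_monotone) (use g_mono g_ge_A0 in auto)
  also have "\<dots> = (g (norm v) *\<^sub>R v - g (norm w) *\<^sub>R w) \<bullet> (v - w) - A 0 * (norm (v - w))\<^sup>2"
  proof -
    have "(g (norm v) - A 0) *\<^sub>R v - (g (norm w) - A 0) *\<^sub>R w
        = (g (norm v) *\<^sub>R v - g (norm w) *\<^sub>R w) - A 0 *\<^sub>R (v - w)"
      by (simp add: scaleR_diff_left scaleR_diff_right)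
    then show ?thesis by (simp only: inner_diff_left inner_scaleR_left power2_norm_eq_inner)
  qed
  also have "(g (norm v) *\<^sub>R v - g (norm w) *\<^sub>R w) \<bullet> (v - w) = (F v - F w) \<bullet> (v - w)"
  proof -
    have "F v - F w = (g (norm v) *\<^sub>R v - g (norm w) *\<^sub>R w) + R *\<^sub>R cross3 k (v - w)"
      by (simp add: F_eq Cross3.right_diff_distrib scaleR_diff_right)
    then show ?thesis by (simp add: inner_add_left dot_cross_self)
  qed
  finally have "A 0 * (norm (v - w))\<^sup>2 \<le> (F v - F w) \<bullet> (v - w)" by simp
  also have "\<dots> \<le> norm (F v - F w) * norm (v - w)" by (rule norm_cauchy_schwarz)
  finally have *: "(A 0 * norm (v - w)) * norm (v - w) \<le> norm (F v - F w) * norm (v - w)"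
    by (simp add: power2_eq_square)
  show ?thesis
  proof (cases "v = w")
    case False
    then show ?thesis using mult_right_le_imp_le[OF *] by simp
  qed simp
qed

lemma F_inj: "inj F"
proof (rule injI)
  fix v w assume "F v = F w"
  then show "v = w" using F_strong_mono[of v w] A[of 0] by (simp add: mult_le_0_iff)
qed

lemma F_cont: "continuous_on UNIV F"
  by (rule continuous_at_imp_continuous_on) (auto intro: has_derivative_continuous F_has_derivative)

text \<open>The range is open by invariance of domain. It is closed because strong monotonicity
  turns a convergent sequence of values into a Cauchy sequence of arguments. Connectedness of the
  space finishes.\<close>

lemma F_surj: "surj F"
proof -
  have "open (range F)" by (rule invariance_of_domain[OF F_cont open_UNIV F_inj])
  moreover have "closed (range F)"
  proof (unfold closed_sequential_limits, intro allI impI)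
    fix y l assume y: "(\<forall>n. y n \<in> range F) \<and> y \<longlonglongrightarrow> l"
    then have "\<forall>n. \<exists>v. y n = F v" by auto
    then obtain v where v: "\<And>n. y n = F (v n)" using choice[of "\<lambda>n v. y n = F v"] by auto
    have "Cauchy v"
    proof (rule metric_CauchyI)
      fix e :: real assume e: "e > 0"
      have "Cauchy y" using y by (auto intro: LIMSEQ_imp_Cauchy)
      then obtain n0 where n0: "\<And>m n. m \<ge> n0 \<Longrightarrow> n \<ge> n0 \<Longrightarrow> dist (y m) (y n) < A 0 * e"
        using metric_CauchyD[of y "A 0 * e"] e A[of 0] by auto
      have "dist (v m) (v n) < e" if "m \<ge> n0" "n \<ge> n0" for m n
      proof -
        have "A 0 * norm (v m - v n) < A 0 * e"
          using F_strong_mono[of "v m" "v n"] n0[OF that] by (simp add: v dist_norm)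
        then show ?thesis using A[of 0] by (simp add: dist_norm)
      qed
      then show "\<exists>M. \<forall>m\<ge>M. \<forall>n\<ge>M. dist (v m) (v n) < e" by blast
    qed
    then obtain w where "v \<longlonglongrightarrow> w" using Cauchy_convergent convergent_def by blast
    then have "(\<lambda>n. F (v n)) \<longlonglongrightarrow> F w"
      by (rule isCont_tendsto_compose[OF has_derivative_continuous[OF F_has_derivative]])
    then have "(\<lambda>n. y n) \<longlonglongrightarrow> F w" by (simp add: v)
    then have "l = F w" by (rule LIMSEQ_unique[rotated]) (use y in simp)
    then show "l \<in> range F" by simp
  qed
  ultimately have "range F = {} \<or> range F = UNIV" using clopen by blast
  then show ?thesis by auto
qed

lemma F_X [simp]: "F (X y) = y"
  unfolding flow_X_def by (rule surj_f_inv_f[OF F_surj])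

lemma X_cont: "continuous_on UNIV X"
proof (rule continuous_onI)
  fix y e :: real and x :: "real^3" assume e: "e > 0"
  have "dist (X x') (X x) \<le> e" if "dist x' x < A 0 * e" for x'
  proof -
    have "A 0 * norm (X x' - X x) \<le> norm (x' - x)" using F_strong_mono[of "X x'" "X x"] by simp
    also have "\<dots> \<le> A 0 * e" using that by (simp add: dist_norm)
    finally show ?thesis using A[of 0] by (simp add: dist_norm)
  qed
  then show "\<exists>d>0. \<forall>x'\<in>UNIV. dist x' x < d \<longrightarrow> dist (X x') (X x) \<le> e"
    using A[of 0] e by (intro exI[of _ "A 0 * e"]) auto
qed

lemma DF_coercive: "g (norm v) * (norm h)\<^sup>2 \<le> h \<bullet> DF v h"
proof -
  have "0 \<le> ge (norm v) / (norm v)\<^sup>2 * (v \<bullet> h)\<^sup>2" using ge_nonneg by auto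
  then show ?thesis by (simp add: DF_def inner_add_right dot_cross_self inner_radial_deriv)
qed

lemma DF_bounded: "norm (DF v h) \<le> ((1 + \<alpha> N) * g (norm v) + R) * norm h"
proof -
  have "norm (DF v h) \<le> (g (norm v) + ge (norm v)) * norm h + R * norm h"
    unfolding DF_def
  proof (rule norm_triangle_le, rule add_mono)
    show "norm (radial_deriv g ge v h) \<le> (g (norm v) + ge (norm v)) * norm h"
      using norm_radial_deriv_le[of g ge v h] g_pos[of "norm v"] ge_nonneg[of "norm v"] by simp
    show "norm (R *\<^sub>R cross3 k h) \<le> R * norm h"
      using norm_cross3_le[OF k, of h] R by (simp add: mult_left_mono)
  qed
  also have "\<dots> = (g (norm v) + ge (norm v) + R) * norm h" by (simp add: algebra_simps)
  also have "\<dots> \<le> ((1 + \<alpha> N) * g (norm v) + R) * norm h"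
    using ge_le[of "norm v"] by (intro mult_right_mono) (auto simp: algebra_simps)
  finally show ?thesis .
qed

lemma bounded_linear_DF: "bounded_linear (DF v)"
  by (rule has_derivative_bounded_linear[OF F_has_derivative])

definition DX :: "real^3 \<Rightarrow> real^3 \<Rightarrow> real^3" where "DX y = inv (DF (X y))"

lemma DF_bij: "bij (DF v)"
proof -
  have lin: "linear (DF v)" by (rule bounded_linear.linear[OF bounded_linear_DF])
  have "inj (DF v)"
  proof (unfold linear_injective_0[OF lin], intro allI impI)
    fix h assume "DF v h = 0"
    then have "g (norm v) * (norm h)\<^sup>2 \<le> 0" using DF_coercive[of v h] by simp
    then show "h = 0" using g_pos[of "norm v"] by (simp add: mult_le_0_iff)
  qed
  then show ?thesis using linear_injective_imp_surjective[OF lin] by (simp add: bij_def)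
qed

lemma DF_DX [simp]: "DF (X y) (DX y h) = h"
  unfolding DX_def using DF_bij by (simp add: bij_is_surj surj_f_inv_f)

lemma DX_DF [simp]: "DX y (DF (X y) h) = h"
  unfolding DX_def using DF_bij by (simp add: bij_is_inj inv_f_f)

lemma bounded_linear_DX: "bounded_linear (DX y)"
proof -
  have lin: "linear (DF (X y))" by (rule bounded_linear.linear[OF bounded_linear_DF])
  have "linear (DX y)"
    unfolding DX_def
    by (rule inj_linear_imp_inv_linear[OF lin bij_is_inj[OF DF_bij]])
  then show ?thesis by (simp add: linear_linear)
qed

lemma X_has_derivative: "(X has_derivative DX y) (at y)"
proof (rule has_derivative_inverse_basic[where T = UNIV])
  show "(F has_derivative DF (X y)) (at (X y))" by (rule F_has_derivative)
  show "DX y \<circ> DF (X y) = id" by auto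
  show "isCont X y" using X_cont by (simp add: continuous_on_eq_continuous_at)
qed (auto simp: bounded_linear_DX)

lemma norm_DX_le: "g (norm (X y)) * norm (DX y h) \<le> norm h"
proof -
  let ?z = "DX y h"
  have "g (norm (X y)) * (norm ?z)\<^sup>2 \<le> ?z \<bullet> h" using DF_coercive[of "X y" ?z] by simp
  also have "\<dots> \<le> norm ?z * norm h" by (rule norm_cauchy_schwarz)
  finally have "norm ?z * (g (norm (X y)) * norm ?z) \<le> norm ?z * norm h"
    by (simp add: power2_eq_square algebra_simps)
  then show ?thesis by (cases "?z = 0") (auto dest: mult_left_le_imp_le)
qed

text \<open>Resolvent identity: with \<open>z = DX y h\<close>, the difference
  \<open>DX y' h - z\<close> equals \<open>DX y' (h - DF (X y') z)\<close>. The operators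
  \<open>DX y'\<close> are bounded uniformly by \<open>1 / A 0\<close>, so continuity of
  \<open>DF\<close> along \<open>X\<close> is enough.\<close>

lemma continuous_on_DX: "continuous_on UNIV (\<lambda>y. DX y h)"
proof -
  have "((\<lambda>y'. DX y' h) \<longlongrightarrow> DX y h) (at y)" for y
  proof -
    let ?z = "DX y h"
    have c: "continuous_on UNIV (\<lambda>y'. DF (X y') ?z)"
      unfolding DF_def
      by (intro continuous_intros continuous_on_radial_deriv g_cont ge_cont ge_0 X_cont)
    have "((\<lambda>y'. DF (X y') ?z) \<longlongrightarrow> DF (X y) ?z) (at y)"
    proof -
      have "isCont (\<lambda>y'. DF (X y') ?z) y" using c by (simp add: continuous_on_eq_continuous_at)
      then show ?thesis unfolding isCont_def .
    qed
    then have "((\<lambda>y'. DF (X y') ?z - h) \<longlongrightarrow> 0) (at y)"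
      by (simp only: DF_DX LIM_zero_iff)
    from tendsto_divide_zero[OF tendsto_norm_zero[OF this], of "A 0"]
    have lim: "((\<lambda>y'. norm (DF (X y') ?z - h) / A 0) \<longlongrightarrow> 0) (at y)" .
    have "norm (DX y' h - ?z) \<le> norm (DF (X y') ?z - h) / A 0" for y'
    proof -
      have "DX y' h - ?z = DX y' (h - DF (X y') ?z)"
        using bounded_linear.linear[OF bounded_linear_DX[of y']] by (simp add: linear_diff)
      then have "g (norm (X y')) * norm (DX y' h - ?z) \<le> norm (DF (X y') ?z - h)"
        using norm_DX_le[of y' "h - DF (X y') ?z"] by (simp add: norm_minus_commute)
      moreover have "A 0 * norm (DX y' h - ?z) \<le> g (norm (X y')) * norm (DX y' h - ?z)"
        using g_ge_A0 by (intro mult_right_mono) auto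
      ultimately show ?thesis using A[of 0] by (simp add: field_simps)
    qed
    then have "((\<lambda>y'. DX y' h - ?z) \<longlongrightarrow> 0) (at y)"
      by (intro Lim_null_comparison[OF _ lim] always_eventually) auto
    then show ?thesis by (simp add: LIM_zero_iff)
  qed
  then show ?thesis by (simp add: continuous_at_imp_continuous_on isCont_def)
qed

lemma X_inner: "X y \<bullet> y = g (norm (X y)) * (norm (X y))\<^sup>2"
proof -
  have "X y \<bullet> F (X y) = g (norm (X y)) * (norm (X y))\<^sup>2"
    unfolding F_eq inner_add_right inner_scaleR_right power2_norm_eq_inner
    by (simp add: dot_cross_self)
  then show ?thesis by simp
qed

lemma X_upper: "g (norm (X y)) * norm (X y) \<le> norm y"
proof -
  have "X y \<bullet> y = g (norm (X y)) * (norm (X y))\<^sup>2" by (rule X_inner)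
  moreover have "X y \<bullet> y \<le> norm (X y) * norm y" by (rule norm_cauchy_schwarz)
  ultimately have "norm (X y) * (g (norm (X y)) * norm (X y)) \<le> norm (X y) * norm y"
    by (simp add: power2_eq_square algebra_simps)
  then show ?thesis by (cases "X y = 0") (auto dest: mult_left_le_imp_le)
qed

lemma norm_F_le: "norm y \<le> (g (norm (X y)) + R) * norm (X y)"
proof -
  have "norm (F (X y)) \<le> g (norm (X y)) * norm (X y) + R * norm (X y)"
    unfolding F_eq
    by (rule norm_triangle_le, rule add_mono)
      (use norm_cross3_le[OF k, of "X y"] R g_pos[of "norm (X y)"] in \<open>auto simp: mult_left_mono\<close>)
  then show ?thesis by (simp add: distrib_right)
qed

text \<open>With \<open>r = norm (X y)\<close>, the identity \<open>F (X y) = y\<close> gives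
  \<open>g r * r \<le> norm y\<close> and \<open>norm y \<le> (g r + R) * r\<close>. As
  \<open>g r\<close> grows like \<open>(1 + r) powr \<alpha> N\<close> and
  \<open>(1 + \<alpha> N) * a = \<alpha> N\<close>, the quantity \<open>(1 + norm y) powr a\<close>
  is comparable to \<open>g r\<close>. The weight \<open>K y\<close> is thus the reciprocal of
  \<open>g r\<close> up to constants and a power of \<open>1 + R\<close>, and the four bounds follow
  from those for \<open>F\<close> and \<open>DF\<close>.\<close>

lemma flow_X_estimates_aux:
  assumes c: "c \<ge> 1" "\<And>r. r \<ge> 0 \<Longrightarrow> (1 + r) powr \<alpha> N \<le> c * g r \<and> g r \<le> c * (1 + r) powr \<alpha> N"
    and C: "C = (1 + \<alpha> N)\<^sup>2 * c\<^sup>2 * (2 * c ^ 3 * 2 powr \<alpha> N)"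
  defines "K \<equiv> \<lambda>y::real^3. (1 + norm y) powr (- a)"
  shows "K y * (norm y)\<^sup>2 \<le> C * (1 + R)\<^sup>2 * (X y \<bullet> y)"
    and "norm (X y) \<le> C * (1 + R) powr a * K y * norm y"
    and "K y * (norm h)\<^sup>2 \<le> C * (1 + R)\<^sup>2 * (DX y h \<bullet> h)"
    and "norm (DX y h) \<le> C * (1 + R) powr a * K y * norm h"
proof -
  define r where "r = norm (X y)"
  define z where "z = DX y h"
  define c4 where "c4 = 2 * c ^ 3 * 2 powr \<alpha> N"
  have r: "r \<ge> 0" by (simp add: r_def)
  have aN: "\<alpha> N > 0" "a > 0" "a < 1" "(1 + \<alpha> N) * a = \<alpha> N"
    using \<alpha>_pos[of N] N a_pos a_less_1 by (auto simp: a)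
  have gp: "g r > 0" by (rule g_pos)
  have c2: "2 powr \<alpha> N \<ge> 1" using aN by (simp add: ge_one_powr_ge_zero)
  have one: "1 \<le> c * g r"
    using c(2)[OF r] ge_one_powr_ge_zero[of "1 + r" "\<alpha> N"] r aN by linarith
  have gR: "g r + R \<le> c * (1 + R) * g r"
  proof -
    have "g r \<le> c * g r" using c(1) gp by simp
    moreover have "R * 1 \<le> R * (c * g r)" using one R by (intro mult_left_mono) auto
    ultimately show ?thesis by (simp add: algebra_simps)
  qed
  have gr: "g r * r \<le> norm y" using X_upper[of y] by (simp add: r_def)
  have yr: "norm y \<le> c * (1 + R) * g r * r"
    using norm_F_le[of y] mult_right_mono[OF gR r] by (simp add: r_def)
  have "0 < 1 + norm y" by (simp add: add_pos_nonneg)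
  then have ny: "1 + norm y \<noteq> 0" by linarith
  then have Kp: "K y > 0" unfolding K_def by simp
  have Ky: "K y * (1 + norm y) powr a = 1"
    unfolding K_def using ny by (simp add: powr_minus field_simps)
  \<comment> \<open>Lower bound for \<open>K y * g r\<close>. It rests on the upper bound for
    \<open>norm y\<close>, in which \<open>R\<close> occurs, and so loses
    \<open>(1 + R) powr a\<close>.\<close>
  have up: "1 \<le> c ^ 3 * (1 + R) powr a * K y * g r"
  proof -
    have "norm y \<le> c * (1 + R) * (c * (1 + r) powr \<alpha> N) * r"
      using yr c(2)[OF r] R r c(1)
      by (meson mult_left_mono mult_right_mono mult_nonneg_nonneg add_nonneg_nonneg order_trans zero_le_one)
    moreover have "1 \<le> c * (1 + R) * (c * (1 + r) powr \<alpha> N) * 1"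
    proof -
      have "1 * 1 * (1 * 1) \<le> c * (1 + R) * (c * (1 + r) powr \<alpha> N)"
        using c(1) R r aN by (intro mult_mono ge_one_powr_ge_zero) auto
      then show ?thesis by simp
    qed
    ultimately have "1 + norm y \<le> c * (1 + R) * (c * (1 + r) powr \<alpha> N) * (1 + r)"
      by (simp add: distrib_left)
    also have "\<dots> = c\<^sup>2 * (1 + R) * (1 + r) powr (1 + \<alpha> N)"
      using r by (simp add: powr_add power2_eq_square)
    finally have "(1 + norm y) powr a \<le> (c\<^sup>2 * (1 + R) * (1 + r) powr (1 + \<alpha> N)) powr a"
      using aN by (intro powr_mono2) auto
    also have "\<dots> = (c\<^sup>2) powr a * (1 + R) powr a * (1 + r) powr \<alpha> N"
      using c(1) R r aN by (simp add: powr_mult powr_powr)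
    also have "\<dots> \<le> c\<^sup>2 * (1 + R) powr a * (c * g r)"
    proof (intro mult_mono)
      show "(c\<^sup>2) powr a \<le> c\<^sup>2" using powr_mono[of a 1 "c\<^sup>2"] c(1) aN by simp
    qed (use c r in auto)
    finally have "(1 + norm y) powr a \<le> c ^ 3 * (1 + R) powr a * g r"
      by (simp add: power2_eq_square power3_eq_cube algebra_simps)
    from mult_left_mono[OF this less_imp_le[OF Kp]] show ?thesis
      by (simp add: Ky algebra_simps)
  qed
  \<comment> \<open>The opposite bound rests on \<open>g r * r \<le> norm y\<close> and is free of
    \<open>R\<close>. Values \<open>r \<le> 1\<close> are treated apart because
    \<open>g r * r\<close> does not control \<open>g r\<close> there.\<close>
  have lo: "K y * g r \<le> c4"
  proof -
    define D where "D = 2 * c\<^sup>2 * 2 powr \<alpha> N"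
    have "1 * 1 * 1 \<le> D" using c(1) c2 unfolding D_def by (intro mult_mono) auto
    then have D: "D \<ge> 1" by simp
    have g1: "g r \<le> c * 2 powr \<alpha> N + norm y"
    proof (cases "r \<le> 1")
      case True
      have "g r \<le> c * (1 + r) powr \<alpha> N" using c(2)[OF r] by simp
      also have "\<dots> \<le> c * 2 powr \<alpha> N" using True r aN c(1) by (intro mult_left_mono powr_mono2) auto
      finally show ?thesis using norm_ge_zero[of y] by linarith
    next
      case False
      then have "g r * 1 \<le> g r * r" using gp by (intro mult_left_mono) auto
      moreover have "0 \<le> c * 2 powr \<alpha> N" using c(1) by simp
      ultimately show ?thesis using gr by linarith
    qed
    have "(1 + r) powr (1 + \<alpha> N) = (1 + r) * (1 + r) powr \<alpha> N" using r by (simp add: powr_add)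
    also have "\<dots> \<le> (1 + r) * (c * g r)" using c(2)[OF r] r by (intro mult_left_mono) auto
    also have "\<dots> = c * g r + c * (g r * r)" by (simp add: algebra_simps)
    also have "\<dots> \<le> c * (c * 2 powr \<alpha> N + norm y) + c * norm y"
      using c(1) g1 gr by (intro add_mono mult_left_mono) auto
    also have "\<dots> \<le> D * (1 + norm y)"
    proof -
      have "2 * c * norm y \<le> D * norm y"
      proof (rule mult_right_mono)
        have "2 * c * 1 * 1 \<le> 2 * c * c * 2 powr \<alpha> N" using c(1) c2 by (intro mult_mono) auto
        then show "2 * c \<le> D" by (simp add: D_def power2_eq_square algebra_simps)
      qed simp
      moreover have "c * (c * 2 powr \<alpha> N) \<le> D" using c(1) by (simp add: D_def power2_eq_square)
      ultimately show ?thesis by (simp add: algebra_simps)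
    qed
    finally have "((1 + r) powr (1 + \<alpha> N)) powr a \<le> (D * (1 + norm y)) powr a"
      using aN by (intro powr_mono2) auto
    then have "(1 + r) powr \<alpha> N \<le> D powr a * (1 + norm y) powr a"
      using D aN by (simp add: powr_powr powr_mult)
    also have "\<dots> \<le> D * (1 + norm y) powr a"
      using powr_mono[of a 1 D] D aN by (intro mult_right_mono) auto
    finally have "c * (1 + r) powr \<alpha> N \<le> c * (D * (1 + norm y) powr a)" using c(1) by simp
    then have "g r \<le> c * (D * (1 + norm y) powr a)" using c(2)[OF r] by linarith
    from mult_left_mono[OF this less_imp_le[OF Kp]]
    have "K y * g r \<le> c * D * (K y * (1 + norm y) powr a)" by (simp add: algebra_simps)
    then show ?thesis by (simp only: Ky) (simp add: c4_def D_def power2_eq_square power3_eq_cube)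
  qed
  have C4: "C = (1 + \<alpha> N)\<^sup>2 * c\<^sup>2 * c4" using C by (simp add: c4_def)
  have c4p: "c4 \<ge> c ^ 3"
    using c(1) c2 mult_mono[of "c ^ 3 * 1" "2 * c ^ 3" 1 "2 powr \<alpha> N"] by (simp add: c4_def)
  have c3: "c ^ 3 \<ge> 1" using c(1) by simp
  have q: "(1 + \<alpha> N)\<^sup>2 \<ge> 1" "c\<^sup>2 \<ge> 1" using aN c(1) by (auto intro!: one_le_power)
  have Cc: "C \<ge> c ^ 3"
  proof -
    have "1 * 1 * c ^ 3 \<le> C" unfolding C4 using q c4p c3 c(1) by (intro mult_mono) auto
    then show ?thesis by simp
  qed
  have Cc2: "C \<ge> c\<^sup>2 * c4"
    unfolding C4 using mult_right_mono[of 1 "(1 + \<alpha> N)\<^sup>2" "c\<^sup>2 * c4"] q c4p c3 by simp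
  have up': "1 \<le> C * (1 + R) powr a * K y * g r"
    using up mult_right_mono[OF Cc, of "(1 + R) powr a * K y * g r"] Kp gp by (simp add: mult.assoc)
  \<comment> \<open>One factor \<open>g r\<close> of the square is cancelled by the weight through
    \<open>lo\<close>; the other stays and matches the coercivity of \<open>X\<close> or of
    \<open>DF\<close>.\<close>
  have main: "K y * (b * c * (1 + R) * g r * w)\<^sup>2 \<le> b\<^sup>2 * (c\<^sup>2 * c4) * (1 + R)\<^sup>2 * (g r * w\<^sup>2)" for b w
  proof -
    have "K y * (b * c * (1 + R) * g r * w)\<^sup>2 = (K y * g r) * (b\<^sup>2 * c\<^sup>2 * (1 + R)\<^sup>2 * (g r * w\<^sup>2))"
      by (simp add: power2_eq_square algebra_simps)
    also have "\<dots> \<le> c4 * (b\<^sup>2 * c\<^sup>2 * (1 + R)\<^sup>2 * (g r * w\<^sup>2))"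
      using lo gp by (intro mult_right_mono) auto
    finally show ?thesis by (simp add: algebra_simps)
  qed
  have Xy: "X y \<bullet> y = g r * r\<^sup>2" using X_inner[of y] by (simp add: r_def)
  have "K y * (norm y)\<^sup>2 \<le> K y * (1 * c * (1 + R) * g r * r)\<^sup>2"
    using yr Kp by (intro mult_left_mono power_mono) auto
  also have "\<dots> \<le> c\<^sup>2 * c4 * ((1 + R)\<^sup>2 * (g r * r\<^sup>2))" using main[of 1 r] by (simp add: mult.assoc)
  also have "\<dots> \<le> C * ((1 + R)\<^sup>2 * (g r * r\<^sup>2))" using Cc2 gp by (intro mult_right_mono) auto
  finally show "K y * (norm y)\<^sup>2 \<le> C * (1 + R)\<^sup>2 * (X y \<bullet> y)" by (simp add: Xy mult.assoc)
  have "r * 1 \<le> r * (C * (1 + R) powr a * K y * g r)" using up' r by (rule mult_left_mono)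
  also have "\<dots> = C * (1 + R) powr a * K y * (g r * r)" by (simp add: algebra_simps)
  also have "\<dots> \<le> C * (1 + R) powr a * K y * norm y"
    using gr Kp Cc c3 by (intro mult_left_mono) auto
  finally show "norm (X y) \<le> C * (1 + R) powr a * K y * norm y" by (simp add: r_def)
  have gz: "g r * norm z \<le> norm h" using norm_DX_le[of y h] by (simp add: r_def z_def)
  have "norm z * 1 \<le> norm z * (C * (1 + R) powr a * K y * g r)" using up' by (intro mult_left_mono) auto
  also have "\<dots> = C * (1 + R) powr a * K y * (g r * norm z)" by (simp add: algebra_simps)
  also have "\<dots> \<le> C * (1 + R) powr a * K y * norm h"
    using gz Kp Cc c3 by (intro mult_left_mono) auto
  finally show "norm (DX y h) \<le> C * (1 + R) powr a * K y * norm h" by (simp add: z_def)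
  have zh: "g r * (norm z)\<^sup>2 \<le> z \<bullet> h" using DF_coercive[of "X y" z] by (simp add: z_def r_def)
  have "norm h \<le> ((1 + \<alpha> N) * g r + R) * norm z" using DF_bounded[of "X y" z] by (simp add: z_def r_def)
  also have "\<dots> \<le> ((1 + \<alpha> N) * c * (1 + R) * g r) * norm z"
  proof (rule mult_right_mono)
    have "R \<le> (1 + \<alpha> N) * R" using R aN by (simp add: distrib_right)
    then have "(1 + \<alpha> N) * g r + R \<le> (1 + \<alpha> N) * (g r + R)" by (simp add: distrib_left)
    also have "\<dots> \<le> (1 + \<alpha> N) * (c * (1 + R) * g r)" using gR aN by (intro mult_left_mono) auto
    finally show "(1 + \<alpha> N) * g r + R \<le> (1 + \<alpha> N) * c * (1 + R) * g r" by (simp add: mult.assoc)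
  qed simp
  finally have hz: "norm h \<le> (1 + \<alpha> N) * c * (1 + R) * g r * norm z" .
  have "K y * (norm h)\<^sup>2 \<le> K y * ((1 + \<alpha> N) * c * (1 + R) * g r * norm z)\<^sup>2"
    using hz Kp by (intro mult_left_mono power_mono) auto
  also have "\<dots> \<le> C * (1 + R)\<^sup>2 * (g r * (norm z)\<^sup>2)"
    using main[of "1 + \<alpha> N" "norm z"] by (simp add: C4 mult.assoc)
  also have "\<dots> \<le> C * (1 + R)\<^sup>2 * (z \<bullet> h)" using zh Cc c3 by (intro mult_left_mono) auto
  finally show "K y * (norm h)\<^sup>2 \<le> C * (1 + R)\<^sup>2 * (DX y h \<bullet> h)" by (simp add: z_def)
qed

end

lemma flow_X_estimates:
  "\<exists>C\<ge>1. \<forall>R\<ge>0. \<forall>k. norm k = 1 \<longrightarrow> (\<exists>DX. degenerate_law a C R (flow_X N A \<alpha> R k) DX)"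
proof -
  obtain c where c: "c \<ge> 1" "\<And>r. r \<ge> 0 \<Longrightarrow> (1 + r) powr \<alpha> N \<le> c * g r \<and> g r \<le> c * (1 + r) powr \<alpha> N"
    using g_bounds by auto
  define C where "C = (1 + \<alpha> N)\<^sup>2 * c\<^sup>2 * (2 * c ^ 3 * 2 powr \<alpha> N)"
  have aN: "\<alpha> N > 0" using \<alpha>_pos[of N] N by auto
  have "1 * 1 * (1 * 1 * 1) \<le> (1 + \<alpha> N)\<^sup>2 * c\<^sup>2 * (2 * c ^ 3 * 2 powr \<alpha> N)"
    using c(1) aN by (intro mult_mono one_le_power ge_one_powr_ge_zero) auto
  then have "C \<ge> 1" by (simp add: C_def)
  show ?thesis unfolding degenerate_law_def
  proof (intro exI[of _ C] conjI allI impI \<open>C \<ge> 1\<close>)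
    fix R :: real and k :: "real^3" assume Rk: "R \<ge> 0" "norm k = 1"
    show "\<exists>DX. (\<forall>y. (flow_X N A \<alpha> R k has_derivative DX y) (at y)) \<and>
      (\<forall>h. continuous_on UNIV (\<lambda>y. DX y h)) \<and>
      (\<forall>y h. (1 + norm y) powr (- a) * (norm y)\<^sup>2 \<le> C * (1 + R)\<^sup>2 * (flow_X N A \<alpha> R k y \<bullet> y) \<and>
       norm (flow_X N A \<alpha> R k y) \<le> C * (1 + R) powr a * (1 + norm y) powr (- a) * norm y \<and>
       (1 + norm y) powr (- a) * (norm h)\<^sup>2 \<le> C * (1 + R)\<^sup>2 * (DX y h \<bullet> h) \<and>
       norm (DX y h) \<le> C * (1 + R) powr a * (1 + norm y) powr (- a) * norm h)"
      by (rule exI[of _ "DX R k"], intro conjI allI)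
        (simp_all only: X_has_derivative[OF Rk] continuous_on_DX[OF Rk] flow_X_estimates_aux[OF Rk c C_def])
  qed
qed

end

subsection \<open>Integration by parts over a bounded open set\<close>

lemma set_integrable_bounded_continuous:
  fixes f :: "'a::euclidean_space \<Rightarrow> 'b::euclidean_space"
  assumes "open U" "bounded U" "continuous_on U f" "\<And>x. x \<in> U \<Longrightarrow> norm (f x) \<le> B"
  shows "set_integrable lborel U f"
proof -
  have m: "(\<lambda>x. indicator U x *\<^sub>R f x) \<in> borel_measurable lborel"
    using borel_measurable_continuous_on_indicator[of U f] assms by simp
  have "emeasure lborel U < \<infinity>" using emeasure_bounded_finite assms(2) by auto
  then show ?thesis unfolding set_integrable_def
    by (intro integrableI_bounded_set[where A = U and B = B] m) (use assms in auto)
qed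

lemma set_integrable_continuous_on_closure:
  fixes f :: "'a::euclidean_space \<Rightarrow> 'b::euclidean_space"
  assumes "open U" "bounded U" "continuous_on (closure U) f"
  shows "set_integrable lborel U f"
proof -
  have "compact (f ` closure U)" using assms by (intro compact_continuous_image) auto
  then obtain B where B: "\<And>y. y \<in> f ` closure U \<Longrightarrow> norm y \<le> B"
    using compact_imp_bounded bounded_iff by metis
  have "norm (f x) \<le> B" if "x \<in> U" for x using B[of "f x"] that closure_subset[of U] by auto
  with assms show ?thesis
    by (intro set_integrable_bounded_continuous[where B = B] continuous_on_subset[OF assms(3) closure_subset]) auto
qed

lemma lborel_integral_shift:
  fixes f :: "'a::euclidean_space \<Rightarrow> real"
  assumes "f \<in> borel_measurable borel"
  shows "(LINT x|lborel. f (v + x)) = (LINT x|lborel. f x)"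
proof -
  have "(LINT x|lborel. f x) = (LINT x|distr lborel borel ((+) v). f x)"
    by (simp add: lborel_distr_plus)
  also have "\<dots> = (LINT x|lborel. f (v + x))"
    using assms by (intro integral_distr) auto
  finally show ?thesis by simp
qed

lemma difference_quotient_tendsto:
  fixes f :: "'a::real_normed_vector \<Rightarrow> real"
  assumes f: "(f has_derivative f') (at x)" and s: "s \<longlonglongrightarrow> 0" "\<And>n. s n \<noteq> 0"
  shows "(\<lambda>n. (f (x + s n *\<^sub>R e) - f x) / s n) \<longlonglongrightarrow> f' e"
proof -
  have l: "linear f'" using f has_derivative_linear by blast
  have "((\<lambda>t::real. x + t *\<^sub>R e) has_derivative (\<lambda>t. t *\<^sub>R e)) (at 0)"
    by (auto intro!: derivative_eq_intros)
  moreover have "(f has_derivative f') (at (x + 0 *\<^sub>R e))" using f by simp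
  ultimately have "((\<lambda>t. f (x + t *\<^sub>R e)) has_derivative (\<lambda>t. f' (t *\<^sub>R e))) (at 0)"
    by (rule has_derivative_compose)
  then have "((\<lambda>t. f (x + t *\<^sub>R e)) has_real_derivative f' e) (at 0)"
    unfolding has_field_derivative_def
    by (rule has_derivative_eq_rhs) (auto simp: linear_cmul[OF l])
  then have "((\<lambda>t. (f (x + t *\<^sub>R e) - f x) / t) \<longlongrightarrow> f' e) (at 0)"
    by (simp add: DERIV_def)
  moreover have "filterlim s (at 0) sequentially" using s by (simp add: filterlim_at)
  ultimately show ?thesis by (rule filterlim_compose)
qed

text \<open>The end points may lie on the boundary: the mean value theorem asks for
  differentiability only inside the segment and for continuity at its ends.\<close>

lemma derivative_bound_open_segment:
  fixes f :: "'a::euclidean_space \<Rightarrow> real"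
  assumes contf: "continuous_on (closure U) f"
    and der: "\<And>x. x \<in> U \<Longrightarrow> (f has_derivative f' x) (at x)"
    and bd: "\<And>x h. x \<in> U \<Longrightarrow> \<bar>f' x h\<bar> \<le> B * norm h"
    and xy: "x \<in> closure U" "y \<in> closure U" "\<And>s. 0 < s \<Longrightarrow> s < 1 \<Longrightarrow> x + s *\<^sub>R (y - x) \<in> U"
  shows "\<bar>f y - f x\<bar> \<le> B * norm (y - x)"
proof -
  define \<phi> where "\<phi> s = f (x + s *\<^sub>R (y - x))" for s :: real
  have in_cl: "x + s *\<^sub>R (y - x) \<in> closure U" if "s \<in> {0..1}" for s
  proof (cases "s = 0 \<or> s = 1")
    case True then show ?thesis using xy by auto
  next
    case False then show ?thesis using xy(3)[of s] that closure_subset[of U] by auto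
  qed
  have "continuous_on {0..1} \<phi>" unfolding \<phi>_def
    by (rule continuous_on_compose2[OF contf]) (use in_cl in \<open>auto intro!: continuous_intros\<close>)
  moreover have "(\<phi> has_derivative (\<lambda>t. f' (x + s *\<^sub>R (y - x)) (t *\<^sub>R (y - x)))) (at s)"
    if s: "0 < s" "s < 1" for s
  proof -
    have "((\<lambda>t::real. x + t *\<^sub>R (y - x)) has_derivative (\<lambda>t. t *\<^sub>R (y - x))) (at s)"
      by (auto intro!: derivative_eq_intros)
    from has_derivative_compose[OF this der[OF xy(3)[OF s]]]
    show ?thesis by (simp add: \<phi>_def[abs_def])
  qed
  ultimately obtain \<xi> where \<xi>: "0 < \<xi>" "\<xi> < 1"
    "\<phi> 1 - \<phi> 0 = f' (x + \<xi> *\<^sub>R (y - x)) ((1 - 0) *\<^sub>R (y - x))"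
    by (rule mvt[OF zero_less_one]) blast+
  then have "f y - f x = f' (x + \<xi> *\<^sub>R (y - x)) (y - x)" by (simp add: \<phi>_def)
  then show ?thesis using bd[OF xy(3)[OF \<xi>(1,2)], of "y - x"] by simp
qed

text \<open>Makes the extension by zero of a function vanishing on the boundary Lipschitz.\<close>

lemma boundary_vanishing_bound:
  fixes f :: "'a::euclidean_space \<Rightarrow> real"
  assumes U: "open U" and contf: "continuous_on (closure U) f"
    and zero: "\<And>x. x \<in> frontier U \<Longrightarrow> f x = 0"
    and der: "\<And>x. x \<in> U \<Longrightarrow> (f has_derivative f' x) (at x)"
    and bd: "\<And>x h. x \<in> U \<Longrightarrow> \<bar>f' x h\<bar> \<le> B * norm h"
    and B: "B \<ge> 0" and x: "x \<in> U" and z: "z \<notin> U"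
  shows "\<bar>f x\<bar> \<le> B * norm (z - x)"
proof -
  obtain y where y: "y \<in> - U" "\<And>w. w \<in> - U \<Longrightarrow> dist x y \<le> dist x w"
    using distance_attains_inf[of "- U" x] U z by auto
  have xy: "x \<noteq> y" using x y(1) by auto
  \<comment> \<open>\<open>y\<close> is a point of the complement nearest to \<open>x\<close>; a
    point of the open segment outside \<open>U\<close> would be nearer.\<close>
  have seg: "x + s *\<^sub>R (y - x) \<in> U" if "0 < s" "s < 1" for s
  proof (rule ccontr)
    assume "x + s *\<^sub>R (y - x) \<notin> U"
    then have "dist x y \<le> dist x (x + s *\<^sub>R (y - x))" using y(2) by simp
    also have "\<dots> = s * dist x y" using that by (simp add: dist_norm norm_minus_commute)
    finally show False using that xy by simp
  qed
  have "(\<lambda>n. x + (1 - inverse (real (Suc (Suc n)))) *\<^sub>R (y - x)) \<longlonglongrightarrow> x + (1 - 0) *\<^sub>R (y - x)"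
    by (intro tendsto_intros LIMSEQ_Suc[OF LIMSEQ_inverse_real_of_nat])
  then have lim: "(\<lambda>n. x + (1 - inverse (real (Suc (Suc n)))) *\<^sub>R (y - x)) \<longlonglongrightarrow> y" by simp
  have "x + (1 - inverse (real (Suc (Suc n)))) *\<^sub>R (y - x) \<in> U" for n
    by (rule seg) (auto simp: field_simps)
  with lim have "y \<in> closure U" unfolding closure_sequential
    by (intro exI[of _ "\<lambda>n. x + (1 - inverse (real (Suc (Suc n)))) *\<^sub>R (y - x)"]) simp
  then have fr: "y \<in> frontier U" using y(1) U by (simp add: frontier_def interior_open)
  have "\<bar>f y - f x\<bar> \<le> B * norm (y - x)"
    by (rule derivative_bound_open_segment[OF contf der bd])
      (use x \<open>y \<in> closure U\<close> closure_subset[of U] seg in auto)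
  also have "norm (y - x) \<le> norm (z - x)" using y(2)[of z] z by (simp add: dist_norm norm_minus_commute)
  finally show ?thesis using zero[OF fr] B by (simp add: mult_left_mono)
qed

text \<open>The integral of a difference quotient of the extension by zero vanishes by translation invariance; pass to the limit by
  dominated convergence.\<close>

lemma integral_directional_derivative_eq_0:
  fixes f :: "'a::euclidean_space \<Rightarrow> real"
  assumes U: "open U" "bounded U" "negligible (frontier U)"
    and contf: "continuous_on (closure U) f"
    and zero: "\<And>x. x \<in> frontier U \<Longrightarrow> f x = 0"
    and der: "\<And>x. x \<in> U \<Longrightarrow> (f has_derivative f' x) (at x)"
    and bd: "\<And>x h. x \<in> U \<Longrightarrow> \<bar>f' x h\<bar> \<le> B * norm h"
    and cont': "continuous_on U (\<lambda>x. f' x e)"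
  shows "(LINT x:U|lborel. f' x e) = 0"
proof (cases "U = {}")
  case True then show ?thesis by (simp add: set_lebesgue_integral_def)
next
  case False
  then obtain x0 where x0: "x0 \<in> U" by auto
  have B: "B \<ge> 0"
  proof (cases "\<exists>h::'a. h \<noteq> 0")
    case True
    then obtain h :: 'a where "h \<noteq> 0" by auto
    then show ?thesis using bd[OF x0, of h] zero_less_norm_iff[of h]
      by (smt (verit) mult_neg_pos)
  next
    case False
    then have "(SOME b. b \<in> (Basis::'a set)) = 0" by blast
    then show ?thesis using nonempty_Basis some_in_eq nonzero_Basis by metis
  qed
  define F where "F x = indicator U x *\<^sub>R f x" for x
  define s where "s n = inverse (real (Suc n))" for n
  have s: "s \<longlonglongrightarrow> 0" "\<And>n. s n > 0" "\<And>n. s n \<le> 1"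
    unfolding s_def using LIMSEQ_inverse_real_of_nat by (auto simp: field_simps)
  have Fm: "F \<in> borel_measurable borel" unfolding F_def
    using U contf closure_subset by (intro borel_measurable_continuous_on_indicator) (auto intro: continuous_on_subset)
  have Fi: "integrable lborel F"
    using set_integrable_continuous_on_closure[OF U(1,2) contf] by (simp add: set_integrable_def F_def[abs_def])
  have Fshift: "integrable lborel (\<lambda>x. F (v + x))" for v
  proof -
    have "integrable (distr lborel borel ((+) v)) F" using Fi by (simp add: lborel_distr_plus)
    then show ?thesis by (subst (asm) integrable_distr_eq) (use Fm in auto)
  qed
  \<comment> \<open>Either the open segment stays in \<open>U\<close>, or it meets the complement in
    a point whose distance to both ends is at most \<open>norm v\<close>. In the second case each
    end value is bounded by \<open>B * norm v\<close> separately, whence the factor 2.\<close>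
  have lip: "\<bar>F (x + v) - F x\<bar> \<le> 2 * B * norm v" for x v
  proof -
    have bnd: "\<bar>f x\<bar> \<le> B * norm (z - x)" if "x \<in> U" "z \<notin> U" for x z
      by (rule boundary_vanishing_bound[OF U(1) contf zero der bd B that])
    show ?thesis
    proof (cases "\<forall>s. 0 < s \<and> s < 1 \<longrightarrow> x + s *\<^sub>R v \<in> U")
      case True
      show ?thesis
      proof (cases "x \<in> U \<and> x + v \<in> U")
        case xv: True
        have "\<bar>f (x + v) - f x\<bar> \<le> B * norm ((x + v) - x)"
          by (rule derivative_bound_open_segment[OF contf der bd])
            (use True xv closure_subset[of U] in auto)
        moreover have "B * norm v \<le> 2 * B * norm v" using B by (simp add: mult_right_mono)
        ultimately show ?thesis using xv by (simp add: F_def)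
      next
        case False
        have n: "0 \<le> B * norm v" using B by simp
        show ?thesis
        proof (cases "x \<in> U")
          case True
          then show ?thesis using False bnd[of x "x + v"] n by (simp add: F_def)
        next
          case xU: False
          show ?thesis
          proof (cases "x + v \<in> U")
            case True
            then show ?thesis using xU bnd[of "x + v" x] n by (simp add: F_def)
          next
            case False
            then show ?thesis using xU n by (simp add: F_def)
          qed
        qed
      qed
    next
      case False
      then obtain t where t: "0 < t" "t < 1" "x + t *\<^sub>R v \<notin> U" by auto
      have "\<bar>F x\<bar> \<le> B * norm v"
      proof (cases "x \<in> U")
        case True
        have "\<bar>f x\<bar> \<le> B * (t * norm v)" using bnd[OF True t(3)] t by simp
        also have "\<dots> \<le> B * norm v" using t B by (intro mult_left_mono mult_left_le_one_le) auto
        finally show ?thesis using True by (simp add: F_def)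
      qed (use B in \<open>simp add: F_def\<close>)
      moreover have "\<bar>F (x + v)\<bar> \<le> B * norm v"
      proof (cases "x + v \<in> U")
        case True
        have "x + t *\<^sub>R v - (x + v) = (t - 1) *\<^sub>R v" by (simp add: scaleR_diff_left)
        then have "\<bar>f (x + v)\<bar> \<le> B * ((1 - t) * norm v)" using bnd[OF True t(3)] t by simp
        also have "\<dots> \<le> B * norm v" using t B by (intro mult_left_mono mult_left_le_one_le) auto
        finally show ?thesis using True by (simp add: F_def)
      qed (use B in \<open>simp add: F_def\<close>)
      ultimately show ?thesis by linarith
    qed
  qed
  define D where "D n x = (F (s n *\<^sub>R e + x) - F x) / s n" for n x
  obtain b where b: "\<And>x. x \<in> U \<Longrightarrow> norm x \<le> b" using U(2) bounded_iff by blast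
  have int0: "(LINT x|lborel. D n x) = 0" for n
    unfolding D_def using lborel_integral_shift[OF Fm] Fi Fshift by simp
  have "(\<lambda>n. LINT x|lborel. D n x) \<longlonglongrightarrow> (LINT x|lborel. indicator U x *\<^sub>R f' x e)"
  proof (rule integral_dominated_convergence)
    show "(\<lambda>x. indicator U x *\<^sub>R f' x e) \<in> borel_measurable lborel"
      using borel_measurable_continuous_on_indicator[OF _ cont'] U by simp
    show "D n \<in> borel_measurable lborel" for n
      unfolding D_def[abs_def] using Fm by simp
    show "integrable lborel (\<lambda>x. 2 * B * norm e * indicator (cball 0 (b + norm e)) x)"
      using emeasure_bounded_finite[OF bounded_cball[of 0 "b + norm e"]]
      by (intro integrable_mult_right integrable_real_indicator) auto
    \<comment> \<open>All steps satisfy \<open>s n \<le> 1\<close>, so every difference quotient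
      vanishes outside one fixed ball, and inside it the Lipschitz bound is an integrable
      majorant.\<close>
    show "AE x in lborel. norm (D n x) \<le> 2 * B * norm e * indicator (cball 0 (b + norm e)) x" for n
    proof (rule AE_I2)
      fix x
      show "norm (D n x) \<le> 2 * B * norm e * indicator (cball 0 (b + norm e)) x"
      proof (cases "x \<in> cball 0 (b + norm e)")
        case True
        have "\<bar>F (s n *\<^sub>R e + x) - F x\<bar> \<le> 2 * B * (s n * norm e)"
          using lip[of x "s n *\<^sub>R e"] s(2)[of n] by (simp add: add.commute)
        then show ?thesis using True s(2)[of n] by (simp add: D_def field_simps)
      next
        case False
        have "norm (s n *\<^sub>R e) \<le> norm e" using s(2,3)[of n] by (simp add: mult_left_le_one_le)
        then have "x \<notin> U \<and> s n *\<^sub>R e + x \<notin> U"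
          using False b[of x] b[of "s n *\<^sub>R e + x"] norm_triangle_ineq4[of "s n *\<^sub>R e + x" "s n *\<^sub>R e"] norm_ge_zero[of e]
          by (auto simp: dist_norm)
        then show ?thesis using False by (simp add: D_def F_def)
      qed
    qed
    \<comment> \<open>The extension by zero is differentiable off the boundary, in \<open>U\<close>
      as well as in the exterior; this is where the boundary has to be a null set.\<close>
    have "AE x in lborel. x \<notin> frontier U"
    proof (rule AE_not_in)
      show "frontier U \<in> null_sets lborel"
        using U(3) unfolding negligible_iff_null_sets
        by (subst (asm) null_sets_completion_iff) auto
    qed
    then show "AE x in lborel. (\<lambda>n. D n x) \<longlonglongrightarrow> indicator U x *\<^sub>R f' x e"
    proof eventually_elim
      fix x assume x: "x \<notin> frontier U"
      have "(F has_derivative (\<lambda>h. indicator U x *\<^sub>R f' x h)) (at x)"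
      proof (cases "x \<in> U")
        case True
        then show ?thesis
          using has_derivative_transform_within_open[OF der[OF True] U(1) True, of F]
          by (simp add: F_def)
      next
        case False
        then have "x \<in> - closure U" using x U(1) by (simp add: frontier_def interior_open)
        moreover have "((\<lambda>_. 0) has_derivative (\<lambda>h. 0)) (at x)" for x :: 'a by simp
        ultimately have "(F has_derivative (\<lambda>h. 0)) (at x)"
          using closure_subset[of U]
          by (intro has_derivative_transform_within_open[of "\<lambda>_. 0" _ x UNIV "- closure U" F])
            (auto simp: F_def indicator_def)
        then show ?thesis using False by simp
      qed
      from difference_quotient_tendsto[OF this s(1), of e] s(2)
      show "(\<lambda>n. D n x) \<longlonglongrightarrow> indicator U x *\<^sub>R f' x e"
        by (simp add: D_def add.commute less_imp_neq[symmetric])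
    qed
  qed
  then show ?thesis using LIMSEQ_unique[OF tendsto_const[of 0]] by (auto simp: int0 set_lebesgue_integral_def)
qed

text \<open>Dominated convergence along a filter: the limit is tested on sequences, and since
  continuity and the bound hold only eventually, an initial segment of each sequence is
  dropped.\<close>

lemma set_integral_tendsto:
  fixes G :: "'a::euclidean_space \<Rightarrow> real \<Rightarrow> real"
  assumes U: "open U" "bounded U"
    and G: "\<forall>\<^sub>F \<tau> in at t within S. continuous_on U (\<lambda>x. G x \<tau>) \<and> (\<forall>x\<in>U. \<bar>G x \<tau>\<bar> \<le> B)"
    and lim: "\<And>x. x \<in> U \<Longrightarrow> (G x \<longlongrightarrow> L x) (at t within S)"
  shows "((\<lambda>\<tau>. LINT x:U|lborel. G x \<tau>) \<longlongrightarrow> (LINT x:U|lborel. L x)) (at t within S)"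
  unfolding tendsto_at_iff_sequentially
proof (intro allI impI)
  fix X assume X: "\<forall>i. X i \<in> S - {t}" "X \<longlonglongrightarrow> t"
  then have fX: "filterlim X (at t within S) sequentially" by (simp add: filterlim_at)
  from eventually_compose_filterlim[OF G fX]
  obtain N where N: "\<And>n. n \<ge> N \<Longrightarrow> continuous_on U (\<lambda>x. G x (X n)) \<and> (\<forall>x\<in>U. \<bar>G x (X n)\<bar> \<le> B)"
    by (auto simp: eventually_sequentially)
  have m: "(\<lambda>x. indicator U x *\<^sub>R G x (X (n + N))) \<in> borel_measurable lborel" for n
    using borel_measurable_continuous_on_indicator[of U "\<lambda>x. G x (X (n + N))"] N[of "n + N"] U by simp
  have l: "(\<lambda>n. indicator U x *\<^sub>R G x (X (n + N))) \<longlonglongrightarrow> indicator U x *\<^sub>R L x" for x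
  proof (cases "x \<in> U")
    case True
    have "(\<lambda>n. G x (X n)) \<longlonglongrightarrow> L x" by (rule filterlim_compose[OF lim[OF True] fX])
    from LIMSEQ_ignore_initial_segment[OF this, of N] True show ?thesis by simp
  qed simp
  have "(\<lambda>n. LINT x|lborel. indicator U x *\<^sub>R G x (X (n + N))) \<longlonglongrightarrow> (LINT x|lborel. indicator U x *\<^sub>R L x)"
  proof (rule integral_dominated_convergence)
    show "(\<lambda>x. indicator U x *\<^sub>R L x) \<in> borel_measurable lborel"
      by (rule borel_measurable_LIMSEQ_real[OF l m])
    show "integrable lborel (\<lambda>x. B * indicator U x)"
      using U emeasure_bounded_finite by (intro integrable_mult_right integrable_real_indicator) auto
    show "AE x in lborel. norm (indicator U x *\<^sub>R G x (X (n + N))) \<le> B * indicator U x" for n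
      using N[of "n + N"] by (intro AE_I2) (auto simp: indicator_def)
  qed (use m l in auto)
  then have "(\<lambda>n. LINT x:U|lborel. G x (X (n + N))) \<longlonglongrightarrow> (LINT x:U|lborel. L x)"
    by (simp add: set_lebesgue_integral_def)
  then show "((\<lambda>\<tau>. LINT x:U|lborel. G x \<tau>) \<circ> X) \<longlonglongrightarrow> (LINT x:U|lborel. L x)"
    unfolding o_def by (rule LIMSEQ_offset)
qed

lemma borel_measurable_indicator_continuous:
  fixes f :: "'a::euclidean_space \<Rightarrow> real"
  assumes "open U" "continuous_on U f"
  shows "(\<lambda>x. indicator U x *\<^sub>R f x) \<in> borel_measurable lborel"
  using borel_measurable_continuous_on_indicator[of U f] assms by simp

text \<open>Two integrations by parts without second derivatives of \<open>f\<close> or \<open>g\<close>: one of the derivatives is replaced by a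
  difference quotient.\<close>

lemma integral_mixed_derivatives:
  fixes f g :: "'a::euclidean_space \<Rightarrow> real"
  assumes U: "open U" "bounded U" "negligible (frontier U)"
    and contf: "continuous_on (closure U) f"
    and derf: "\<And>x. x \<in> U \<Longrightarrow> (f has_derivative f' x) (at x)"
    and bdf: "\<And>x h. x \<in> U \<Longrightarrow> \<bar>f' x h\<bar> \<le> Bf * norm h"
    and contf': "\<And>h. continuous_on U (\<lambda>x. f' x h)"
    and derg: "\<And>x. (g has_derivative g' x) (at x)"
    and bdg: "\<And>x h. \<bar>g' x h\<bar> \<le> Bg * norm h"
    and contg': "\<And>h. continuous_on UNIV (\<lambda>x. g' x h)"
    and K: "compact K" "K \<subseteq> U" "\<And>x. x \<notin> K \<Longrightarrow> g x = 0"
  shows "(LINT x:U|lborel. f' x a * g' x b) = (LINT x:U|lborel. f' x b * g' x a)"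
proof -
  have g'0: "g' x h = 0" if "x \<notin> K" for x h
  proof -
    have "((\<lambda>_. 0) has_derivative g' x) (at x)"
      by (rule has_derivative_transform_within_open[OF derg, of "- K"])
        (use K compact_imp_closed that in auto)
    then have "g' x = (\<lambda>_. 0)" by (rule has_derivative_unique) simp
    then show ?thesis by simp
  qed
  have contg: "continuous_on S g" for S
    by (intro continuous_at_imp_continuous_on ballI has_derivative_continuous[OF derg])
  \<comment> \<open>The distance from the support of \<open>g\<close> to the complement of
    \<open>U\<close>; shifts shorter than \<open>d\<close> keep the support inside
    \<open>U\<close>.\<close>
  obtain d where d: "d > 0" "\<And>x y. x \<in> K \<Longrightarrow> y \<in> - U \<Longrightarrow> d \<le> dist x y"
  proof -
    have "K \<inter> - U = {}" using K by auto
    from separate_compact_closed[OF K(1) closed_Compl[OF U(1)] this] show ?thesis using that by blast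
  qed
  \<comment> \<open>The summand 1 keeps \<open>\<beta>\<close> positive also for
    \<open>b = 0\<close>; with \<open>t = d / (2 * \<beta>)\<close> every shift
    \<open>s n *\<^sub>R b\<close> has length at most \<open>d / 2\<close>.\<close>
  define \<beta> where "\<beta> = 1 + norm b"
  define t where "t = d / (2 * \<beta>)"
  have nb: "\<beta> > 0" by (simp add: \<beta>_def add_pos_nonneg)
  have t: "t > 0" using d(1) nb by (simp add: t_def)
  define s where "s n = t * inverse (real (Suc n))" for n
  have s: "s \<longlonglongrightarrow> 0" "\<And>n. s n > 0"
    unfolding s_def using tendsto_mult_right_zero[OF LIMSEQ_inverse_real_of_nat, of t] t by auto
  have sb: "norm (s n *\<^sub>R b) < d" for n
  proof -
    have "s n \<le> t" unfolding s_def using t by (simp add: field_simps)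
    then have "norm (s n *\<^sub>R b) \<le> t * norm b" using s(2)[of n] by (simp add: mult_right_mono)
    also have "\<dots> \<le> t * \<beta>" using t by (intro mult_left_mono) (auto simp: \<beta>_def)
    also have "\<dots> = d / 2" using nb by (simp add: t_def)
    also have "\<dots> < d" using d(1) by simp
    finally show ?thesis .
  qed
  have inU: "x + w \<in> U" if "x \<in> K" "norm w < d" for x w
  proof (rule ccontr)
    assume "x + w \<notin> U"
    then have "d \<le> dist x (x + w)" using d(2) that by blast
    then show False using that by (simp add: dist_norm)
  qed
  have Bf: "\<bar>f (x + w) - f x\<bar> \<le> Bf * norm w" if "x \<in> K" "norm w < d" for x w
  proof -
    have "\<bar>f (x + w) - f x\<bar> \<le> Bf * norm ((x + w) - x)"
    proof (rule derivative_bound_open_segment[OF contf derf bdf])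
      fix s :: real assume s: "0 < s" "s < 1"
      have "norm (s *\<^sub>R w) \<le> norm w" using s by (simp add: mult_left_le_one_le)
      then show "x + s *\<^sub>R ((x + w) - x) \<in> U" using inU[of x "s *\<^sub>R w"] that by simp
    qed (use that K inU[of x w] closure_subset[of U] in auto)
    then show ?thesis by simp
  qed
  have Bg: "\<bar>g y - g x\<bar> \<le> Bg * norm (y - x)" for x y
    by (rule derivative_bound_open_segment[of UNIV g g']) (use contg derg bdg in auto)
  have compU: "compact (closure U)" using U(2) by simp
  obtain Mf where Mf: "\<And>x. x \<in> closure U \<Longrightarrow> \<bar>f x\<bar> \<le> Mf"
    using compact_imp_bounded[OF compact_continuous_image[OF contf compU]]
    unfolding bounded_iff by auto
  \<comment> \<open>The derivative of \<open>f x * (g x - g (x - w))\<close> in direction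
    \<open>a\<close> has integral 0, since the product vanishes on the boundary. Shifting the
    variable by \<open>w\<close> in the term with \<open>g' (x - w) a\<close> turns the backward
    difference of \<open>g\<close> into the forward difference of \<open>f\<close>.\<close>
  have key: "(LINT x:U|lborel. f' x a * (g x - g (x - w))) = (LINT x:U|lborel. (f (x + w) - f x) * g' x a) \<and>
     (\<lambda>x. indicator U x *\<^sub>R ((f (x + w) - f x) * g' x a)) \<in> borel_measurable borel"
    if w: "norm w < d" for w
  proof -
    define \<phi> where "\<phi> x = f x * (g x - g (x - w))" for x
    define \<phi>' where "\<phi>' x h = f x * (g' x h - g' (x - w) h) + f' x h * (g x - g (x - w))" for x h
    have c1: "continuous_on S (\<lambda>x. g (x - w))" for S
      by (rule continuous_on_compose2[OF contg[of UNIV]]) (auto intro!: continuous_intros)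
    have c2: "continuous_on S (\<lambda>x. g' (x - w) h)" for S h
      by (rule continuous_on_compose2[OF contg'[of h]]) (auto intro!: continuous_intros)
    have c3: "continuous_on S (\<lambda>x. g' x h)" for S h
      by (rule continuous_on_subset[OF contg'[of h]]) auto
    have cfU: "continuous_on U f" using contf closure_subset continuous_on_subset by blast
    have outK: "x \<notin> K \<and> x - w \<notin> K" if "x \<in> frontier U" for x
      using that inU[of "x - w" w] K w U(1) by (auto simp: frontier_def interior_open)
    have I0: "(LINT x:U|lborel. \<phi>' x a) = 0"
    proof (rule integral_directional_derivative_eq_0[OF U, of \<phi>])
      show "continuous_on (closure U) \<phi>" unfolding \<phi>_def by (intro continuous_intros contf contg c1)
      show "\<phi> x = 0" if "x \<in> frontier U" for x using outK[OF that] K by (simp add: \<phi>_def)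
      show "continuous_on U (\<lambda>x. \<phi>' x a)"
        unfolding \<phi>'_def by (intro continuous_intros cfU contf' contg c1 c2 c3)
      fix x assume x: "x \<in> U"
      have "((\<lambda>x. x - w) has_derivative (\<lambda>h. h)) (at x)" by (auto intro!: derivative_eq_intros)
      from has_derivative_compose[OF this derg]
      have "((\<lambda>x. g x - g (x - w)) has_derivative (\<lambda>h. g' x h - g' (x - w) h)) (at x)"
        by (intro has_derivative_diff derg)
      from has_derivative_mult[OF derf[OF x] this]
      show "(\<phi> has_derivative \<phi>' x) (at x)" unfolding \<phi>_def[abs_def] \<phi>'_def .
      fix h
      have "\<bar>f x * (g' x h - g' (x - w) h)\<bar> \<le> Mf * (Bg * norm h + Bg * norm h)"
        unfolding abs_mult using Mf[of x] x closure_subset[of U] bdg[of x h] bdg[of "x - w" h]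
        by (intro mult_mono) auto
      moreover have "\<bar>f' x h * (g x - g (x - w))\<bar> \<le> (Bf * norm h) * (Bg * norm w)"
        unfolding abs_mult using bdf[OF x, of h] Bg[of x "x - w"] order_trans[OF abs_ge_zero bdf[OF x, of h]]
        by (intro mult_mono) auto
      ultimately show "\<bar>\<phi>' x h\<bar> \<le> (2 * Mf * Bg + Bf * (Bg * norm w)) * norm h"
        unfolding \<phi>'_def by (simp add: algebra_simps)
    qed
    define \<psi> where "\<psi> x = indicator U x *\<^sub>R (f x * g' (x - w) a)" for x
    have \<psi>m: "\<psi> \<in> borel_measurable borel" unfolding \<psi>_def[abs_def]
      using U(1) cfU c2 by (intro borel_measurable_continuous_on_indicator continuous_intros) auto
    have \<psi>w: "\<psi> (w + x) = indicator U x *\<^sub>R (f (x + w) * g' x a)" for x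
    proof (cases "x \<in> K")
      case True
      then show ?thesis using inU[OF True w] K by (auto simp: \<psi>_def add.commute)
    next
      case False
      then show ?thesis by (simp add: \<psi>_def g'0)
    qed
    have \<psi>wm: "(\<lambda>x. indicator U x *\<^sub>R (f (x + w) * g' x a)) \<in> borel_measurable borel"
      unfolding \<psi>w[symmetric] using \<psi>m by measurable
    have fm: "(\<lambda>x. indicator U x *\<^sub>R (f x * g' x a)) \<in> borel_measurable borel"
      using U(1) cfU c3 by (intro borel_measurable_continuous_on_indicator continuous_intros) auto
    have i1: "set_integrable lborel U (\<lambda>x. f' x a * (g x - g (x - w)))"
    proof (rule set_integrable_bounded_continuous[OF U(1,2)])
      show "continuous_on U (\<lambda>x. f' x a * (g x - g (x - w)))" by (intro continuous_intros contf' contg c1)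
      show "norm (f' x a * (g x - g (x - w))) \<le> (Bf * norm a) * (Bg * norm w)" if "x \<in> U" for x
        unfolding real_norm_def abs_mult using bdf[OF that, of a] Bg[of x "x - w"] order_trans[OF abs_ge_zero bdf[OF that, of a]]
        by (intro mult_mono) auto
    qed
    have i2: "set_integrable lborel U (\<lambda>x. f x * g' x a)"
      by (rule set_integrable_continuous_on_closure[OF U(1,2)]) (intro continuous_intros contf c3)
    have i3: "set_integrable lborel U (\<lambda>x. f x * g' (x - w) a)"
      by (rule set_integrable_continuous_on_closure[OF U(1,2)]) (intro continuous_intros contf c2)
    have i4: "set_integrable lborel U (\<lambda>x. f (x + w) * g' x a)"
    proof -
      have "integrable (distr lborel borel ((+) w)) \<psi>"
        using i3 by (simp add: lborel_distr_plus set_integrable_def \<psi>_def[abs_def])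
      then show ?thesis
        by (subst (asm) integrable_distr_eq) (use \<psi>m in \<open>auto simp: \<psi>w set_integrable_def\<close>)
    qed
    have sh: "(LINT x:U|lborel. f x * g' (x - w) a) = (LINT x:U|lborel. f (x + w) * g' x a)"
      using lborel_integral_shift[OF \<psi>m, of w] unfolding \<psi>w
      by (simp add: \<psi>_def set_lebesgue_integral_def)
    have "(LINT x:U|lborel. \<phi>' x a) = (LINT x:U|lborel. (f x * g' x a - f x * g' (x - w) a) + f' x a * (g x - g (x - w)))"
      by (simp add: \<phi>'_def right_diff_distrib)
    also have "\<dots> = (LINT x:U|lborel. f x * g' x a) - (LINT x:U|lborel. f x * g' (x - w) a)
        + (LINT x:U|lborel. f' x a * (g x - g (x - w)))"
      using i1 i2 i3 by (simp add: set_integral_add set_integral_diff)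
    finally have "(LINT x:U|lborel. f' x a * (g x - g (x - w)))
        = (LINT x:U|lborel. f (x + w) * g' x a) - (LINT x:U|lborel. f x * g' x a)"
      using I0 sh by simp
    also have "\<dots> = (LINT x:U|lborel. (f (x + w) - f x) * g' x a)"
      using i2 i4 by (simp add: set_integral_diff left_diff_distrib)
    finally show ?thesis using borel_measurable_diff[OF \<psi>wm fm]
      by (simp add: left_diff_distrib right_diff_distrib)
  qed
  have Bf0: "0 \<le> Bf * norm b" if "x \<in> U" for x using order_trans[OF abs_ge_zero bdf[OF that]] .
  have Bg0: "0 \<le> Bg * norm c" for c :: 'a using order_trans[OF abs_ge_zero bdg] .
  have Uint: "integrable lborel (\<lambda>x. c * indicator U x)" for c :: real
    using U emeasure_bounded_finite by (intro integrable_mult_right integrable_real_indicator) auto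
  have snz: "s n \<noteq> 0" for n using s(2)[of n] by simp
  have L1: "(\<lambda>n. LINT x:U|lborel. f' x a * ((g x - g (x - s n *\<^sub>R b)) / s n)) \<longlonglongrightarrow> (LINT x:U|lborel. f' x a * g' x b)"
    unfolding set_lebesgue_integral_def
  proof (rule integral_dominated_convergence[OF _ _ Uint[of "(Bf * norm a) * (Bg * norm b)"]])
    show "(\<lambda>x. indicator U x *\<^sub>R (f' x a * g' x b)) \<in> borel_measurable lborel"
      by (intro borel_measurable_indicator_continuous U(1) continuous_on_mult contf' continuous_on_subset[OF contg'] subset_UNIV)
    show "(\<lambda>x. indicator U x *\<^sub>R (f' x a * ((g x - g (x - s n *\<^sub>R b)) / s n))) \<in> borel_measurable lborel" for n
    proof -
      have "continuous_on U (\<lambda>x. g (x - s n *\<^sub>R b))"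
        by (rule continuous_on_compose2[OF contg[of UNIV]]) (auto intro!: continuous_intros)
      then show ?thesis using snz
        by (intro borel_measurable_indicator_continuous U(1) continuous_on_mult contf' continuous_on_divide
            continuous_on_diff contg continuous_on_const ballI)
    qed
    show "AE x in lborel. (\<lambda>n. indicator U x *\<^sub>R (f' x a * ((g x - g (x - s n *\<^sub>R b)) / s n))) \<longlonglongrightarrow> indicator U x *\<^sub>R (f' x a * g' x b)"
    proof (rule AE_I2)
      fix x
      have "(\<lambda>n. (g (x + s n *\<^sub>R (- b)) - g x) / s n) \<longlonglongrightarrow> g' x (- b)"
        by (rule difference_quotient_tendsto[OF derg s(1) snz])
      then have "(\<lambda>n. - ((g (x + s n *\<^sub>R (- b)) - g x) / s n)) \<longlonglongrightarrow> - g' x (- b)" by (rule tendsto_minus)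
      moreover have "g' x (- b) = - g' x b"
        using has_derivative_linear[OF derg[of x]] by (simp add: linear_neg)
      ultimately have "(\<lambda>n. (g x - g (x - s n *\<^sub>R b)) / s n) \<longlonglongrightarrow> g' x b"
        by (simp add: minus_divide_left)
      then show "(\<lambda>n. indicator U x *\<^sub>R (f' x a * ((g x - g (x - s n *\<^sub>R b)) / s n))) \<longlonglongrightarrow> indicator U x *\<^sub>R (f' x a * g' x b)"
        by (intro tendsto_intros)
    qed
    show "AE x in lborel. norm (indicator U x *\<^sub>R (f' x a * ((g x - g (x - s n *\<^sub>R b)) / s n)))
        \<le> (Bf * norm a) * (Bg * norm b) * indicator U x" for n
    proof (rule AE_I2)
      fix x
      have q: "\<bar>(g x - g (x - s n *\<^sub>R b)) / s n\<bar> \<le> Bg * norm b"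
        using Bg[of x "x - s n *\<^sub>R b"] s(2)[of n] by (simp add: abs_minus_commute field_simps)
      show "norm (indicator U x *\<^sub>R (f' x a * ((g x - g (x - s n *\<^sub>R b)) / s n)))
        \<le> (Bf * norm a) * (Bg * norm b) * indicator U x"
      proof (cases "x \<in> U")
        case True
        have "\<bar>f' x a\<bar> * \<bar>(g x - g (x - s n *\<^sub>R b)) / s n\<bar> \<le> (Bf * norm a) * (Bg * norm b)"
          by (rule mult_mono[OF bdf[OF True] q order_trans[OF abs_ge_zero bdf[OF True]]]) simp
        then show ?thesis using True by (simp only: abs_mult real_norm_def) (simp add: abs_mult)
      qed simp
    qed
  qed
  have L2: "(\<lambda>n. LINT x:U|lborel. (f (x + s n *\<^sub>R b) - f x) / s n * g' x a) \<longlonglongrightarrow> (LINT x:U|lborel. f' x b * g' x a)"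
    unfolding set_lebesgue_integral_def
  proof (rule integral_dominated_convergence[OF _ _ Uint[of "(Bf * norm b) * (Bg * norm a)"]])
    show "(\<lambda>x. indicator U x *\<^sub>R (f' x b * g' x a)) \<in> borel_measurable lborel"
      by (intro borel_measurable_indicator_continuous U(1) continuous_on_mult contf' continuous_on_subset[OF contg'] subset_UNIV)
    show "(\<lambda>x. indicator U x *\<^sub>R ((f (x + s n *\<^sub>R b) - f x) / s n * g' x a)) \<in> borel_measurable lborel" for n
    proof -
      have "(\<lambda>x. inverse (s n) * (indicator U x *\<^sub>R ((f (x + s n *\<^sub>R b) - f x) * g' x a))) \<in> borel_measurable lborel"
        using key[OF sb[of n]] by (intro borel_measurable_times borel_measurable_const) auto
      then show ?thesis by (simp add: field_simps)
    qed
    show "AE x in lborel. (\<lambda>n. indicator U x *\<^sub>R ((f (x + s n *\<^sub>R b) - f x) / s n * g' x a)) \<longlonglongrightarrow> indicator U x *\<^sub>R (f' x b * g' x a)"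
    proof (rule AE_I2)
      fix x
      show "(\<lambda>n. indicator U x *\<^sub>R ((f (x + s n *\<^sub>R b) - f x) / s n * g' x a)) \<longlonglongrightarrow> indicator U x *\<^sub>R (f' x b * g' x a)"
      proof (cases "x \<in> U")
        case True
        from tendsto_mult[OF difference_quotient_tendsto[OF derf[OF True] s(1) snz, of b] tendsto_const[of "g' x a"]] True
        show ?thesis by simp
      qed simp
    qed
    show "AE x in lborel. norm (indicator U x *\<^sub>R ((f (x + s n *\<^sub>R b) - f x) / s n * g' x a))
        \<le> (Bf * norm b) * (Bg * norm a) * indicator U x" for n
    proof (rule AE_I2)
      fix x
      show "norm (indicator U x *\<^sub>R ((f (x + s n *\<^sub>R b) - f x) / s n * g' x a))
        \<le> (Bf * norm b) * (Bg * norm a) * indicator U x"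
      proof (cases "x \<in> K")
        case True
        have "\<bar>(f (x + s n *\<^sub>R b) - f x) / s n\<bar> \<le> Bf * norm b"
          using Bf[OF True sb[of n]] s(2)[of n] by (simp add: field_simps)
        then have "\<bar>(f (x + s n *\<^sub>R b) - f x) / s n\<bar> * \<bar>g' x a\<bar> \<le> (Bf * norm b) * (Bg * norm a)"
          by (rule mult_mono[OF _ bdg Bf0]) (use True K in auto)
        then show ?thesis using True K by (auto simp: abs_mult)
      next
        case False
        then show ?thesis using Bf0[of x] Bg0[of a] by (auto simp: g'0 indicator_def)
      qed
    qed
  qed
  have eq: "(LINT x:U|lborel. f' x a * ((g x - g (x - s n *\<^sub>R b)) / s n))
      = (LINT x:U|lborel. (f (x + s n *\<^sub>R b) - f x) / s n * g' x a)" for n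
  proof -
    have "(LINT x:U|lborel. f' x a * (g x - g (x - s n *\<^sub>R b))) / s n
      = (LINT x:U|lborel. (f (x + s n *\<^sub>R b) - f x) * g' x a) / s n"
      using key[OF sb[of n]] by simp
    then show ?thesis
      by (simp only: set_integral_divide_zero[symmetric] times_divide_eq_right times_divide_eq_left)
  qed
  show ?thesis using L1 L2 unfolding eq by (rule LIMSEQ_unique)
qed

section \<open>Differentiation under the integral sign and cutoff functions\<close>

lemma has_real_derivative_set_integral:
  fixes F :: "'a::euclidean_space \<Rightarrow> real \<Rightarrow> real"
  assumes U: "open U" "bounded U" and t: "c < t" "t < d"
    and F: "\<And>\<tau>. c < \<tau> \<Longrightarrow> \<tau> < d \<Longrightarrow> set_integrable lborel U (\<lambda>x. F x \<tau>)"
    and cont: "\<And>\<tau>. c < \<tau> \<Longrightarrow> \<tau> < d \<Longrightarrow> continuous_on U (\<lambda>x. F x \<tau>)"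
    and der: "\<And>x \<tau>. x \<in> U \<Longrightarrow> c < \<tau> \<Longrightarrow> \<tau> < d \<Longrightarrow> (F x has_real_derivative F' x \<tau>) (at \<tau>)"
    and bd: "\<And>x \<tau>. x \<in> U \<Longrightarrow> c < \<tau> \<Longrightarrow> \<tau> < d \<Longrightarrow> \<bar>F' x \<tau>\<bar> \<le> B"
  shows "((\<lambda>t. LINT x:U|lborel. F x t) has_real_derivative (LINT x:U|lborel. F' x t)) (at t)"
  unfolding has_field_derivative_iff
proof (rule Lim_transform_eventually)
  have ev: "\<forall>\<^sub>F \<tau> in at t. c < \<tau> \<and> \<tau> < d \<and> \<tau> \<noteq> t"
    unfolding eventually_at
    by (rule exI[of _ "min (t - c) (d - t)"]) (use t in \<open>auto simp: dist_real_def\<close>)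
  show "((\<lambda>\<tau>. LINT x:U|lborel. (F x \<tau> - F x t) / (\<tau> - t)) \<longlongrightarrow> (LINT x:U|lborel. F' x t)) (at t)"
  proof (rule set_integral_tendsto[OF U, where B = B])
    show "\<forall>\<^sub>F \<tau> in at t. continuous_on U (\<lambda>x. (F x \<tau> - F x t) / (\<tau> - t)) \<and>
      (\<forall>x\<in>U. \<bar>(F x \<tau> - F x t) / (\<tau> - t)\<bar> \<le> B)"
      using ev
    proof eventually_elim
      case (elim \<tau>)
      have "\<bar>F x \<tau> - F x t\<bar> \<le> B * \<bar>\<tau> - t\<bar>" if x: "x \<in> U" for x
      proof -
        have "norm (F x \<tau> - F x t) \<le> B * norm (\<tau> - t)"
        proof (rule field_differentiable_bound[of "{c<..<d}" "F x" "F' x" B])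
          show "\<And>z. z \<in> {c<..<d} \<Longrightarrow> (F x has_field_derivative F' x z) (at z within {c<..<d})"
            using der[OF x] by (auto intro: has_field_derivative_at_within)
        qed (use bd[OF x] elim t in auto)
        then show ?thesis by simp
      qed
      then show ?case using elim t cont[of \<tau>] cont[of t]
        by (auto intro!: continuous_intros simp: field_simps)
    qed
    show "((\<lambda>\<tau>. (F x \<tau> - F x t) / (\<tau> - t)) \<longlongrightarrow> F' x t) (at t)" if "x \<in> U" for x
      using der[OF that t] by (simp add: has_field_derivative_iff)
  qed
  show "\<forall>\<^sub>F \<tau> in at t. (LINT x:U|lborel. (F x \<tau> - F x t) / (\<tau> - t))
      = ((LINT x:U|lborel. F x \<tau>) - (LINT x:U|lborel. F x t)) / (\<tau> - t)"
    using ev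
  proof eventually_elim
    case (elim \<tau>)
    have "(LINT x:U|lborel. (F x \<tau> - F x t) / (\<tau> - t)) = (LINT x:U|lborel. F x \<tau> - F x t) / (\<tau> - t)"
      by (rule set_integral_divide_zero)
    then show ?case using F[of \<tau>] F[of t] elim t by (simp add: set_integral_diff)
  qed
qed

text \<open>The squared positive part is the building block of the cutoffs: it is of class C1, which
  is all the smoothness they need.\<close>

lemma power2_max_0_has_derivative:
  "((\<lambda>s::real. (max 0 s)\<^sup>2) has_real_derivative 2 * max 0 s) (at s)"
proof (cases "s = 0")
  case True
  have "((\<lambda>h. ((max 0 h)\<^sup>2 - 0) / h) \<longlongrightarrow> 0) (at (0::real))"
  proof (rule Lim_null_comparison)
    show "\<forall>\<^sub>F h in at (0::real). norm (((max 0 h)\<^sup>2 - 0) / h) \<le> \<bar>h\<bar>"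
      unfolding eventually_at by (rule exI[of _ 1]) (auto simp: max_def power2_eq_square)
    show "((\<lambda>h::real. \<bar>h\<bar>) \<longlongrightarrow> 0) (at 0)" by (rule tendsto_rabs_zero[OF tendsto_ident_at])
  qed
  then show ?thesis using True by (simp add: has_field_derivative_iff)
next
  case False
  then consider "s > 0" | "s < 0" by linarith
  then show ?thesis
  proof cases
    case 1
    have "((\<lambda>s::real. s\<^sup>2) has_real_derivative 2 * max 0 s) (at s)"
      using 1 by (auto intro!: derivative_eq_intros)
    then show ?thesis
      by (rule has_field_derivative_transform_within_open[of _ _ _ "{0<..}"]) (use 1 in auto)
  next
    case 2
    have "((\<lambda>s::real. 0) has_real_derivative 2 * max 0 s) (at s)" using 2 by simp
    then show ?thesis
      by (rule has_field_derivative_transform_within_open[of _ _ _ "{..<0}"]) (use 2 in auto)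
  qed
qed

text \<open>Cover \<open>K\<close> by finitely many balls whose closures lie in \<open>U\<close> and
  let \<open>b\<close> be the sum of the squared positive parts of
  \<open>(r y)\<^sup>2 - dist\<^sup>2\<close>. This bump is C1, vanishes off the closed balls and is
  bounded below on \<open>K\<close> by some \<open>c > 0\<close>. The gradient of the cutoff is
  bounded because it is continuous with compact support.\<close>

lemma C1_cutoff:
  fixes K U :: "'a::euclidean_space set"
  assumes K: "compact K" and U: "open U" and KU: "K \<subseteq> U"
  obtains \<eta> :: "'a \<Rightarrow> real" and n :: "'a \<Rightarrow> 'a" and S C where
    "compact S" "S \<subseteq> U" "C \<ge> 0" "\<And>x. (\<eta> has_derivative (\<lambda>h. n x \<bullet> h)) (at x)"
    "continuous_on UNIV n" "\<And>x. norm (n x) \<le> C" "\<And>x. 0 \<le> \<eta> x" "\<And>x. \<eta> x \<le> 1"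
    "\<And>x. x \<in> K \<Longrightarrow> \<eta> x = 1" "\<And>x. x \<notin> S \<Longrightarrow> \<eta> x = 0"
proof -
  have "\<exists>r>0. cball x r \<subseteq> U" if "x \<in> K" for x
    using that KU U open_contains_cball by blast
  then obtain r where r: "\<And>x. x \<in> K \<Longrightarrow> r x > 0 \<and> cball x (r x) \<subseteq> U" by metis
  have "K \<subseteq> (\<Union>x\<in>K. ball x (r x))" using r by auto
  then obtain I where I: "I \<subseteq> K" "finite I" "K \<subseteq> (\<Union>x\<in>I. ball x (r x))"
    using compactE_image[OF K, of K "\<lambda>x. ball x (r x)"] by auto
  define S where "S = (\<Union>x\<in>I. cball x (r x))"
  define b where "b x = (\<Sum>y\<in>I. (max 0 ((r y)\<^sup>2 - (x - y) \<bullet> (x - y)))\<^sup>2)" for x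
  define nb where "nb x = (\<Sum>y\<in>I. (2 * max 0 ((r y)\<^sup>2 - (x - y) \<bullet> (x - y))) *\<^sub>R (- 2 *\<^sub>R (x - y)))" for x
  have b_der: "(b has_derivative (\<lambda>h. nb x \<bullet> h)) (at x)" for x
  proof -
    have "((\<lambda>x. (max 0 ((r y)\<^sup>2 - (x - y) \<bullet> (x - y)))\<^sup>2) has_derivative
      (\<lambda>h. 2 * max 0 ((r y)\<^sup>2 - (x - y) \<bullet> (x - y)) * (- ((x - y) \<bullet> h + h \<bullet> (x - y))))) (at x)" for y
    proof -
      have "((\<lambda>x. (r y)\<^sup>2 - (x - y) \<bullet> (x - y)) has_derivative (\<lambda>h. - ((x - y) \<bullet> h + h \<bullet> (x - y)))) (at x)"
        by (auto intro!: derivative_eq_intros)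
      from has_derivative_compose[OF this power2_max_0_has_derivative[unfolded has_field_derivative_def]]
      show ?thesis .
    qed
    then have "(b has_derivative (\<lambda>h. \<Sum>y\<in>I. 2 * max 0 ((r y)\<^sup>2 - (x - y) \<bullet> (x - y)) * (- ((x - y) \<bullet> h + h \<bullet> (x - y))))) (at x)"
      unfolding b_def[abs_def] by (intro has_derivative_sum)
    moreover have "(\<Sum>y\<in>I. 2 * max 0 ((r y)\<^sup>2 - (x - y) \<bullet> (x - y)) * (- ((x - y) \<bullet> h + h \<bullet> (x - y)))) = nb x \<bullet> h" for h
      unfolding nb_def inner_sum_left by (intro sum.cong) (auto simp: inner_commute[of h])
    ultimately show ?thesis by simp
  qed
  have nb_cont: "continuous_on UNIV nb"
    unfolding nb_def by (intro continuous_intros)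
  have b_cont: "continuous_on K b"
    unfolding b_def by (intro continuous_intros)
  have b_nonneg: "b x \<ge> 0" for x unfolding b_def by (intro sum_nonneg) auto
  have b_pos: "b x > 0" if "x \<in> K" for x
  proof -
    have "x \<in> (\<Union>x\<in>I. ball x (r x))" using I(3) that by blast
    then obtain y where y: "y \<in> I" "dist y x < r y" by auto
    have "(dist y x)\<^sup>2 < (r y)\<^sup>2" using y by (intro power_strict_mono) auto
    then have "0 < (max 0 ((r y)\<^sup>2 - (x - y) \<bullet> (x - y)))\<^sup>2"
      by (simp add: dist_norm power2_norm_eq_inner[symmetric] norm_minus_commute)
    also have "\<dots> \<le> b x" unfolding b_def using y I by (intro member_le_sum) auto
    finally show ?thesis .
  qed
  have b_out: "b x = 0" "nb x = 0" if "x \<notin> S" for x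
  proof -
    have "max 0 ((r y)\<^sup>2 - (x - y) \<bullet> (x - y)) = 0" if "y \<in> I" for y
    proof -
      have "r y < dist y x" using \<open>x \<notin> S\<close> that by (auto simp: S_def)
      moreover have "0 < r y" using r that I by auto
      ultimately have "(r y)\<^sup>2 \<le> (dist y x)\<^sup>2" by (intro power_mono) auto
      then show ?thesis by (simp add: dist_norm power2_norm_eq_inner[symmetric] norm_minus_commute)
    qed
    then show "b x = 0" "nb x = 0" by (simp_all add: b_def nb_def)
  qed
  obtain c where c: "c > 0" "\<And>x. x \<in> K \<Longrightarrow> c \<le> b x"
  proof (cases "K = {}")
    case True
    then show ?thesis using that[of 1] by auto
  next
    case False
    then obtain x where "x \<in> K" "\<And>y. y \<in> K \<Longrightarrow> b x \<le> b y"
      using continuous_attains_inf[OF K _ b_cont] by auto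
    then show ?thesis using that[of "b x"] b_pos by auto
  qed
  \<comment> \<open>This profile is 0 where \<open>b = 0\<close> and saturates at 1 as soon as
    \<open>b \<ge> c\<close>, in particular on \<open>K\<close>; the square makes both the
    transition and the saturation C1.\<close>
  define \<eta> where "\<eta> x = 1 - (max 0 (1 - b x / c))\<^sup>2" for x
  define n where "n x = (2 * max 0 (1 - b x / c) / c) *\<^sub>R nb x" for x
  have cS: "compact S" unfolding S_def using I by (intro compact_UN) auto
  have n_cont: "continuous_on UNIV n"
  proof -
    have "continuous_on UNIV b" unfolding b_def by (intro continuous_intros)
    then show ?thesis unfolding n_def
      by (intro continuous_intros nb_cont) (simp_all add: less_imp_neq[OF c(1), symmetric])
  qed
  have "compact (n ` S)" by (rule compact_continuous_image[OF continuous_on_subset[OF n_cont] cS]) auto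
  from compact_imp_bounded[OF this] obtain C where C: "\<And>x. x \<in> S \<Longrightarrow> norm (n x) \<le> C"
    unfolding bounded_iff by auto
  show thesis
  proof (rule that[of S "max 0 C" \<eta> n])
    show "S \<subseteq> U" unfolding S_def using r I by auto
    show "(\<eta> has_derivative (\<lambda>h. n x \<bullet> h)) (at x)" for x
    proof -
      have "((\<lambda>x. 1 - b x / c) has_derivative (\<lambda>h. - (nb x \<bullet> h / c))) (at x)"
        using has_derivative_diff[OF has_derivative_const[of 1]
            bounded_linear.has_derivative[OF bounded_linear_divide[of c] b_der]] by simp
      from has_derivative_compose[OF this power2_max_0_has_derivative[unfolded has_field_derivative_def]]
      have "((\<lambda>x. (max 0 (1 - b x / c))\<^sup>2) has_derivative (\<lambda>h. 2 * max 0 (1 - b x / c) * (- (nb x \<bullet> h / c)))) (at x)" .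
      from has_derivative_diff[OF has_derivative_const[of 1] this]
      show ?thesis by (simp add: \<eta>_def[abs_def] n_def)
    qed
    show "norm (n x) \<le> max 0 C" for x
      using C[of x] b_out[of x] by (cases "x \<in> S") (auto simp: n_def)
    show "0 \<le> \<eta> x" for x
    proof -
      have "max 0 (1 - b x / c) \<le> 1" using b_nonneg[of x] c by simp
      then have "(max 0 (1 - b x / c))\<^sup>2 \<le> 1" by (intro power_le_one) auto
      then show ?thesis by (simp add: \<eta>_def)
    qed
    show "\<eta> x = 1" if "x \<in> K" for x
    proof -
      have "1 - b x / c \<le> 0" using c(2)[OF that] c(1) by simp
      then show ?thesis by (simp add: \<eta>_def)
    qed
    show "\<eta> x = 0" if "x \<notin> S" for x using b_out[OF that] by (simp add: \<eta>_def)
  qed (auto simp: cS n_cont \<eta>_def)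
qed

text \<open>The second difference \<open>D\<close> is symmetric in its two directions. Divided by
  the squared step it tends to \<open>H x w \<bullet> v\<close>, and exchanging the directions gives
  the other value of the same limit.\<close>

lemma symmetric_second_derivative:
  fixes u :: "'a::euclidean_space \<Rightarrow> real"
  assumes U: "open U" "x \<in> U"
    and u: "\<And>y. y \<in> U \<Longrightarrow> (u has_derivative (\<lambda>h. p y \<bullet> h)) (at y)"
    and p: "\<And>y. y \<in> U \<Longrightarrow> (p has_derivative H y) (at y)"
    and H: "\<And>a. continuous_on U (\<lambda>y. H y a)"
  shows "H x a \<bullet> b = H x b \<bullet> a"
proof -
  obtain e where e: "e > 0" "ball x e \<subseteq> U" using U open_contains_ball by blast
  define c where "c = 1 + norm a + norm b"
  have c: "c > 0" by (simp add: c_def add_pos_nonneg)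
  define t where "t n = e / c * inverse (real (Suc (Suc n)))" for n
  have t0: "t n > 0" for n using e c by (simp add: t_def)
  have tlt: "t n * c < e" for n
  proof -
    have "inverse (real (Suc (Suc n))) < 1" by (simp add: field_simps)
    then have "e * inverse (real (Suc (Suc n))) < e * 1" using e(1) by (intro mult_strict_left_mono)
    then show ?thesis using c by (simp add: t_def)
  qed
  have tlim: "t \<longlonglongrightarrow> 0"
    unfolding t_def using tendsto_mult_right_zero[OF LIMSEQ_Suc[OF LIMSEQ_inverse_real_of_nat], of "e / c"] by simp
  define D where "D n v w = u (x + t n *\<^sub>R v + t n *\<^sub>R w) - u (x + t n *\<^sub>R v) - u (x + t n *\<^sub>R w) + u x" for n v w
  \<comment> \<open>The mean value theorem is applied once in direction \<open>v\<close> and once in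
    direction \<open>w\<close>. The intermediate point depends on the order, but it lies within
    \<open>t n * c\<close> of \<open>x\<close>, and \<open>t\<close> was scaled so that this stays
    below \<open>e\<close>.\<close>
  have ex: "\<exists>z. dist z x \<le> t n * c \<and> D n v w = (t n)\<^sup>2 * (H z w \<bullet> v)"
    if vw: "norm v + norm w \<le> c" for n v w
  proof -
    have din: "dist (x + \<xi> *\<^sub>R v + \<zeta> *\<^sub>R w) x \<le> t n * c" if "0 \<le> \<xi>" "\<xi> \<le> t n" "0 \<le> \<zeta>" "\<zeta> \<le> t n" for \<xi> \<zeta>
    proof -
      have "dist (x + \<xi> *\<^sub>R v + \<zeta> *\<^sub>R w) x = norm (\<xi> *\<^sub>R v + \<zeta> *\<^sub>R w)" by (simp add: dist_norm)
      also have "\<dots> \<le> \<xi> * norm v + \<zeta> * norm w" using that norm_triangle_ineq[of "\<xi> *\<^sub>R v" "\<zeta> *\<^sub>R w"] by simp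
      also have "\<dots> \<le> t n * norm v + t n * norm w" using that by (intro add_mono mult_right_mono) auto
      also have "\<dots> = t n * (norm v + norm w)" by (simp add: distrib_left)
      also have "\<dots> \<le> t n * c" using vw t0[of n] by (intro mult_left_mono) auto
      finally show ?thesis .
    qed
    have inU: "x + \<xi> *\<^sub>R v + \<zeta> *\<^sub>R w \<in> U" if "0 \<le> \<xi>" "\<xi> \<le> t n" "0 \<le> \<zeta>" "\<zeta> \<le> t n" for \<xi> \<zeta>
      using din[OF that] tlt[of n] e(2) by (auto simp: mem_ball dist_commute subset_iff)
    have lineder: "((\<lambda>s. u (x + s *\<^sub>R v + \<zeta> *\<^sub>R w)) has_real_derivative p (x + s *\<^sub>R v + \<zeta> *\<^sub>R w) \<bullet> v) (at s)"
      if "0 \<le> s" "s \<le> t n" "0 \<le> \<zeta>" "\<zeta> \<le> t n" for s \<zeta>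
    proof -
      have "((\<lambda>s. x + s *\<^sub>R v + \<zeta> *\<^sub>R w) has_derivative (\<lambda>h. h *\<^sub>R v)) (at s)"
        by (auto intro!: derivative_eq_intros)
      from has_derivative_compose[OF this u[OF inU[OF that]]]
      show ?thesis unfolding has_field_derivative_def
        by (rule has_derivative_eq_rhs) (auto simp: mult.commute)
    qed
    define \<phi> where "\<phi> s = u (x + s *\<^sub>R v + t n *\<^sub>R w) - u (x + s *\<^sub>R v)" for s
    have "(\<phi> has_real_derivative (p (x + s *\<^sub>R v + t n *\<^sub>R w) - p (x + s *\<^sub>R v)) \<bullet> v) (at s)"
      if "0 \<le> s" "s \<le> t n" for s
      using DERIV_diff[OF lineder[of s "t n"] lineder[of s 0]] that t0[of n]
      by (simp add: \<phi>_def[abs_def] inner_diff_left)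
    then obtain \<xi> where \<xi>: "0 < \<xi>" "\<xi> < t n"
      "\<phi> (t n) - \<phi> 0 = (t n - 0) * ((p (x + \<xi> *\<^sub>R v + t n *\<^sub>R w) - p (x + \<xi> *\<^sub>R v)) \<bullet> v)"
      using MVT2[OF t0[of n], of \<phi> "\<lambda>s. (p (x + s *\<^sub>R v + t n *\<^sub>R w) - p (x + s *\<^sub>R v)) \<bullet> v"] by auto
    define \<psi> where "\<psi> s = p (x + \<xi> *\<^sub>R v + s *\<^sub>R w) \<bullet> v" for s
    have "(\<psi> has_real_derivative H (x + \<xi> *\<^sub>R v + s *\<^sub>R w) w \<bullet> v) (at s)" if "0 \<le> s" "s \<le> t n" for s
    proof -
      have iu: "x + \<xi> *\<^sub>R v + s *\<^sub>R w \<in> U" using inU[of \<xi> s] \<xi> that by simp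
      have "((\<lambda>s. x + \<xi> *\<^sub>R v + s *\<^sub>R w) has_derivative (\<lambda>h. h *\<^sub>R w)) (at s)"
        by (auto intro!: derivative_eq_intros)
      from has_derivative_inner_left[OF has_derivative_compose[OF this p[OF iu]], of v]
      show ?thesis unfolding has_field_derivative_def \<psi>_def
        by (rule has_derivative_eq_rhs)
          (auto simp: linear_cmul[OF has_derivative_linear[OF p[OF iu]]] mult.commute)
    qed
    then obtain \<zeta> where \<zeta>: "0 < \<zeta>" "\<zeta> < t n" "\<psi> (t n) - \<psi> 0 = (t n - 0) * (H (x + \<xi> *\<^sub>R v + \<zeta> *\<^sub>R w) w \<bullet> v)"
      using MVT2[OF t0[of n], of \<psi> "\<lambda>s. H (x + \<xi> *\<^sub>R v + s *\<^sub>R w) w \<bullet> v"] by auto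
    have "D n v w = \<phi> (t n) - \<phi> 0" by (simp add: D_def \<phi>_def)
    also have "\<dots> = t n * (\<psi> (t n) - \<psi> 0)" using \<xi>(3) by (simp add: \<psi>_def inner_diff_left)
    also have "\<dots> = (t n)\<^sup>2 * (H (x + \<xi> *\<^sub>R v + \<zeta> *\<^sub>R w) w \<bullet> v)" using \<zeta>(3) by (simp add: power2_eq_square)
    finally show ?thesis using din[of \<xi> \<zeta>] \<xi> \<zeta> by (intro exI[of _ "x + \<xi> *\<^sub>R v + \<zeta> *\<^sub>R w"]) auto
  qed
  have lim: "(\<lambda>n. D n v w / (t n)\<^sup>2) \<longlonglongrightarrow> H x w \<bullet> v" if vw: "norm v + norm w \<le> c" for v w
  proof -
    define z where "z n = (SOME z. dist z x \<le> t n * c \<and> D n v w = (t n)\<^sup>2 * (H z w \<bullet> v))" for n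
    have z: "dist (z n) x \<le> t n * c" "D n v w = (t n)\<^sup>2 * (H (z n) w \<bullet> v)" for n
      using someI_ex[OF ex[OF vw, of n]] by (auto simp: z_def)
    have "(\<lambda>n. t n * c) \<longlonglongrightarrow> 0" using tendsto_mult_left_zero[OF tlim, of c] .
    then have "(\<lambda>n. dist (z n) x) \<longlonglongrightarrow> 0" 
      by (rule tendsto_sandwich[OF always_eventually[OF allI[OF zero_le_dist]]
            always_eventually[OF allI[OF z(1)]] tendsto_const])
    then have "z \<longlonglongrightarrow> x" by (rule tendsto_dist_iff[THEN iffD2])
    moreover have "isCont (\<lambda>y. H y w) x" using H[of w] U by (simp add: continuous_on_eq_continuous_at)
    ultimately have "(\<lambda>n. H (z n) w) \<longlonglongrightarrow> H x w" by (rule isCont_tendsto_compose[rotated])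
    then have "(\<lambda>n. H (z n) w \<bullet> v) \<longlonglongrightarrow> H x w \<bullet> v" by (intro tendsto_intros)
    then show ?thesis using t0 by (simp add: z(2) less_imp_neq[symmetric])
  qed
  have "D n a b = D n b a" for n by (simp add: D_def algebra_simps)
  then have "(\<lambda>n. D n a b / (t n)\<^sup>2) \<longlonglongrightarrow> H x a \<bullet> b" using lim[of b a] by (simp add: c_def)
  moreover have "(\<lambda>n. D n a b / (t n)\<^sup>2) \<longlonglongrightarrow> H x b \<bullet> a" using lim[of a b] by (simp add: c_def)
  ultimately show ?thesis by (rule LIMSEQ_unique)
qed

text \<open>Near each of its points the boundary is contained in a rotated graph, that is, in the
  image of a hyperplane under the differentiable map \<open>\<Gamma>\<close>, and such an image is a
  null set. Local negligibility then gives the global statement.\<close>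

lemma negligible_frontier_C1_boundary:
  assumes U: "open U" and C1: "C1_boundary U"
  shows "negligible (frontier U)"
proof (rule locally_negligible_alt[THEN iffD2], rule ballI)
  fix x0 assume x0: "x0 \<in> frontier U"
  have "\<exists>r>0. \<exists>(Q :: real^3 \<Rightarrow> real^3) (\<gamma> :: real^2 \<Rightarrow> real) (\<gamma>' :: real^2 \<Rightarrow> real^2).
        orthogonal_transformation Q \<and>
        (\<forall>y. (\<gamma> has_derivative (\<lambda>h. \<gamma>' y \<bullet> h)) (at y)) \<and>
        continuous_on UNIV \<gamma>' \<and>
        U \<inter> ball x0 r = {x \<in> ball x0 r. Q x $ 3 > \<gamma> (vector [Q x $ 1, Q x $ 2])}"
    by (rule bspec[OF C1[unfolded C1_boundary_def] x0])
  then obtain r :: real and Q :: "real^3 \<Rightarrow> real^3" and \<gamma> :: "real^2 \<Rightarrow> real" and \<gamma>' :: "real^2 \<Rightarrow> real^2"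
    where r: "r > 0" and Q: "orthogonal_transformation Q"
    and \<gamma>0: "\<forall>y. (\<gamma> has_derivative (\<lambda>h. \<gamma>' y \<bullet> h)) (at y)"
    and eq: "U \<inter> ball x0 r = {x \<in> ball x0 r. Q x $ 3 > \<gamma> (vector [Q x $ 1, Q x $ 2])}"
    by (elim exE conjE) (rule that; assumption)
  note \<gamma> = \<gamma>0[rule_format]
  define \<pi> where "\<pi> y = (vector [y $ 1, y $ 2] :: real^2)" for y :: "real^3"
  have lin\<pi>: "linear \<pi>"
    by (rule linearI) (auto simp: \<pi>_def vec_eq_iff forall_2)
  have mem: "y \<in> U \<longleftrightarrow> \<gamma> (\<pi> (Q y)) < Q y $ 3" if "y \<in> ball x0 r" for y
    using set_eq_iff[THEN iffD1, OF eq, rule_format, of y] that by (simp add: \<pi>_def)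
  define \<Gamma> where "\<Gamma> y = inv Q (y + \<gamma> (\<pi> y) *\<^sub>R axis 3 1)" for y
  have linQ: "linear Q" using Q by (simp add: orthogonal_transformation_def)
  have bijQ: "bij Q" using Q by (simp add: orthogonal_transformation_bij)
  have liniQ: "linear (inv Q)" using Q orthogonal_transformation_inv orthogonal_transformation_linear by blast
  have contQ: "continuous_on UNIV Q" using linQ linear_continuous_on linear_conv_bounded_linear by blast
  have cont\<gamma>: "continuous_on UNIV \<gamma>"
    by (intro continuous_at_imp_continuous_on ballI has_derivative_continuous[OF \<gamma>])
  have cont\<pi>: "continuous_on UNIV \<pi>" using lin\<pi> linear_continuous_on linear_conv_bounded_linear by blast
  have contf: "continuous_on UNIV (\<lambda>x. Q x $ 3 - \<gamma> (\<pi> (Q x)))"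
    by (intro continuous_intros contQ continuous_on_compose2[OF cont\<gamma>] continuous_on_compose2[OF cont\<pi> contQ]) auto
  let ?V = "frontier U \<inter> ball x0 r"
  have V: "?V \<subseteq> \<Gamma> ` {y. axis 3 1 \<bullet> y = 0}"
  proof
    fix x assume x: "x \<in> ?V"
    have "x \<notin> U" using x U by (auto simp: frontier_def interior_open)
    then have le: "Q x $ 3 \<le> \<gamma> (\<pi> (Q x))" using mem[of x] x by simp
    \<comment> \<open>If \<open>x\<close> lay strictly below the graph, a whole neighbourhood of it
      would avoid \<open>U\<close>, although \<open>x\<close> belongs to the closure of
      \<open>U\<close>.\<close>
    have ge: "Q x $ 3 \<ge> \<gamma> (\<pi> (Q x))"
    proof (rule ccontr)
      assume lt: "\<not> ?thesis"
      define W where "W = {x. Q x $ 3 - \<gamma> (\<pi> (Q x)) < 0} \<inter> ball x0 r"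
      have W: "open W" unfolding W_def by (intro open_Int open_Collect_less contf continuous_on_const open_ball)
      have "x \<in> W" "x \<in> closure U" using lt x by (auto simp: W_def frontier_def)
      then have "W \<inter> U \<noteq> {}" using open_Int_closure_eq_empty[OF W, of U] by blast
      then obtain y where "y \<in> U" "y \<in> W" by blast
      then show False using mem[of y] by (simp add: W_def)
    qed
    define y where "y = Q x - (Q x $ 3) *\<^sub>R axis 3 1"
    have "\<pi> y = \<pi> (Q x)" by (simp add: \<pi>_def y_def axis_def)
    then have "\<Gamma> y = inv Q (Q x)" using le ge by (simp add: \<Gamma>_def y_def)
    then have "\<Gamma> y = x" using bijQ by (simp add: bij_is_inj inv_f_f)
    moreover have "axis 3 1 \<bullet> y = 0" by (simp add: y_def inner_axis' inner_diff_right)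
    ultimately show "x \<in> \<Gamma> ` {y. axis 3 1 \<bullet> y = 0}" by force
  qed
  have "negligible (\<Gamma> ` {y. axis 3 1 \<bullet> y = 0})"
  proof (rule negligible_differentiable_image_negligible)
    have "axis 3 1 \<noteq> (0 :: real^3)" by (simp add: axis_eq_0_iff)
    then show "negligible {y::real^3. axis 3 1 \<bullet> y = 0}" by (intro negligible_hyperplane) auto
    have "(\<Gamma> has_derivative (\<lambda>h. inv Q (h + (\<gamma>' (\<pi> y) \<bullet> \<pi> h) *\<^sub>R axis 3 1))) (at y)" for y
      unfolding \<Gamma>_def
    proof (rule bounded_linear.has_derivative[OF linear_conv_bounded_linear[THEN iffD1, OF liniQ]])
      have "(\<pi> has_derivative \<pi>) (at y)" using lin\<pi> by (simp add: linear_imp_has_derivative)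
      from has_derivative_compose[OF this \<gamma>]
      show "((\<lambda>y. y + \<gamma> (\<pi> y) *\<^sub>R axis 3 1) has_derivative (\<lambda>h. h + (\<gamma>' (\<pi> y) \<bullet> \<pi> h) *\<^sub>R axis 3 1)) (at y)"
        by (intro has_derivative_add has_derivative_ident has_derivative_scaleR_left)
    qed
    then show "\<Gamma> differentiable_on {y. axis 3 1 \<bullet> y = 0}"
      unfolding differentiable_on_def differentiable_def by (meson has_derivative_at_withinI)
  qed simp
  then have "negligible ?V" using V negligible_subset by blast
  moreover have "openin (top_of_set (frontier U)) ?V" by (simp add: openin_open_Int)
  moreover have "x0 \<in> ?V" using x0 r by simp
  ultimately show "\<exists>V. openin (top_of_set (frontier U)) V \<and> x0 \<in> V \<and> negligible V" by blast
qed

subsection \<open>Pointwise lower bound for the dissipation\<close>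

lemma quadratic_lower: fixes x b l :: real assumes "l > 0" shows "l * x\<^sup>2 - b * x \<ge> - (b\<^sup>2 / (4 * l))"
proof -
  have "0 \<le> (2 * l * x - b)\<^sup>2 / (4 * l)" using assms by simp
  also have "\<dots> = l * x\<^sup>2 - b * x + b\<^sup>2 / (4 * l)"
    using assms by (simp add: power2_eq_square field_simps)
  finally show ?thesis by simp
qed

lemma sum_Basis_inner_mult:
  fixes x y :: "'a::euclidean_space"
  shows "(\<Sum>b\<in>Basis. (x \<bullet> b) * (y \<bullet> b)) = x \<bullet> y"
  by (simp add: euclidean_inner[of x y])

lemma linear_Basis_expand:
  fixes L :: "'a::euclidean_space \<Rightarrow> 'b::real_vector"
  assumes "linear L" shows "(\<Sum>b\<in>Basis. (x \<bullet> b) *\<^sub>R L b) = L x"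
proof -
  have "L x = L (\<Sum>b\<in>Basis. (x \<bullet> b) *\<^sub>R b)" by (simp add: euclidean_representation)
  also have "\<dots> = (\<Sum>b\<in>Basis. (x \<bullet> b) *\<^sub>R L b)" using assms by (simp add: linear_sum linear_cmul)
  finally show ?thesis by simp
qed

text \<open>Symmetry of \<open>H\<close> collapses the double sum to three inner products: of
  \<open>DV j\<close> with \<open>H j\<close>, of \<open>DV q\<close> with \<open>H q\<close>, and
  of \<open>DV q\<close> with \<open>n\<close>. \<open>L\<close> need not be symmetric; ellipticity
  makes the leading parts of the first two nonnegative. In the application \<open>L\<close> is the
  derivative of \<open>X\<close>, \<open>H\<close> the Hessian, \<open>P\<close> the contribution of
  \<open>Z\<close>, and \<open>n\<close> the gradient of the weight \<open>\<omega>\<close>.\<close>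

lemma trace_product_lower:
  fixes L H P :: "real^3 \<Rightarrow> real^3" and q n :: "real^3"
  assumes lin: "linear L" "linear H" "linear P"
    and sym: "\<And>v w. H v \<bullet> w = H w \<bullet> v"
    and ell: "\<And>h. l * (norm h)\<^sup>2 \<le> L h \<bullet> h" and bd: "\<And>h. norm (L h) \<le> \<Lambda> * norm h" and l: "0 < l" "l \<le> \<Lambda>"
    and P: "\<And>h. norm (P h) \<le> \<pi> * norm h" and \<pi>: "\<pi> \<ge> 0"
    and f: "f \<ge> 0" and e: "0 \<le> e" "e \<le> d * f" and w: "\<omega> \<ge> 0" "w2 \<ge> 0" "(norm n)\<^sup>2 \<le> \<omega> * w2"
  defines "DV \<equiv> \<lambda>h. L (H h + P h)"
    and "DW \<equiv> \<lambda>h. \<omega> *\<^sub>R (f *\<^sub>R H h + (e / (norm q)\<^sup>2 * (q \<bullet> H h)) *\<^sub>R q) + (n \<bullet> h) *\<^sub>R (f *\<^sub>R q)"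
  shows "f * (l / 2 * \<omega> * (\<Sum>j\<in>Basis. (norm (H j))\<^sup>2) - \<Lambda>\<^sup>2 / l * ((4 + d) * \<pi>\<^sup>2 * \<omega> + 2 * (norm q)\<^sup>2 * w2))
    \<le> (\<Sum>i\<in>Basis. \<Sum>j\<in>Basis. (DV j \<bullet> i) * (DW i \<bullet> j))"
proof -
  define hs where "hs = (\<Sum>j\<in>Basis. (norm (H j))\<^sup>2)"
  have hs: "hs \<ge> 0" unfolding hs_def by (intro sum_nonneg) auto
  have linDV: "linear DV" unfolding DV_def
    using linear_compose[OF linear_compose_add[OF lin(2,3)] lin(1)] by (simp add: o_def)
  have \<Lambda>: "\<Lambda> > 0" using l by simp
  have LP: "\<bar>L (P h) \<bullet> v\<bar> \<le> \<Lambda> * \<pi> * norm h * norm v" for h v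
  proof -
    have "\<bar>L (P h) \<bullet> v\<bar> \<le> norm (L (P h)) * norm v" by (rule Cauchy_Schwarz_ineq2)
    also have "\<dots> \<le> (\<Lambda> * (\<pi> * norm h)) * norm v"
      using bd[of "P h"] P[of h] \<Lambda> by (intro mult_right_mono order_trans[OF bd] mult_left_mono) auto
    finally show ?thesis by (simp add: mult.assoc)
  qed
  have DVadd: "DV h = L (H h) + L (P h)" for h using lin(1) by (simp add: DV_def linear_add)
  have 1: "(\<Sum>i\<in>Basis. \<Sum>j\<in>Basis. (DV j \<bullet> i) * (H i \<bullet> j)) = (\<Sum>j\<in>Basis. DV j \<bullet> H j)"
  proof -
    have "(\<Sum>i\<in>Basis. \<Sum>j\<in>Basis. (DV j \<bullet> i) * (H i \<bullet> j)) = (\<Sum>j\<in>Basis. \<Sum>i\<in>Basis. (DV j \<bullet> i) * (H j \<bullet> i))"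
      by (subst sum.swap) (simp add: sym)
    then show ?thesis by (simp add: sum_Basis_inner_mult)
  qed
  have DVq: "(\<Sum>j\<in>Basis. (q \<bullet> j) * (DV j \<bullet> i)) = DV q \<bullet> i" for i
  proof -
    have "(\<Sum>j\<in>Basis. (q \<bullet> j) * (DV j \<bullet> i)) = (\<Sum>j\<in>Basis. (q \<bullet> j) *\<^sub>R DV j) \<bullet> i"
      by (simp add: inner_sum_left)
    then show ?thesis by (simp add: linear_Basis_expand[OF linDV])
  qed
  have 2: "(\<Sum>i\<in>Basis. \<Sum>j\<in>Basis. (DV j \<bullet> i) * ((q \<bullet> H i) * (q \<bullet> j))) = DV q \<bullet> H q"
  proof -
    have "(\<Sum>i\<in>Basis. \<Sum>j\<in>Basis. (DV j \<bullet> i) * ((q \<bullet> H i) * (q \<bullet> j)))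
      = (\<Sum>i\<in>Basis. (q \<bullet> H i) * (\<Sum>j\<in>Basis. (q \<bullet> j) * (DV j \<bullet> i)))"
      by (simp add: sum_distrib_left algebra_simps)
    also have "\<dots> = (\<Sum>i\<in>Basis. (DV q \<bullet> i) * (H q \<bullet> i))"
      unfolding DVq by (intro sum.cong) (auto simp: inner_commute[of q] sym[of _ q])
    finally show ?thesis by (simp add: sum_Basis_inner_mult)
  qed
  have 3: "(\<Sum>i\<in>Basis. \<Sum>j\<in>Basis. (DV j \<bullet> i) * ((n \<bullet> i) * (q \<bullet> j))) = DV q \<bullet> n"
  proof -
    have "(\<Sum>i\<in>Basis. \<Sum>j\<in>Basis. (DV j \<bullet> i) * ((n \<bullet> i) * (q \<bullet> j)))
      = (\<Sum>i\<in>Basis. (n \<bullet> i) * (\<Sum>j\<in>Basis. (q \<bullet> j) * (DV j \<bullet> i)))"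
      by (simp add: sum_distrib_left algebra_simps)
    also have "\<dots> = (\<Sum>i\<in>Basis. (DV q \<bullet> i) * (n \<bullet> i))" unfolding DVq by (simp add: mult.commute)
    finally show ?thesis by (simp add: sum_Basis_inner_mult)
  qed
  have S: "(\<Sum>i\<in>Basis. \<Sum>j\<in>Basis. (DV j \<bullet> i) * (DW i \<bullet> j))
    = \<omega> * f * (\<Sum>j\<in>Basis. DV j \<bullet> H j) + \<omega> * (e / (norm q)\<^sup>2) * (DV q \<bullet> H q) + f * (DV q \<bullet> n)"
  proof -
    have "(DV j \<bullet> i) * (DW i \<bullet> j) = \<omega> * f * ((DV j \<bullet> i) * (H i \<bullet> j))
      + \<omega> * (e / (norm q)\<^sup>2) * ((DV j \<bullet> i) * ((q \<bullet> H i) * (q \<bullet> j))) + f * ((DV j \<bullet> i) * ((n \<bullet> i) * (q \<bullet> j)))" for i j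
      unfolding DW_def by (simp add: inner_add_left algebra_simps)
    then have "(\<Sum>i\<in>Basis. \<Sum>j\<in>Basis. (DV j \<bullet> i) * (DW i \<bullet> j)) =
      \<omega> * f * (\<Sum>i\<in>Basis. \<Sum>j\<in>Basis. (DV j \<bullet> i) * (H i \<bullet> j))
      + \<omega> * (e / (norm q)\<^sup>2) * (\<Sum>i\<in>Basis. \<Sum>j\<in>Basis. (DV j \<bullet> i) * ((q \<bullet> H i) * (q \<bullet> j)))
      + f * (\<Sum>i\<in>Basis. \<Sum>j\<in>Basis. (DV j \<bullet> i) * ((n \<bullet> i) * (q \<bullet> j)))"
      by (simp only: sum.distrib sum_distrib_left)
    then show ?thesis by (simp only: 1 2 3)
  qed
  define R where "R = \<Lambda>\<^sup>2 / l"
  have R: "R > 0" "\<Lambda> \<le> R" unfolding R_def using l \<Lambda> by (auto simp: field_simps power2_eq_square)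
  \<comment> \<open>A quarter of the ellipticity pays for \<open>P\<close> here and another quarter
    pays for the cutoff in \<open>T3\<close>; the remaining half appears in the conclusion.\<close>
  have T1: "3 * l / 4 * hs - 3 * R * \<pi>\<^sup>2 \<le> (\<Sum>j\<in>Basis. DV j \<bullet> H j)"
  proof -
    have "3 * l / 4 * (norm (H j))\<^sup>2 - R * \<pi>\<^sup>2 \<le> DV j \<bullet> H j" if "j \<in> Basis" for j
    proof -
      have "l * (norm (H j))\<^sup>2 - \<Lambda> * \<pi> * norm (H j) \<le> DV j \<bullet> H j"
        using ell[of "H j"] LP[of j "H j"] that by (simp add: DVadd inner_add_left)
      moreover have "- ((\<Lambda> * \<pi>)\<^sup>2 / (4 * (l / 4))) \<le> l / 4 * (norm (H j))\<^sup>2 - \<Lambda> * \<pi> * norm (H j)"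
        by (rule quadratic_lower) (use l in simp)
      ultimately show ?thesis by (simp add: R_def power_mult_distrib)
    qed
    then have "(\<Sum>j\<in>(Basis::(real^3) set). 3 * l / 4 * (norm (H j))\<^sup>2 - R * \<pi>\<^sup>2) \<le> (\<Sum>j\<in>Basis. DV j \<bullet> H j)"
      by (rule sum_mono)
    then show ?thesis by (simp add: sum_subtractf hs_def sum_distrib_left)
  qed
  \<comment> \<open>This term comes from differentiating the radial factor. Its coercivity is spent
    entirely on \<open>P\<close>, so only a lower-order remainder survives.\<close>
  have T2: "- (R * \<pi>\<^sup>2 / 4 * (norm q)\<^sup>2) \<le> DV q \<bullet> H q"
  proof -
    have "l * (norm (H q))\<^sup>2 - \<Lambda> * \<pi> * norm q * norm (H q) \<le> DV q \<bullet> H q"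
      using ell[of "H q"] LP[of q "H q"] by (simp add: DVadd inner_add_left)
    moreover have "- ((\<Lambda> * \<pi> * norm q)\<^sup>2 / (4 * l)) \<le> l * (norm (H q))\<^sup>2 - \<Lambda> * \<pi> * norm q * norm (H q)"
      by (rule quadratic_lower) (use l in simp)
    ultimately show ?thesis by (simp add: R_def power_mult_distrib mult.commute)
  qed
  have T2': "- (d * f * (R * \<pi>\<^sup>2 / 4)) \<le> e / (norm q)\<^sup>2 * (DV q \<bullet> H q)"
  proof -
    have "e * (R * \<pi>\<^sup>2 / 4) \<le> d * f * (R * \<pi>\<^sup>2 / 4)" using e R by (intro mult_right_mono) auto
    moreover have "- (e * (R * \<pi>\<^sup>2 / 4)) \<le> e / (norm q)\<^sup>2 * (DV q \<bullet> H q)"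
    proof (cases "q = 0")
      case True then show ?thesis using e R by simp
    next
      case False
      have "e / (norm q)\<^sup>2 * (- (R * \<pi>\<^sup>2 / 4 * (norm q)\<^sup>2)) \<le> e / (norm q)\<^sup>2 * (DV q \<bullet> H q)"
        using T2 e by (intro mult_left_mono) auto
      then show ?thesis using False by (simp add: field_simps)
    qed
    ultimately show ?thesis by linarith
  qed
  have Hq: "norm (H q) \<le> sqrt hs * norm q"
  proof (rule power2_le_imp_le)
    have "(norm (H q))\<^sup>2 = (\<Sum>j\<in>Basis. (H q \<bullet> j)\<^sup>2)"
      unfolding power2_norm_eq_inner by (simp add: power2_eq_square sum_Basis_inner_mult)
    also have "\<dots> \<le> (\<Sum>j\<in>Basis. (norm (H j))\<^sup>2 * (norm q)\<^sup>2)"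
    proof (rule sum_mono)
      fix j :: "real^3"
      have "\<bar>H q \<bullet> j\<bar> \<le> norm (H j) * norm q" using sym[of q j] Cauchy_Schwarz_ineq2[of "H j" q] by simp
      then have "\<bar>H q \<bullet> j\<bar>\<^sup>2 \<le> (norm (H j) * norm q)\<^sup>2" by (intro power_mono) auto
      then show "(H q \<bullet> j)\<^sup>2 \<le> (norm (H j))\<^sup>2 * (norm q)\<^sup>2" by (simp add: power_mult_distrib)
    qed
    also have "\<dots> = (sqrt hs * norm q)\<^sup>2" using hs by (simp add: hs_def power_mult_distrib sum_distrib_right)
    finally show "(norm (H q))\<^sup>2 \<le> (sqrt hs * norm q)\<^sup>2" .
  qed (use hs in simp)
  have nn: "norm n \<le> sqrt \<omega> * sqrt w2"
    using w real_sqrt_le_mono[OF w(3)] by (simp add: real_sqrt_mult)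
  \<comment> \<open>The cutoff term is the only one without a sign. The factorization
    \<open>(norm n)\<^sup>2 \<le> \<omega> * w2\<close> leaves a full factor \<open>\<omega>\<close>
    beside the Hessian, so that Young's inequality can absorb it.\<close>
  have T3: "- (l / 4 * hs * \<omega> + R * (3 / 2 * (norm q)\<^sup>2 * w2 + \<pi>\<^sup>2 * \<omega> / 2)) \<le> DV q \<bullet> n"
  proof -
    have "\<bar>DV q \<bullet> n\<bar> \<le> (\<Lambda> * (norm (H q) + \<pi> * norm q)) * norm n"
    proof -
      have "norm (DV q) \<le> \<Lambda> * norm (H q + P q)" unfolding DV_def by (rule bd)
      also have "\<dots> \<le> \<Lambda> * (norm (H q) + \<pi> * norm q)"
        using P[of q] norm_triangle_ineq[of "H q" "P q"] \<Lambda> by (intro mult_left_mono) auto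
      finally show ?thesis
        by (intro order_trans[OF Cauchy_Schwarz_ineq2] mult_right_mono) auto
    qed
    also have "\<dots> \<le> (\<Lambda> * (sqrt hs * norm q + \<pi> * norm q)) * (sqrt \<omega> * sqrt w2)"
      using Hq nn \<Lambda> \<pi> hs by (intro mult_mono mult_left_mono add_mono) auto
    also have "\<dots> = \<Lambda> * (sqrt hs * sqrt \<omega>) * (norm q * sqrt w2) + \<Lambda> * ((\<pi> * sqrt \<omega>) * (norm q * sqrt w2))"
      by (simp add: algebra_simps)
    also have "\<dots> \<le> (l / 4 * (sqrt hs * sqrt \<omega>)\<^sup>2 + R * (norm q * sqrt w2)\<^sup>2)
        + \<Lambda> * (((\<pi> * sqrt \<omega>)\<^sup>2 + (norm q * sqrt w2)\<^sup>2) / 2)"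
    proof (rule add_mono)
      have "- ((\<Lambda> * (norm q * sqrt w2))\<^sup>2 / (4 * (l / 4))) \<le> l / 4 * (sqrt hs * sqrt \<omega>)\<^sup>2 - \<Lambda> * (norm q * sqrt w2) * (sqrt hs * sqrt \<omega>)"
        by (rule quadratic_lower) (use l in simp)
      then show "\<Lambda> * (sqrt hs * sqrt \<omega>) * (norm q * sqrt w2) \<le> l / 4 * (sqrt hs * sqrt \<omega>)\<^sup>2 + R * (norm q * sqrt w2)\<^sup>2"
        by (simp add: R_def power_mult_distrib algebra_simps)
      show "\<Lambda> * ((\<pi> * sqrt \<omega>) * (norm q * sqrt w2)) \<le> \<Lambda> * (((\<pi> * sqrt \<omega>)\<^sup>2 + (norm q * sqrt w2)\<^sup>2) / 2)"
        using \<Lambda> sum_squares_bound[of "\<pi> * sqrt \<omega>" "norm q * sqrt w2"] by (intro mult_left_mono) auto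
    qed
    also have "\<dots> \<le> (l / 4 * (sqrt hs * sqrt \<omega>)\<^sup>2 + R * (norm q * sqrt w2)\<^sup>2)
        + R * (((\<pi> * sqrt \<omega>)\<^sup>2 + (norm q * sqrt w2)\<^sup>2) / 2)"
      using R by (intro add_left_mono mult_right_mono) auto
    also have "\<dots> = l / 4 * hs * \<omega> + R * (3 / 2 * (norm q)\<^sup>2 * w2 + \<pi>\<^sup>2 * \<omega> / 2)"
      using hs w by (simp add: power_mult_distrib field_simps)
    finally show ?thesis by linarith
  qed
  have "f * (l / 2 * \<omega> * hs - R * ((4 + d) * \<pi>\<^sup>2 * \<omega> + 2 * (norm q)\<^sup>2 * w2)) \<le>
    \<omega> * f * (3 * l / 4 * hs - 3 * R * \<pi>\<^sup>2) - \<omega> * (d * f * (R * \<pi>\<^sup>2 / 4))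
    - f * (l / 4 * hs * \<omega> + R * (3 / 2 * (norm q)\<^sup>2 * w2 + \<pi>\<^sup>2 * \<omega> / 2))"
  proof -
    have d: "0 \<le> d * f" using e by linarith
    have h1: "0 \<le> f * (R * \<pi>\<^sup>2 * \<omega>)" and h3: "0 \<le> f * (R * (norm q)\<^sup>2 * w2)"
      using f R w by simp_all
    have h2: "0 \<le> (d * f) * (R * \<pi>\<^sup>2 * \<omega>)" by (rule mult_nonneg_nonneg[OF d]) (use R w in simp)
    show ?thesis using h1 h2 h3 by (simp add: field_simps)
  qed
  also have "\<dots> \<le> \<omega> * f * (\<Sum>j\<in>Basis. DV j \<bullet> H j) + \<omega> * (e / (norm q)\<^sup>2 * (DV q \<bullet> H q)) + f * (DV q \<bullet> n)"
  proof -
    have "\<omega> * f * (3 * l / 4 * hs - 3 * R * \<pi>\<^sup>2) \<le> \<omega> * f * (\<Sum>j\<in>Basis. DV j \<bullet> H j)"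
      using T1 w f by (intro mult_left_mono) auto
    moreover have "\<omega> * (- (d * f * (R * \<pi>\<^sup>2 / 4))) \<le> \<omega> * (e / (norm q)\<^sup>2 * (DV q \<bullet> H q))"
      using T2' w by (intro mult_left_mono) auto
    moreover have "f * (- (l / 4 * hs * \<omega> + R * (3 / 2 * (norm q)\<^sup>2 * w2 + \<pi>\<^sup>2 * \<omega> / 2))) \<le> f * (DV q \<bullet> n)"
      using T3 f by (intro mult_left_mono) auto
    ultimately show ?thesis by linarith
  qed
  finally show ?thesis unfolding S hs_def[symmetric] R_def[symmetric] by (simp add: mult.assoc)
qed

text \<open>The power \<open>r powr (p - 2)\<close>, corrected at \<open>p = 2\<close>, \<open>r = 0\<close>, where \<open>0 powr 0 = 0\<close>.\<close>

definition fpow :: "real \<Rightarrow> real \<Rightarrow> real" where "fpow p r = (if p = 2 then 1 else r powr (p - 2))"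

lemma fpow_nonneg: "0 \<le> fpow p r" by (simp add: fpow_def)

lemma fpow_square: "r \<ge> 0 \<Longrightarrow> fpow p r * r\<^sup>2 = r powr p"
  by (cases "r = 0") (auto simp: fpow_def powr_diff powr_numeral)

lemma fpow_cont: assumes "p \<ge> 2" shows "continuous_on {0..} (fpow p)"
proof (cases "p = 2")
  case False
  then have "continuous_on {0..} (\<lambda>r::real. r powr (p - 2))"
    using assms by (intro continuous_on_powr') (auto intro!: continuous_intros)
  then show ?thesis using False by (simp add: fpow_def[abs_def])
qed (simp add: fpow_def[abs_def])

lemma fpow_deriv: assumes "r > 0" shows "(fpow p has_real_derivative ((p - 2) * fpow p r) / r) (at r)"
proof (cases "p = 2")
  case False
  have "((\<lambda>r. r powr (p - 2)) has_real_derivative (p - 2) * r powr (p - 2 - 1)) (at r)"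
    by (rule has_real_derivative_powr[OF assms])
  also have "(p - 2) * r powr (p - 2 - 1) = (p - 2) * fpow p r / r"
    using False assms powr_diff[of r "p - 2" 1] by (simp add: fpow_def)
  finally show ?thesis using False by (simp add: fpow_def[abs_def])
qed (simp add: fpow_def[abs_def])

definition kpow :: "real \<Rightarrow> real \<Rightarrow> real \<Rightarrow> real \<Rightarrow> real" where
  "kpow a L p r = (L + r) powr (- a) * r powr p"

text \<open>\<open>kpow'\<close> is \<open>r\<close> times the derivative of \<open>kpow\<close>.\<close>

definition kpow' :: "real \<Rightarrow> real \<Rightarrow> real \<Rightarrow> real \<Rightarrow> real" where
  "kpow' a L p r = kpow a L p r * (p - a * (r / (L + r)))"

lemma kpow_cont: assumes "p \<ge> 2" "L \<ge> 1"
  shows "continuous_on {0..} (kpow a L p)" "continuous_on {0..} (kpow' a L p)"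
proof -
  have 1: "continuous_on {0..} (\<lambda>r::real. r powr p)"
    using assms by (intro continuous_on_powr') (auto intro!: continuous_intros)
  have 2: "continuous_on {0..} (\<lambda>r::real. (L + r) powr (- a))"
    using assms by (intro continuous_on_powr') (auto intro!: continuous_intros)
  show c: "continuous_on {0..} (kpow a L p)" unfolding kpow_def by (intro continuous_on_mult 1 2)
  show "continuous_on {0..} (kpow' a L p)" unfolding kpow'_def
    using assms by (intro continuous_on_mult c continuous_intros) auto
qed

lemma kpow_deriv: assumes "r > 0" "L \<ge> 1"
  shows "(kpow a L p has_real_derivative kpow' a L p r / r) (at r)"
proof -
  have "((\<lambda>r. L + r) has_real_derivative 1) (at r)" by (auto intro!: derivative_eq_intros)
  from DERIV_powr[OF this, of "\<lambda>_. - a" 0]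
  have 1: "((\<lambda>r. (L + r) powr (- a)) has_real_derivative (L + r) powr (- a) * (- a / (L + r))) (at r)"
    using assms by simp
  have 2: "((\<lambda>r. r powr p) has_real_derivative p * r powr (p - 1)) (at r)"
    by (rule has_real_derivative_powr[OF assms(1)])
  have "kpow' a L p r / r = (L + r) powr (- a) * (- a / (L + r)) * r powr p + p * r powr (p - 1) * (L + r) powr (- a)"
    using assms by (simp add: kpow'_def kpow_def powr_diff field_simps)
  with DERIV_mult[OF 1 2] show ?thesis by (simp add: kpow_def[abs_def])
qed

lemma kpow'_bound: assumes "p \<ge> 2" "0 < a" "a < 1" "L \<ge> 1" "r \<ge> 0"
  shows "0 \<le> kpow' a L p r" "kpow' a L p r \<le> p * kpow a L p r"
proof -
  have k: "0 \<le> kpow a L p r" by (simp add: kpow_def)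
  define t where "t = r / (L + r)"
  have "t \<le> 1" "0 \<le> t" using assms by (auto simp: t_def)
  then have "a * t \<le> 1 * 1" "0 \<le> a * t" using assms by (intro mult_mono mult_nonneg_nonneg; simp)+
  then have "0 \<le> p - a * (r / (L + r))" "p - a * (r / (L + r)) \<le> p"
    using assms unfolding t_def by linarith+
  then show "0 \<le> kpow' a L p r" "kpow' a L p r \<le> p * kpow a L p r"
    using k mult_left_mono[of "p - a * (r / (L + r))" p "kpow a L p r"]
    by (auto simp: kpow'_def mult.commute)
qed

section \<open>Integral calculus on a bounded domain with null boundary\<close>

lemma continuous_linear_family_bound:
  fixes D :: "'a::topological_space \<Rightarrow> 'b::euclidean_space \<Rightarrow> 'c::euclidean_space"
  assumes S: "compact S" and cont: "\<And>h. continuous_on S (\<lambda>x. D x h)"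
    and lin: "\<And>x. x \<in> S \<Longrightarrow> linear (D x)"
  obtains B where "B \<ge> 0" "\<And>x h. x \<in> S \<Longrightarrow> norm (D x h) \<le> B * norm h"
proof -
  have "compact ((\<lambda>x. \<Sum>b\<in>Basis. norm (D x b)) ` S)"
    by (intro compact_continuous_image S continuous_intros cont)
  from compact_imp_bounded[OF this] obtain B where B: "\<And>x. x \<in> S \<Longrightarrow> \<bar>\<Sum>b\<in>Basis. norm (D x b)\<bar> \<le> B"
    unfolding bounded_iff by auto
  show thesis
  proof (rule that[of "max 0 B"])
    fix x :: 'a and h :: 'b assume x: "x \<in> S"
    have "norm (D x h) = norm (\<Sum>b\<in>Basis. (h \<bullet> b) *\<^sub>R D x b)"
      by (simp add: linear_Basis_expand[OF lin[OF x]])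
    also have "\<dots> \<le> (\<Sum>b\<in>Basis. norm h * norm (D x b))"
      by (intro sum_norm_le) (auto intro!: mult_right_mono Basis_le_norm)
    also have "\<dots> = norm h * (\<Sum>b\<in>Basis. norm (D x b))" by (simp add: sum_distrib_left)
    also have "\<dots> \<le> norm h * max 0 B" using B[OF x] by (intro mult_left_mono) auto
    finally show "norm (D x h) \<le> max 0 B * norm h" by (simp add: mult.commute)
  qed simp
qed

locale bounded_domain =
  fixes U :: "'a::euclidean_space set"
  assumes U: "open U" "bounded U" and nf: "negligible (frontier U)"
begin

abbreviation I :: "('a \<Rightarrow> real) \<Rightarrow> real" where "I f \<equiv> (LINT x:U|lborel. f x)"

lemma compact_closure_U: "compact (closure U)" using U by simp

lemma in_closure: "x \<in> U \<Longrightarrow> x \<in> closure U" using closure_subset by blast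

lemma bounded_on_closure:
  fixes f :: "'a \<Rightarrow> 'b::real_normed_vector"
  assumes "continuous_on (closure U) f"
  obtains B where "B \<ge> 0" "\<And>x. x \<in> closure U \<Longrightarrow> norm (f x) \<le> B"
proof -
  from compact_imp_bounded[OF compact_continuous_image[OF assms compact_closure_U]]
  obtain B where B: "\<And>x. x \<in> closure U \<Longrightarrow> norm (f x) \<le> B" unfolding bounded_iff by auto
  show thesis by (rule that[of "max 0 B"]) (auto intro: order_trans[OF B])
qed

lemma int_ok: "continuous_on (closure U) f \<Longrightarrow> set_integrable lborel U f" for f :: "'a \<Rightarrow> real"
  using set_integrable_continuous_on_closure[OF U] .

lemma U_sets: "U \<in> sets lborel" using U by simp

lemma I_cong: "(\<And>x. x \<in> U \<Longrightarrow> f x = g x) \<Longrightarrow> I f = I g"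
  using set_lebesgue_integral_cong[OF U_sets] by blast

lemma I_add: "continuous_on (closure U) f \<Longrightarrow> continuous_on (closure U) g \<Longrightarrow> I (\<lambda>x. f x + g x) = I f + I g"
  by (simp add: int_ok)

lemma I_diff: "continuous_on (closure U) f \<Longrightarrow> continuous_on (closure U) g \<Longrightarrow> I (\<lambda>x. f x - g x) = I f - I g"
  by (simp add: int_ok set_integral_diff)

lemma I_uminus: "continuous_on (closure U) f \<Longrightarrow> I (\<lambda>x. - f x) = - I f"
  by (simp add: int_ok set_integral_uminus)

lemma I_mono: "continuous_on (closure U) f \<Longrightarrow> continuous_on (closure U) g \<Longrightarrow> (\<And>x. x \<in> U \<Longrightarrow> f x \<le> g x) \<Longrightarrow> I f \<le> I g"
  by (intro set_integral_mono int_ok)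

lemma I_nonneg: "(\<And>x. x \<in> U \<Longrightarrow> 0 \<le> f x) \<Longrightarrow> 0 \<le> I f"
  unfolding set_lebesgue_integral_def by (intro Bochner_Integration.integral_nonneg) (auto simp: indicator_def)

lemma I_sum: "finite S \<Longrightarrow> (\<And>i. i \<in> S \<Longrightarrow> continuous_on (closure U) (f i)) \<Longrightarrow> I (\<lambda>x. \<Sum>i\<in>S. f i x) = (\<Sum>i\<in>S. I (f i))"
proof (induction S rule: finite_induct)
  case empty
  then show ?case by (simp add: set_lebesgue_integral_def)
next
  case (insert i S)
  then show ?case by (simp add: I_add continuous_on_sum)
qed

lemma I_const: "I (\<lambda>x. c) = measure lborel U * c"
  using set_integral_const[OF U_sets, of c] emeasure_bounded_finite[OF U(2)] by simp

text \<open>The divergence theorem for \<open>w V\<close>, one basis direction at a time. On the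
  boundary it is enough that one of the two factors vanishes: for test fields this is the field, in
  the energy estimate it is the scalar.\<close>

lemma integral_div_mult:
  fixes V :: "'a \<Rightarrow> 'a" and w :: "'a \<Rightarrow> real"
  assumes V: "continuous_on (closure U) V" "\<And>x. x \<in> U \<Longrightarrow> (V has_derivative DV x) (at x)"
      "\<And>h. continuous_on (closure U) (\<lambda>x. DV x h)" "\<And>x. x \<in> closure U \<Longrightarrow> linear (DV x)"
    and w: "continuous_on (closure U) w" "\<And>x. x \<in> U \<Longrightarrow> (w has_derivative (\<lambda>h. g x \<bullet> h)) (at x)"
      "continuous_on (closure U) g"
    and zero: "\<And>x. x \<in> frontier U \<Longrightarrow> w x = 0 \<or> V x = 0"
  shows "I (\<lambda>x. w x * (\<Sum>b\<in>Basis. DV x b \<bullet> b)) = - I (\<lambda>x. g x \<bullet> V x)"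
proof -
  obtain BD where BD: "BD \<ge> 0" "\<And>x h. x \<in> closure U \<Longrightarrow> norm (DV x h) \<le> BD * norm h"
    using continuous_linear_family_bound[OF compact_closure_U V(3,4)] by auto
  obtain BV where BV: "BV \<ge> 0" "\<And>x. x \<in> closure U \<Longrightarrow> norm (V x) \<le> BV" using bounded_on_closure[OF V(1)] by auto
  obtain Bw where Bw: "Bw \<ge> 0" "\<And>x. x \<in> closure U \<Longrightarrow> norm (w x) \<le> Bw" using bounded_on_closure[OF w(1)] by auto
  obtain Bg where Bg: "Bg \<ge> 0" "\<And>x. x \<in> closure U \<Longrightarrow> norm (g x) \<le> Bg" using bounded_on_closure[OF w(3)] by auto
  have 0: "I (\<lambda>x. w x * (DV x b \<bullet> b) + (g x \<bullet> b) * (V x \<bullet> b)) = 0" if b: "b \<in> Basis" for b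
  proof (rule integral_directional_derivative_eq_0[OF U nf, of "\<lambda>x. w x * (V x \<bullet> b)"
        "\<lambda>x h. w x * (DV x h \<bullet> b) + (g x \<bullet> h) * (V x \<bullet> b)"])
    show "continuous_on (closure U) (\<lambda>x. w x * (V x \<bullet> b))" by (intro continuous_intros V w)
    show "x \<in> frontier U \<Longrightarrow> w x * (V x \<bullet> b) = 0" for x using zero[of x] by auto
    show "continuous_on U (\<lambda>x. w x * (DV x b \<bullet> b) + (g x \<bullet> b) * (V x \<bullet> b))"
      by (rule continuous_on_subset[OF _ closure_subset]) (intro continuous_intros V w)
    fix x h assume x: "x \<in> U"
    show "((\<lambda>x. w x * (V x \<bullet> b)) has_derivative (\<lambda>h. w x * (DV x h \<bullet> b) + (g x \<bullet> h) * (V x \<bullet> b))) (at x)"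
      by (rule has_derivative_mult[OF w(2)[OF x] has_derivative_inner_left[OF V(2)[OF x]]])
    have xc: "x \<in> closure U" by (rule in_closure[OF x])
    have "\<bar>DV x h \<bullet> b\<bar> \<le> BD * norm h"
      using Cauchy_Schwarz_ineq2[of "DV x h" b] BD(2)[OF xc, of h] b by simp
    then have "\<bar>w x * (DV x h \<bullet> b)\<bar> \<le> Bw * (BD * norm h)"
      unfolding abs_mult using Bw(2)[OF xc] Bw(1) by (intro mult_mono) auto
    moreover have "\<bar>V x \<bullet> b\<bar> \<le> BV" using Cauchy_Schwarz_ineq2[of "V x" b] BV(2)[OF xc] b by simp
    moreover have "\<bar>g x \<bullet> h\<bar> \<le> Bg * norm h"
      using Cauchy_Schwarz_ineq2[of "g x" h] mult_right_mono[OF Bg(2)[OF xc], of "norm h"] by simp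
    ultimately have "\<bar>w x * (DV x h \<bullet> b)\<bar> + \<bar>(g x \<bullet> h) * (V x \<bullet> b)\<bar> \<le> Bw * (BD * norm h) + (Bg * norm h) * BV"
      unfolding abs_mult[of "g x \<bullet> h"] using Bg(1) by (intro add_mono mult_mono) auto
    then show "\<bar>w x * (DV x h \<bullet> b) + (g x \<bullet> h) * (V x \<bullet> b)\<bar> \<le> (Bw * BD + Bg * BV) * norm h"
      using abs_triangle_ineq[of "w x * (DV x h \<bullet> b)" "(g x \<bullet> h) * (V x \<bullet> b)"] by (simp add: algebra_simps)
  qed
  have "I (\<lambda>x. w x * (\<Sum>b\<in>Basis. DV x b \<bullet> b)) + I (\<lambda>x. g x \<bullet> V x)
    = I (\<lambda>x. w x * (\<Sum>b\<in>Basis. DV x b \<bullet> b) + g x \<bullet> V x)"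
    by (intro I_add[symmetric] continuous_intros V w)
  also have "\<dots> = I (\<lambda>x. \<Sum>b\<in>Basis. w x * (DV x b \<bullet> b) + (g x \<bullet> b) * (V x \<bullet> b))"
    by (intro I_cong) (simp add: sum_distrib_left sum.distrib sum_Basis_inner_mult)
  also have "\<dots> = (\<Sum>b\<in>Basis. I (\<lambda>x. w x * (DV x b \<bullet> b) + (g x \<bullet> b) * (V x \<bullet> b)))"
    by (rule I_sum) (auto intro!: continuous_intros V w)
  also have "\<dots> = 0" using 0 by simp
  finally show ?thesis by simp
qed

end

definition radial_pair :: "(real \<Rightarrow> real) \<Rightarrow> (real \<Rightarrow> real) \<Rightarrow> bool" where
  "radial_pair f e \<longleftrightarrow> continuous_on {0..} f \<and> continuous_on {0..} e \<and> e 0 = 0 \<and>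
     (\<forall>r>0. (f has_real_derivative e r / r) (at r))"

text \<open>\<open>n\<close> is the gradient of \<open>\<omega>\<close>. Both vanish off a compact
  subset of \<open>U\<close>, so that products with functions that are smooth only in
  \<open>U\<close> extend by zero to the whole space.\<close>

definition C1_weight :: "'a::euclidean_space set \<Rightarrow> ('a \<Rightarrow> real) \<Rightarrow> ('a \<Rightarrow> 'a) \<Rightarrow> 'a set \<Rightarrow> bool" where
  "C1_weight U \<omega> n S \<longleftrightarrow> (\<forall>x. (\<omega> has_derivative (\<lambda>h. n x \<bullet> h)) (at x)) \<and> continuous_on UNIV n \<and>
     compact S \<and> S \<subseteq> U \<and> (\<forall>x. x \<notin> S \<longrightarrow> \<omega> x = 0 \<and> n x = 0)"

subsection \<open>The equation at a fixed time\<close>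

text \<open>\<open>q\<close>, \<open>H\<close> and \<open>J\<close> are the gradient of \<open>u\<close>, the Hessian of \<open>u\<close> and the derivative of \<open>Z\<close>. The bounds on
  \<open>X\<close> and \<open>DX\<close> express that the mobility degenerates like \<open>norm y powr (- a)\<close>.\<close>

locale slice = bounded_domain U for U :: "(real^3) set" +
  fixes a c \<kappa> M :: real and X :: "real^3 \<Rightarrow> real^3" and DX :: "real^3 \<Rightarrow> real^3 \<Rightarrow> real^3"
    and u :: "real^3 \<Rightarrow> real" and q :: "real^3 \<Rightarrow> real^3" and H :: "real^3 \<Rightarrow> real^3 \<Rightarrow> real^3"
    and Z :: "real^3 \<Rightarrow> real^3" and J :: "real^3 \<Rightarrow> real^3"
  assumes a: "0 < a" "a < 1" and c: "c \<ge> 1" and \<kappa>: "\<kappa> \<ge> 1" and M: "M > 0"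
    and X_der: "\<And>y. (X has_derivative DX y) (at y)"
    and DX_cont: "\<And>h. continuous_on UNIV (\<lambda>y. DX y h)"
    and X1: "\<And>y. (1 + norm y) powr (- a) * (norm y)\<^sup>2 \<le> c * \<kappa>\<^sup>2 * (X y \<bullet> y)"
    and X2: "\<And>y. norm (X y) \<le> c * \<kappa> powr a * (1 + norm y) powr (- a) * norm y"
    and DX1: "\<And>y h. (1 + norm y) powr (- a) * (norm h)\<^sup>2 \<le> c * \<kappa>\<^sup>2 * (DX y h \<bullet> h)"
    and DX2: "\<And>y h. norm (DX y h) \<le> c * \<kappa> powr a * (1 + norm y) powr (- a) * norm h"
    and cont_u: "continuous_on (closure U) u" and cont_q: "continuous_on (closure U) q"
    and cont_H: "\<And>h. continuous_on (closure U) (\<lambda>x. H x h)" and cont_Z: "continuous_on (closure U) Z"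
    and lin_H: "\<And>x. linear (H x)" and lin_J: "linear J"
    and der_u: "\<And>x. x \<in> U \<Longrightarrow> (u has_derivative (\<lambda>h. q x \<bullet> h)) (at x)"
    and der_q: "\<And>x. x \<in> U \<Longrightarrow> (q has_derivative H x) (at x)"
    and der_Z: "\<And>x. x \<in> U \<Longrightarrow> (Z has_derivative J) (at x)"
    and bd_u: "\<And>x. x \<in> U \<Longrightarrow> \<bar>u x\<bar> \<le> M"
    and bd_Z: "\<And>x. x \<in> U \<Longrightarrow> norm (Z x) \<le> \<kappa>\<^sup>2"
    and bd_J: "\<And>h. norm (J h) \<le> \<kappa>\<^sup>2 * norm h"
begin

definition \<Phi> where "\<Phi> x = q x + (u x)\<^sup>2 *\<^sub>R Z x"
definition K where "K x = (1 + norm (\<Phi> x)) powr (- a)"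
definition V where "V x = X (\<Phi> x)"
text \<open>The derivative of \<open>u\<^sup>2 Z\<close>: the lower-order perturbation of the
  Hessian in the derivative of \<open>\<Phi>\<close>.\<close>

definition Pm where "Pm x h = (2 * u x * (q x \<bullet> h)) *\<^sub>R Z x + (u x)\<^sup>2 *\<^sub>R J h"
definition DV where "DV x h = DX (\<Phi> x) (H x h + Pm x h)"
text \<open>\<open>K'\<close> is a lower bound of \<open>K\<close> that depends on \<open>x\<close> only through \<open>norm (q x)\<close>, so that it can serve in a test field.\<close>

definition L where "L = 1 + M\<^sup>2 * \<kappa>\<^sup>2"
definition K' where "K' x = (L + norm (q x)) powr (- a)"
definition hs where "hs x = (\<Sum>j\<in>Basis. (norm (H x j))\<^sup>2)"
definition divV where "divV x = (\<Sum>b\<in>Basis. DV x b \<bullet> b)"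

lemma cont_J: "continuous_on S J" using lin_J by (simp add: linear_continuous_on linear_conv_bounded_linear)

lemma cont_\<Phi>: "continuous_on (closure U) \<Phi>"
  unfolding \<Phi>_def by (intro continuous_intros cont_u cont_q cont_Z)

lemma X_cont: "continuous_on UNIV X"
  by (intro continuous_at_imp_continuous_on ballI has_derivative_continuous[OF X_der])

lemma cont_V: "continuous_on (closure U) V"
  unfolding V_def by (rule continuous_on_compose2[OF X_cont cont_\<Phi>]) auto

lemma lin_DX: "linear (DX y)" by (rule has_derivative_linear[OF X_der])

lemma lin_Pm: "linear (Pm x)"
  unfolding Pm_def
  by (rule linearI) (simp_all add: inner_add_right linear_add[OF lin_J] linear_cmul[OF lin_J]
      scaleR_add_right distrib_left scaleR_add_left mult.commute)

lemma lin_DV: "linear (DV x)"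
  unfolding DV_def
  using linear_compose[OF linear_compose_add[OF lin_H[of x] lin_Pm[of x]] lin_DX[of "\<Phi> x"]] by (simp add: o_def)

lemma cont_DV: "continuous_on (closure U) (\<lambda>x. DV x h)"
proof -
  define v where "v x = H x h + Pm x h" for x
  have v: "continuous_on (closure U) v"
    unfolding v_def Pm_def by (intro continuous_intros cont_H cont_u cont_q cont_Z cont_J)
  have "DV x h = (\<Sum>b\<in>Basis. (v x \<bullet> b) *\<^sub>R DX (\<Phi> x) b)" for x
    unfolding DV_def v_def[symmetric] by (simp add: linear_Basis_expand[OF lin_DX])
  moreover have "continuous_on (closure U) (\<lambda>x. \<Sum>b\<in>Basis. (v x \<bullet> b) *\<^sub>R DX (\<Phi> x) b)"
    by (intro continuous_intros v continuous_on_compose2[OF DX_cont cont_\<Phi>]) auto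
  ultimately show ?thesis by simp
qed

lemma \<Phi>_der: assumes x: "x \<in> U" shows "(\<Phi> has_derivative (\<lambda>h. H x h + Pm x h)) (at x)"
  unfolding \<Phi>_def[abs_def] Pm_def
  by (rule has_derivative_eq_rhs[OF has_derivative_add[OF der_q[OF x]
        has_derivative_scaleR[OF has_derivative_power[OF der_u[OF x], of 2] der_Z[OF x]]]])
    (auto simp: algebra_simps)

lemma V_der: "x \<in> U \<Longrightarrow> (V has_derivative DV x) (at x)"
  unfolding V_def[abs_def] DV_def using has_derivative_compose[OF \<Phi>_der X_der] .

lemma cont_divV: "continuous_on (closure U) divV"
  unfolding divV_def by (intro continuous_intros cont_DV)

lemma sym_H: "x \<in> U \<Longrightarrow> H x v \<bullet> w = H x w \<bullet> v"
  by (rule symmetric_second_derivative[OF U(1) _ der_u der_q])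
    (auto intro: continuous_on_subset[OF cont_H closure_subset])

lemma K_pos: "0 < K x"
proof -
  have "0 < 1 + norm (\<Phi> x)" by (simp add: add_pos_nonneg)
  then show ?thesis by (simp add: K_def)
qed

lemma norm_u2Z: assumes "x \<in> U" shows "norm ((u x)\<^sup>2 *\<^sub>R Z x) \<le> M\<^sup>2 * \<kappa>\<^sup>2"
proof -
  have "\<bar>u x\<bar>\<^sup>2 \<le> M\<^sup>2" using bd_u[OF assms] by (intro power_mono) auto
  then show ?thesis using bd_Z[OF assms] by (auto intro!: mult_mono)
qed

lemma L_ge_1: "L \<ge> 1" by (simp add: L_def)

lemma K'_pos: "0 < K' x"
proof -
  have "0 < L + norm (q x)" using L_ge_1 norm_ge_zero[of "q x"] by linarith
  then show ?thesis by (simp add: K'_def)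
qed

lemma K'_le_K: assumes "x \<in> U" shows "K' x \<le> K x"
proof -
  have "1 + norm (\<Phi> x) \<le> L + norm (q x)"
    using norm_triangle_ineq[of "q x" "(u x)\<^sup>2 *\<^sub>R Z x"] norm_u2Z[OF assms] by (simp add: \<Phi>_def L_def)
  moreover have "0 < 1 + norm (\<Phi> x)" by (simp add: add_pos_nonneg)
  ultimately show ?thesis unfolding K_def K'_def using a by (intro powr_mono2') auto
qed

lemma K_le_1: "K x \<le> 1"
  unfolding K_def using powr_mono[of "- a" 0 "1 + norm (\<Phi> x)"] a
  by (simp add: add_nonneg_eq_0_iff split: if_splits)

lemma norm_Pm: assumes "x \<in> U" shows "norm (Pm x h) \<le> ((2 * M * norm (q x) + M\<^sup>2) * \<kappa>\<^sup>2) * norm h"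
proof -
  have u: "\<bar>u x\<bar> \<le> M" by (rule bd_u[OF assms])
  then have u2: "\<bar>u x\<bar>\<^sup>2 \<le> M\<^sup>2" by (intro power_mono) auto
  have "norm ((2 * u x * (q x \<bullet> h)) *\<^sub>R Z x) \<le> (2 * M * (norm (q x) * norm h)) * \<kappa>\<^sup>2"
    unfolding norm_scaleR abs_mult using u bd_Z[OF assms] Cauchy_Schwarz_ineq2[of "q x" h] M
    by (intro mult_mono) auto
  moreover have "norm ((u x)\<^sup>2 *\<^sub>R J h) \<le> M\<^sup>2 * (\<kappa>\<^sup>2 * norm h)"
    using u2 bd_J[of h] by (auto intro!: mult_mono)
  ultimately show ?thesis
    using norm_triangle_ineq[of "(2 * u x * (q x \<bullet> h)) *\<^sub>R Z x" "(u x)\<^sup>2 *\<^sub>R J h"]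
    unfolding Pm_def by (simp add: algebra_simps)
qed

lemma cont_K: "continuous_on (closure U) K"
  unfolding K_def by (intro continuous_intros cont_\<Phi>) (auto simp: add_nonneg_eq_0_iff)

lemma cont_K': "continuous_on (closure U) K'"
proof -
  have "L + norm (q x) \<noteq> 0" for x using L_ge_1 norm_ge_zero[of "q x"] by linarith
  then show ?thesis unfolding K'_def by (intro continuous_intros cont_q) auto
qed

lemma cont_hs: "continuous_on (closure U) hs"
  unfolding hs_def by (intro continuous_intros cont_H)

lemma hs_nonneg: "hs x \<ge> 0" unfolding hs_def by (intro sum_nonneg) auto

text \<open>The test field, \<open>\<omega>\<close> times a radial function of the gradient. The
  case distinction makes it a C1 field on the whole space, as
  \<open>integral_mixed_derivatives\<close> requires of one of its two factors.\<close>

definition W :: "(real \<Rightarrow> real) \<Rightarrow> (real^3 \<Rightarrow> real) \<Rightarrow> real^3 \<Rightarrow> real^3" where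
  "W f \<omega> x = (if x \<in> U then \<omega> x *\<^sub>R (f (norm (q x)) *\<^sub>R q x) else 0)"

definition DW :: "(real \<Rightarrow> real) \<Rightarrow> (real \<Rightarrow> real) \<Rightarrow> (real^3 \<Rightarrow> real) \<Rightarrow> (real^3 \<Rightarrow> real^3) \<Rightarrow> real^3 \<Rightarrow> real^3 \<Rightarrow> real^3" where
  "DW f e \<omega> n x h = (if x \<in> U then \<omega> x *\<^sub>R radial_deriv f e (q x) (H x h)
      + (n x \<bullet> h) *\<^sub>R (f (norm (q x)) *\<^sub>R q x) else 0)"

definition divW where "divW f e \<omega> n x = (\<Sum>b\<in>Basis. DW f e \<omega> n x b \<bullet> b)"

context
  fixes f e :: "real \<Rightarrow> real" and \<omega> :: "real^3 \<Rightarrow> real" and n :: "real^3 \<Rightarrow> real^3" and S :: "(real^3) set"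
  assumes fe_pair: "radial_pair f e" and weight: "C1_weight U \<omega> n S"
begin

lemma f: "continuous_on {0..} f" and e: "continuous_on {0..} e" "e 0 = 0"
  and fe: "r > 0 \<Longrightarrow> (f has_real_derivative e r / r) (at r)"
  using fe_pair unfolding radial_pair_def by auto

lemma w: "(\<omega> has_derivative (\<lambda>h. n x \<bullet> h)) (at x)" and n: "continuous_on UNIV n"
  and S: "compact S" "S \<subseteq> U" "x \<notin> S \<Longrightarrow> \<omega> x = 0" "x \<notin> S \<Longrightarrow> n x = 0"
  using weight unfolding C1_weight_def by auto


lemma cont_w: "continuous_on UNIV \<omega>"
  by (intro continuous_at_imp_continuous_on ballI has_derivative_continuous[OF w])

lemma open_Compl_S: "open (- S)" using compact_imp_closed[OF S(1)] by (rule open_Compl)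

lemma W_out: "x \<notin> S \<Longrightarrow> W f \<omega> x = 0" and DW_out: "x \<notin> S \<Longrightarrow> DW f e \<omega> n x h = 0"
  using S by (auto simp: W_def DW_def)

text \<open>\<open>U\<close> and the complement of \<open>S\<close> are open and cover the space. On
  the first the product rule applies, on the second the field is zero; the continuity of the
  derivative is glued in the same way.\<close>

lemma W_der: "(W f \<omega> has_derivative DW f e \<omega> n x) (at x)"
proof (cases "x \<in> U")
  case True
  have "((\<lambda>x. f (norm (q x)) *\<^sub>R q x) has_derivative (\<lambda>h. radial_deriv f e (q x) (H x h))) (at x)"
    using has_derivative_compose[OF der_q[OF True] radial_has_derivative[OF f fe]] .
  from has_derivative_scaleR[OF w this]
  have "((\<lambda>x. \<omega> x *\<^sub>R (f (norm (q x)) *\<^sub>R q x)) has_derivative DW f e \<omega> n x) (at x)"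
    using True by (simp add: DW_def[abs_def])
  then show ?thesis
    by (rule has_derivative_transform_within_open[OF _ U(1) True]) (simp add: W_def)
next
  case False
  then have x: "x \<in> - S" using S by auto
  have "((\<lambda>_. 0) has_derivative DW f e \<omega> n x) (at x)"
    using False by (simp add: DW_def[abs_def])
  then show ?thesis
    by (rule has_derivative_transform_within_open[OF _ _ x])
      (use W_out open_Compl_S in auto)
qed

lemma cont_fq: "continuous_on (closure U) (\<lambda>x. f (norm (q x)))"
  by (rule continuous_on_compose2[OF f]) (auto intro!: continuous_intros cont_q)

lemma cont_DW: "continuous_on T (\<lambda>x. DW f e \<omega> n x h)"
proof -
  have "continuous_on U (\<lambda>x. \<omega> x *\<^sub>R radial_deriv f e (q x) (H x h) + (n x \<bullet> h) *\<^sub>R (f (norm (q x)) *\<^sub>R q x))"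
    by (rule continuous_on_subset[OF _ closure_subset])
      (intro continuous_intros continuous_on_radial_deriv f e cont_q cont_H cont_fq
        continuous_on_subset[OF cont_w] continuous_on_subset[OF n] subset_UNIV)
  then have 1: "continuous_on U (\<lambda>x. DW f e \<omega> n x h)" by (rule continuous_on_eq) (simp add: DW_def)
  have 2: "continuous_on (- S) (\<lambda>x. DW f e \<omega> n x h)"
    by (rule continuous_on_eq[of _ "\<lambda>_. 0"]) (auto simp: DW_out)
  have "continuous_on (U \<union> - S) (\<lambda>x. DW f e \<omega> n x h)"
    by (intro continuous_on_open_Un U(1) 1 2 open_Compl_S)
  moreover have "U \<union> - S = UNIV" using S by auto
  ultimately show ?thesis using continuous_on_subset[of UNIV] by auto
qed

lemma cont_W: "continuous_on T (W f \<omega>)"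
  by (intro continuous_at_imp_continuous_on ballI has_derivative_continuous[OF W_der])

lemma lin_DW: "linear (DW f e \<omega> n x)" by (rule has_derivative_linear[OF W_der])


lemma cont_divW: "continuous_on T (divW f e \<omega> n)" unfolding divW_def[abs_def] by (intro continuous_intros cont_DW)

lemma parts_W:
  assumes v: "continuous_on (closure U) v" "\<And>x. x \<in> U \<Longrightarrow> (v has_derivative (\<lambda>h. g x \<bullet> h)) (at x)"
      "continuous_on (closure U) g"
  shows "I (\<lambda>x. v x * divW f e \<omega> n x) = - I (\<lambda>x. g x \<bullet> W f \<omega> x)"
  unfolding divW_def
proof (rule integral_div_mult[OF cont_W W_der cont_DW lin_DW v])
  fix x assume "x \<in> frontier U"
  then have "x \<notin> U" using U by (simp add: frontier_def interior_open)
  then show "v x = 0 \<or> W f \<omega> x = 0" by (simp add: W_def)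
qed

text \<open>For each pair of indices the two derivatives trade places by
  \<open>integral_mixed_derivatives\<close>. Integrating by parts twice in the ordinary way would
  require second derivatives of \<open>V\<close> or of the test field.\<close>

lemma divV_divW: "I (\<lambda>x. divV x * divW f e \<omega> n x) = I (\<lambda>x. \<Sum>i\<in>Basis. \<Sum>j\<in>Basis. (DV x j \<bullet> i) * (DW f e \<omega> n x i \<bullet> j))"
proof -
  obtain BV where BV: "BV \<ge> 0" "\<And>x h. x \<in> closure U \<Longrightarrow> norm (DV x h) \<le> BV * norm h"
    using continuous_linear_family_bound[OF compact_closure_U cont_DV lin_DV] by auto
  obtain BW where BW: "BW \<ge> 0" "\<And>x h. x \<in> S \<Longrightarrow> norm (DW f e \<omega> n x h) \<le> BW * norm h"
    using continuous_linear_family_bound[OF S(1) cont_DW lin_DW] by auto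
  have eq: "I (\<lambda>x. (DV x i \<bullet> i) * (DW f e \<omega> n x j \<bullet> j)) = I (\<lambda>x. (DV x j \<bullet> i) * (DW f e \<omega> n x i \<bullet> j))"
    if ij: "i \<in> Basis" "j \<in> Basis" for i j
  proof (rule integral_mixed_derivatives[OF U nf, of "\<lambda>x. V x \<bullet> i" "\<lambda>x h. DV x h \<bullet> i" BV "\<lambda>x. W f \<omega> x \<bullet> j" "\<lambda>x h. DW f e \<omega> n x h \<bullet> j" BW S])
    show "continuous_on (closure U) (\<lambda>x. V x \<bullet> i)" by (intro continuous_intros cont_V)
    show "((\<lambda>x. V x \<bullet> i) has_derivative (\<lambda>h. DV x h \<bullet> i)) (at x)" if "x \<in> U" for x
      by (rule has_derivative_inner_left[OF V_der[OF that]])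
    show "((\<lambda>x. W f \<omega> x \<bullet> j) has_derivative (\<lambda>h. DW f e \<omega> n x h \<bullet> j)) (at x)" for x
      by (rule has_derivative_inner_left[OF W_der])
    show "\<bar>DV x h \<bullet> i\<bar> \<le> BV * norm h" if "x \<in> U" for x h
      using Cauchy_Schwarz_ineq2[of "DV x h" i] BV(2)[OF in_closure[OF that], of h] ij by simp
    show "\<bar>DW f e \<omega> n x h \<bullet> j\<bar> \<le> BW * norm h" for x h
      using Cauchy_Schwarz_ineq2[of "DW f e \<omega> n x h" j] BW(2)[of x h] BW(1) ij DW_out[of x h] by (cases "x \<in> S") auto
    show "continuous_on U (\<lambda>x. DV x h \<bullet> i)" for h
      by (rule continuous_on_subset[OF _ closure_subset]) (intro continuous_intros cont_DV)
    show "continuous_on UNIV (\<lambda>x. DW f e \<omega> n x h \<bullet> j)" for h by (intro continuous_intros cont_DW)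
    show "W f \<omega> x \<bullet> j = 0" if "x \<notin> S" for x using W_out[OF that] by simp
  qed (use S in auto)
  have "I (\<lambda>x. divV x * divW f e \<omega> n x) = I (\<lambda>x. \<Sum>i\<in>Basis. \<Sum>j\<in>Basis. (DV x i \<bullet> i) * (DW f e \<omega> n x j \<bullet> j))"
    by (intro I_cong) (simp add: divV_def divW_def sum_product)
  also have "\<dots> = (\<Sum>i\<in>Basis. \<Sum>j\<in>Basis. I (\<lambda>x. (DV x i \<bullet> i) * (DW f e \<omega> n x j \<bullet> j)))"
    by (subst I_sum; (intro sum.cong refl I_sum finite_Basis continuous_intros cont_DV cont_DW)?)
  also have "\<dots> = (\<Sum>i\<in>Basis. \<Sum>j\<in>Basis. I (\<lambda>x. (DV x j \<bullet> i) * (DW f e \<omega> n x i \<bullet> j)))"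
    by (intro sum.cong refl eq)
  also have "\<dots> = I (\<lambda>x. \<Sum>i\<in>Basis. \<Sum>j\<in>Basis. (DV x j \<bullet> i) * (DW f e \<omega> n x i \<bullet> j))"
    by (subst I_sum; (intro sum.cong refl I_sum[symmetric] finite_Basis continuous_intros cont_DV cont_DW)?)
  finally show ?thesis .
qed

end

end

text \<open>Cauchy-Schwarz in three dimensions, with the square root of 3 rounded up to 2.\<close>

lemma sum_norm_Basis3_le:
  fixes g :: "real^3 \<Rightarrow> 'b::real_normed_vector"
  shows "(\<Sum>b\<in>Basis. norm (g b)) \<le> 2 * sqrt (\<Sum>b\<in>Basis. (norm (g b))\<^sup>2)"
proof (rule power2_le_imp_le)
  have nn: "0 \<le> (\<Sum>b\<in>Basis. (norm (g b))\<^sup>2)" by (intro sum_nonneg) auto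
  have "(\<Sum>b\<in>(Basis::(real^3) set). norm (g b))\<^sup>2 \<le> (\<Sum>b\<in>(Basis::(real^3) set). 1\<^sup>2) * (\<Sum>b\<in>Basis. (norm (g b))\<^sup>2)"
    using Cauchy_Schwarz_ineq_sum[of "\<lambda>_. 1" "\<lambda>b. norm (g b)" "Basis::(real^3) set"] by simp
  also have "\<dots> = 3 * (\<Sum>b\<in>Basis. (norm (g b))\<^sup>2)" by simp
  also have "\<dots> \<le> 4 * (\<Sum>b\<in>Basis. (norm (g b))\<^sup>2)" using nn by simp
  finally show "(\<Sum>b\<in>Basis. norm (g b))\<^sup>2 \<le> (2 * sqrt (\<Sum>b\<in>Basis. (norm (g b))\<^sup>2))\<^sup>2"
    using nn by (simp add: power_mult_distrib)
  show "0 \<le> 2 * sqrt (\<Sum>b\<in>Basis. (norm (g b))\<^sup>2)" using nn by simp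
qed

section \<open>From the Hessian to a higher power of the gradient\<close>

context slice begin

context
  fixes p :: real and \<omega> :: "real^3 \<Rightarrow> real" and n :: "real^3 \<Rightarrow> real^3" and S :: "(real^3) set" and w2 :: "real^3 \<Rightarrow> real"
  assumes p: "p \<ge> 2"
    and weight: "C1_weight U \<omega> n S"
    and w2: "continuous_on UNIV w2" "\<And>x. 0 \<le> \<omega> x" "\<And>x. 0 \<le> w2 x" "\<And>x. (norm (n x))\<^sup>2 \<le> \<omega> x * w2 x"
begin

lemma fpow_pair: "radial_pair (fpow p) (\<lambda>r. (p - 2) * fpow p r)"
  unfolding radial_pair_def
proof (intro conjI allI impI)
  show "(p - 2) * fpow p 0 = 0" by (simp add: fpow_def)
qed (intro continuous_on_mult_left fpow_cont[OF p] fpow_deriv; assumption)+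

lemma kpow_pair: "radial_pair (kpow a L p) (kpow' a L p)"
  using kpow_cont[OF p L_ge_1] kpow_deriv[OF _ L_ge_1] unfolding radial_pair_def
  by (auto simp: kpow'_def kpow_def)

abbreviation dW where "dW \<equiv> divW (fpow p) (\<lambda>r. (p - 2) * fpow p r) \<omega> n"
abbreviation fq where "fq x \<equiv> fpow p (norm (q x))"
abbreviation P2 where "P2 x \<equiv> ((2 * M * norm (q x) + M\<^sup>2) * \<kappa>\<^sup>2)\<^sup>2"

lemma conts: "continuous_on (closure U) fq" "continuous_on (closure U) \<omega>" "continuous_on (closure U) n"
  "continuous_on (closure U) w2"
  using cont_fq[OF fpow_pair weight] cont_w[OF fpow_pair weight] n[OF fpow_pair weight] w2
  by (auto intro: continuous_on_subset)

text \<open>The trace bound is applied at each point with ellipticity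
  \<open>l = K x / (c * \<kappa>\<^sup>2)\<close> and upper bound
  \<open>\<Lambda> = c * \<kappa> powr a * K x\<close>. Both are proportional to \<open>K x\<close>,
  hence so is \<open>\<Lambda>\<^sup>2 / l\<close>, and the errors carry the same weight as the
  dissipation.\<close>

lemma diffusion_lower:
  "- I (\<lambda>x. divV x * dW x) \<le> I (\<lambda>x. - (1 / (2 * c * \<kappa>\<^sup>2)) * (K x * fq x * hs x * \<omega> x)
     + (p + 2) * c ^ 3 * \<kappa> powr (2 + 2 * a) * (K x * fq x * (P2 x * \<omega> x + (norm (q x))\<^sup>2 * w2 x)))"
proof -
  have "- I (\<lambda>x. divV x * dW x) = - I (\<lambda>x. \<Sum>i\<in>Basis. \<Sum>j\<in>Basis. (DV x j \<bullet> i) *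
      (DW (fpow p) (\<lambda>r. (p - 2) * fpow p r) \<omega> n x i \<bullet> j))"
    by (simp only: divV_divW[OF fpow_pair weight])
  also have "\<dots> = I (\<lambda>x. - (\<Sum>i\<in>Basis. \<Sum>j\<in>Basis. (DV x j \<bullet> i) *
      (DW (fpow p) (\<lambda>r. (p - 2) * fpow p r) \<omega> n x i \<bullet> j)))"
    by (intro I_uminus[symmetric] continuous_intros cont_DV cont_DW[OF fpow_pair weight])
  also have "\<dots> \<le> I (\<lambda>x. - (1 / (2 * c * \<kappa>\<^sup>2)) * (K x * fq x * hs x * \<omega> x)
     + (p + 2) * c ^ 3 * \<kappa> powr (2 + 2 * a) * (K x * fq x * (P2 x * \<omega> x + (norm (q x))\<^sup>2 * w2 x)))"
  proof (rule I_mono)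
    fix x assume x: "x \<in> U"
    define l where "l = K x / (c * \<kappa>\<^sup>2)"
    define \<Lambda> where "\<Lambda> = c * \<kappa> powr a * K x"
    have K: "K x > 0" by (rule K_pos)
    have cp: "c > 0" "\<kappa> > 0" using c \<kappa> by auto
    have l: "l > 0" using K cp by (simp add: l_def)
    have "1 * 1 \<le> c * \<kappa>\<^sup>2" "1 * 1 \<le> c * \<kappa> powr a"
      using c \<kappa> a by (intro mult_mono; simp add: ge_one_powr_ge_zero)+
    then have "K x / (c * \<kappa>\<^sup>2) \<le> K x / 1" "1 * K x \<le> c * \<kappa> powr a * K x"
      using K by (intro divide_left_mono mult_right_mono; simp)+
    then have l\<Lambda>: "l \<le> \<Lambda>" by (simp add: l_def \<Lambda>_def)
    have R: "\<Lambda>\<^sup>2 / l = c ^ 3 * \<kappa> powr (2 + 2 * a) * K x"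
    proof -
      have "\<Lambda>\<^sup>2 / l = c ^ 3 * (\<kappa>\<^sup>2 * (\<kappa> powr a)\<^sup>2) * K x"
        using K cp by (simp add: l_def \<Lambda>_def power2_eq_square power3_eq_cube field_simps)
      moreover have "\<kappa>\<^sup>2 * (\<kappa> powr a)\<^sup>2 = \<kappa> powr (2 + 2 * a)"
      proof -
        have "\<kappa> powr (2 + 2 * a) = \<kappa> powr 2 * (\<kappa> powr a * \<kappa> powr a)" by (simp only: powr_add mult_2)
        moreover have "\<kappa> powr 2 = \<kappa>\<^sup>2" using cp by (simp add: powr_numeral)
        ultimately show ?thesis by (simp only: power2_eq_square[of "\<kappa> powr a"])
      qed
      ultimately show ?thesis by simp
    qed
    have main: "fq x * (l / 2 * \<omega> x * (\<Sum>j\<in>Basis. (norm (H x j))\<^sup>2)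
        - \<Lambda>\<^sup>2 / l * ((4 + (p - 2)) * P2 x * \<omega> x + 2 * (norm (q x))\<^sup>2 * w2 x))
      \<le> (\<Sum>i\<in>Basis. \<Sum>j\<in>Basis. (DX (\<Phi> x) (H x j + Pm x j) \<bullet> i) *
        ((\<omega> x *\<^sub>R (fq x *\<^sub>R H x i + ((p - 2) * fq x / (norm (q x))\<^sup>2 * (q x \<bullet> H x i)) *\<^sub>R q x) + (n x \<bullet> i) *\<^sub>R (fq x *\<^sub>R q x)) \<bullet> j))"
    proof (rule trace_product_lower[OF lin_DX lin_H lin_Pm sym_H[OF x] _ _ l l\<Lambda> norm_Pm[OF x]])
      show "l * (norm h)\<^sup>2 \<le> DX (\<Phi> x) h \<bullet> h" for h
        using DX1[of "\<Phi> x" h] cp by (simp add: l_def K_def field_simps)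
      show "norm (DX (\<Phi> x) h) \<le> \<Lambda> * norm h" for h
        using DX2[of "\<Phi> x" h] by (simp add: \<Lambda>_def K_def)
      show "0 \<le> (2 * M * norm (q x) + M\<^sup>2) * \<kappa>\<^sup>2" using M by simp
      show "0 \<le> (p - 2) * fq x" using p fpow_nonneg[of p] by simp
    qed (use fpow_nonneg w2 in auto)
    have "(\<Sum>i\<in>Basis. \<Sum>j\<in>Basis. (DV x j \<bullet> i) * (DW (fpow p) (\<lambda>r. (p - 2) * fpow p r) \<omega> n x i \<bullet> j))
      = (\<Sum>i\<in>Basis. \<Sum>j\<in>Basis. (DX (\<Phi> x) (H x j + Pm x j) \<bullet> i) *
        ((\<omega> x *\<^sub>R (fq x *\<^sub>R H x i + ((p - 2) * fq x / (norm (q x))\<^sup>2 * (q x \<bullet> H x i)) *\<^sub>R q x) + (n x \<bullet> i) *\<^sub>R (fq x *\<^sub>R q x)) \<bullet> j))"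
      unfolding DW_def using x by (simp add: DV_def radial_deriv_def)
    with main have m2: "- (\<Sum>i\<in>Basis. \<Sum>j\<in>Basis. (DV x j \<bullet> i) * (DW (fpow p) (\<lambda>r. (p - 2) * fpow p r) \<omega> n x i \<bullet> j))
      \<le> - (fq x * (l / 2 * \<omega> x * hs x - \<Lambda>\<^sup>2 / l * ((4 + (p - 2)) * P2 x * \<omega> x + 2 * (norm (q x))\<^sup>2 * w2 x)))"
      by (simp add: hs_def)
    also have "\<dots> = - (1 / (2 * c * \<kappa>\<^sup>2)) * (K x * fq x * hs x * \<omega> x)
      + (c ^ 3 * \<kappa> powr (2 + 2 * a) * K x * fq x) * ((p + 2) * (P2 x * \<omega> x) + 2 * ((norm (q x))\<^sup>2 * w2 x))"
      unfolding R by (simp add: l_def algebra_simps)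
    also have "\<dots> \<le> - (1 / (2 * c * \<kappa>\<^sup>2)) * (K x * fq x * hs x * \<omega> x)
      + (c ^ 3 * \<kappa> powr (2 + 2 * a) * K x * fq x) * ((p + 2) * (P2 x * \<omega> x) + (p + 2) * ((norm (q x))\<^sup>2 * w2 x))"
      using p K cp fpow_nonneg[of p "norm (q x)"] w2(3)[of x] by (intro add_left_mono mult_left_mono add_mono mult_right_mono) auto
    finally show "- (\<Sum>i\<in>Basis. \<Sum>j\<in>Basis. (DV x j \<bullet> i) * (DW (fpow p) (\<lambda>r. (p - 2) * fpow p r) \<omega> n x i \<bullet> j))
      \<le> - (1 / (2 * c * \<kappa>\<^sup>2)) * (K x * fq x * hs x * \<omega> x)
      + (p + 2) * c ^ 3 * \<kappa> powr (2 + 2 * a) * (K x * fq x * (P2 x * \<omega> x + (norm (q x))\<^sup>2 * w2 x))"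
      by (simp add: distrib_left mult_ac)
  qed (intro continuous_intros cont_DV cont_DW[OF fpow_pair weight] cont_K cont_hs conts cont_q)+
  finally show ?thesis .
qed

text \<open>Write \<open>norm (q x) ^ 4\<close> as \<open>(norm (q x))\<^sup>2 * (q x \<bullet> q x)\<close>, integrate one factor \<open>q = \<nabla>u\<close> by parts and use \<open>\<bar>u\<bar> \<le> M\<close>.\<close>

lemma embedding:
  "I (\<lambda>x. K' x * fq x * norm (q x) ^ 4 * \<omega> x)
    \<le> 8 * (1 + p)\<^sup>2 * M\<^sup>2 * I (\<lambda>x. K' x * fq x * (hs x * \<omega> x + (norm (q x))\<^sup>2 * w2 x))"
proof -
  \<comment> \<open>The profile of the test field, chosen so that its product with the gradient is
    the integrand on the left. It is built from \<open>K'\<close>, a function of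
    \<open>norm (q x)\<close> alone, and so its derivative involves only the Hessian.\<close>
  define k where "k x = kpow a L p (norm (q x))" for x
  have k: "k x = K' x * fq x * (norm (q x))\<^sup>2" for x
    by (simp add: k_def kpow_def K'_def fpow_square[symmetric])
  have k0: "0 \<le> k x" for x by (simp add: k_def kpow_def)
  let ?dW = "divW (kpow a L p) (kpow' a L p) \<omega> n"
  define A where "A x = K' x * fq x * norm (q x) ^ 4 * \<omega> x" for x
  define B where "B x = K' x * fq x * (hs x * \<omega> x + (norm (q x))\<^sup>2 * w2 x)" for x
  have cA: "continuous_on (closure U) A" and cB: "continuous_on (closure U) B"
    unfolding A_def B_def by (intro continuous_intros cont_K' cont_hs conts cont_q)+
  have "I A = I (\<lambda>x. q x \<bullet> W (kpow a L p) \<omega> x)"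
  proof (rule I_cong)
    fix x assume "x \<in> U"
    then have "q x \<bullet> W (kpow a L p) \<omega> x = \<omega> x * (k x * (norm (q x))\<^sup>2)"
      unfolding W_def by (simp add: k_def power2_norm_eq_inner)
    then show "A x = q x \<bullet> W (kpow a L p) \<omega> x" by (simp add: A_def k power4_eq_xxxx power2_eq_square)
  qed
  also have "\<dots> = - I (\<lambda>x. u x * ?dW x)"
    using parts_W[OF kpow_pair weight cont_u der_u cont_q] by simp
  also have "\<dots> = I (\<lambda>x. - (u x * ?dW x))"
    by (intro I_uminus[symmetric] continuous_intros cont_u cont_divW[OF kpow_pair weight])
  also have "\<dots> \<le> I (\<lambda>x. 1 / 2 * A x + 4 * (1 + p)\<^sup>2 * M\<^sup>2 * B x)"
  proof (rule I_mono)
    fix x assume x: "x \<in> U"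
    define y where "y = norm (q x)"
    define s where "s = sqrt (hs x)"
    define o1 where "o1 = sqrt (\<omega> x)"
    define o2 where "o2 = sqrt (w2 x)"
    have y: "y \<ge> 0" and s: "s \<ge> 0" and o: "o1 \<ge> 0" "o2 \<ge> 0"
      using hs_nonneg w2 by (auto simp: y_def s_def o1_def o2_def)
    have sq: "hs x = s\<^sup>2" "\<omega> x = o1\<^sup>2" "w2 x = o2\<^sup>2"
      using hs_nonneg w2 by (auto simp: s_def o1_def o2_def)
    have nn: "norm (n x) \<le> o1 * o2"
      using w2(2,3) real_sqrt_le_mono[OF w2(4)[of x]] by (simp add: real_sqrt_mult o1_def o2_def)
    have "?dW x = (\<Sum>b\<in>Basis. (\<omega> x *\<^sub>R radial_deriv (kpow a L p) (kpow' a L p) (q x) (H x b)) \<bullet> b)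
        + (\<Sum>b\<in>Basis. k x * ((n x \<bullet> b) * (q x \<bullet> b)))"
      unfolding divW_def DW_def using x
      by (simp add: inner_add_left sum.distrib k_def algebra_simps)
    also have "(\<Sum>b\<in>Basis. k x * ((n x \<bullet> b) * (q x \<bullet> b))) = k x * (n x \<bullet> q x)"
      by (simp only: sum_distrib_left[symmetric] sum_Basis_inner_mult)
    finally have d: "?dW x = (\<Sum>b\<in>Basis. (\<omega> x *\<^sub>R radial_deriv (kpow a L p) (kpow' a L p) (q x) (H x b)) \<bullet> b) + k x * (n x \<bullet> q x)" .
    have "\<bar>\<Sum>b\<in>Basis. (\<omega> x *\<^sub>R radial_deriv (kpow a L p) (kpow' a L p) (q x) (H x b)) \<bullet> b\<bar>
      \<le> (\<Sum>b\<in>Basis. \<omega> x * (((1 + p) * k x) * norm (H x b)))"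
    proof (rule order_trans[OF sum_abs], rule sum_mono)
      fix b :: "real^3" assume b: "b \<in> Basis"
      have "norm (radial_deriv (kpow a L p) (kpow' a L p) (q x) (H x b)) \<le> (\<bar>kpow a L p y\<bar> + \<bar>kpow' a L p y\<bar>) * norm (H x b)"
        unfolding y_def by (rule norm_radial_deriv_le)
      also have "\<dots> \<le> ((1 + p) * k x) * norm (H x b)"
        using kpow'_bound[OF p a L_ge_1 y] k0[of x] by (intro mult_right_mono) (auto simp: k_def y_def algebra_simps)
      finally have "norm (radial_deriv (kpow a L p) (kpow' a L p) (q x) (H x b)) \<le> ((1 + p) * k x) * norm (H x b)" .
      then have "\<omega> x * norm (radial_deriv (kpow a L p) (kpow' a L p) (q x) (H x b)) \<le> \<omega> x * (((1 + p) * k x) * norm (H x b))"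
        using w2(2)[of x] by (rule mult_left_mono)
      then show "\<bar>(\<omega> x *\<^sub>R radial_deriv (kpow a L p) (kpow' a L p) (q x) (H x b)) \<bullet> b\<bar> \<le> \<omega> x * (((1 + p) * k x) * norm (H x b))"
        using Cauchy_Schwarz_ineq2[of "\<omega> x *\<^sub>R radial_deriv (kpow a L p) (kpow' a L p) (q x) (H x b)" b] b w2(2)[of x] by simp
    qed
    also have "\<dots> = \<omega> x * ((1 + p) * k x) * (\<Sum>b\<in>Basis. norm (H x b))" by (simp add: sum_distrib_left mult.assoc)
    also have "\<dots> \<le> \<omega> x * ((1 + p) * k x) * (2 * s)"
      using sum_norm_Basis3_le[of "H x"] w2(2)[of x] k0[of x] p by (intro mult_left_mono) (auto simp: s_def hs_def)
    finally have d1: "\<bar>\<Sum>b\<in>Basis. (\<omega> x *\<^sub>R radial_deriv (kpow a L p) (kpow' a L p) (q x) (H x b)) \<bullet> b\<bar>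
      \<le> \<omega> x * ((1 + p) * k x) * (2 * s)" .
    have "\<bar>n x \<bullet> q x\<bar> \<le> (o1 * o2) * y"
      using Cauchy_Schwarz_ineq2[of "n x" "q x"] mult_right_mono[OF nn, of y] y by (simp add: y_def)
    then have d2: "\<bar>k x * (n x \<bullet> q x)\<bar> \<le> k x * ((o1 * o2) * y)"
      unfolding abs_mult using k0[of x] by (simp add: mult_left_mono)
    have "\<bar>?dW x\<bar> \<le> k x * (2 * (1 + p) * s * \<omega> x + o1 * o2 * y)"
      unfolding d using d1 d2 abs_triangle_ineq[of "\<Sum>b\<in>Basis. (\<omega> x *\<^sub>R radial_deriv (kpow a L p) (kpow' a L p) (q x) (H x b)) \<bullet> b" "k x * (n x \<bullet> q x)"]
      by (simp add: algebra_simps)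
    then have "\<bar>u x\<bar> * \<bar>?dW x\<bar> \<le> M * (k x * (2 * (1 + p) * s * \<omega> x + o1 * o2 * y))"
      using bd_u[OF x] M by (intro mult_mono) auto
    then have "- (u x * ?dW x) \<le> M * (k x * (2 * (1 + p) * s * \<omega> x + o1 * o2 * y))"
      using abs_ge_minus_self[of "u x * ?dW x"] by (simp add: abs_mult)
    \<comment> \<open>The factors are grouped so that each of the two products contains
      \<open>1 / 2 * y\<^sup>2 * o1\<close>. The squares of the two copies add up to half of
      \<open>A\<close>, which is moved to the left at the end.\<close>
    also have "\<dots> = (K' x * fq x) * (2 * (1 / 2 * y\<^sup>2 * o1) * (2 * (1 + p) * M * s * o1) + 2 * (1 / 2 * y\<^sup>2 * o1) * (M * y * o2))"
      unfolding k sq y_def[symmetric] by (simp add: power2_eq_square algebra_simps)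
    also have "\<dots> \<le> (K' x * fq x) * (((1 / 2 * y\<^sup>2 * o1)\<^sup>2 + (2 * (1 + p) * M * s * o1)\<^sup>2) + ((1 / 2 * y\<^sup>2 * o1)\<^sup>2 + (M * y * o2)\<^sup>2))"
      using K'_pos[of x] fpow_nonneg[of p] by (intro mult_left_mono add_mono sum_squares_bound) auto
    also have "\<dots> = 1 / 2 * A x + 4 * (1 + p)\<^sup>2 * M\<^sup>2 * (K' x * fq x * (hs x * \<omega> x)) + M\<^sup>2 * (K' x * fq x * (y\<^sup>2 * w2 x))"
      unfolding A_def sq y_def[symmetric] by (simp add: power2_eq_square power4_eq_xxxx algebra_simps)
    also have "\<dots> \<le> 1 / 2 * A x + 4 * (1 + p)\<^sup>2 * M\<^sup>2 * (K' x * fq x * (hs x * \<omega> x)) + 4 * (1 + p)\<^sup>2 * M\<^sup>2 * (K' x * fq x * (y\<^sup>2 * w2 x))"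
    proof (intro add_left_mono mult_right_mono)
      have "1 \<le> (1 + p)\<^sup>2" using p by (intro one_le_power) auto
      then have "1 * M\<^sup>2 \<le> (4 * (1 + p)\<^sup>2) * M\<^sup>2" by (intro mult_right_mono) auto
      then show "M\<^sup>2 \<le> 4 * (1 + p)\<^sup>2 * M\<^sup>2" by simp
      show "0 \<le> K' x * fq x * (y\<^sup>2 * w2 x)" using K'_pos[of x] fpow_nonneg[of p] w2(3)[of x] by simp
    qed
    also have "\<dots> = 1 / 2 * A x + 4 * (1 + p)\<^sup>2 * M\<^sup>2 * B x"
      by (simp add: B_def y_def distrib_left)
    finally show "- (u x * ?dW x) \<le> 1 / 2 * A x + 4 * (1 + p)\<^sup>2 * M\<^sup>2 * B x" .
  qed (intro continuous_intros cont_u cont_divW[OF kpow_pair weight] cA cB)+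
  also have "\<dots> = I (\<lambda>x. 1 / 2 * A x) + I (\<lambda>x. 4 * (1 + p)\<^sup>2 * M\<^sup>2 * B x)"
    by (intro I_add continuous_intros cA cB)
  also have "\<dots> = 1 / 2 * I A + 4 * (1 + p)\<^sup>2 * M\<^sup>2 * I B"
    by (simp only: set_integral_mult_right)
  finally show ?thesis by (simp add: A_def B_def)
qed

text \<open>The Hessian term is traded, by means of \<open>embedding\<close> and
  \<open>K' \<le> K\<close>, for the fourth power of the gradient. The factor
  \<open>8 * (1 + p)\<^sup>2 * M\<^sup>2\<close> of the embedding times
  \<open>2 * c * \<kappa>\<^sup>2\<close> gives the denominator, and the cutoff remainder of the
  embedding raises \<open>p + 2\<close> to \<open>p + 3\<close>.\<close>

lemma dissipation:
  "- I (\<lambda>x. divV x * dW x) \<le> I (\<lambda>x. - (1 / (16 * (1 + p)\<^sup>2 * c * \<kappa>\<^sup>2 * M\<^sup>2)) * (K' x * fq x * norm (q x) ^ 4 * \<omega> x)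
     + (p + 3) * c ^ 3 * \<kappa> powr (2 + 2 * a) * (K x * fq x * (P2 x * \<omega> x + (norm (q x))\<^sup>2 * w2 x)))"
proof -
  define A where "A x = K' x * fq x * norm (q x) ^ 4 * \<omega> x" for x
  define E where "E x = K x * fq x * (P2 x * \<omega> x + (norm (q x))\<^sup>2 * w2 x)" for x
  define G where "G x = K x * fq x * hs x * \<omega> x" for x
  define G' where "G' x = K' x * fq x * hs x * \<omega> x" for x
  define N where "N x = K' x * fq x * ((norm (q x))\<^sup>2 * w2 x)" for x
  have ca: "continuous_on (closure U) A" "continuous_on (closure U) E" "continuous_on (closure U) G"
    "continuous_on (closure U) G'" "continuous_on (closure U) N"
    unfolding A_def E_def G_def G'_def N_def
    by (intro continuous_intros cont_K' cont_K cont_hs conts cont_q)+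
  define b where "b = 1 / (2 * c * \<kappa>\<^sup>2)"
  define B where "B = c ^ 3 * \<kappa> powr (2 + 2 * a)"
  have b1: "1 \<le> c * \<kappa>\<^sup>2" using mult_mono[of 1 c 1 "\<kappa>\<^sup>2"] c \<kappa> by simp
  have b: "b > 0" "b \<le> 1" using b1 by (auto simp: b_def field_simps)
  have B: "B \<ge> 1" unfolding B_def
    using mult_mono[of 1 "c ^ 3" 1 "\<kappa> powr (2 + 2 * a)"] c \<kappa> a by (simp add: ge_one_powr_ge_zero)
  define e where "e = 8 * (1 + p)\<^sup>2 * M\<^sup>2"
  have e: "e > 0" using M p by (simp add: e_def)
  have emb: "I A \<le> e * (I G' + I N)"
  proof -
    have "I (\<lambda>x. K' x * fq x * (hs x * \<omega> x + (norm (q x))\<^sup>2 * w2 x)) = I (\<lambda>x. G' x + N x)"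
      by (intro I_cong) (simp add: G'_def N_def algebra_simps)
    then show ?thesis using embedding I_add[OF ca(4,5)] by (simp add: A_def e_def)
  qed
  have GG: "I G' \<le> I G"
    by (rule I_mono[OF ca(4,3)]) (use K'_le_K fpow_nonneg hs_nonneg w2(2) in \<open>auto simp: G_def G'_def intro!: mult_right_mono\<close>)
  have NE: "I N \<le> I E"
  proof (rule I_mono[OF ca(5,2)])
    fix x assume x: "x \<in> U"
    have "K' x * fq x * ((norm (q x))\<^sup>2 * w2 x) \<le> K x * fq x * (P2 x * \<omega> x + (norm (q x))\<^sup>2 * w2 x)"
      using K'_le_K[OF x] K'_pos[of x] fpow_nonneg[of p] w2(2,3)[of x] by (intro mult_mono) auto
    then show "N x \<le> E x" by (simp add: N_def E_def)
  qed
  have E0: "0 \<le> I E" by (rule I_nonneg) (use K_pos fpow_nonneg w2(2,3) in \<open>auto simp: E_def less_imp_le\<close>)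
  have "- I (\<lambda>x. divV x * dW x) \<le> I (\<lambda>x. - b * G x + (p + 2) * B * E x)"
    using diffusion_lower by (simp add: b_def G_def B_def E_def mult.assoc)
  also have "\<dots> = I (\<lambda>x. - b * G x) + I (\<lambda>x. (p + 2) * B * E x)"
    by (intro I_add continuous_intros ca)
  also have "\<dots> = - b * I G + (p + 2) * B * I E"
    by (simp only: set_integral_mult_right)
  also have "\<dots> \<le> - b * I A / e + (p + 3) * B * I E"
  proof -
    have "I A / e \<le> I G' + I N" using emb e by (simp add: field_simps)
    then have "I A / e - I E \<le> I G" using GG NE by linarith
    then have "b * (I A / e - I E) \<le> b * I G" using b by (intro mult_left_mono) auto
    moreover have "b * I E \<le> B * I E" using b B E0 by (intro mult_right_mono) auto
    ultimately show ?thesis by (simp add: algebra_simps)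
  qed
  also have "\<dots> = I (\<lambda>x. - (b / e) * A x) + I (\<lambda>x. (p + 3) * B * E x)"
    by (simp only: set_integral_mult_right) simp
  also have "\<dots> = I (\<lambda>x. - (b / e) * A x + (p + 3) * B * E x)"
    by (intro I_add[symmetric] continuous_intros ca)
  also have "b / e = 1 / (16 * (1 + p)\<^sup>2 * c * \<kappa>\<^sup>2 * M\<^sup>2)" by (simp add: b_def e_def)
  finally show ?thesis by (simp add: A_def E_def B_def mult.assoc)
qed

end
end

subsection \<open>Absorption by Young's inequality\<close>

text \<open>Split at the threshold \<open>(B / \<delta>) powr (1 / (e - b))\<close>. Above it
  \<open>B * y powr b\<close> is at most \<open>\<delta> * y powr e\<close>; below it
  \<open>y powr b\<close> is at most the corresponding power of the threshold.\<close>

lemma young_absorb: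
  fixes y B \<delta> b e :: real
  assumes "B \<ge> 0" "\<delta> > 0" "y \<ge> 0" "0 \<le> b" "b < e"
  shows "B * y powr b \<le> \<delta> * y powr e + B * (B / \<delta>) powr (b / (e - b))"
proof (cases "B = 0")
  case True then show ?thesis using assms by simp
next
  case False
  define t where "t = (B / \<delta>) powr (1 / (e - b))"
  have B: "B > 0" using False assms by simp
  then have t: "t > 0" using assms by (simp add: t_def)
  show ?thesis
  proof (cases "t \<le> y")
    case True
    have "B / \<delta> = t powr (e - b)" using assms B by (simp add: t_def powr_powr)
    also have "\<dots> \<le> y powr (e - b)" using True t assms by (intro powr_mono2) auto
    finally have "B \<le> \<delta> * y powr (e - b)" using assms by (simp add: field_simps)
    then have "B * y powr b \<le> \<delta> * y powr (e - b) * y powr b" by (intro mult_right_mono) auto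
    also have "\<dots> = \<delta> * y powr e" by (simp add: powr_add[symmetric] mult.assoc)
    finally show ?thesis using assms by (simp add: add_increasing2)
  next
    case False
    then have "y powr b \<le> t powr b" using assms by (intro powr_mono2) auto
    also have "\<dots> = (B / \<delta>) powr (b / (e - b))" by (simp add: t_def powr_powr)
    finally have "B * y powr b \<le> B * (B / \<delta>) powr (b / (e - b))" using assms by (intro mult_left_mono) auto
    then show ?thesis using assms by (simp add: add_increasing)
  qed
qed

text \<open>The first summand belongs to gradients of size at most \<open>2 * d\<close>. The other
  two are the remainders of Young's inequality for the powers \<open>p - 2\<close> and
  \<open>p + a - 2\<close> against \<open>p\<close>, each with half of \<open>\<epsilon>\<close>;
  the last one exists because the \<open>B2\<close> term has no weight.\<close>

definition absorb_const :: "real \<Rightarrow> real \<Rightarrow> real \<Rightarrow> real \<Rightarrow> real \<Rightarrow> real \<Rightarrow> real" where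
  "absorb_const a p d \<epsilon> B1 B2 = (B1 + B2 * (1 + 3 * d) powr a) * (2 * d) powr (p - 2)
     + (3 * B1 + 4 * B2) * ((3 * B1 + 4 * B2) / (\<epsilon> / 2)) powr ((p - 2) / 2)
     + 4 * B2 * (4 * B2 / (\<epsilon> / 2)) powr ((p + a - 2) / (2 - a))"

text \<open>For \<open>x \<le> 2 * d\<close> powers of \<open>x\<close> are bounded outright; for \<open>x > 2 * d\<close> the weights \<open>k\<close> and \<open>k'\<close> are comparable and
  Young's inequality applies, \<open>m \<ge> p + 1\<close> leaving enough powers of the cutoff \<open>\<sigma>\<close>.\<close>

lemma pointwise_absorb:
  fixes x z \<sigma> :: real and m :: nat
  assumes p: "p \<ge> 2" and a: "0 < a" "a < 1" and x: "x \<ge> 0" and \<sigma>: "0 \<le> \<sigma>" "\<sigma> \<le> 1"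
    and d: "d > 0" and z: "x - d \<le> z" "z \<le> x + d" "z \<ge> 0" and m: "real m \<ge> p + 1"
    and B: "B1 \<ge> 0" "B2 \<ge> 0" and \<epsilon>: "\<epsilon> > 0"
  defines "k \<equiv> (1 + z) powr (- a)" and "k' \<equiv> (1 + d + x) powr (- a)"
  shows "B1 * (k * x powr p * \<sigma> ^ (m - 2)) + B2 * (x powr p * \<sigma> ^ (m - 1))
    \<le> \<epsilon> * (k' * (x powr p * x\<^sup>2) * \<sigma> ^ m) + absorb_const a p d \<epsilon> B1 B2 * (k * x\<^sup>2)"
proof -
  have k: "k > 0" and k': "k' > 0" using z x d by (auto simp: k_def k'_def)
  have k'k: "k' \<le> k" unfolding k_def k'_def using z x d a by (intro powr_mono2') auto
  have m3: "m \<ge> 3" using m p by linarith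
  define T1 where "T1 = (B1 + B2 * (1 + 3 * d) powr a) * (2 * d) powr (p - 2)"
  define T2 where "T2 = (3 * B1 + 4 * B2) * ((3 * B1 + 4 * B2) / (\<epsilon> / 2)) powr ((p - 2) / 2)"
  define T3 where "T3 = 4 * B2 * (4 * B2 / (\<epsilon> / 2)) powr ((p + a - 2) / (2 - a))"
  have T: "T1 \<ge> 0" "T2 \<ge> 0" "T3 \<ge> 0" using B by (auto simp: T1_def T2_def T3_def)
  have bt: "absorb_const a p d \<epsilon> B1 B2 = T1 + T2 + T3" by (simp add: absorb_const_def T1_def T2_def T3_def)
  have e0: "0 \<le> \<epsilon> * (k' * (x powr p * x\<^sup>2) * \<sigma> ^ m)" using \<epsilon> k' \<sigma> by simp
  have kx: "0 \<le> k * x\<^sup>2" using k by simp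
  consider "x = 0 \<or> \<sigma> = 0" | "x > 0" "\<sigma> > 0" "x \<le> 2 * d" | "x > 0" "\<sigma> > 0" "x > 2 * d" using x \<sigma> by linarith
  then show ?thesis
  proof cases
    case 1
    then have "B1 * (k * x powr p * \<sigma> ^ (m - 2)) + B2 * (x powr p * \<sigma> ^ (m - 1)) = 0"
      using m3 p by (auto simp: power_0_left)
    then show ?thesis unfolding bt using e0 mult_nonneg_nonneg[OF _ kx, of "T1 + T2 + T3"] T by linarith
  next
    case 2
    have xp: "x powr p \<le> (2 * d) powr (p - 2) * x\<^sup>2"
    proof -
      have "x powr p = x powr (p - 2) * x powr 2" by (simp add: powr_add[symmetric])
      also have "\<dots> \<le> (2 * d) powr (p - 2) * x powr 2" using 2 p by (intro mult_right_mono powr_mono2) auto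
      finally show ?thesis using 2 by (simp add: powr_numeral)
    qed
    have k1: "1 \<le> k * (1 + 3 * d) powr a"
    proof -
      have "1 = k * (1 + z) powr a" using z by (simp add: k_def powr_minus)
      also have "\<dots> \<le> k * (1 + 3 * d) powr a" using k z 2 a by (intro mult_left_mono powr_mono2) auto
      finally show ?thesis .
    qed
    have "B1 * (k * x powr p * \<sigma> ^ (m - 2)) \<le> B1 * (k * ((2 * d) powr (p - 2) * x\<^sup>2) * 1)"
      using B k xp \<sigma> by (intro mult_left_mono mult_mono power_le_one) auto
    moreover have "B2 * (x powr p * \<sigma> ^ (m - 1)) \<le> B2 * (((2 * d) powr (p - 2) * x\<^sup>2) * (k * (1 + 3 * d) powr a))"
    proof -
      have "\<sigma> ^ (m - 1) \<le> 1" using \<sigma> by (intro power_le_one) auto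
      then show ?thesis using B xp k1 \<sigma> by (intro mult_left_mono mult_mono) auto
    qed
    ultimately have "B1 * (k * x powr p * \<sigma> ^ (m - 2)) + B2 * (x powr p * \<sigma> ^ (m - 1)) \<le> T1 * (k * x\<^sup>2)"
      by (simp add: T1_def algebra_simps)
    moreover have "0 \<le> (T2 + T3) * (k * x\<^sup>2)" by (rule mult_nonneg_nonneg[OF _ kx]) (use T in simp)
    ultimately show ?thesis unfolding bt using e0 by (simp add: distrib_right)
  next
    case 3
    \<comment> \<open>From \<open>x > 2 * d\<close> and \<open>z \<ge> x - d\<close>. This makes the
      two weights comparable with factor 3.\<close>
    have zx: "1 + d + x \<le> 3 * (1 + z)"
    proof -
      have "3 * x - 3 * d \<le> 3 * z" using z(1) by simp
      then show ?thesis using 3(3) by simp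
    qed
    have kk: "k \<le> 3 * k'"
    proof -
      have "(3 * (1 + z)) powr (- a) = 3 powr (- a) * (1 + z) powr (- a)" by (rule powr_mult)
      then have "k = 3 powr a * (3 * (1 + z)) powr (- a)"
        unfolding k_def by (simp only: mult.assoc[symmetric]) (simp add: powr_minus)
      also have "\<dots> \<le> 3 powr 1 * (1 + d + x) powr (- a)"
        using a zx d 3 by (intro mult_mono powr_mono powr_mono2') auto
      finally show ?thesis by (simp add: k'_def)
    qed
    \<comment> \<open>The price of inserting the weight into the \<open>B2\<close> term, which has
      none: an extra factor \<open>1 + x powr a\<close>.\<close>
    have k1: "1 \<le> 4 * k' * (1 + x powr a)"
    proof -
      have "(1 + d + x) powr a \<le> (4 * max 1 x) powr a" using 3 d a by (intro powr_mono2) auto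
      also have "\<dots> = 4 powr a * (max 1 x) powr a" by (simp add: powr_mult)
      also have "\<dots> \<le> 4 powr 1 * (1 + x powr a)"
        using a by (intro mult_mono powr_mono) (auto simp: max_def)
      finally have "(1 + d + x) powr a \<le> 4 * (1 + x powr a)" by simp
      then have "k' * (1 + d + x) powr a \<le> k' * (4 * (1 + x powr a))" using k' by (intro mult_left_mono) auto
      moreover have "k' * (1 + d + x) powr a = 1" using 3 d by (simp add: k'_def powr_minus)
      ultimately have "1 \<le> k' * (4 * (1 + x powr a))" by linarith
      then show ?thesis by (simp only: mult.assoc mult.left_commute[of k' 4])
    qed
    define y where "y = x * \<sigma>"
    \<comment> \<open>The surplus of the cutoff beyond the power \<open>p\<close>. After it is split
      off, gradient and cutoff enter only through \<open>y = x * \<sigma>\<close>, and Young's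
      inequality becomes a statement about powers of \<open>y\<close>.\<close>
    define s where "s = \<sigma> powr (real m - p)"
    have y: "y > 0" using 3 by (simp add: y_def)
    have s: "0 < s" "s \<le> 1" using 3 m p \<sigma> powr_le1[of "real m - p" \<sigma>] by (auto simp: s_def)
    have sm: "\<sigma> ^ j = \<sigma> powr real j" for j using 3 by (simp add: powr_realpow)
    have e1: "x powr p * \<sigma> ^ (m - 2) = x\<^sup>2 * (s * y powr (p - 2))"
    proof -
      have "\<sigma> ^ (m - 2) = s * \<sigma> powr (p - 2)" using m3 by (simp add: sm s_def powr_add[symmetric] of_nat_diff)
      moreover have "x powr p = x\<^sup>2 * x powr (p - 2)" using 3 by (simp add: powr_diff powr_numeral)
      ultimately show ?thesis using 3 by (simp add: y_def powr_mult)
    qed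
    \<comment> \<open>The cutoff occurs here with \<open>p - 1\<close> powers beyond
      \<open>s\<close>, while \<open>p + a - 2\<close> are needed for \<open>y\<close>;
      \<open>a < 1\<close> makes this sufficient.\<close>
    have e2: "x powr p * x powr a * \<sigma> ^ (m - 1) \<le> x\<^sup>2 * (s * y powr (p + a - 2))"
    proof -
      have "\<sigma> ^ (m - 1) = s * \<sigma> powr (p - 1)" using m3 by (simp add: sm s_def powr_add[symmetric] of_nat_diff)
      moreover have "\<sigma> powr (p - 1) \<le> \<sigma> powr (p + a - 2)"
        using 3 \<sigma> a by (intro powr_mono') auto
      ultimately have "\<sigma> ^ (m - 1) \<le> s * \<sigma> powr (p + a - 2)" using s by simp
      then have "x powr p * x powr a * \<sigma> ^ (m - 1) \<le> x powr p * x powr a * (s * \<sigma> powr (p + a - 2))"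
        by (intro mult_left_mono) auto
      moreover have "x powr p * x powr a = x\<^sup>2 * x powr (p + a - 2)"
        using 3 by (simp add: powr_add powr_diff powr_numeral)
      ultimately show ?thesis using 3 by (simp add: y_def powr_mult mult_ac)
    qed
    have e3: "(x powr p * x\<^sup>2) * \<sigma> ^ m = x\<^sup>2 * (s * y powr p)"
    proof -
      have "\<sigma> ^ m = s * \<sigma> powr p" by (simp add: sm s_def powr_add[symmetric])
      then show ?thesis using 3 by (simp add: y_def powr_mult)
    qed
    have "\<sigma> ^ (m - 1) \<le> \<sigma> ^ (m - 2)" using \<sigma> m3 by (intro power_decreasing) auto
    then have e4: "x powr p * \<sigma> ^ (m - 1) \<le> x\<^sup>2 * (s * y powr (p - 2))"
      unfolding e1[symmetric] by (intro mult_left_mono) auto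
    have "B1 * (k * x powr p * \<sigma> ^ (m - 2)) \<le> 3 * B1 * (k' * (x\<^sup>2 * (s * y powr (p - 2))))"
    proof -
      have "B1 * (k * (x powr p * \<sigma> ^ (m - 2))) \<le> B1 * (3 * k' * (x powr p * \<sigma> ^ (m - 2)))"
        using B kk \<sigma> by (intro mult_left_mono mult_right_mono) auto
      then show ?thesis by (simp add: e1 mult_ac)
    qed
    moreover have "B2 * (x powr p * \<sigma> ^ (m - 1)) \<le> 4 * B2 * (k' * (x\<^sup>2 * (s * y powr (p - 2)))) + 4 * B2 * (k' * (x\<^sup>2 * (s * y powr (p + a - 2))))"
    proof -
      have "1 * (x powr p * \<sigma> ^ (m - 1)) \<le> (4 * k' * (1 + x powr a)) * (x powr p * \<sigma> ^ (m - 1))"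
        using k1 \<sigma> by (intro mult_right_mono) auto
      also have "\<dots> = 4 * k' * (x powr p * \<sigma> ^ (m - 1) + x powr p * x powr a * \<sigma> ^ (m - 1))"
        by (simp add: algebra_simps)
      also have "\<dots> \<le> 4 * k' * (x\<^sup>2 * (s * y powr (p - 2)) + x\<^sup>2 * (s * y powr (p + a - 2)))"
        using k' e2 e4 by (intro mult_left_mono add_mono) auto
      finally have "B2 * (x powr p * \<sigma> ^ (m - 1)) \<le> B2 * (4 * k' * (x\<^sup>2 * (s * y powr (p - 2)) + x\<^sup>2 * (s * y powr (p + a - 2))))"
        using B by (intro mult_left_mono) auto
      then show ?thesis by (simp add: algebra_simps)
    qed
    ultimately have "B1 * (k * x powr p * \<sigma> ^ (m - 2)) + B2 * (x powr p * \<sigma> ^ (m - 1))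
      \<le> (k' * x\<^sup>2 * s) * ((3 * B1 + 4 * B2) * y powr (p - 2) + 4 * B2 * y powr (p + a - 2))"
      by (simp add: algebra_simps)
    also have "\<dots> \<le> (k' * x\<^sup>2 * s) * ((\<epsilon> / 2 * y powr p + T2) + (\<epsilon> / 2 * y powr p + T3))"
    proof (intro mult_left_mono add_mono)
      show "(3 * B1 + 4 * B2) * y powr (p - 2) \<le> \<epsilon> / 2 * y powr p + T2"
        using young_absorb[of "3 * B1 + 4 * B2" "\<epsilon> / 2" y "p - 2" p] B \<epsilon> y p by (simp add: T2_def)
      show "4 * B2 * y powr (p + a - 2) \<le> \<epsilon> / 2 * y powr p + T3"
        using young_absorb[of "4 * B2" "\<epsilon> / 2" y "p + a - 2" p] B \<epsilon> y p a by (simp add: T3_def)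
    qed (use k' s in auto)
    also have "\<dots> = \<epsilon> * (k' * ((x powr p * x\<^sup>2) * \<sigma> ^ m)) + (T2 + T3) * (s * (k' * x\<^sup>2))"
      unfolding e3 by (simp add: algebra_simps)
    also have "\<dots> \<le> \<epsilon> * (k' * ((x powr p * x\<^sup>2) * \<sigma> ^ m)) + (T1 + T2 + T3) * (k * x\<^sup>2)"
    proof (rule add_left_mono, rule mult_mono)
      have "s * (k' * x\<^sup>2) \<le> 1 * (k * x\<^sup>2)" using s k'k k' by (intro mult_mono mult_right_mono) auto
      then show "s * (k' * x\<^sup>2) \<le> k * x\<^sup>2" by simp
    qed (use T s k' in auto)
    finally show ?thesis unfolding bt by (simp add: mult.assoc)
  qed
qed

section \<open>Diffusion estimate for the cutoff test field\<close>

context slice begin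

lemma norm_\<Phi>_bounds: assumes "x \<in> U"
  shows "norm (q x) - M\<^sup>2 * \<kappa>\<^sup>2 \<le> norm (\<Phi> x)" "norm (\<Phi> x) \<le> norm (q x) + M\<^sup>2 * \<kappa>\<^sup>2"
  using norm_u2Z[OF assms] norm_triangle_ineq[of "q x" "(u x)\<^sup>2 *\<^sub>R Z x"]
    norm_diff_ineq[of "q x" "(u x)\<^sup>2 *\<^sub>R Z x"] by (auto simp: \<Phi>_def)

text \<open>\<open>\<theta>\<close> is the value of a time cutoff and the \<open>B2\<close> term
  will be its derivative, hence only the power \<open>m - 1\<close>. Both it and the diffusive
  errors are absorbed pointwise into the dissipation, up to a multiple of the energy density and a
  constant from points where the gradient is below \<open>M\<close>.\<close>

lemma slice_estimate:
  fixes \<eta> :: "real^3 \<Rightarrow> real" and n0 :: "real^3 \<Rightarrow> real^3" and m :: nat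
  assumes p: "p \<ge> 2" and m: "real m \<ge> p + 1"
    and \<eta>: "C1_weight U \<eta> n0 S" "\<And>x. 0 \<le> \<eta> x" "\<And>x. \<eta> x \<le> 1" "\<And>x. norm (n0 x) \<le> C"
    and \<theta>: "0 \<le> \<theta>" "\<theta> \<le> 1" and B2: "B2 \<ge> 0"
  defines "\<omega> \<equiv> \<lambda>x. (\<theta> * \<eta> x) ^ m" and "n \<equiv> \<lambda>x. (\<theta> ^ m * (real m * \<eta> x ^ (m - 1))) *\<^sub>R n0 x"
    and "B0 \<equiv> (p + 3) * c ^ 3 * \<kappa> powr (2 + 2 * a)"
  shows "C1_weight U \<omega> n S"
    and "- I (\<lambda>x. divV x * divW (fpow p) (\<lambda>r. (p - 2) * fpow p r) \<omega> n x)
      + B2 * I (\<lambda>x. norm (q x) powr p * (\<theta> * \<eta> x) ^ (m - 1))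
    \<le> absorb_const a p (M\<^sup>2 * \<kappa>\<^sup>2) (1 / (16 * (1 + p)\<^sup>2 * c * \<kappa>\<^sup>2 * M\<^sup>2))
          (B0 * (10 * M\<^sup>2 * \<kappa> ^ 4 + (real m * C)\<^sup>2)) B2 * I (\<lambda>x. K x * (norm (q x))\<^sup>2)
      + 2 * B0 * \<kappa> ^ 4 * M powr (p + 2) * measure lborel U"
proof -
  have m3: "m \<ge> 3" using m p by linarith
  have \<eta>': "(\<eta> has_derivative (\<lambda>h. n0 x \<bullet> h)) (at x)" "continuous_on UNIV n0" "compact S" "S \<subseteq> U"
    "x \<notin> S \<Longrightarrow> \<eta> x = 0" "x \<notin> S \<Longrightarrow> n0 x = 0" for x
    using \<eta>(1) by (auto simp: C1_weight_def)
  have \<eta>c: "continuous_on T \<eta>" for T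
    by (intro continuous_at_imp_continuous_on ballI has_derivative_continuous[OF \<eta>'(1)])
  show wt: "C1_weight U \<omega> n S"
    unfolding C1_weight_def
  proof (intro conjI allI impI)
    fix x
    have "((\<lambda>x. \<theta> ^ m * \<eta> x ^ m) has_derivative (\<lambda>h. \<theta> ^ m * (real m * (n0 x \<bullet> h) * \<eta> x ^ (m - 1)))) (at x)"
      by (intro has_derivative_mult_right has_derivative_power \<eta>'(1))
    then show "(\<omega> has_derivative (\<lambda>h. n x \<bullet> h)) (at x)"
      by (simp add: \<omega>_def n_def power_mult_distrib mult_ac)
    show "continuous_on UNIV n" unfolding n_def by (intro continuous_intros \<eta>c \<eta>')
  qed (use \<eta>' m3 in \<open>auto simp: \<omega>_def n_def\<close>)
  \<comment> \<open>The squared gradient of \<open>\<omega>\<close> contains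
    \<open>\<eta> x ^ (2 * m - 2)\<close>, which splits into \<open>\<eta> x ^ m\<close>, belonging
    to \<open>\<omega>\<close>, and \<open>\<eta> x ^ (m - 2)\<close>, belonging to
    \<open>w2\<close>.\<close>
  define w2 where "w2 x = (real m * C)\<^sup>2 * (\<theta> * \<eta> x) ^ (m - 2)" for x
  have w2c: "continuous_on UNIV w2" unfolding w2_def by (intro continuous_intros \<eta>c)
  have \<omega>0: "0 \<le> \<omega> x" for x using \<theta> \<eta> by (simp add: \<omega>_def)
  have w20: "0 \<le> w2 x" for x using \<theta> \<eta> by (simp add: w2_def)
  have C: "0 \<le> C" using order_trans[OF norm_ge_zero \<eta>(4)] .
  have nw: "(norm (n x))\<^sup>2 \<le> \<omega> x * w2 x" for x
  proof -
    have "norm (n x) = \<theta> ^ m * (real m * \<eta> x ^ (m - 1)) * norm (n0 x)" using \<theta> \<eta> by (simp add: n_def)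
    also have "\<dots> \<le> \<theta> ^ m * (real m * \<eta> x ^ (m - 1)) * C" using \<theta> \<eta> by (intro mult_left_mono) auto
    finally have "(norm (n x))\<^sup>2 \<le> (\<theta> ^ m * (real m * \<eta> x ^ (m - 1)) * C)\<^sup>2" by (intro power_mono) auto
    also have "\<dots> = (\<theta> ^ m * \<theta> ^ m) * ((real m * C)\<^sup>2 * (\<eta> x ^ (m - 1) * \<eta> x ^ (m - 1)))"
      by (simp add: power2_eq_square mult_ac)
    also have "\<eta> x ^ (m - 1) * \<eta> x ^ (m - 1) = \<eta> x ^ m * \<eta> x ^ (m - 2)"
    proof -
      have "(m - 1) + (m - 1) = m + (m - 2)" using m3 by simp
      then show ?thesis by (simp only: power_add[symmetric])
    qed
    also have "(\<theta> ^ m * \<theta> ^ m) * ((real m * C)\<^sup>2 * (\<eta> x ^ m * \<eta> x ^ (m - 2)))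
      \<le> (\<theta> ^ m * \<theta> ^ (m - 2)) * ((real m * C)\<^sup>2 * (\<eta> x ^ m * \<eta> x ^ (m - 2)))"
      using \<theta> \<eta> by (intro mult_right_mono mult_left_mono power_decreasing) auto
    also have "\<dots> = \<omega> x * w2 x" by (simp add: \<omega>_def w2_def power_mult_distrib mult_ac)
    finally show ?thesis .
  qed
  define \<epsilon> where "\<epsilon> = 1 / (16 * (1 + p)\<^sup>2 * c * \<kappa>\<^sup>2 * M\<^sup>2)"
  have \<epsilon>: "\<epsilon> > 0" using p c \<kappa> M by (auto simp: \<epsilon>_def)
  define B1 where "B1 = B0 * (10 * M\<^sup>2 * \<kappa> ^ 4 + (real m * C)\<^sup>2)"
  define Bt where "Bt = absorb_const a p (M\<^sup>2 * \<kappa>\<^sup>2) \<epsilon> B1 B2"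
  have B0: "B0 \<ge> 0" using p c by (simp add: B0_def)
  have B1: "B1 \<ge> 0" using B0 by (simp add: B1_def)
  let ?fq = "\<lambda>x. fpow p (norm (q x))"
  let ?P2 = "\<lambda>x. ((2 * M * norm (q x) + M\<^sup>2) * \<kappa>\<^sup>2)\<^sup>2"
  have cf: "continuous_on (closure U) ?fq"
    by (rule continuous_on_compose2[OF fpow_cont[OF p]]) (auto intro!: continuous_intros cont_q)
  have cp: "continuous_on (closure U) (\<lambda>x. norm (q x) powr p)"
  proof -
    have "continuous_on (closure U) (\<lambda>x. ?fq x * (norm (q x))\<^sup>2)" by (intro continuous_intros cf cont_q)
    then show ?thesis by (simp add: fpow_square)
  qed
  have \<omega>c: "continuous_on (closure U) \<omega>" unfolding \<omega>_def by (intro continuous_intros \<eta>c)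
  have w2c': "continuous_on (closure U) w2" using w2c by (rule continuous_on_subset) simp
  let ?D = "\<lambda>x. - \<epsilon> * (K' x * ?fq x * norm (q x) ^ 4 * \<omega> x) + B0 * (K x * ?fq x * (?P2 x * \<omega> x + (norm (q x))\<^sup>2 * w2 x))"
  have cD: "continuous_on (closure U) ?D"
    by (intro continuous_intros cont_K cont_K' cf cont_q \<omega>c w2c')
  have cT: "continuous_on (closure U) (\<lambda>x. B2 * (norm (q x) powr p * (\<theta> * \<eta> x) ^ (m - 1)))"
    by (intro continuous_intros cp \<eta>c)
  have "- I (\<lambda>x. divV x * divW (fpow p) (\<lambda>r. (p - 2) * fpow p r) \<omega> n x)
      + B2 * I (\<lambda>x. norm (q x) powr p * (\<theta> * \<eta> x) ^ (m - 1)) \<le> I ?D + B2 * I (\<lambda>x. norm (q x) powr p * (\<theta> * \<eta> x) ^ (m - 1))"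
    using dissipation[OF p wt w2c \<omega>0 w20 nw] by (simp add: B0_def \<epsilon>_def)
  also have "\<dots> = I (\<lambda>x. ?D x + B2 * (norm (q x) powr p * (\<theta> * \<eta> x) ^ (m - 1)))"
    unfolding set_integral_mult_right[symmetric] by (rule I_add[symmetric, OF cD cT])
  also have "\<dots> \<le> I (\<lambda>x. Bt * (K x * (norm (q x))\<^sup>2) + 2 * B0 * \<kappa> ^ 4 * M powr (p + 2))"
  proof (rule I_mono[OF continuous_on_add[OF cD cT]])
    show "continuous_on (closure U) (\<lambda>x. Bt * (K x * (norm (q x))\<^sup>2) + 2 * B0 * \<kappa> ^ 4 * M powr (p + 2))"
      by (intro continuous_intros cont_K cont_q)
  next
    fix x assume x: "x \<in> U"
    define y where "y = norm (q x)"
    define \<sigma> where "\<sigma> = \<theta> * \<eta> x"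
    have y: "y \<ge> 0" by (simp add: y_def)
    have \<sigma>: "0 \<le> \<sigma>" "\<sigma> \<le> 1" using \<theta> \<eta> by (auto simp: \<sigma>_def intro: mult_le_one)
    have Kp: "0 < K x" by (rule K_pos)
    have fy: "fpow p y * y\<^sup>2 = y powr p" using y by (rule fpow_square)
    have sm: "\<sigma> ^ m \<le> \<sigma> ^ (m - 2)" using \<sigma> by (intro power_decreasing) auto
    have s1: "\<sigma> ^ (m - 2) \<le> 1" using \<sigma> by (intro power_le_one) auto
    have w\<sigma>: "\<omega> x = \<sigma> ^ m" "w2 x = (real m * C)\<^sup>2 * \<sigma> ^ (m - 2)"
      by (simp_all add: \<omega>_def w2_def \<sigma>_def)
    \<comment> \<open>Split at \<open>y = M\<close>: for larger \<open>y\<close> two powers of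
      \<open>M\<close> are exchanged for two powers of \<open>y\<close>, for smaller
      \<open>y\<close> the factor \<open>fpow p y\<close> is at most \<open>M powr (p - 2)\<close>.
      Thus no additive term is left without a power of \<open>M\<close>.\<close>
    have M4: "M ^ 4 * fpow p y \<le> M\<^sup>2 * y powr p + M powr (p + 2)"
    proof (cases "M \<le> y")
      case True
      have "M ^ 4 * fpow p y = M\<^sup>2 * M\<^sup>2 * fpow p y" by (simp add: power2_eq_square power4_eq_xxxx)
      also have "\<dots> \<le> M\<^sup>2 * y\<^sup>2 * fpow p y"
        using True M fpow_nonneg[of p y] by (intro mult_right_mono mult_left_mono power_mono) auto
      also have "\<dots> = M\<^sup>2 * y powr p" by (simp add: fy[symmetric] mult_ac)
      finally show ?thesis by (simp add: add_increasing2)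
    next
      case False
      have "fpow p y \<le> M powr (p - 2)"
        using False y p M by (auto simp: fpow_def intro!: powr_mono2)
      then have "M ^ 4 * fpow p y \<le> M powr 4 * M powr (p - 2)" using M by (simp add: powr_numeral)
      also have "\<dots> = M powr (p + 2)" by (simp add: powr_add[symmetric] add.commute)
      finally show ?thesis by (simp add: add_increasing)
    qed
    have P2: "?P2 x \<le> (8 * M\<^sup>2 * y\<^sup>2 + 2 * M ^ 4) * \<kappa> ^ 4"
    proof -
      have "(2 * M * y + M\<^sup>2)\<^sup>2 \<le> 8 * M\<^sup>2 * y\<^sup>2 + 2 * M ^ 4"
        using sum_squares_bound[of "2 * M * y" "M\<^sup>2"] by (simp add: power2_eq_square power4_eq_xxxx algebra_simps)
      then have "(2 * M * y + M\<^sup>2)\<^sup>2 * \<kappa> ^ 4 \<le> (8 * M\<^sup>2 * y\<^sup>2 + 2 * M ^ 4) * \<kappa> ^ 4" by (intro mult_right_mono) auto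
      then show ?thesis by (simp add: y_def power_mult_distrib flip: power_mult)
    qed
    have fP: "fpow p y * (?P2 x * \<sigma> ^ m) \<le> (10 * M\<^sup>2 * y powr p * \<sigma> ^ (m - 2) + 2 * M powr (p + 2)) * \<kappa> ^ 4"
    proof -
      have "fpow p y * (?P2 x * \<sigma> ^ m) \<le> fpow p y * (((8 * M\<^sup>2 * y\<^sup>2 + 2 * M ^ 4) * \<kappa> ^ 4) * \<sigma> ^ (m - 2))"
        using P2 sm \<sigma> fpow_nonneg[of p y] by (intro mult_left_mono mult_mono) auto
      also have "\<dots> = (8 * M\<^sup>2 * y powr p + 2 * (M ^ 4 * fpow p y)) * (\<sigma> ^ (m - 2) * \<kappa> ^ 4)"
        by (simp add: fy[symmetric] algebra_simps)
      also have "\<dots> \<le> (8 * M\<^sup>2 * y powr p + 2 * (M\<^sup>2 * y powr p + M powr (p + 2))) * (\<sigma> ^ (m - 2) * \<kappa> ^ 4)"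
      proof (rule mult_right_mono)
        show "8 * M\<^sup>2 * y powr p + 2 * (M ^ 4 * fpow p y) \<le> 8 * M\<^sup>2 * y powr p + 2 * (M\<^sup>2 * y powr p + M powr (p + 2))"
          by (intro add_left_mono mult_left_mono M4) simp
      qed (use \<sigma> in auto)
      also have "\<dots> = (10 * M\<^sup>2 * y powr p * \<sigma> ^ (m - 2) + 2 * M powr (p + 2) * \<sigma> ^ (m - 2)) * \<kappa> ^ 4"
        by (simp add: algebra_simps)
      also have "\<dots> \<le> (10 * M\<^sup>2 * y powr p * \<sigma> ^ (m - 2) + 2 * M powr (p + 2) * 1) * \<kappa> ^ 4"
        using s1 by (intro mult_right_mono add_left_mono mult_left_mono) auto
      finally show ?thesis by simp
    qed
    have T2: "B0 * (K x * ?fq x * (?P2 x * \<omega> x + (norm (q x))\<^sup>2 * w2 x))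
      \<le> B1 * (K x * y powr p * \<sigma> ^ (m - 2)) + 2 * B0 * \<kappa> ^ 4 * M powr (p + 2)"
    proof -
      have "K x * ?fq x * (?P2 x * \<omega> x + (norm (q x))\<^sup>2 * w2 x)
        = K x * (fpow p y * (?P2 x * \<sigma> ^ m)) + K x * (y powr p * ((real m * C)\<^sup>2 * \<sigma> ^ (m - 2)))"
        unfolding w\<sigma> y_def[symmetric] fy[symmetric] by (simp add: algebra_simps)
      also have "\<dots> \<le> K x * ((10 * M\<^sup>2 * y powr p * \<sigma> ^ (m - 2) + 2 * M powr (p + 2)) * \<kappa> ^ 4) + K x * (y powr p * ((real m * C)\<^sup>2 * \<sigma> ^ (m - 2)))"
        using fP Kp by (intro add_right_mono mult_left_mono) auto
      also have "\<dots> = (10 * M\<^sup>2 * \<kappa> ^ 4 + (real m * C)\<^sup>2) * (K x * y powr p * \<sigma> ^ (m - 2)) + K x * (2 * \<kappa> ^ 4 * M powr (p + 2))"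
        by (simp add: algebra_simps)
      also have "\<dots> \<le> (10 * M\<^sup>2 * \<kappa> ^ 4 + (real m * C)\<^sup>2) * (K x * y powr p * \<sigma> ^ (m - 2)) + 1 * (2 * \<kappa> ^ 4 * M powr (p + 2))"
        using K_le_1[of x] by (intro add_left_mono mult_right_mono) auto
      finally have "B0 * (K x * ?fq x * (?P2 x * \<omega> x + (norm (q x))\<^sup>2 * w2 x))
        \<le> B0 * ((10 * M\<^sup>2 * \<kappa> ^ 4 + (real m * C)\<^sup>2) * (K x * y powr p * \<sigma> ^ (m - 2)) + 1 * (2 * \<kappa> ^ 4 * M powr (p + 2)))"
        using B0 by (rule mult_left_mono)
      then show ?thesis by (simp add: B1_def algebra_simps)
    qed
    have "B1 * (K x * y powr p * \<sigma> ^ (m - 2)) + B2 * (y powr p * \<sigma> ^ (m - 1))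
      \<le> \<epsilon> * (K' x * (y powr p * y\<^sup>2) * \<sigma> ^ m) + Bt * (K x * y\<^sup>2)"
      unfolding K_def K'_def L_def y_def[symmetric] Bt_def
      by (rule pointwise_absorb[OF p a y \<sigma> _ _ _ _ m B1 B2 \<epsilon>])
        (use norm_\<Phi>_bounds[OF x] M \<kappa> in \<open>auto simp: y_def\<close>)
    moreover have "K' x * ?fq x * norm (q x) ^ 4 * \<omega> x = K' x * (y powr p * y\<^sup>2) * \<sigma> ^ m"
      unfolding w\<sigma> y_def[symmetric] fy[symmetric] by (simp add: power2_eq_square power4_eq_xxxx)
    ultimately show "?D x + B2 * (norm (q x) powr p * (\<theta> * \<eta> x) ^ (m - 1))
      \<le> Bt * (K x * (norm (q x))\<^sup>2) + 2 * B0 * \<kappa> ^ 4 * M powr (p + 2)"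
      using T2 unfolding y_def[symmetric] \<sigma>_def[symmetric] by (simp only: mult_minus_left)
  qed
  also have "\<dots> = I (\<lambda>x. Bt * (K x * (norm (q x))\<^sup>2)) + I (\<lambda>x. 2 * B0 * \<kappa> ^ 4 * M powr (p + 2))"
    by (intro I_add continuous_intros cont_K cont_q)
  also have "\<dots> = Bt * I (\<lambda>x. K x * (norm (q x))\<^sup>2) + 2 * B0 * \<kappa> ^ 4 * M powr (p + 2) * measure lborel U"
    by (simp only: set_integral_mult_right I_const) simp
  finally show "- I (\<lambda>x. divV x * divW (fpow p) (\<lambda>r. (p - 2) * fpow p r) \<omega> n x)
      + B2 * I (\<lambda>x. norm (q x) powr p * (\<theta> * \<eta> x) ^ (m - 1))
    \<le> absorb_const a p (M\<^sup>2 * \<kappa>\<^sup>2) (1 / (16 * (1 + p)\<^sup>2 * c * \<kappa>\<^sup>2 * M\<^sup>2))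
          (B0 * (10 * M\<^sup>2 * \<kappa> ^ 4 + (real m * C)\<^sup>2)) B2 * I (\<lambda>x. K x * (norm (q x))\<^sup>2)
      + 2 * B0 * \<kappa> ^ 4 * M powr (p + 2) * measure lborel U"
    by (simp add: Bt_def B1_def \<epsilon>_def)
qed

end

text \<open>The tangent inequality for the convex function \<open>norm v powr p\<close>, whose
  gradient is \<open>p * fpow p (norm v)\<close> times \<open>v\<close>. After Cauchy-Schwarz it is
  Young's inequality with the exponents \<open>p / (p - 1)\<close> and \<open>p\<close>.\<close>

lemma powr_norm_convex:
  fixes v w :: "'a::real_inner"
  assumes p: "p \<ge> 2"
  shows "p * (fpow p (norm v) * (v \<bullet> (w - v))) \<le> norm w powr p - norm v powr p"
proof (cases "v = 0")
  case True then show ?thesis using p by simp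
next
  case False
  define r s where "r = norm v" and "s = norm w"
  have r: "r > 0" and s: "s \<ge> 0" using False by (auto simp: r_def s_def)
  have q: "p / (p - 1) > 1" "1 / (p / (p - 1)) + 1 / p = 1" using p by (auto simp: field_simps)
  have "r powr (p - 1) * s \<le> (r powr (p - 1)) powr (p / (p - 1)) / (p / (p - 1)) + s powr p / p"
    using Youngs_inequality[OF q(1) _ q(2), of "r powr (p - 1)" s] p s by simp
  also have "(r powr (p - 1)) powr (p / (p - 1)) = r powr p" using p by (simp add: powr_powr)
  finally have "p * (r powr (p - 1) * s) \<le> p * (r powr p / (p / (p - 1)) + s powr p / p)"
    using p by (intro mult_left_mono) auto
  also have "\<dots> = (p - 1) * r powr p + s powr p" using p by (simp add: field_simps)
  finally have Y: "p * (r powr (p - 1) * s) \<le> (p - 1) * r powr p + s powr p" .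
  have f1: "fpow p r * r\<^sup>2 = r powr p" using r by (simp add: fpow_square)
  have f2: "fpow p r * r = r powr (p - 1)"
  proof -
    have "fpow p r * r * r = r powr (p - 1) * r" using f1 r by (simp add: power2_eq_square powr_diff mult.assoc)
    then show ?thesis using r by simp
  qed
  have "fpow p r * (v \<bullet> (w - v)) = fpow p r * (v \<bullet> w) - r powr p"
    by (simp add: inner_diff_right right_diff_distrib r_def power2_norm_eq_inner flip: fpow_square)
  also have "\<dots> \<le> fpow p r * (r * s) - r powr p"
    using norm_cauchy_schwarz[of v w] fpow_nonneg[of p r] by (simp add: r_def s_def mult_left_mono)
  also have "\<dots> = r powr (p - 1) * s - r powr p" using f2 by (simp add: mult.assoc[symmetric])
  finally have "p * (fpow p r * (v \<bullet> (w - v))) \<le> p * (r powr (p - 1) * s - r powr p)"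
    using p by (intro mult_left_mono) auto
  also have "\<dots> \<le> s powr p - r powr p" using Y by (simp add: algebra_simps)
  finally show ?thesis by (simp add: r_def s_def)
qed

section \<open>Energy estimate at a fixed time\<close>

context slice begin

text \<open>The test function is \<open>w\<close>, later \<open>u - \<Psi>\<close>. One part of its
  gradient is \<open>\<Phi>\<close>, on which \<open>V\<close> is coercive; the rest,
  \<open>u\<^sup>2 Z\<close> and \<open>g\<close>, is bounded by \<open>D + G\<close> and absorbed
  with half of the coercivity.\<close>

lemma energy_slice:
  assumes w: "continuous_on (closure U) w" "\<And>x. x \<in> U \<Longrightarrow> (w has_derivative (\<lambda>h. (q x - g x) \<bullet> h)) (at x)"
    and g: "continuous_on (closure U) g" and zero: "\<And>x. x \<in> frontier U \<Longrightarrow> w x = 0"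
  shows "I (\<lambda>x. divV x * w x) \<le> - (1 / (4 * c * \<kappa>\<^sup>2)) * I (\<lambda>x. K x * (norm (q x))\<^sup>2)
    + 2 * c ^ 3 * \<kappa> powr (2 + 2 * a) * ((M\<^sup>2 * \<kappa>\<^sup>2)\<^sup>2 * measure lborel U + I (\<lambda>x. (norm (g x))\<^sup>2))"
proof -
  define D where "D = M\<^sup>2 * \<kappa>\<^sup>2"
  define R where "R = c ^ 3 * \<kappa> powr (2 + 2 * a)"
  have cp: "c > 0" "\<kappa> > 0" using c \<kappa> by auto
  have cg: "continuous_on (closure U) (\<lambda>x. q x - g x)" by (intro continuous_intros cont_q g)
  have "I (\<lambda>x. divV x * w x) = I (\<lambda>x. w x * (\<Sum>b\<in>Basis. DV x b \<bullet> b))"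
    by (intro I_cong) (simp add: divV_def)
  also have "\<dots> = - I (\<lambda>x. (q x - g x) \<bullet> V x)"
    by (rule integral_div_mult[OF cont_V V_der cont_DV lin_DV w cg]) (use zero in auto)
  also have "\<dots> = I (\<lambda>x. - ((q x - g x) \<bullet> V x))"
    by (intro I_uminus[symmetric] continuous_intros cg cont_V)
  also have "\<dots> \<le> I (\<lambda>x. - (1 / (4 * c * \<kappa>\<^sup>2)) * (K x * (norm (q x))\<^sup>2) + (2 * R * (norm (g x))\<^sup>2 + 2 * R * D\<^sup>2))"
  proof (rule I_mono)
    show "continuous_on (closure U) (\<lambda>x. - ((q x - g x) \<bullet> V x))"
      by (intro continuous_intros cg cont_V)
    show "continuous_on (closure U) (\<lambda>x. - (1 / (4 * c * \<kappa>\<^sup>2)) * (K x * (norm (q x))\<^sup>2) + (2 * R * (norm (g x))\<^sup>2 + 2 * R * D\<^sup>2))"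
      by (intro continuous_intros cont_K cont_q g)
    fix x assume x: "x \<in> U"
    define l where "l = K x / (c * \<kappa>\<^sup>2)"
    define \<Lambda> where "\<Lambda> = c * \<kappa> powr a * K x"
    define y where "y = norm (\<Phi> x)"
    define G where "G = norm (g x)"
    have K: "K x > 0" by (rule K_pos)
    have l: "l > 0" using K cp by (simp add: l_def)
    have b1: "1 \<le> c * \<kappa>\<^sup>2" using mult_mono[of 1 c 1 "\<kappa>\<^sup>2"] c \<kappa> by simp
    have R1: "1 \<le> R" unfolding R_def
      using mult_mono[of 1 "c ^ 3" 1 "\<kappa> powr (2 + 2 * a)"] c \<kappa> a by (simp add: ge_one_powr_ge_zero)
    have RL: "\<Lambda>\<^sup>2 / l \<le> R"
    proof -
      have "\<kappa> powr (2 + 2 * a) = \<kappa> powr 2 * (\<kappa> powr a * \<kappa> powr a)" by (simp only: powr_add mult_2)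
      moreover have "\<kappa> powr 2 = \<kappa>\<^sup>2" using cp by (simp add: powr_numeral)
      moreover have "\<Lambda>\<^sup>2 / l = c ^ 3 * (\<kappa>\<^sup>2 * (\<kappa> powr a * \<kappa> powr a)) * K x"
        using K cp by (simp add: l_def \<Lambda>_def power2_eq_square power3_eq_cube field_simps)
      ultimately have "\<Lambda>\<^sup>2 / l = R * K x" by (simp add: R_def)
      also have "\<dots> \<le> R * 1" using R1 K_le_1[of x] by (intro mult_left_mono) auto
      finally show ?thesis by simp
    qed
    have Vu: "norm (V x) \<le> \<Lambda> * y" using X2[of "\<Phi> x"] by (simp add: V_def \<Lambda>_def y_def K_def mult_ac)
    have Vl: "l * y\<^sup>2 \<le> V x \<bullet> \<Phi> x"
      using X1[of "\<Phi> x"] cp by (simp add: V_def l_def y_def K_def field_simps)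
    have "\<bar>((u x)\<^sup>2 *\<^sub>R Z x + g x) \<bullet> V x\<bar> \<le> (D + G) * (\<Lambda> * y)"
    proof (rule order_trans[OF Cauchy_Schwarz_ineq2], rule mult_mono[OF _ Vu])
      show "norm ((u x)\<^sup>2 *\<^sub>R Z x + g x) \<le> D + G"
        using norm_triangle_ineq[of "(u x)\<^sup>2 *\<^sub>R Z x" "g x"] norm_u2Z[OF x] by (simp add: D_def G_def)
    qed (simp_all add: D_def G_def)
    moreover have "(q x - g x) \<bullet> V x = V x \<bullet> \<Phi> x - ((u x)\<^sup>2 *\<^sub>R Z x + g x) \<bullet> V x"
      by (simp add: \<Phi>_def inner_diff_left inner_add_left inner_add_right inner_commute)
    ultimately have "l * y\<^sup>2 - (D + G) * \<Lambda> * y \<le> (q x - g x) \<bullet> V x" using Vl by (simp add: mult.assoc)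
    moreover have "- (((D + G) * \<Lambda>)\<^sup>2 / (4 * (l / 2))) \<le> l / 2 * y\<^sup>2 - (D + G) * \<Lambda> * y"
      by (rule quadratic_lower) (use l in simp)
    moreover have "((D + G) * \<Lambda>)\<^sup>2 / (4 * (l / 2)) \<le> R * (D\<^sup>2 + G\<^sup>2)"
    proof -
      have "((D + G) * \<Lambda>)\<^sup>2 / (4 * (l / 2)) = (\<Lambda>\<^sup>2 / l) * ((D + G)\<^sup>2 / 2)"
        unfolding power_mult_distrib using l by (simp add: field_simps)
      also have "\<dots> \<le> R * (D\<^sup>2 + G\<^sup>2)"
      proof (rule mult_mono[OF RL])
        show "(D + G)\<^sup>2 / 2 \<le> D\<^sup>2 + G\<^sup>2" using sum_squares_bound[of D G] by (simp add: power2_sum)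
      qed (use R1 in auto)
      finally show ?thesis .
    qed
    ultimately have 1: "l / 2 * y\<^sup>2 - R * (D\<^sup>2 + G\<^sup>2) \<le> (q x - g x) \<bullet> V x" by linarith
    \<comment> \<open>The remaining half of the coercivity controls \<open>\<Phi>\<close>; passing
      from \<open>\<Phi>\<close> back to \<open>q\<close> costs another factor 2 and a term with
      \<open>D\<^sup>2\<close>.\<close>
    have "norm (q x) \<le> y + D" using norm_\<Phi>_bounds(1)[OF x] by (simp add: y_def D_def)
    then have "(norm (q x))\<^sup>2 \<le> (y + D)\<^sup>2" by (intro power_mono) auto
    also have "\<dots> \<le> 2 * y\<^sup>2 + 2 * D\<^sup>2" using sum_squares_bound[of y D] by (simp add: power2_sum)
    finally have "l / 4 * (norm (q x))\<^sup>2 \<le> l / 4 * (2 * y\<^sup>2 + 2 * D\<^sup>2)" using l by (intro mult_left_mono) auto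
    moreover have "l / 2 * D\<^sup>2 \<le> R * D\<^sup>2"
    proof (rule mult_right_mono)
      have "l \<le> 1" using K_le_1[of x] b1 K cp unfolding l_def by (simp add: field_simps)
      then show "l / 2 \<le> R" using R1 l by linarith
    qed simp
    ultimately have "l / 4 * (norm (q x))\<^sup>2 - 2 * R * D\<^sup>2 - R * G\<^sup>2 \<le> (q x - g x) \<bullet> V x"
      using 1 by (simp add: algebra_simps)
    moreover have "0 \<le> R * G\<^sup>2" using R1 by simp
    moreover have "l / 4 * (norm (q x))\<^sup>2 = 1 / (4 * c * \<kappa>\<^sup>2) * (K x * (norm (q x))\<^sup>2)" by (simp add: l_def)
    ultimately show "- ((q x - g x) \<bullet> V x) \<le> - (1 / (4 * c * \<kappa>\<^sup>2)) * (K x * (norm (q x))\<^sup>2) + (2 * R * (norm (g x))\<^sup>2 + 2 * R * D\<^sup>2)"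
      by (simp only: G_def mult_minus_left)
  qed
  also have "\<dots> = I (\<lambda>x. - (1 / (4 * c * \<kappa>\<^sup>2)) * (K x * (norm (q x))\<^sup>2)) + (I (\<lambda>x. 2 * R * (norm (g x))\<^sup>2) + I (\<lambda>x. 2 * R * D\<^sup>2))"
  proof -
    have c1: "continuous_on (closure U) (\<lambda>x. - (1 / (4 * c * \<kappa>\<^sup>2)) * (K x * (norm (q x))\<^sup>2))"
      and c2: "continuous_on (closure U) (\<lambda>x. 2 * R * (norm (g x))\<^sup>2)" and c3: "continuous_on (closure U) (\<lambda>x. 2 * R * D\<^sup>2)"
      by (intro continuous_intros cont_K cont_q g)+
    show ?thesis unfolding I_add[OF c1 continuous_on_add[OF c2 c3]] I_add[OF c2 c3] ..
  qed
  also have "I (\<lambda>x. - (1 / (4 * c * \<kappa>\<^sup>2)) * (K x * (norm (q x))\<^sup>2)) = - (1 / (4 * c * \<kappa>\<^sup>2)) * I (\<lambda>x. K x * (norm (q x))\<^sup>2)"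
    by (rule set_integral_mult_right)
  also have "I (\<lambda>x. 2 * R * (norm (g x))\<^sup>2) = 2 * R * I (\<lambda>x. (norm (g x))\<^sup>2)" by (rule set_integral_mult_right)
  also have "I (\<lambda>x. 2 * R * D\<^sup>2) = measure lborel U * (2 * R * D\<^sup>2)" by (rule I_const)
  finally show ?thesis by (simp add: R_def D_def algebra_simps)
qed

text \<open>A time factor of the weight comes out of the divergence, so the time derivative has to
  be computed only for the purely spatial weight.\<close>

lemma divW_scale: "divW f e (\<lambda>x. k * \<omega> x) (\<lambda>x. k *\<^sub>R n x) x = k * divW f e \<omega> n x"
  by (cases "x \<in> U") (simp_all add: divW_def DW_def sum_distrib_left inner_add_left distrib_left mult_ac)

end

section \<open>Time slices and parameter integrals of jointly continuous functions\<close>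

lemma continuous_on_time_slice:
  fixes f :: "'a::topological_space \<Rightarrow> real \<Rightarrow> 'b::topological_space"
  assumes "continuous_on (S \<times> T) (\<lambda>(x, t). f x t)" "t \<in> T"
  shows "continuous_on S (\<lambda>x. f x t)"
proof -
  have "continuous_on S (\<lambda>x. (\<lambda>(x, t). f x t) (x, t))"
    by (rule continuous_on_compose2[OF assms(1) continuous_on_Pair[OF continuous_on_id continuous_on_const]])
      (use assms(2) in auto)
  then show ?thesis by simp
qed

lemma continuous_on_space_slice:
  fixes f :: "'a::topological_space \<Rightarrow> real \<Rightarrow> 'b::topological_space"
  assumes "continuous_on (S \<times> T) (\<lambda>(x, t). f x t)" "x \<in> S"
  shows "continuous_on T (\<lambda>t. f x t)"
proof -
  have "continuous_on T (\<lambda>t. (\<lambda>(x, t). f x t) (x, t))"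
    by (rule continuous_on_compose2[OF assms(1) continuous_on_Pair[OF continuous_on_const continuous_on_id]])
      (use assms(2) in auto)
  then show ?thesis by simp
qed

context bounded_domain begin

lemma bounded_on_slab:
  fixes f :: "'a \<Rightarrow> real \<Rightarrow> 'b::real_normed_vector"
  assumes "continuous_on (closure U \<times> T) (\<lambda>(x, t). f x t)" "{s..t} \<subseteq> T"
  obtains B where "B \<ge> 0" "\<And>x \<tau>. x \<in> closure U \<Longrightarrow> \<tau> \<in> {s..t} \<Longrightarrow> norm (f x \<tau>) \<le> B"
proof -
  have "compact (closure U \<times> {s..t})" by (intro compact_Times compact_closure_U) auto
  moreover have "continuous_on (closure U \<times> {s..t}) (\<lambda>(x, t). f x t)"
    by (rule continuous_on_subset[OF assms(1)]) (use assms(2) in auto)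
  ultimately have "compact ((\<lambda>(x, t). f x t) ` (closure U \<times> {s..t}))" by (intro compact_continuous_image)
  from compact_imp_bounded[OF this] obtain B where B: "\<And>z. z \<in> closure U \<times> {s..t} \<Longrightarrow> norm (case z of (x, t) \<Rightarrow> f x t) \<le> B"
    unfolding bounded_iff by auto
  show thesis
  proof (rule that[of "max 0 B"])
    fix x \<tau> assume "x \<in> closure U" "\<tau> \<in> {s..t}"
    then show "norm (f x \<tau>) \<le> max 0 B" using B[of "(x, \<tau>)"] by auto
  qed simp
qed

lemma continuous_on_I:
  fixes f :: "'a \<Rightarrow> real \<Rightarrow> real"
  assumes "continuous_on (closure U \<times> {s..t}) (\<lambda>(x, t). f x t)"
  shows "continuous_on {s..t} (\<lambda>\<tau>. I (\<lambda>x. f x \<tau>))"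
  unfolding continuous_on_def
proof
  fix \<tau> assume \<tau>: "\<tau> \<in> {s..t}"
  obtain B where "B \<ge> 0" and B: "\<And>x \<tau>. x \<in> closure U \<Longrightarrow> \<tau> \<in> {s..t} \<Longrightarrow> norm (f x \<tau>) \<le> B"
    by (rule bounded_on_slab[OF assms order_refl]) blast
  show "((\<lambda>\<tau>. I (\<lambda>x. f x \<tau>)) \<longlongrightarrow> I (\<lambda>x. f x \<tau>)) (at \<tau> within {s..t})"
  proof (rule set_integral_tendsto[OF U, where B = B])
    show "\<forall>\<^sub>F \<tau> in at \<tau> within {s..t}. continuous_on U (\<lambda>x. f x \<tau>) \<and> (\<forall>x\<in>U. \<bar>f x \<tau>\<bar> \<le> B)"
      unfolding eventually_at_filter
    proof (rule always_eventually, intro allI impI conjI ballI)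
      fix \<sigma> assume s: "\<sigma> \<in> {s..t}"
      show "continuous_on U (\<lambda>x. f x \<sigma>)"
        by (rule continuous_on_subset[OF continuous_on_time_slice[OF assms s] closure_subset])
      show "\<bar>f x \<sigma>\<bar> \<le> B" if "x \<in> U" for x using B[OF in_closure[OF that] s] by simp
    qed
    show "((\<lambda>\<tau>. f x \<tau>) \<longlongrightarrow> f x \<tau>) (at \<tau> within {s..t})" if "x \<in> U" for x
      using continuous_on_space_slice[OF assms in_closure[OF that]] \<tau> by (simp add: continuous_on_def)
  qed
qed

end

text \<open>Dividing by a time increment of unknown sign may swap the two bounds; minimum and
  maximum cover times before and after the base point at once.\<close>

lemma quotient_between:
  fixes A B D d :: real
  assumes "d \<noteq> 0" "d * A \<le> D" "D \<le> d * B"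
  shows "min A B \<le> D / d \<and> D / d \<le> max A B"
proof (cases "d > 0")
  case True
  then have "A \<le> D / d" "D / d \<le> B" using assms by (simp_all add: pos_le_divide_eq pos_divide_le_eq mult.commute)
  then show ?thesis by auto
next
  case False
  then have "d < 0" using assms by simp
  then have "D / d \<le> A" "B \<le> D / d" using assms by (simp_all add: neg_le_divide_eq neg_divide_le_eq mult.commute)
  then show ?thesis by auto
qed

subsection \<open>Evolution of the gradient norm\<close>

text \<open>\<open>P\<close>, \<open>H\<close> and \<open>qt\<close> are the gradient, the Hessian
  and the time derivative of \<open>u\<close>, available for positive times only, while
  \<open>u\<close> is continuous down to time 0. The equation is expressed with
  \<open>slice.divV\<close>, the divergence already computed by the chain rule.\<close>

locale flow = bounded_domain U for U :: "(real^3) set" +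
  fixes a c \<kappa> M \<phi> T :: real and X :: "real^3 \<Rightarrow> real^3" and DX :: "real^3 \<Rightarrow> real^3 \<Rightarrow> real^3"
    and u :: "real^3 \<Rightarrow> real \<Rightarrow> real" and P :: "real^3 \<Rightarrow> real \<Rightarrow> real^3"
    and H :: "real^3 \<Rightarrow> real \<Rightarrow> real^3 \<Rightarrow> real^3" and qt :: "real^3 \<Rightarrow> real \<Rightarrow> real"
    and Z :: "real^3 \<Rightarrow> real \<Rightarrow> real^3" and J :: "real^3 \<Rightarrow> real^3"
  assumes a: "0 < a" "a < 1" and c: "c \<ge> 1" and \<kappa>: "\<kappa> \<ge> 1" and M: "M > 0"
    and \<phi>: "0 < \<phi>" "\<phi> \<le> 1" and T: "T > 0"
    and X_der: "\<And>y. (X has_derivative DX y) (at y)"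
    and DX_cont: "\<And>h. continuous_on UNIV (\<lambda>y. DX y h)"
    and X1: "\<And>y. (1 + norm y) powr (- a) * (norm y)\<^sup>2 \<le> c * \<kappa>\<^sup>2 * (X y \<bullet> y)"
    and X2: "\<And>y. norm (X y) \<le> c * \<kappa> powr a * (1 + norm y) powr (- a) * norm y"
    and DX1: "\<And>y h. (1 + norm y) powr (- a) * (norm h)\<^sup>2 \<le> c * \<kappa>\<^sup>2 * (DX y h \<bullet> h)"
    and DX2: "\<And>y h. norm (DX y h) \<le> c * \<kappa> powr a * (1 + norm y) powr (- a) * norm h"
    and cont_u: "continuous_on (closure U \<times> {0..T}) (\<lambda>(x, t). u x t)"
    and cont_P: "continuous_on (closure U \<times> {0<..T}) (\<lambda>(x, t). P x t)"
    and cont_H: "\<And>h. continuous_on (closure U \<times> {0<..T}) (\<lambda>(x, t). H x t h)"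
    and cont_qt: "continuous_on (closure U \<times> {0<..T}) (\<lambda>(x, t). qt x t)"
    and cont_Z: "\<And>t. continuous_on (closure U) (\<lambda>x. Z x t)"
    and lin_H: "\<And>x t. linear (H x t)" and lin_J: "linear J"
    and der_u: "\<And>x t. x \<in> U \<Longrightarrow> t \<in> {0<..T} \<Longrightarrow> ((\<lambda>x. u x t) has_derivative (\<lambda>h. P x t \<bullet> h)) (at x)"
    and der_P: "\<And>x t. x \<in> U \<Longrightarrow> t \<in> {0<..T} \<Longrightarrow> ((\<lambda>x. P x t) has_derivative H x t) (at x)"
    and der_t: "\<And>x t. x \<in> U \<Longrightarrow> t \<in> {0<..T} \<Longrightarrow> (u x has_real_derivative qt x t) (at t within {0<..T})"
    and der_Z: "\<And>x t. x \<in> U \<Longrightarrow> ((\<lambda>x. Z x t) has_derivative J) (at x)"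
    and bd_u: "\<And>x t. x \<in> U \<Longrightarrow> t \<in> {0..T} \<Longrightarrow> \<bar>u x t\<bar> \<le> M"
    and bd_Z: "\<And>x t. x \<in> U \<Longrightarrow> norm (Z x t) \<le> \<kappa>\<^sup>2"
    and bd_J: "\<And>h. norm (J h) \<le> \<kappa>\<^sup>2 * norm h"
    and pde: "\<And>x t. x \<in> U \<Longrightarrow> t \<in> {0<..T} \<Longrightarrow>
      \<phi> * qt x t = slice.divV DX (\<lambda>x. u x t) (\<lambda>x. P x t) (\<lambda>x. H x t) (\<lambda>x. Z x t) J x"
begin

lemma slice_at:
  assumes t: "t \<in> {0<..T}"
  shows "slice U a c \<kappa> M X DX (\<lambda>x. u x t) (\<lambda>x. P x t) (\<lambda>x. H x t) (\<lambda>x. Z x t) J"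
proof (rule slice.intro[OF bounded_domain_axioms], rule slice_axioms.intro)
  show "continuous_on (closure U) (\<lambda>x. u x t)"
    by (rule continuous_on_time_slice[OF cont_u]) (use t in auto)
  show "\<bar>u x t\<bar> \<le> M" if "x \<in> U" for x using bd_u[OF that] t by auto
qed (assumption | rule a c \<kappa> M X_der DX_cont X1 X2 DX1 DX2 cont_Z lin_H lin_J der_Z bd_Z bd_J
    der_u[OF _ t] der_P[OF _ t] continuous_on_time_slice[OF cont_P t] continuous_on_time_slice[OF cont_H t])+

context
  fixes p :: real and \<omega> :: "real^3 \<Rightarrow> real" and n :: "real^3 \<Rightarrow> real^3" and S :: "(real^3) set"
  assumes p: "p \<ge> 2" and weight: "C1_weight U \<omega> n S" and \<omega>: "\<And>x. 0 \<le> \<omega> x"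
begin

abbreviation dW where "dW t \<equiv> slice.divW U (\<lambda>x. P x t) (\<lambda>x. H x t) (fpow p) (\<lambda>r. (p - 2) * fpow p r) \<omega> n"

text \<open>The formula for \<open>dW\<close> without its case distinction on \<open>U\<close>; in
  this form it is jointly continuous up to the boundary, hence bounded on compact time
  intervals.\<close>

definition E where "E x t = (\<Sum>b\<in>Basis. (\<omega> x *\<^sub>R radial_deriv (fpow p) (\<lambda>r. (p - 2) * fpow p r) (P x t) (H x t b)
    + (n x \<bullet> b) *\<^sub>R (fpow p (norm (P x t)) *\<^sub>R P x t)) \<bullet> b)"

definition Ip where "Ip t = I (\<lambda>x. norm (P x t) powr p * \<omega> x)"

lemma fp_pair: "radial_pair (fpow p) (\<lambda>r. (p - 2) * fpow p r)"
  unfolding radial_pair_def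
proof (intro conjI allI impI)
  show "(p - 2) * fpow p 0 = 0" by (simp add: fpow_def)
qed (intro continuous_on_mult_left fpow_cont[OF p] fpow_deriv; assumption)+

lemma cont_\<omega>: "continuous_on A \<omega>" and cont_n: "continuous_on A n"
proof -
  have "(\<omega> has_derivative (\<lambda>h. n x \<bullet> h)) (at x)" for x using weight by (auto simp: C1_weight_def)
  then show "continuous_on A \<omega>"
    by (intro continuous_at_imp_continuous_on ballI has_derivative_continuous)
  show "continuous_on A n" using weight continuous_on_subset[of UNIV n A] by (auto simp: C1_weight_def)
qed

lemma dW_E: assumes "t \<in> {0<..T}" "x \<in> U" shows "dW t x = E x t"
proof -
  interpret s: slice U a c \<kappa> M X DX "\<lambda>x. u x t" "\<lambda>x. P x t" "\<lambda>x. H x t" "\<lambda>x. Z x t" J by (rule slice_at[OF assms(1)])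
  show ?thesis using assms by (simp add: s.divW_def s.DW_def E_def)
qed

lemma cont_P': "continuous_on (closure U \<times> {0<..T}) (\<lambda>z. P (fst z) (snd z))"
  and cont_H': "continuous_on (closure U \<times> {0<..T}) (\<lambda>z. H (fst z) (snd z) h)"
  using cont_P cont_H[of h] by (simp_all add: case_prod_unfold)

lemma cont_pow: "continuous_on (closure U \<times> {0<..T}) (\<lambda>(x, t). norm (P x t) powr p * \<omega> x)"
proof -
  have "continuous_on (closure U \<times> {0<..T}) (\<lambda>z. fpow p (norm (P (fst z) (snd z))) * (norm (P (fst z) (snd z)))\<^sup>2 * \<omega> (fst z))"
    by (intro continuous_intros continuous_on_compose2[OF fpow_cont[OF p]] cont_P' continuous_on_compose2[OF cont_\<omega>[of UNIV]]) auto
  then show ?thesis by (simp add: fpow_square case_prod_unfold)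
qed

lemma cont_E: "continuous_on (closure U \<times> {0<..T}) (\<lambda>(x, t). E x t)"
  unfolding E_def case_prod_unfold
  by (intro continuous_intros continuous_on_radial_deriv cont_P' cont_H' continuous_on_compose2[OF cont_\<omega>[of UNIV]]
      continuous_on_compose2[OF cont_n[of UNIV]] continuous_on_compose2[OF fpow_cont[OF p]] fpow_cont[OF p]
      continuous_on_mult_left) (auto simp: fpow_def)

text \<open>Convexity replaces the missing time derivative of \<open>P\<close>; exchanging \<open>s\<close> and \<open>t\<close> gives the bound from above.\<close>

lemma Ip_diff_ge:
  assumes s: "s \<in> {0<..T}" and t: "t \<in> {0<..T}"
  shows "- p * I (\<lambda>x. (u x s - u x t) * dW t x) \<le> Ip s - Ip t"
proof -
  interpret st: slice U a c \<kappa> M X DX "\<lambda>x. u x t" "\<lambda>x. P x t" "\<lambda>x. H x t" "\<lambda>x. Z x t" J by (rule slice_at[OF t])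
  interpret ss: slice U a c \<kappa> M X DX "\<lambda>x. u x s" "\<lambda>x. P x s" "\<lambda>x. H x s" "\<lambda>x. Z x s" J by (rule slice_at[OF s])
  have cg: "continuous_on (closure U) (\<lambda>x. P x s - P x t)" by (intro continuous_intros ss.cont_q st.cont_q)
  have parts: "I (\<lambda>x. (u x s - u x t) * dW t x) = - I (\<lambda>x. (P x s - P x t) \<bullet> st.W (fpow p) \<omega> x)"
  proof (rule st.parts_W[OF fp_pair weight _ _ cg])
    show "continuous_on (closure U) (\<lambda>x. u x s - u x t)" by (intro continuous_intros ss.cont_u st.cont_u)
    show "((\<lambda>x. u x s - u x t) has_derivative (\<lambda>h. (P x s - P x t) \<bullet> h)) (at x)" if "x \<in> U" for x
      using has_derivative_diff[OF der_u[OF that s] der_u[OF that t]] by (simp add: inner_diff_left)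
  qed
  have cs: "continuous_on (closure U) (\<lambda>x. norm (P x s) powr p * \<omega> x)" if "s \<in> {0<..T}" for s
    by (rule continuous_on_time_slice[OF cont_pow that])
  have "- p * I (\<lambda>x. (u x s - u x t) * dW t x) = I (\<lambda>x. p * ((P x s - P x t) \<bullet> st.W (fpow p) \<omega> x))"
    by (simp add: parts)
  also have "\<dots> \<le> I (\<lambda>x. norm (P x s) powr p * \<omega> x - norm (P x t) powr p * \<omega> x)"
  proof (rule I_mono)
    show "continuous_on (closure U) (\<lambda>x. p * ((P x s - P x t) \<bullet> st.W (fpow p) \<omega> x))"
      by (intro continuous_intros cg st.cont_W[OF fp_pair weight])
    show "continuous_on (closure U) (\<lambda>x. norm (P x s) powr p * \<omega> x - norm (P x t) powr p * \<omega> x)"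
      by (intro continuous_on_diff cs s t)
    fix x assume x: "x \<in> U"
    have "p * ((P x s - P x t) \<bullet> st.W (fpow p) \<omega> x) = \<omega> x * (p * (fpow p (norm (P x t)) * (P x t \<bullet> (P x s - P x t))))"
      using x by (simp add: st.W_def inner_commute)
    also have "\<dots> \<le> \<omega> x * (norm (P x s) powr p - norm (P x t) powr p)"
      by (rule mult_left_mono[OF powr_norm_convex[OF p] \<omega>])
    finally show "p * ((P x s - P x t) \<bullet> st.W (fpow p) \<omega> x) \<le> norm (P x s) powr p * \<omega> x - norm (P x t) powr p * \<omega> x"
      by (simp add: right_diff_distrib mult.commute)
  qed
  also have "\<dots> = Ip s - Ip t" unfolding Ip_def by (rule I_diff[OF cs[OF s] cs[OF t]])
  finally show ?thesis .
qed

lemma Ip_cont: assumes "0 < s" shows "continuous_on {s..T} Ip"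
  unfolding Ip_def[abs_def]
  by (rule continuous_on_I, rule continuous_on_subset[OF cont_pow]) (use assms in auto)

text \<open>The convexity inequality at the times \<open>t\<close> and \<open>s\<close> encloses the
  difference quotient of \<open>Ip\<close> between two integrals containing the quotient of
  \<open>u\<close>, with the divergence taken at \<open>t\<close> or at \<open>s\<close>. Both have
  the same limit by dominated convergence.\<close>

lemma Ip_derivative:
  assumes t: "0 < t" "t < T"
  shows "(Ip has_real_derivative - p * I (\<lambda>x. qt x t * dW t x)) (at t)"
proof -
  have tT: "t \<in> {0<..T}" using t by auto
  obtain Bq where Bq: "Bq \<ge> 0" "\<And>x \<tau>. x \<in> closure U \<Longrightarrow> \<tau> \<in> {t/2..T} \<Longrightarrow> norm (qt x \<tau>) \<le> Bq"
    by (rule bounded_on_slab[OF cont_qt, of "t/2" T]) (use t in auto)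
  obtain BE where BE: "BE \<ge> 0" "\<And>x \<tau>. x \<in> closure U \<Longrightarrow> \<tau> \<in> {t/2..T} \<Longrightarrow> norm (E x \<tau>) \<le> BE"
    by (rule bounded_on_slab[OF cont_E, of "t/2" T]) (use t in auto)
  have ev: "\<forall>\<^sub>F s in at t. s \<in> {t/2..T} \<and> s \<noteq> t"
    unfolding eventually_at by (rule exI[of _ "min (t/2) (T - t)"]) (use t in \<open>auto simp: dist_real_def abs_if split: if_splits\<close>)
  define r where "r x s = (u x s - u x t) / (s - t)" for x s
  have rb: "\<bar>r x s\<bar> \<le> Bq" if x: "x \<in> U" and s: "s \<in> {t/2..T}" "s \<noteq> t" for x s
  proof -
    have "norm (u x s - u x t) \<le> Bq * norm (s - t)"
    proof (rule field_differentiable_bound[of "{t/2..T}" "u x" "qt x" Bq])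
      show "(u x has_field_derivative qt x z) (at z within {t/2..T})" if "z \<in> {t/2..T}" for z
        by (rule DERIV_subset[OF der_t[OF x]]) (use that t in auto)
    qed (use Bq(2)[OF in_closure[OF x]] s t in auto)
    then show ?thesis using s by (simp add: r_def field_simps)
  qed
  have rlim: "((\<lambda>s. r x s) \<longlongrightarrow> qt x t) (at t)" if x: "x \<in> U" for x
  proof -
    have "at t within {0<..T} = at t" by (rule at_within_interior) (use t in auto)
    then show ?thesis using der_t[OF x tT] by (simp add: has_field_derivative_iff r_def)
  qed
  have Elim: "((\<lambda>s. E x s) \<longlongrightarrow> E x t) (at t)" if x: "x \<in> U" for x
  proof -
    have "at t within {0<..T} = at t" by (rule at_within_interior) (use t in auto)
    moreover have "((\<lambda>s. E x s) \<longlongrightarrow> E x t) (at t within {0<..T})"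
      using continuous_on_space_slice[OF cont_E in_closure[OF x]] tT by (simp add: continuous_on_def)
    ultimately show ?thesis by simp
  qed
  have Ec: "continuous_on U (\<lambda>x. E x s)" if "s \<in> {t/2..T}" for s
    by (rule continuous_on_subset[OF continuous_on_time_slice[OF cont_E] closure_subset]) (use that t in auto)
  have rc: "continuous_on U (\<lambda>x. r x s)" if "s \<in> {t/2..T}" "s \<noteq> t" for s
    unfolding r_def
    by (intro continuous_intros continuous_on_subset[OF continuous_on_time_slice[OF cont_u] closure_subset])
      (use that t in auto)
  have lim1: "((\<lambda>s. - p * I (\<lambda>x. r x s * E x t)) \<longlongrightarrow> - p * I (\<lambda>x. qt x t * E x t)) (at t)"
  proof (rule tendsto_mult_left, rule set_integral_tendsto[OF U, where B = "Bq * BE"])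
    show "\<forall>\<^sub>F s in at t. continuous_on U (\<lambda>x. r x s * E x t) \<and> (\<forall>x\<in>U. \<bar>r x s * E x t\<bar> \<le> Bq * BE)"
      using ev
    proof eventually_elim
      case (elim s)
      have "\<bar>r x s * E x t\<bar> \<le> Bq * BE" if x: "x \<in> U" for x
        unfolding abs_mult using rb[OF x, of s] BE(2)[OF in_closure[OF x], of t] elim t Bq BE
        by (intro mult_mono) auto
      then show ?case using rc[of s] Ec[of t] elim t by (auto intro!: continuous_intros)
    qed
    show "((\<lambda>s. r x s * E x t) \<longlongrightarrow> qt x t * E x t) (at t)" if "x \<in> U" for x
      by (intro tendsto_intros rlim that)
  qed
  \<comment> \<open>Here both factors move with \<open>s\<close>; the joint continuity of
    \<open>E\<close> supplies the limit and the bound.\<close>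
  have lim2: "((\<lambda>s. - p * I (\<lambda>x. r x s * E x s)) \<longlongrightarrow> - p * I (\<lambda>x. qt x t * E x t)) (at t)"
  proof (rule tendsto_mult_left, rule set_integral_tendsto[OF U, where B = "Bq * BE"])
    show "\<forall>\<^sub>F s in at t. continuous_on U (\<lambda>x. r x s * E x s) \<and> (\<forall>x\<in>U. \<bar>r x s * E x s\<bar> \<le> Bq * BE)"
      using ev
    proof eventually_elim
      case (elim s)
      have "\<bar>r x s * E x s\<bar> \<le> Bq * BE" if x: "x \<in> U" for x
        unfolding abs_mult using rb[OF x, of s] BE(2)[OF in_closure[OF x], of s] elim t Bq BE
        by (intro mult_mono) auto
      then show ?case using rc[of s] Ec[of s] elim t by (auto intro!: continuous_intros)
    qed
    show "((\<lambda>s. r x s * E x s) \<longlongrightarrow> qt x t * E x t) (at t)" if "x \<in> U" for x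
      by (intro tendsto_intros rlim Elim that)
  qed
  let ?A = "\<lambda>s. - p * I (\<lambda>x. r x s * E x t)" and ?B = "\<lambda>s. - p * I (\<lambda>x. r x s * E x s)"
  have "((\<lambda>s. (Ip s - Ip t) / (s - t)) \<longlongrightarrow> - p * I (\<lambda>x. qt x t * E x t)) (at t)"
  proof (rule tendsto_sandwich)
    have mm: "min (?A s) (?B s) \<le> (Ip s - Ip t) / (s - t) \<and> (Ip s - Ip t) / (s - t) \<le> max (?A s) (?B s)"
      if s: "s \<in> {t/2..T}" "s \<noteq> t" for s
    proof -
      have sT: "s \<in> {0<..T}" using s t by auto
      have d: "- p * I (\<lambda>x. (u x s - u x t) * dW \<tau> x) = (s - t) * (- p * I (\<lambda>x. r x s * E x \<tau>))" if "\<tau> \<in> {0<..T}" for \<tau>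
      proof -
        have "I (\<lambda>x. (u x s - u x t) * dW \<tau> x) = I (\<lambda>x. (s - t) * (r x s * E x \<tau>))"
          by (rule I_cong) (use s dW_E[OF that] in \<open>simp add: r_def\<close>)
        then show ?thesis by simp
      qed
      have 1: "(s - t) * ?A s \<le> Ip s - Ip t" using Ip_diff_ge[OF sT tT] unfolding d[OF tT] .
      have e2: "- p * I (\<lambda>x. (u x t - u x s) * dW s x) = - (- p * I (\<lambda>x. (u x s - u x t) * dW s x))"
      proof -
        have "I (\<lambda>x. (u x t - u x s) * dW s x) = I (\<lambda>x. - 1 * ((u x s - u x t) * dW s x))"
          by (rule I_cong) (simp add: algebra_simps)
        then show ?thesis by (simp only: set_integral_mult_right)
      qed
      have 2: "Ip s - Ip t \<le> (s - t) * ?B s" using Ip_diff_ge[OF tT sT] unfolding e2 d[OF sT] by linarith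
      show ?thesis using s by (intro quotient_between[OF _ 1 2]) auto
    qed
    show "\<forall>\<^sub>F s in at t. min (?A s) (?B s) \<le> (Ip s - Ip t) / (s - t)"
      using ev by eventually_elim (use mm in blast)
    show "\<forall>\<^sub>F s in at t. (Ip s - Ip t) / (s - t) \<le> max (?A s) (?B s)"
      using ev by eventually_elim (use mm in blast)
    show "((\<lambda>s. min (?A s) (?B s)) \<longlongrightarrow> - p * I (\<lambda>x. qt x t * E x t)) (at t)"
      using tendsto_min[OF lim1 lim2] by simp
    show "((\<lambda>s. max (?A s) (?B s)) \<longlongrightarrow> - p * I (\<lambda>x. qt x t * E x t)) (at t)"
      using tendsto_max[OF lim1 lim2] by simp
  qed
  moreover have "I (\<lambda>x. qt x t * E x t) = I (\<lambda>x. qt x t * dW t x)"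
    by (rule I_cong) (simp add: dW_E[OF tT])
  ultimately show ?thesis by (simp add: has_field_derivative_iff)
qed

end

end

section \<open>Combining the gradient and the energy estimates in time\<close>

context flow begin

text \<open>Two functions are shown to decrease: the energy with its sources subtracted, and the
  localized gradient integral plus a multiple of that energy. The multiple is chosen so that the
  energy dissipation cancels the remainder \<open>Bt * e t\<close> of \<open>slice_estimate\<close>.
  The exponent \<open>6 + 2 * a\<close> in \<open>R3\<close> is \<open>2 + 2 * a\<close> plus 4, the
  latter from the square of the bound for \<open>u\<^sup>2 Z\<close>.\<close>

lemma flow_estimate:
  fixes \<eta> :: "real^3 \<Rightarrow> real" and n0 :: "real^3 \<Rightarrow> real^3" and m :: nat
    and \<Psi> :: "real^3 \<Rightarrow> real \<Rightarrow> real" and g :: "real^3 \<Rightarrow> real \<Rightarrow> real^3" and \<Psi>t :: "real^3 \<Rightarrow> real \<Rightarrow> real"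
  assumes p: "p \<ge> 2" and m: "real m \<ge> p + 1"
    and \<eta>: "C1_weight U \<eta> n0 S" "\<And>x. 0 \<le> \<eta> x" "\<And>x. \<eta> x \<le> 1" "\<And>x. norm (n0 x) \<le> C"
    and \<Psi>: "continuous_on (closure U \<times> {0..T}) (\<lambda>(x, t). \<Psi> x t)"
      "continuous_on (closure U \<times> {0..T}) (\<lambda>(x, t). g x t)"
      "continuous_on (closure U \<times> {0..T}) (\<lambda>(x, t). \<Psi>t x t)"
      "\<And>x t. x \<in> U \<Longrightarrow> t \<in> {0..T} \<Longrightarrow> ((\<lambda>x. \<Psi> x t) has_derivative (\<lambda>h. g x t \<bullet> h)) (at x)"
      "\<And>x t. x \<in> U \<Longrightarrow> t \<in> {0..T} \<Longrightarrow> (\<Psi> x has_real_derivative \<Psi>t x t) (at t within {0..T})"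
      "\<And>x t. x \<in> frontier U \<Longrightarrow> t \<in> {0<..T} \<Longrightarrow> \<Psi> x t = u x t"
    and t1: "0 < \<delta>" "\<delta> < t1" "t1 \<le> T"
  defines "D \<equiv> \<lambda>t. I (\<lambda>x. (norm (g x t))\<^sup>2 + \<phi> * \<bar>\<Psi>t x t\<bar>\<^sup>2 + \<phi> * (\<Psi> x t)\<^sup>2)"
    and "B0 \<equiv> (p + 3) * c ^ 3 * \<kappa> powr (2 + 2 * a)"
    and "R3 \<equiv> 2 * c ^ 3 * \<kappa> powr (6 + 2 * a)"
  shows "continuous_on {0..T} D"
    and "\<phi> / p * I (\<lambda>x. norm (P x t1) powr p * \<eta> x ^ m) \<le>
      4 * c * \<kappa>\<^sup>2 * absorb_const a p (M\<^sup>2 * \<kappa>\<^sup>2) (1 / (16 * (1 + p)\<^sup>2 * c * \<kappa>\<^sup>2 * M\<^sup>2))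
          (B0 * (10 * M\<^sup>2 * \<kappa> ^ 4 + (real m * C)\<^sup>2)) (real m / (t1 - \<delta>)) *
        (\<phi> / 2 * I (\<lambda>x. (u x 0 - \<Psi> x 0)\<^sup>2) + R3 * ((1 + M\<^sup>2) * M\<^sup>2 * measure lborel U * T + integral {0..T} D))
      + 2 * B0 * \<kappa> ^ 4 * M powr (p + 2) * measure lborel U * T"
proof -
  have m3: "m \<ge> 3" using m p by linarith
  define Bt where "Bt = absorb_const a p (M\<^sup>2 * \<kappa>\<^sup>2) (1 / (16 * (1 + p)\<^sup>2 * c * \<kappa>\<^sup>2 * M\<^sup>2))
          (B0 * (10 * M\<^sup>2 * \<kappa> ^ 4 + (real m * C)\<^sup>2)) (real m / (t1 - \<delta>))"
  define mU where "mU = measure lborel U"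
  define R where "R = 2 * B0 * \<kappa> ^ 4 * M powr (p + 2) * mU"
  \<comment> \<open>\<open>1 / (4 * c * \<kappa>\<^sup>2)\<close> is the dissipation coefficient of
    the energy; multiplied by \<open>\<Lambda>\<close> it becomes exactly \<open>Bt\<close>.\<close>
  define \<Lambda> where "\<Lambda> = 4 * c * \<kappa>\<^sup>2 * Bt"
  define w where "w x t = u x t - \<Psi> x t" for x t
  define Y where "Y t = I (\<lambda>x. (w x t)\<^sup>2)" for t
  define G where "G t = R3 * ((1 + M\<^sup>2) * M\<^sup>2 * mU * t + integral {0..t} D)" for t
  define e where "e t = I (\<lambda>x. slice.K a (\<lambda>x. u x t) (\<lambda>x. P x t) (\<lambda>x. Z x t) x * (norm (P x t))\<^sup>2)" for t
  have cp: "c > 0" "\<kappa> > 0" using c \<kappa> by auto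
  have mU: "mU \<ge> 0" by (simp add: mU_def)
  have B0: "B0 \<ge> 0" using p c by (simp add: B0_def)
  have Bt: "Bt \<ge> 0" unfolding Bt_def absorb_const_def using B0 t1 by (intro add_nonneg_nonneg mult_nonneg_nonneg) auto
  have \<Lambda>: "\<Lambda> \<ge> 0" using Bt cp by (simp add: \<Lambda>_def)
  have R: "R \<ge> 0" using B0 mU by (simp add: R_def)
  have R31: "R3 \<ge> 1" unfolding R3_def
    using mult_mono[of 1 "c ^ 3" 1 "\<kappa> powr (6 + 2 * a)"] c \<kappa> a by (simp add: ge_one_powr_ge_zero)
  have contD: "continuous_on (closure U \<times> {0..T}) (\<lambda>(x, t). (norm (g x t))\<^sup>2 + \<phi> * \<bar>\<Psi>t x t\<bar>\<^sup>2 + \<phi> * (\<Psi> x t)\<^sup>2)"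
    using \<Psi>(1-3) unfolding case_prod_unfold by (intro continuous_intros)
  show Dc: "continuous_on {0..T} D"
    unfolding D_def by (rule continuous_on_I[OF contD])
  have D0: "D t \<ge> 0" for t unfolding D_def using \<phi> by (intro I_nonneg) auto
  have contw: "continuous_on (closure U \<times> {0..T}) (\<lambda>(x, t). w x t)"
    unfolding w_def using cont_u \<Psi>(1) unfolding case_prod_unfold by (intro continuous_intros)
  have contw2: "continuous_on (closure U \<times> {0..T}) (\<lambda>(x, t). (w x t)\<^sup>2)"
    using contw unfolding case_prod_unfold by (intro continuous_intros)
  have Yc: "continuous_on {0..T} Y" unfolding Y_def[abs_def] by (rule continuous_on_I[OF contw2])
  have Gc: "continuous_on {0..T} G"
  proof -
    have "D integrable_on {0..T}" by (rule integrable_continuous_interval[OF Dc])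
    then have "continuous_on {0..T} (\<lambda>t. integral {0..t} D)" by (rule indefinite_integral_continuous_1)
    then show ?thesis unfolding G_def by (intro continuous_intros)
  qed
  have Gd: "(G has_real_derivative R3 * ((1 + M\<^sup>2) * M\<^sup>2 * mU + D t)) (at t)" if t: "0 < t" "t < T" for t
  proof -
    have "((\<lambda>x. integral {0..x} D) has_real_derivative D t) (at t within {0..T})"
      by (rule integral_has_real_derivative[OF Dc]) (use t in auto)
    moreover have "at t within {0..T} = at t" by (rule at_within_interior) (use t in auto)
    ultimately have "((\<lambda>x. integral {0..x} D) has_real_derivative D t) (at t)" by simp
    moreover have "((\<lambda>t. (1 + M\<^sup>2) * M\<^sup>2 * mU * t) has_real_derivative (1 + M\<^sup>2) * M\<^sup>2 * mU) (at t)"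
      by (rule DERIV_cmult_Id)
    ultimately show ?thesis unfolding G_def[abs_def] by (intro DERIV_cmult DERIV_add)
  qed
  have G0: "G 0 = 0" by (simp add: G_def)
  have GT: "G t \<le> G T" if t: "0 \<le> t" "t \<le> T" for t
  proof -
    have "integral {0..t} D \<le> integral {0..T} D"
      by (rule integral_subset_le) (use t D0 Dc in \<open>auto intro!: integrable_continuous_interval continuous_on_subset[OF Dc]\<close>)
    moreover have "(1 + M\<^sup>2) * M\<^sup>2 * mU * t \<le> (1 + M\<^sup>2) * M\<^sup>2 * mU * T" using t mU by (intro mult_left_mono) auto
    ultimately show ?thesis unfolding G_def using R31 by (intro mult_left_mono[OF add_mono]) auto
  qed
  have Yd: "(Y has_real_derivative 2 * I (\<lambda>x. w x t * (qt x t - \<Psi>t x t))) (at t)" if t: "0 < t" "t < T" for t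
  proof -
    obtain Bw where Bw: "Bw \<ge> 0" "\<And>x \<tau>. x \<in> closure U \<Longrightarrow> \<tau> \<in> {0..T} \<Longrightarrow> norm (w x \<tau>) \<le> Bw"
      by (rule bounded_on_slab[OF contw order_refl]) blast
    obtain Bp where Bp: "Bp \<ge> 0" "\<And>x \<tau>. x \<in> closure U \<Longrightarrow> \<tau> \<in> {0..T} \<Longrightarrow> norm (\<Psi>t x \<tau>) \<le> Bp"
      by (rule bounded_on_slab[OF \<Psi>(3) order_refl]) blast
    obtain Bq where Bq: "Bq \<ge> 0" "\<And>x \<tau>. x \<in> closure U \<Longrightarrow> \<tau> \<in> {t/2..T} \<Longrightarrow> norm (qt x \<tau>) \<le> Bq"
      by (rule bounded_on_slab[OF cont_qt, of "t/2" T]) (use t in auto)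
    have "((\<lambda>t. I (\<lambda>x. (w x t)\<^sup>2)) has_real_derivative I (\<lambda>x. 2 * (w x t * (qt x t - \<Psi>t x t)))) (at t)"
    proof (rule has_real_derivative_set_integral[OF U, of "t/2" t T _ _ "2 * (Bw * (Bq + Bp))"])
      fix \<tau> assume \<tau>: "t / 2 < \<tau>" "\<tau> < T"
      have \<tau>T: "\<tau> \<in> {0..T}" "\<tau> \<in> {0<..T}" "\<tau> \<in> {t/2..T}" using \<tau> t by auto
      show "set_integrable lborel U (\<lambda>x. (w x \<tau>)\<^sup>2)"
        by (rule int_ok[OF continuous_on_time_slice[OF contw2 \<tau>T(1)]])
      show "continuous_on U (\<lambda>x. (w x \<tau>)\<^sup>2)"
        by (rule continuous_on_subset[OF continuous_on_time_slice[OF contw2 \<tau>T(1)] closure_subset])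
      fix x assume x: "x \<in> U"
      have xc: "x \<in> closure U" by (rule in_closure[OF x])
      have "at \<tau> within {0<..T} = at \<tau>" "at \<tau> within {0..T} = at \<tau>"
        by (rule at_within_interior; use \<tau> t in auto)+
      then have "(w x has_real_derivative qt x \<tau> - \<Psi>t x \<tau>) (at \<tau>)"
        unfolding w_def[abs_def] using DERIV_diff[OF der_t[OF x \<tau>T(2)]] \<Psi>(5)[OF x \<tau>T(1)] by simp
      from DERIV_power[OF this, of 2]
      show "((\<lambda>t. (w x t)\<^sup>2) has_real_derivative 2 * (w x \<tau> * (qt x \<tau> - \<Psi>t x \<tau>))) (at \<tau>)"
        by (simp add: mult_ac)
      have "\<bar>w x \<tau>\<bar> * \<bar>qt x \<tau> - \<Psi>t x \<tau>\<bar> \<le> Bw * (Bq + Bp)"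
      proof (rule mult_mono)
        show "\<bar>qt x \<tau> - \<Psi>t x \<tau>\<bar> \<le> Bq + Bp"
          using Bq(2)[OF xc \<tau>T(3)] Bp(2)[OF xc \<tau>T(1)] by simp
      qed (use Bw Bw(2)[OF xc \<tau>T(1)] in auto)
      then show "\<bar>2 * (w x \<tau> * (qt x \<tau> - \<Psi>t x \<tau>))\<bar> \<le> 2 * (Bw * (Bq + Bp))" by (simp add: abs_mult)
    qed (use t in auto)
    then show ?thesis unfolding Y_def[abs_def] by simp
  qed
  have energy: "\<phi> * I (\<lambda>x. w x t * (qt x t - \<Psi>t x t)) \<le> - (1 / (4 * c * \<kappa>\<^sup>2)) * e t + R3 * ((1 + M\<^sup>2) * M\<^sup>2 * mU + D t)"
    if t: "t \<in> {0<..T}" for t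
  proof -
    interpret s: slice U a c \<kappa> M X DX "\<lambda>x. u x t" "\<lambda>x. P x t" "\<lambda>x. H x t" "\<lambda>x. Z x t" J by (rule slice_at[OF t])
    have t': "t \<in> {0..T}" using t by auto
    have c1: "continuous_on (closure U) (\<lambda>x. w x t)" by (rule continuous_on_time_slice[OF contw t'])
    have c2: "continuous_on (closure U) (\<lambda>x. g x t)" by (rule continuous_on_time_slice[OF \<Psi>(2) t'])
    have c3: "continuous_on (closure U) (\<lambda>x. \<Psi>t x t)" by (rule continuous_on_time_slice[OF \<Psi>(3) t'])
    have c4: "continuous_on (closure U) (\<lambda>x. \<Psi> x t)" by (rule continuous_on_time_slice[OF \<Psi>(1) t'])
    define Gg where "Gg = I (\<lambda>x. (norm (g x t))\<^sup>2)"
    define Gp where "Gp = I (\<lambda>x. \<phi> * \<bar>\<Psi>t x t\<bar>\<^sup>2 + \<phi> * (\<Psi> x t)\<^sup>2)"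
    have Gg0: "Gg \<ge> 0" unfolding Gg_def by (intro I_nonneg) auto
    have Gp0: "Gp \<ge> 0" unfolding Gp_def using \<phi> by (intro I_nonneg) auto
    have DG: "D t = Gg + Gp"
    proof -
      have "D t = I (\<lambda>x. (norm (g x t))\<^sup>2 + (\<phi> * \<bar>\<Psi>t x t\<bar>\<^sup>2 + \<phi> * (\<Psi> x t)\<^sup>2))" by (simp add: D_def add.assoc)
      also have "\<dots> = Gg + Gp" unfolding Gg_def Gp_def by (intro I_add continuous_intros c2 c3 c4)
      finally show ?thesis .
    qed
    have es: "I (\<lambda>x. s.divV x * w x t) \<le> - (1 / (4 * c * \<kappa>\<^sup>2)) * e t
        + 2 * c ^ 3 * \<kappa> powr (2 + 2 * a) * ((M\<^sup>2 * \<kappa>\<^sup>2)\<^sup>2 * mU + Gg)"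
      unfolding e_def mU_def Gg_def
    proof (rule s.energy_slice[OF c1 _ c2])
      show "((\<lambda>x. w x t) has_derivative (\<lambda>h. (P x t - g x t) \<bullet> h)) (at x)" if "x \<in> U" for x
        unfolding w_def using has_derivative_diff[OF der_u[OF that t] \<Psi>(4)[OF that t']] by (simp add: inner_diff_left)
      show "w x t = 0" if "x \<in> frontier U" for x using \<Psi>(6)[OF that t] by (simp add: w_def)
    qed
    have "\<phi> * I (\<lambda>x. w x t * (qt x t - \<Psi>t x t)) = I (\<lambda>x. \<phi> * (w x t * (qt x t - \<Psi>t x t)))" by simp
    also have "\<dots> = I (\<lambda>x. s.divV x * w x t + - \<phi> * (w x t * \<Psi>t x t))"
      by (rule I_cong) (simp add: pde[OF _ t, symmetric] algebra_simps)
    also have "\<dots> = I (\<lambda>x. s.divV x * w x t) + I (\<lambda>x. - \<phi> * (w x t * \<Psi>t x t))"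
      by (intro I_add continuous_intros s.cont_divV c1 c3)
    \<comment> \<open>\<open>w\<close> is replaced by \<open>u\<close> and \<open>\<Psi>\<close>,
      and \<open>\<phi> \<le> 1\<close> permits the bound \<open>M\<^sup>2\<close> for the part from
      \<open>u\<close>; the rest is already a part of the density of \<open>D\<close>.\<close>
    also have "I (\<lambda>x. - \<phi> * (w x t * \<Psi>t x t)) \<le> I (\<lambda>x. M\<^sup>2 + (\<phi> * \<bar>\<Psi>t x t\<bar>\<^sup>2 + \<phi> * (\<Psi> x t)\<^sup>2))"
    proof (rule I_mono)
      show "continuous_on (closure U) (\<lambda>x. - \<phi> * (w x t * \<Psi>t x t))" by (intro continuous_intros c1 c3)
      show "continuous_on (closure U) (\<lambda>x. M\<^sup>2 + (\<phi> * \<bar>\<Psi>t x t\<bar>\<^sup>2 + \<phi> * (\<Psi> x t)\<^sup>2))"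
        by (intro continuous_intros c3 c4)
      fix x assume x: "x \<in> U"
      have "- (w x t * \<Psi>t x t) \<le> ((w x t)\<^sup>2 + (\<Psi>t x t)\<^sup>2) / 2"
        using sum_squares_bound[of "- w x t" "\<Psi>t x t"] by simp
      moreover have "(w x t)\<^sup>2 \<le> 2 * (u x t)\<^sup>2 + 2 * (\<Psi> x t)\<^sup>2"
        using sum_squares_bound[of "u x t" "- \<Psi> x t"] by (simp add: w_def power2_diff)
      moreover have "(u x t)\<^sup>2 \<le> M\<^sup>2" using power_mono[OF bd_u[OF x t'], of 2] by simp
      moreover have "0 \<le> (\<Psi>t x t)\<^sup>2" by simp
      ultimately have "- (w x t * \<Psi>t x t) \<le> M\<^sup>2 + (\<Psi>t x t)\<^sup>2 + (\<Psi> x t)\<^sup>2" by argo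
      then have "\<phi> * (- (w x t * \<Psi>t x t)) \<le> \<phi> * (M\<^sup>2 + (\<Psi>t x t)\<^sup>2 + (\<Psi> x t)\<^sup>2)"
        using \<phi> by (intro mult_left_mono) auto
      moreover have "\<phi> * M\<^sup>2 \<le> M\<^sup>2" using \<phi> by (simp add: mult_left_le_one_le)
      ultimately show "- \<phi> * (w x t * \<Psi>t x t) \<le> M\<^sup>2 + (\<phi> * \<bar>\<Psi>t x t\<bar>\<^sup>2 + \<phi> * (\<Psi> x t)\<^sup>2)"
        by (simp add: distrib_left)
    qed
    also have "I (\<lambda>x. M\<^sup>2 + (\<phi> * \<bar>\<Psi>t x t\<bar>\<^sup>2 + \<phi> * (\<Psi> x t)\<^sup>2)) = I (\<lambda>x. M\<^sup>2) + Gp"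
      unfolding Gp_def by (intro I_add continuous_intros c3 c4)
    also have "I (\<lambda>x. M\<^sup>2) = mU * M\<^sup>2" unfolding mU_def by (rule I_const)
    finally have 1: "\<phi> * I (\<lambda>x. w x t * (qt x t - \<Psi>t x t)) \<le> - (1 / (4 * c * \<kappa>\<^sup>2)) * e t
        + (2 * c ^ 3 * \<kappa> powr (2 + 2 * a) * ((M\<^sup>2 * \<kappa>\<^sup>2)\<^sup>2 * mU + Gg) + (mU * M\<^sup>2 + Gp))"
      using es by linarith
    have k4: "\<kappa> powr (2 + 2 * a) * \<kappa> ^ 4 = \<kappa> powr (6 + 2 * a)"
    proof -
      have "\<kappa> ^ 4 = \<kappa> powr 4" using cp by (simp add: powr_numeral)
      then show ?thesis by (simp add: powr_add[symmetric])
    qed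
    have "2 * c ^ 3 * \<kappa> powr (2 + 2 * a) * ((M\<^sup>2 * \<kappa>\<^sup>2)\<^sup>2 * mU) = 2 * c ^ 3 * (\<kappa> powr (2 + 2 * a) * \<kappa> ^ 4) * (M\<^sup>2 * M\<^sup>2 * mU)"
      by (simp add: power2_eq_square power4_eq_xxxx)
    also have "\<dots> = R3 * (M\<^sup>2 * M\<^sup>2 * mU)" by (simp only: k4 R3_def)
    finally have 2: "2 * c ^ 3 * \<kappa> powr (2 + 2 * a) * ((M\<^sup>2 * \<kappa>\<^sup>2)\<^sup>2 * mU) = R3 * (M\<^sup>2 * M\<^sup>2 * mU)" .
    have 3: "2 * c ^ 3 * \<kappa> powr (2 + 2 * a) * Gg \<le> R3 * Gg"
      unfolding R3_def using cp \<kappa> Gg0 a by (intro mult_right_mono mult_left_mono powr_mono) auto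
    have 4: "1 * (mU * M\<^sup>2 + Gp) \<le> R3 * (mU * M\<^sup>2 + Gp)" using R31 mU Gp0 by (intro mult_right_mono) auto
    have "2 * c ^ 3 * \<kappa> powr (2 + 2 * a) * ((M\<^sup>2 * \<kappa>\<^sup>2)\<^sup>2 * mU + Gg) + (mU * M\<^sup>2 + Gp)
      \<le> R3 * (M\<^sup>2 * M\<^sup>2 * mU) + R3 * Gg + R3 * (mU * M\<^sup>2 + Gp)"
      using 2 3 4 by (simp only: distrib_left)
    also have "\<dots> = R3 * ((1 + M\<^sup>2) * M\<^sup>2 * mU + D t)" unfolding DG by (simp add: algebra_simps)
    finally show ?thesis using 1 by linarith
  qed
  have e0: "e t \<ge> 0" if t: "t \<in> {0<..T}" for t
  proof -
    interpret s: slice U a c \<kappa> M X DX "\<lambda>x. u x t" "\<lambda>x. P x t" "\<lambda>x. H x t" "\<lambda>x. Z x t" J by (rule slice_at[OF t])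
    show ?thesis unfolding e_def by (intro I_nonneg) (simp add: s.K_pos less_imp_le)
  qed
  \<comment> \<open>Energy minus accumulated sources. \<open>G\<close> contains the time integral of
    \<open>D\<close>, so \<open>f1\<close> has a derivative to which the slice estimate
    applies.\<close>
  define f1 where "f1 t = \<phi> / 2 * Y t - G t" for t
  have f1d: "(f1 has_real_derivative \<phi> * I (\<lambda>x. w x t * (qt x t - \<Psi>t x t)) - R3 * ((1 + M\<^sup>2) * M\<^sup>2 * mU + D t)) (at t)"
    if t: "0 < t" "t < T" for t
    using DERIV_diff[OF DERIV_cmult[OF Yd[OF t], of "\<phi> / 2"] Gd[OF t]] by (simp add: f1_def[abs_def])
  have f1c: "continuous_on {0..T} f1" unfolding f1_def[abs_def] by (intro continuous_intros Yc Gc)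
  \<comment> \<open>At time 0 only continuity is available, which the open-interval criterion
    permits. Up to \<open>\<delta>\<close> the energy is used alone.\<close>
  have step1: "f1 \<delta> \<le> f1 0"
  proof (rule DERIV_nonpos_imp_decreasing_open[of 0 \<delta> f1])
    show "continuous_on {0..\<delta>} f1" by (rule continuous_on_subset[OF f1c]) (use t1 in auto)
    fix t assume t: "0 < t" "t < \<delta>"
    then have tT: "t < T" "t \<in> {0<..T}" using t1 by auto
    have "0 \<le> (1 / (4 * c * \<kappa>\<^sup>2)) * e t" using e0[OF tT(2)] cp by simp
    then have "\<phi> * I (\<lambda>x. w x t * (qt x t - \<Psi>t x t)) - R3 * ((1 + M\<^sup>2) * M\<^sup>2 * mU + D t) \<le> 0"
      using energy[OF tT(2)] by simp
    then show "\<exists>y. (f1 has_real_derivative y) (at t) \<and> y \<le> 0" using f1d[OF t(1) tT(1)] by blast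
  qed (use t1 in auto)
  let ?n = "\<lambda>x. (real m * \<eta> x ^ (m - 1)) *\<^sub>R n0 x"
  have slice_est: "- I (\<lambda>x. slice.divV DX (\<lambda>x. u x t) (\<lambda>x. P x t) (\<lambda>x. H x t) (\<lambda>x. Z x t) J x *
        (\<theta> ^ m * slice.divW U (\<lambda>x. P x t) (\<lambda>x. H x t) (fpow p) (\<lambda>r. (p - 2) * fpow p r) (\<lambda>x. \<eta> x ^ m) ?n x))
      + real m / (t1 - \<delta>) * I (\<lambda>x. norm (P x t) powr p * (\<theta> * \<eta> x) ^ (m - 1)) \<le> Bt * e t + R"
    if t: "t \<in> {0<..T}" and \<theta>: "0 \<le> \<theta>" "\<theta> \<le> 1" for t \<theta>
  proof -
    interpret s: slice U a c \<kappa> M X DX "\<lambda>x. u x t" "\<lambda>x. P x t" "\<lambda>x. H x t" "\<lambda>x. Z x t" J by (rule slice_at[OF t])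
    have "(\<lambda>x. (\<theta> * \<eta> x) ^ m) = (\<lambda>x. \<theta> ^ m * \<eta> x ^ m)"
      "(\<lambda>x. (\<theta> ^ m * (real m * \<eta> x ^ (m - 1))) *\<^sub>R n0 x) = (\<lambda>x. \<theta> ^ m *\<^sub>R ((real m * \<eta> x ^ (m - 1)) *\<^sub>R n0 x))"
      by (simp_all add: power_mult_distrib)
    moreover have "0 \<le> real m / (t1 - \<delta>)" using t1 by simp
    ultimately show ?thesis
      using s.slice_estimate(2)[OF p m \<eta> \<theta>, of "real m / (t1 - \<delta>)"]
      unfolding Bt_def e_def R_def mU_def B0_def by (simp only: s.divW_scale)
  qed
  have weight: "C1_weight U (\<lambda>x. \<eta> x ^ m) ?n S"
  proof -
    interpret s: slice U a c \<kappa> M X DX "\<lambda>x. u x t1" "\<lambda>x. P x t1" "\<lambda>x. H x t1" "\<lambda>x. Z x t1" J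
      by (rule slice_at) (use t1 in auto)
    show ?thesis using s.slice_estimate(1)[OF p m \<eta>, of 1 0] by simp
  qed
  have \<eta>m0: "0 \<le> \<eta> x ^ m" for x using \<eta> by simp
  define Q where "Q t = I (\<lambda>x. norm (P x t) powr p * \<eta> x ^ m)" for t
  have Q_Ip: "Q = Ip p (\<lambda>x. \<eta> x ^ m)" by (rule ext) (simp add: Q_def Ip_def[OF p weight \<eta>m0])
  define dQ where "dQ t = - p * I (\<lambda>x. qt x t * slice.divW U (\<lambda>x. P x t) (\<lambda>x. H x t) (fpow p) (\<lambda>r. (p - 2) * fpow p r) (\<lambda>x. \<eta> x ^ m) ?n x)" for t
  have Qd: "(Q has_real_derivative dQ t) (at t)" if "0 < t" "t < T" for t
    unfolding Q_Ip dQ_def by (rule Ip_derivative[OF p weight \<eta>m0 that])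
  have Qc: "continuous_on {\<delta>..t1} Q"
    unfolding Q_Ip by (rule continuous_on_subset[OF Ip_cont[OF p weight \<eta>m0 t1(1)]]) (use t1 in auto)
  \<comment> \<open>Linear from 0 at \<open>\<delta>\<close> to 1 at \<open>t1\<close>. Its power
    removes the gradient integral at \<open>\<delta>\<close>, for which no bound is at hand.\<close>
  define \<theta> where "\<theta> t = (t - \<delta>) / (t1 - \<delta>)" for t
  have \<theta>d: "((\<lambda>t. \<theta> t ^ m) has_real_derivative real m * \<theta> t ^ (m - 1) / (t1 - \<delta>)) (at t)" for t
  proof -
    have "(\<theta> has_real_derivative 1 / (t1 - \<delta>)) (at t)"
      unfolding \<theta>_def[abs_def] using t1 by (auto intro!: derivative_eq_intros)
    from DERIV_power[OF this, of m] show ?thesis by simp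
  qed
  have \<theta>c: "continuous_on A (\<lambda>t. \<theta> t ^ m)" for A
    unfolding \<theta>_def using t1 by (intro continuous_intros) auto
  \<comment> \<open>The subtracted \<open>R * t\<close> compensates the constant term of
    \<open>slice_estimate\<close>.\<close>
  define f2 where "f2 t = \<phi> / p * (Q t * \<theta> t ^ m) + \<Lambda> * f1 t - R * t" for t
  have "f2 t1 \<le> f2 \<delta>"
  proof (rule DERIV_nonpos_imp_decreasing_open[of \<delta> t1 f2])
    show "continuous_on {\<delta>..t1} f2"
      unfolding f2_def[abs_def] by (intro continuous_intros Qc \<theta>c continuous_on_subset[OF f1c]) (use t1 in auto)
    fix t assume t: "\<delta> < t" "t < t1"
    then have tT: "0 < t" "t < T" "t \<in> {0<..T}" using t1 by auto
    have \<theta>01: "0 \<le> \<theta> t" "\<theta> t \<le> 1" using t t1 by (auto simp: \<theta>_def)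
    define d1 where "d1 = \<phi> * I (\<lambda>x. w x t * (qt x t - \<Psi>t x t)) - R3 * ((1 + M\<^sup>2) * M\<^sup>2 * mU + D t)"
    have d: "(f2 has_real_derivative \<phi> / p * (dQ t * \<theta> t ^ m + real m * \<theta> t ^ (m - 1) / (t1 - \<delta>) * Q t) + \<Lambda> * d1 - R) (at t)"
      unfolding f2_def[abs_def] d1_def
      using DERIV_diff[OF DERIV_add[OF DERIV_cmult[OF DERIV_mult[OF Qd[OF tT(1,2)] \<theta>d], of "\<phi> / p"]
        DERIV_cmult[OF f1d[OF tT(1,2)], of \<Lambda>]] DERIV_cmult_Id[of R]] .
    have A: "\<phi> / p * (dQ t * \<theta> t ^ m) = - I (\<lambda>x. slice.divV DX (\<lambda>x. u x t) (\<lambda>x. P x t) (\<lambda>x. H x t) (\<lambda>x. Z x t) J x *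
        (\<theta> t ^ m * slice.divW U (\<lambda>x. P x t) (\<lambda>x. H x t) (fpow p) (\<lambda>r. (p - 2) * fpow p r) (\<lambda>x. \<eta> x ^ m) ?n x))"
    proof -
      have "I (\<lambda>x. slice.divV DX (\<lambda>x. u x t) (\<lambda>x. P x t) (\<lambda>x. H x t) (\<lambda>x. Z x t) J x *
        (\<theta> t ^ m * slice.divW U (\<lambda>x. P x t) (\<lambda>x. H x t) (fpow p) (\<lambda>r. (p - 2) * fpow p r) (\<lambda>x. \<eta> x ^ m) ?n x))
        = I (\<lambda>x. (\<phi> * \<theta> t ^ m) * (qt x t * slice.divW U (\<lambda>x. P x t) (\<lambda>x. H x t) (fpow p) (\<lambda>r. (p - 2) * fpow p r) (\<lambda>x. \<eta> x ^ m) ?n x))"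
        by (rule I_cong) (simp add: pde[OF _ tT(3), symmetric])
      then show ?thesis unfolding dQ_def using p by simp
    qed
    \<comment> \<open>The derivative of the time cutoff leaves \<open>\<theta> t ^ (m - 1)\<close>
      beside \<open>\<eta> x ^ m\<close>. As \<open>\<eta> x \<le> 1\<close>, one power of
      \<open>\<eta>\<close> may be dropped, and the two cutoffs form the common power that the slice
      estimate absorbs.\<close>
    have B: "\<phi> / p * (real m * \<theta> t ^ (m - 1) / (t1 - \<delta>) * Q t)
      \<le> real m / (t1 - \<delta>) * I (\<lambda>x. norm (P x t) powr p * (\<theta> t * \<eta> x) ^ (m - 1))"
    proof -
      have Q0: "Q t \<ge> 0" unfolding Q_def by (intro I_nonneg mult_nonneg_nonneg \<eta>m0) auto
      have "\<phi> / p \<le> 1" using \<phi> p by simp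
      then have "\<phi> / p * (real m * \<theta> t ^ (m - 1) / (t1 - \<delta>) * Q t) \<le> 1 * (real m * \<theta> t ^ (m - 1) / (t1 - \<delta>) * Q t)"
        using Q0 \<theta>01 t1 by (intro mult_right_mono) auto
      also have "\<dots> = real m / (t1 - \<delta>) * I (\<lambda>x. \<theta> t ^ (m - 1) * (norm (P x t) powr p * \<eta> x ^ m))"
        by (simp add: Q_def)
      also have "\<dots> \<le> real m / (t1 - \<delta>) * I (\<lambda>x. norm (P x t) powr p * (\<theta> t * \<eta> x) ^ (m - 1))"
      proof (rule mult_left_mono[OF I_mono])
        have \<eta>c: "continuous_on (closure U) \<eta>"
        proof -
          have "(\<eta> has_derivative (\<lambda>h. n0 x \<bullet> h)) (at x)" for x using \<eta>(1) by (auto simp: C1_weight_def)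
          then show ?thesis by (intro continuous_at_imp_continuous_on ballI has_derivative_continuous)
        qed
        have cP: "continuous_on (closure U) (\<lambda>x. norm (P x t) powr p)"
        proof -
          have "continuous_on (closure U) (\<lambda>x. fpow p (norm (P x t)) * (norm (P x t))\<^sup>2)"
            by (intro continuous_intros continuous_on_compose2[OF fpow_cont[OF p]] continuous_on_time_slice[OF cont_P tT(3)]) auto
          then show ?thesis by (simp add: fpow_square)
        qed
        show "continuous_on (closure U) (\<lambda>x. \<theta> t ^ (m - 1) * (norm (P x t) powr p * \<eta> x ^ m))"
          "continuous_on (closure U) (\<lambda>x. norm (P x t) powr p * (\<theta> t * \<eta> x) ^ (m - 1))"
          by (intro continuous_intros cP \<eta>c)+
        fix x
        have "\<eta> x ^ m \<le> \<eta> x ^ (m - 1)" using \<eta> by (intro power_decreasing) auto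
        then have "\<theta> t ^ (m - 1) * norm (P x t) powr p * \<eta> x ^ m \<le> \<theta> t ^ (m - 1) * norm (P x t) powr p * \<eta> x ^ (m - 1)"
          using \<theta>01 by (intro mult_left_mono) auto
        then show "\<theta> t ^ (m - 1) * (norm (P x t) powr p * \<eta> x ^ m) \<le> norm (P x t) powr p * (\<theta> t * \<eta> x) ^ (m - 1)"
          by (simp add: power_mult_distrib mult_ac)
      qed (use t1 in auto)
      finally show ?thesis .
    qed
    have C: "\<Lambda> * d1 \<le> - Bt * e t"
    proof -
      have "d1 \<le> - (1 / (4 * c * \<kappa>\<^sup>2)) * e t" unfolding d1_def using energy[OF tT(3)] by linarith
      then have "\<Lambda> * d1 \<le> \<Lambda> * (- (1 / (4 * c * \<kappa>\<^sup>2)) * e t)" using \<Lambda> by (rule mult_left_mono)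
      also have "\<dots> = - Bt * e t" using cp by (simp add: \<Lambda>_def)
      finally show ?thesis .
    qed
    have "\<phi> / p * (dQ t * \<theta> t ^ m + real m * \<theta> t ^ (m - 1) / (t1 - \<delta>) * Q t) + \<Lambda> * d1 - R
      = \<phi> / p * (dQ t * \<theta> t ^ m) + \<phi> / p * (real m * \<theta> t ^ (m - 1) / (t1 - \<delta>) * Q t) + \<Lambda> * d1 - R"
      by (simp only: distrib_left)
    also have "\<dots> \<le> 0" using A B C slice_est[OF tT(3) \<theta>01] by linarith
    finally show "\<exists>y. (f2 has_real_derivative y) (at t) \<and> y \<le> 0" using d by blast
  qed (use t1 in auto)
  moreover have "f2 \<delta> = \<Lambda> * f1 \<delta> - R * \<delta>" using m3 by (simp add: f2_def \<theta>_def)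
  moreover have "\<Lambda> * f1 \<delta> \<le> \<Lambda> * f1 0" using step1 \<Lambda> by (rule mult_left_mono)
  moreover have "f2 t1 = \<phi> / p * Q t1 + \<Lambda> * f1 t1 - R * t1" using t1 by (simp add: f2_def \<theta>_def)
  \<comment> \<open>The nonnegative energy at \<open>t1\<close> is discarded, and the sources are
    enlarged to the full interval to make the bound uniform in \<open>t1\<close>.\<close>
  moreover have "\<Lambda> * (- G T) \<le> \<Lambda> * f1 t1"
  proof (rule mult_left_mono[OF _ \<Lambda>])
    have "Y t1 \<ge> 0" unfolding Y_def by (intro I_nonneg) auto
    then have "0 \<le> \<phi> / 2 * Y t1" using \<phi> by simp
    then show "- G T \<le> f1 t1" using GT[of t1] t1 by (simp add: f1_def)
  qed
  moreover have "\<Lambda> * f1 0 = \<Lambda> * (\<phi> / 2 * Y 0)" by (simp add: f1_def G0)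
  moreover have "R * t1 \<le> R * T" "0 \<le> R * \<delta>" using R t1 by (auto intro: mult_left_mono)
  ultimately have "\<phi> / p * Q t1 \<le> \<Lambda> * (\<phi> / 2 * Y 0 + G T) + R * T"
    by (simp add: distrib_left)
  then show "\<phi> / p * I (\<lambda>x. norm (P x t1) powr p * \<eta> x ^ m) \<le>
      4 * c * \<kappa>\<^sup>2 * absorb_const a p (M\<^sup>2 * \<kappa>\<^sup>2) (1 / (16 * (1 + p)\<^sup>2 * c * \<kappa>\<^sup>2 * M\<^sup>2))
          (B0 * (10 * M\<^sup>2 * \<kappa> ^ 4 + (real m * C)\<^sup>2)) (real m / (t1 - \<delta>)) *
        (\<phi> / 2 * I (\<lambda>x. (u x 0 - \<Psi> x 0)\<^sup>2) + R3 * ((1 + M\<^sup>2) * M\<^sup>2 * measure lborel U * T + integral {0..T} D))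
      + 2 * B0 * \<kappa> ^ 4 * M powr (p + 2) * measure lborel U * T"
    by (simp add: Q_def \<Lambda>_def Bt_def Y_def w_def G_def mU_def R_def)
qed

end

subsection \<open>Comparison of exponents\<close>

text \<open>Each of the three summands of \<open>absorb_const\<close> is compared with one common
  product of powers. The first contributes the \<open>\<kappa>\<close> exponent
  \<open>2 * p + 2 * a + 2\<close>, the second \<open>(4 + a) * p - 2\<close>, and both lie below
  \<open>(4 + a) * (p + a)\<close>; the third fixes the exponent of \<open>\<tau>\<close>. All three
  contain at least the power \<open>p - 2\<close> of \<open>M\<close>, and any excess goes into
  \<open>M + 1\<close>.\<close>

lemma absorb_const_le:
  fixes a p c b1 b2 :: real
  assumes a: "0 < a" "a < 1" and p: "p \<ge> 2" and c: "c \<ge> 1" and b: "b1 \<ge> 0" "b2 \<ge> 0"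
  obtains b where "b > 0"
    "\<And>\<kappa> M \<tau> B1 B2. \<kappa> \<ge> 1 \<Longrightarrow> M > 0 \<Longrightarrow> \<tau> \<ge> 1 \<Longrightarrow> 0 \<le> B1 \<Longrightarrow> B1 \<le> b1 * (\<kappa> powr (6 + 2 * a) * (M + 1) powr 2) \<Longrightarrow>
      0 \<le> B2 \<Longrightarrow> B2 \<le> b2 * \<tau> \<Longrightarrow>
      absorb_const a p (M\<^sup>2 * \<kappa>\<^sup>2) (1 / (16 * (1 + p)\<^sup>2 * c * \<kappa>\<^sup>2 * M\<^sup>2)) B1 B2
        \<le> b * (\<kappa> powr ((4 + a) * (p + a)) * \<tau> powr (p + a - 1) * M powr (p - 2) * (M + 1) powr p)"
proof -
  \<comment> \<open>The reciprocal of half the absorption parameter is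
    \<open>k1 * \<kappa>\<^sup>2 * M\<^sup>2\<close>.\<close>
  define k1 where "k1 = 32 * (1 + p)\<^sup>2 * c"
  define b3 where "b3 = 3 * b1 + 4 * b2"
  define q where "q = (p + a - 2) / (2 - a)"
  have k1: "k1 > 0" using p c by (simp add: k1_def)
  have b3: "b3 \<ge> 0" using b by (simp add: b3_def)
  have q1: "1 + q = p / (2 - a)" using a by (simp add: q_def field_simps)
  \<comment> \<open>\<open>1 + q = p / (2 - a)\<close> is the power of \<open>\<tau>\<close> in the
    third summand. The comparison uses \<open>2 * (1 - a) \<le> p * (1 - a)\<close> together with
    \<open>a * a \<le> a\<close>.\<close>
  have q2: "p / (2 - a) \<le> p + a - 1"
  proof -
    have "2 * (1 - a) \<le> p * (1 - a)" using p a by (intro mult_right_mono) auto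
    moreover have "a * a \<le> 1 * a" using a by (intro mult_right_mono) auto
    ultimately have "p \<le> (p + a - 1) * (2 - a)" by (simp add: algebra_simps)
    then show ?thesis using a by (simp add: pos_divide_le_eq)
  qed
  have q0: "q \<ge> 0" using a p by (simp add: q_def)
  \<comment> \<open>The third summand contains \<open>M powr (2 * q)\<close>; this inequality
    guarantees that \<open>M powr (p - 2)\<close> can be factored out of it.\<close>
  have q3: "2 * q \<ge> p - 2"
  proof -
    have "(p - 2) * (2 - a) \<le> 2 * (p + a - 2)" using mult_nonneg_nonneg[of a p] p a by (simp add: algebra_simps)
    then show ?thesis using a by (simp add: q_def pos_le_divide_eq)
  qed
  have q4: "q \<le> p - 1"
  proof -
    have "p / (2 - a) \<le> p / 1" using a p by (intro divide_left_mono) auto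
    then show ?thesis using q1 by simp
  qed
  have kexp: "4 * p \<le> (4 + a) * (p + a)" "(4 + a) * p \<le> (4 + a) * (p + a)" "2 * p + 2 * a + 2 \<le> (4 + a) * (p + a)"
    using mult_nonneg_nonneg[of a p] p a by (simp_all add: algebra_simps) (smt (verit) mult_nonneg_nonneg)+
  define b where "b = (b1 + 4 * b2) * 2 powr (p - 2) + b3 powr (p / 2) * k1 powr ((p - 2) / 2)
      + 4 * b2 * (4 * b2 * k1) powr q + 1"
  show ?thesis
  proof (rule that)
    show "b > 0" unfolding b_def using b by (intro add_nonneg_pos add_nonneg_nonneg mult_nonneg_nonneg) auto
    fix \<kappa> M \<tau> B1 B2 :: real
    assume \<kappa>: "\<kappa> \<ge> 1" and M: "M > 0" and \<tau>: "\<tau> \<ge> 1" and B1: "0 \<le> B1" "B1 \<le> b1 * (\<kappa> powr (6 + 2 * a) * (M + 1) powr 2)"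
      and B2: "0 \<le> B2" "B2 \<le> b2 * \<tau>"
    define n where "n = M + 1"
    have n: "n \<ge> 1" "n > 0" "M \<le> n" using M by (auto simp: n_def)
    have k0: "\<kappa> > 0" using \<kappa> by simp
    have t0: "\<tau> > 0" using \<tau> by simp
    have K1: "1 \<le> \<kappa> powr r" "1 \<le> n powr r" "1 \<le> \<tau> powr r" if "r \<ge> 0" for r
      using that \<kappa> n \<tau> by (auto intro: ge_one_powr_ge_zero)
    let ?T = "\<kappa> powr ((4 + a) * (p + a)) * \<tau> powr (p + a - 1) * M powr (p - 2) * n powr p"
    have le_T: "\<kappa> powr r1 * \<tau> powr r2 * M powr (p - 2) * n powr r3 \<le> ?T"
      if "r1 \<le> (4 + a) * (p + a)" "r2 \<le> p + a - 1" "r3 \<le> p" for r1 r2 r3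
      using that \<kappa> \<tau> n
      by (intro mult_mono[OF mult_right_mono[OF mult_mono[OF powr_mono powr_mono]] powr_mono]) auto
    \<comment> \<open>\<open>M\<close> may be small or large, so exactly the power
      \<open>p - 2\<close> of \<open>M\<close> is kept and only the excess is estimated by
      \<open>n\<close>.\<close>
    have Mn: "M powr (r + (p - 2)) \<le> M powr (p - 2) * n powr r" if "r \<ge> 0" for r
    proof -
      have "M powr (r + (p - 2)) = M powr (p - 2) * M powr r" by (simp add: powr_add)
      also have "\<dots> \<le> M powr (p - 2) * n powr r" using M n that by (intro mult_left_mono powr_mono2) auto
      finally show ?thesis .
    qed
    have M2: "M\<^sup>2 = M powr 2" and \<kappa>2: "\<kappa>\<^sup>2 = \<kappa> powr 2" using M k0 by (simp_all add: powr_numeral)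
    let ?B = "\<kappa> powr (6 + 2 * a) * n powr 2 * \<tau>"
    have n2: "n\<^sup>2 = n powr 2" using n by (simp add: powr_numeral)
    have B1': "B1 \<le> b1 * ?B"
    proof -
      have "b1 * (\<kappa> powr (6 + 2 * a) * n powr 2 * 1) \<le> b1 * ?B" using \<tau> b by (intro mult_left_mono) auto
      then show ?thesis using B1 by (simp add: n_def)
    qed
    have one_le: "1 \<le> \<kappa> powr (6 + 2 * a) * n powr 2"
      using mult_mono[OF K1(1)[of "6 + 2 * a"] K1(2)[of 2]] a by simp
    have B2': "B2 \<le> b2 * ?B"
    proof -
      have "b2 * (1 * \<tau>) \<le> b2 * ?B" using one_le \<tau> b by (intro mult_left_mono mult_right_mono) auto
      then show ?thesis using B2 by simp
    qed
    have T1: "(B1 + B2 * (1 + 3 * (M\<^sup>2 * \<kappa>\<^sup>2)) powr a) * (2 * (M\<^sup>2 * \<kappa>\<^sup>2)) powr (p - 2) \<le> (b1 + 4 * b2) * 2 powr (p - 2) * ?T"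
    proof -
      have d: "M\<^sup>2 * \<kappa>\<^sup>2 \<le> n\<^sup>2 * \<kappa>\<^sup>2" "1 \<le> n\<^sup>2 * \<kappa>\<^sup>2"
        using n M \<kappa> mult_mono[OF one_le_power[of n 2] one_le_power[of \<kappa> 2]] by (auto intro!: mult_right_mono power_mono)
      have "(1 + 3 * (M\<^sup>2 * \<kappa>\<^sup>2)) powr a \<le> (4 * (n\<^sup>2 * \<kappa>\<^sup>2)) powr a" using d a by (intro powr_mono2) auto
      also have "\<dots> = 4 powr a * (n powr (2 * a) * \<kappa> powr (2 * a))"
        unfolding n2 \<kappa>2 by (simp only: powr_mult powr_powr mult.commute)
      also have "\<dots> \<le> 4 powr 1 * (n powr 2 * \<kappa> powr (6 + 2 * a))"
        using a n \<kappa> by (intro mult_mono powr_mono mult_nonneg_nonneg) auto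
      finally have "(1 + 3 * (M\<^sup>2 * \<kappa>\<^sup>2)) powr a \<le> 4 * (n powr 2 * \<kappa> powr (6 + 2 * a))" by simp
      then have "B2 * (1 + 3 * (M\<^sup>2 * \<kappa>\<^sup>2)) powr a \<le> b2 * \<tau> * (4 * (n powr 2 * \<kappa> powr (6 + 2 * a)))"
        using B2 b \<tau> by (intro mult_mono) auto
      then have 1: "B1 + B2 * (1 + 3 * (M\<^sup>2 * \<kappa>\<^sup>2)) powr a \<le> (b1 + 4 * b2) * ?B"
        using B1' by (simp add: algebra_simps)
      have "(2 * (M\<^sup>2 * \<kappa>\<^sup>2)) powr (p - 2) = 2 powr (p - 2) * (\<kappa> powr (2 * (p - 2)) * M powr ((p - 2) + (p - 2)))"
        unfolding M2 \<kappa>2 mult_2[of "p - 2", symmetric] by (simp only: powr_mult powr_powr mult_ac)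
      also have "\<dots> \<le> 2 powr (p - 2) * (\<kappa> powr (2 * (p - 2)) * (M powr (p - 2) * n powr (p - 2)))"
        using p by (intro mult_left_mono Mn) auto
      finally have 2: "(2 * (M\<^sup>2 * \<kappa>\<^sup>2)) powr (p - 2) \<le> 2 powr (p - 2) * (\<kappa> powr (2 * (p - 2)) * (M powr (p - 2) * n powr (p - 2)))" .
      have "(B1 + B2 * (1 + 3 * (M\<^sup>2 * \<kappa>\<^sup>2)) powr a) * (2 * (M\<^sup>2 * \<kappa>\<^sup>2)) powr (p - 2)
        \<le> ((b1 + 4 * b2) * ?B) * (2 powr (p - 2) * (\<kappa> powr (2 * (p - 2)) * (M powr (p - 2) * n powr (p - 2))))"
        using 1 2 B1 B2 b \<tau> by (intro mult_mono) auto
      also have "\<dots> = (b1 + 4 * b2) * 2 powr (p - 2) *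
          ((\<kappa> powr (6 + 2 * a) * \<kappa> powr (2 * (p - 2))) * \<tau> powr 1 * M powr (p - 2) * (n powr 2 * n powr (p - 2)))"
        using \<tau> by (simp add: mult_ac)
      also have "\<dots> = (b1 + 4 * b2) * 2 powr (p - 2) *
          (\<kappa> powr (2 * p + 2 * a + 2) * \<tau> powr 1 * M powr (p - 2) * n powr p)"
      proof -
        have "\<kappa> powr (6 + 2 * a) * \<kappa> powr (2 * (p - 2)) = \<kappa> powr (2 * p + 2 * a + 2)"
          by (simp only: powr_add[symmetric]) (simp add: algebra_simps)
        moreover have "n powr 2 * n powr (p - 2) = n powr p" by (simp only: powr_add[symmetric]) simp
        ultimately show ?thesis by simp
      qed
      also have "\<dots> \<le> (b1 + 4 * b2) * 2 powr (p - 2) * ?T"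
        using b p a kexp by (intro mult_left_mono le_T) auto
      finally show ?thesis .
    qed
    have eps: "x / (1 / (16 * (1 + p)\<^sup>2 * c * \<kappa>\<^sup>2 * M\<^sup>2) / 2) = x * (k1 * (\<kappa> powr 2 * M powr 2))" for x
      using M k0 unfolding M2[symmetric] \<kappa>2[symmetric] by (simp add: k1_def)
    have T2: "(3 * B1 + 4 * B2) * ((3 * B1 + 4 * B2) * (k1 * (\<kappa> powr 2 * M powr 2))) powr ((p - 2) / 2)
        \<le> b3 powr (p / 2) * k1 powr ((p - 2) / 2) * ?T"
    proof -
      define B3 where "B3 = 3 * B1 + 4 * B2"
      have B3: "0 \<le> B3" "B3 \<le> b3 * ?B" using B1 B2 B1' B2' by (auto simp: B3_def b3_def algebra_simps)
      have pp: "B3 * B3 powr ((p - 2) / 2) = B3 powr (p / 2)"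
      proof (cases "B3 = 0")
        case False
        then have "B3 * B3 powr ((p - 2) / 2) = B3 powr 1 * B3 powr ((p - 2) / 2)" using B3 by simp
        also have "\<dots> = B3 powr (p / 2)" by (simp only: powr_add[symmetric]) (simp add: field_simps)
        finally show ?thesis .
      qed simp
      have "B3 * (B3 * (k1 * (\<kappa> powr 2 * M powr 2))) powr ((p - 2) / 2)
        = B3 * B3 powr ((p - 2) / 2) * (k1 powr ((p - 2) / 2) * (\<kappa> powr (p - 2) * M powr (p - 2)))"
      proof -
        have "(\<kappa> powr 2 * M powr 2) powr ((p - 2) / 2) = \<kappa> powr (p - 2) * M powr (p - 2)"
          unfolding powr_mult powr_powr by (simp only: times_divide_eq_right nonzero_mult_div_cancel_left zero_neq_numeral[symmetric] not_False_eq_True)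
        then show ?thesis using B3 k1 by (simp only: powr_mult mult.assoc)
      qed
      also have "\<dots> \<le> (b3 * ?B) powr (p / 2) * (k1 powr ((p - 2) / 2) * (\<kappa> powr (p - 2) * M powr (p - 2)))"
        unfolding pp using B3 p by (intro mult_right_mono powr_mono2) auto
      also have "(b3 * ?B) powr (p / 2) = b3 powr (p / 2) * (\<kappa> powr ((6 + 2 * a) * (p / 2)) * n powr p * \<tau> powr (p / 2))"
        using b3 t0 by (simp add: powr_mult powr_powr)
      also have "b3 powr (p / 2) * (\<kappa> powr ((6 + 2 * a) * (p / 2)) * n powr p * \<tau> powr (p / 2)) * (k1 powr ((p - 2) / 2) * (\<kappa> powr (p - 2) * M powr (p - 2)))
        = b3 powr (p / 2) * k1 powr ((p - 2) / 2) * ((\<kappa> powr ((6 + 2 * a) * (p / 2)) * \<kappa> powr (p - 2)) * \<tau> powr (p / 2) * M powr (p - 2) * n powr p)"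
        by (simp only: mult_ac)
      also have "\<kappa> powr ((6 + 2 * a) * (p / 2)) * \<kappa> powr (p - 2) = \<kappa> powr ((4 + a) * p - 2)"
        by (simp only: powr_add[symmetric]) (simp add: algebra_simps)
      also have "b3 powr (p / 2) * k1 powr ((p - 2) / 2) * (\<kappa> powr ((4 + a) * p - 2) * \<tau> powr (p / 2) * M powr (p - 2) * n powr p)
        \<le> b3 powr (p / 2) * k1 powr ((p - 2) / 2) * ?T"
        by (intro mult_left_mono le_T order_trans[OF _ kexp(2)]) (use p a in auto)
      finally show ?thesis by (simp add: B3_def)
    qed
    have T3: "4 * B2 * (4 * B2 * (k1 * (\<kappa> powr 2 * M powr 2))) powr q \<le> 4 * b2 * (4 * b2 * k1) powr q * ?T"
    proof -
      have "4 * B2 * (4 * B2 * (k1 * (\<kappa> powr 2 * M powr 2))) powr q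
        \<le> 4 * (b2 * \<tau>) * (4 * (b2 * \<tau>) * (k1 * (\<kappa> powr 2 * M powr 2))) powr q"
        using B2 q0 k1 \<tau> b by (intro mult_mono powr_mono2 mult_nonneg_nonneg mult_left_mono mult_right_mono) auto
      also have "\<dots> = 4 * b2 * (4 * b2 * k1) powr q * (\<kappa> powr (2 * q) * (\<tau> powr 1 * \<tau> powr q) * M powr (2 * q))"
        using b k1 t0 by (simp add: powr_mult powr_powr mult_ac)
      also have "\<tau> powr 1 * \<tau> powr q = \<tau> powr (p / (2 - a))" unfolding q1[symmetric] by (simp only: powr_add)
      also have "4 * b2 * (4 * b2 * k1) powr q * (\<kappa> powr (2 * q) * \<tau> powr (p / (2 - a)) * M powr (2 * q))
        \<le> 4 * b2 * (4 * b2 * k1) powr q * (\<kappa> powr (2 * q) * \<tau> powr (p / (2 - a)) * (M powr (p - 2) * n powr (2 * q - (p - 2))))"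
        using Mn[of "2 * q - (p - 2)"] q3 b by (intro mult_left_mono) auto
      also have "\<dots> = 4 * b2 * (4 * b2 * k1) powr q * (\<kappa> powr (2 * q) * \<tau> powr (p / (2 - a)) * M powr (p - 2) * n powr (2 * q - (p - 2)))"
        by (simp only: mult_ac)
      also have "\<dots> \<le> 4 * b2 * (4 * b2 * k1) powr q * ?T"
        using b kexp q2 q4 p by (intro mult_left_mono le_T) auto
      finally show ?thesis .
    qed
    have T4: "0 \<le> ?T" by simp
    have "absorb_const a p (M\<^sup>2 * \<kappa>\<^sup>2) (1 / (16 * (1 + p)\<^sup>2 * c * \<kappa>\<^sup>2 * M\<^sup>2)) B1 B2 \<le>
      (b1 + 4 * b2) * 2 powr (p - 2) * ?T + b3 powr (p / 2) * k1 powr ((p - 2) / 2) * ?T + 4 * b2 * (4 * b2 * k1) powr q * ?T"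
      unfolding absorb_const_def eps q_def[symmetric] using T1 T2 T3 by linarith
    also have "\<dots> \<le> b * ?T" using T4 unfolding b_def by (simp only: distrib_right)
    finally show "absorb_const a p (M\<^sup>2 * \<kappa>\<^sup>2) (1 / (16 * (1 + p)\<^sup>2 * c * \<kappa>\<^sup>2 * M\<^sup>2)) B1 B2
        \<le> b * (\<kappa> powr ((4 + a) * (p + a)) * \<tau> powr (p + a - 1) * M powr (p - 2) * (M + 1) powr p)"
      by (simp add: n_def)
  qed
qed

text \<open>The prefactor \<open>\<kappa>\<^sup>2\<close> and the energy factor
  \<open>\<kappa> powr (6 + 2 * a)\<close> together add \<open>2 * (4 + a)\<close>, which turns
  \<open>(4 + a) * (p + a)\<close> into \<open>(4 + a) * (p + a + 2)\<close>. The energy also adds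
  two powers of \<open>M + 1\<close>. \<open>C0\<close> is chosen before \<open>\<kappa>\<close>,
  \<open>M\<close>, \<open>\<tau>\<close> and the data quantities.\<close>

lemma total_constant_le:
  fixes a p c m C mU :: real
  assumes a: "0 < a" "a < 1" and p: "p \<ge> 2" and c: "c \<ge> 1" and m: "m \<ge> 0" and mU: "mU \<ge> 0"
  obtains C0 where "C0 > 0"
    "\<And>\<kappa> M \<tau> B2 Y ED T N0. \<kappa> \<ge> 1 \<Longrightarrow> M > 0 \<Longrightarrow> \<tau> \<ge> 1 \<Longrightarrow> 0 \<le> B2 \<Longrightarrow> B2 \<le> 2 * m * \<tau> \<Longrightarrow>
      0 \<le> Y \<Longrightarrow> 0 \<le> ED \<Longrightarrow> 0 \<le> T \<Longrightarrow> N0 = Y + T * M\<^sup>2 + ED \<Longrightarrow>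
      4 * c * \<kappa>\<^sup>2 * absorb_const a p (M\<^sup>2 * \<kappa>\<^sup>2) (1 / (16 * (1 + p)\<^sup>2 * c * \<kappa>\<^sup>2 * M\<^sup>2))
          ((p + 3) * c ^ 3 * \<kappa> powr (2 + 2 * a) * (10 * M\<^sup>2 * \<kappa> ^ 4 + (m * C)\<^sup>2)) B2 *
        (Y / 2 + 2 * c ^ 3 * \<kappa> powr (6 + 2 * a) * ((1 + M\<^sup>2) * M\<^sup>2 * mU * T + ED))
      + 2 * ((p + 3) * c ^ 3 * \<kappa> powr (2 + 2 * a)) * \<kappa> ^ 4 * M powr (p + 2) * mU * T
      \<le> C0 * (\<kappa> powr ((4 + a) * (p + a + 2)) * \<tau> powr (p + a - 1) * M powr (p - 2) * (M + 1) powr (p + 2)) * N0"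
proof -
  define b0 where "b0 = (p + 3) * c ^ 3"
  define b1 where "b1 = b0 * (10 + (m * C)\<^sup>2)"
  have b0: "b0 \<ge> 0" using p c by (simp add: b0_def)
  have b1: "b1 \<ge> 0" unfolding b1_def using b0 by (intro mult_nonneg_nonneg add_nonneg_nonneg) auto
  obtain b where b: "b > 0" "\<And>\<kappa> M \<tau> B1 B2. \<kappa> \<ge> 1 \<Longrightarrow> M > 0 \<Longrightarrow> \<tau> \<ge> 1 \<Longrightarrow> 0 \<le> B1 \<Longrightarrow> B1 \<le> b1 * (\<kappa> powr (6 + 2 * a) * (M + 1) powr 2) \<Longrightarrow>
      0 \<le> B2 \<Longrightarrow> B2 \<le> (2 * m) * \<tau> \<Longrightarrow>
      absorb_const a p (M\<^sup>2 * \<kappa>\<^sup>2) (1 / (16 * (1 + p)\<^sup>2 * c * \<kappa>\<^sup>2 * M\<^sup>2)) B1 B2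
        \<le> b * (\<kappa> powr ((4 + a) * (p + a)) * \<tau> powr (p + a - 1) * M powr (p - 2) * (M + 1) powr p)"
    by (rule absorb_const_le[OF a p c b1, of "2 * m"]) (use m in auto)
  define r where "r = 1 + 2 * c ^ 3 * (mU + 1)"
  have r: "r \<ge> 1" using c mU by (simp add: r_def)
  show ?thesis
  proof (rule that)
    show "4 * c * b * r + 2 * b0 * mU > 0" using c b r b0 mU by (intro add_pos_nonneg mult_pos_pos mult_nonneg_nonneg) auto
    fix \<kappa> M \<tau> B2 Y ED T N0 :: real
    assume h: "\<kappa> \<ge> 1" "M > 0" "\<tau> \<ge> 1" "0 \<le> B2" "B2 \<le> 2 * m * \<tau>" "0 \<le> Y" "0 \<le> ED" "0 \<le> T" "N0 = Y + T * M\<^sup>2 + ED"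
    define n where "n = M + 1"
    have n: "n \<ge> 1" "M \<le> n" using h by (auto simp: n_def)
    have k0: "\<kappa> > 0" using h by simp
    have k4: "\<kappa> powr (2 + 2 * a) * \<kappa> ^ 4 = \<kappa> powr (6 + 2 * a)"
    proof -
      have "\<kappa> ^ 4 = \<kappa> powr 4" using k0 by (simp add: powr_numeral)
      then show ?thesis by (simp add: powr_add[symmetric])
    qed
    have n2: "n powr 2 = n\<^sup>2" using n by (simp add: powr_numeral)
    have MM: "1 + M\<^sup>2 \<le> n\<^sup>2" "M\<^sup>2 \<le> n\<^sup>2" "1 \<le> n\<^sup>2" using h by (auto simp: n_def power2_eq_square algebra_simps)
    define K where "K = \<kappa> powr (6 + 2 * a)"
    have K: "K \<ge> 1" unfolding K_def using h a by (intro ge_one_powr_ge_zero) auto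
    define B1 where "B1 = b0 * \<kappa> powr (2 + 2 * a) * (10 * M\<^sup>2 * \<kappa> ^ 4 + (m * C)\<^sup>2)"
    have B1: "0 \<le> B1" unfolding B1_def using b0 by (intro mult_nonneg_nonneg add_nonneg_nonneg) auto
    have B1': "B1 \<le> b1 * (K * n powr 2)"
    proof -
      have "1 \<le> n\<^sup>2 * \<kappa> ^ 4" using mult_mono[OF MM(3) one_le_power[OF h(1), of 4]] by simp
      then have "(m * C)\<^sup>2 * 1 \<le> (m * C)\<^sup>2 * (n\<^sup>2 * \<kappa> ^ 4)" by (intro mult_left_mono) auto
      moreover have "M\<^sup>2 * \<kappa> ^ 4 \<le> n\<^sup>2 * \<kappa> ^ 4" using MM by (intro mult_right_mono) auto
      ultimately have "10 * M\<^sup>2 * \<kappa> ^ 4 + (m * C)\<^sup>2 \<le> (10 + (m * C)\<^sup>2) * (n\<^sup>2 * \<kappa> ^ 4)" by (simp add: distrib_right)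
      then have "B1 \<le> b0 * \<kappa> powr (2 + 2 * a) * ((10 + (m * C)\<^sup>2) * (n\<^sup>2 * \<kappa> ^ 4))"
        unfolding B1_def using b0 by (intro mult_left_mono) auto
      also have "\<dots> = b1 * ((\<kappa> powr (2 + 2 * a) * \<kappa> ^ 4) * n\<^sup>2)" by (simp only: b1_def mult_ac)
      finally show ?thesis by (simp only: k4 n2 K_def)
    qed
    have N0: "N0 \<ge> 0" "Y \<le> N0" "T * M\<^sup>2 \<le> N0" "T * M\<^sup>2 + ED \<le> N0" using h by auto
    \<comment> \<open>The length \<open>T\<close> occurs only together with
      \<open>M\<^sup>2\<close>, and \<open>T * M\<^sup>2\<close> is a part of \<open>N0\<close>; the
      remaining factor \<open>1 + M\<^sup>2\<close> is at most \<open>n\<^sup>2\<close>.\<close>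
    have en: "Y / 2 + 2 * c ^ 3 * K * ((1 + M\<^sup>2) * M\<^sup>2 * mU * T + ED) \<le> r * (K * n powr 2 * N0)"
    proof -
      have "1 * 1 \<le> K * n\<^sup>2" using K MM by (intro mult_mono) auto
      then have "1 * N0 \<le> K * n\<^sup>2 * N0" using N0 by (intro mult_right_mono) auto
      then have 1: "Y / 2 \<le> K * n\<^sup>2 * N0" using N0 h(6) by linarith
      have "(1 + M\<^sup>2) * (T * M\<^sup>2) \<le> n\<^sup>2 * N0" using MM N0 h by (intro mult_mono) auto
      then have "mU * ((1 + M\<^sup>2) * (T * M\<^sup>2)) \<le> mU * (n\<^sup>2 * N0)" using mU by (rule mult_left_mono)
      moreover have "1 * ED \<le> n\<^sup>2 * N0" using MM N0 h by (intro mult_mono) auto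
      ultimately have "mU * ((1 + M\<^sup>2) * (T * M\<^sup>2)) + ED \<le> (mU + 1) * (n\<^sup>2 * N0)" by (simp add: distrib_right)
      moreover have "mU * ((1 + M\<^sup>2) * (T * M\<^sup>2)) = (1 + M\<^sup>2) * M\<^sup>2 * mU * T" by (simp only: mult_ac)
      ultimately have "(1 + M\<^sup>2) * M\<^sup>2 * mU * T + ED \<le> (mU + 1) * (n\<^sup>2 * N0)" by simp
      then have "2 * c ^ 3 * K * ((1 + M\<^sup>2) * M\<^sup>2 * mU * T + ED) \<le> 2 * c ^ 3 * K * ((mU + 1) * (n\<^sup>2 * N0))"
        using c K by (intro mult_left_mono) auto
      then show ?thesis using 1 by (simp add: n2 r_def algebra_simps)
    qed
    let ?T = "\<kappa> powr ((4 + a) * (p + a + 2)) * \<tau> powr (p + a - 1) * M powr (p - 2) * n powr (p + 2)"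
    define A where "A = absorb_const a p (M\<^sup>2 * \<kappa>\<^sup>2) (1 / (16 * (1 + p)\<^sup>2 * c * \<kappa>\<^sup>2 * M\<^sup>2)) B1 B2"
    have A: "A \<le> b * (\<kappa> powr ((4 + a) * (p + a)) * \<tau> powr (p + a - 1) * M powr (p - 2) * n powr p)"
      unfolding A_def n_def by (rule b(2)) (use h B1 B1' in \<open>auto simp: K_def n_def\<close>)
    have k2: "\<kappa>\<^sup>2 = \<kappa> powr 2" using k0 by (simp add: powr_numeral)
    have "4 * c * \<kappa>\<^sup>2 * A * (Y / 2 + 2 * c ^ 3 * K * ((1 + M\<^sup>2) * M\<^sup>2 * mU * T + ED)) \<le>
      4 * c * \<kappa>\<^sup>2 * (b * (\<kappa> powr ((4 + a) * (p + a)) * \<tau> powr (p + a - 1) * M powr (p - 2) * n powr p)) * (r * (K * n powr 2 * N0))"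
      using A en c b h K mU by (intro mult_mono mult_left_mono mult_nonneg_nonneg add_nonneg_nonneg) auto
    also have "\<dots> = 4 * c * b * r * ((\<kappa> powr ((4 + a) * (p + a)) * \<kappa> powr 2 * \<kappa> powr (6 + 2 * a)) * \<tau> powr (p + a - 1) * M powr (p - 2) * (n powr p * n powr 2)) * N0"
      by (simp only: k2 K_def mult_ac)
    also have "\<kappa> powr ((4 + a) * (p + a)) * \<kappa> powr 2 * \<kappa> powr (6 + 2 * a) = \<kappa> powr ((4 + a) * (p + a + 2))"
      by (simp only: powr_add[symmetric]) (simp add: algebra_simps)
    also have "n powr p * n powr 2 = n powr (p + 2)" by (simp only: powr_add[symmetric])
    finally have 1: "4 * c * \<kappa>\<^sup>2 * A * (Y / 2 + 2 * c ^ 3 * K * ((1 + M\<^sup>2) * M\<^sup>2 * mU * T + ED)) \<le> 4 * c * b * r * ?T * N0" .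
    \<comment> \<open>The power \<open>p + 2\<close> of \<open>M\<close> is split as
      \<open>p - 2\<close>, 2 and 2: the first is kept, the second is estimated by \<open>n\<close>,
      the third joins \<open>T\<close> to become part of \<open>N0\<close>.\<close>
    have "2 * (b0 * \<kappa> powr (2 + 2 * a)) * \<kappa> ^ 4 * M powr (p + 2) * mU * T
      = 2 * b0 * mU * ((\<kappa> powr (2 + 2 * a) * \<kappa> ^ 4) * 1 * (M powr (p - 2) * M powr 2 * M powr 2) * T)"
    proof -
      have "M powr (p + 2) = M powr (p - 2) * M powr 2 * M powr 2" by (simp only: powr_add[symmetric]) simp
      then show ?thesis by (simp only: mult_ac mult_1_left mult_1_right)
    qed
    also have "\<dots> = 2 * b0 * mU * (\<kappa> powr (6 + 2 * a) * 1 * M powr (p - 2) * M powr 2 * (T * M powr 2))"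
      unfolding k4 by (simp only: mult_ac)
    also have "\<dots> \<le> 2 * b0 * mU * (\<kappa> powr ((4 + a) * (p + a + 2)) * \<tau> powr (p + a - 1) * M powr (p - 2) * n powr (p + 2) * N0)"
    proof (rule mult_left_mono)
      have "6 + 2 * a \<le> (4 + a) * (p + a + 2)"
        using mult_mono[of 4 "4 + a" 4 "p + a + 2"] a p by simp
      moreover have "M powr 2 \<le> n powr (p + 2)"
        by (rule order_trans[OF powr_mono2[of 2 M n] powr_mono]) (use n h p in auto)
      moreover have "1 \<le> \<tau> powr (p + a - 1)" using h a p by (intro ge_one_powr_ge_zero) auto
      moreover have "T * M powr 2 \<le> N0" using N0 h by (simp add: powr_numeral)
      ultimately show "\<kappa> powr (6 + 2 * a) * 1 * M powr (p - 2) * M powr 2 * (T * M powr 2) \<le>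
        \<kappa> powr ((4 + a) * (p + a + 2)) * \<tau> powr (p + a - 1) * M powr (p - 2) * n powr (p + 2) * N0"
        using h by (intro mult_mono[OF mult_mono[OF mult_right_mono[OF mult_mono[OF powr_mono]]]]) auto
    qed (use b0 mU in auto)
    finally have 2: "2 * (b0 * \<kappa> powr (2 + 2 * a)) * \<kappa> ^ 4 * M powr (p + 2) * mU * T \<le> 2 * b0 * mU * (?T * N0)" .
    show "4 * c * \<kappa>\<^sup>2 * absorb_const a p (M\<^sup>2 * \<kappa>\<^sup>2) (1 / (16 * (1 + p)\<^sup>2 * c * \<kappa>\<^sup>2 * M\<^sup>2))
          ((p + 3) * c ^ 3 * \<kappa> powr (2 + 2 * a) * (10 * M\<^sup>2 * \<kappa> ^ 4 + (m * C)\<^sup>2)) B2 *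
        (Y / 2 + 2 * c ^ 3 * \<kappa> powr (6 + 2 * a) * ((1 + M\<^sup>2) * M\<^sup>2 * mU * T + ED))
      + 2 * ((p + 3) * c ^ 3 * \<kappa> powr (2 + 2 * a)) * \<kappa> ^ 4 * M powr (p + 2) * mU * T
      \<le> (4 * c * b * r + 2 * b0 * mU) * (\<kappa> powr ((4 + a) * (p + a + 2)) * \<tau> powr (p + a - 1) * M powr (p - 2) * (M + 1) powr (p + 2)) * N0"
      using 1 2 unfolding A_def B1_def K_def b0_def n_def by (simp only: distrib_right mult.assoc)
  qed
qed

text \<open>Since \<open>\<kappa>\<close>, \<open>\<tau>\<close> and \<open>M + 1\<close> are at
  least 1, enlarging their exponents is harmless, and each of the bounds is weaker than the
  hypothesis on \<open>V\<close>. Only the powers of \<open>M\<close> itself need care, because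
  \<open>M\<close> may be below 1.\<close>

lemma exponent_cases:
  fixes a s \<kappa> \<tau> M N0 Ns V :: real
  assumes a: "0 < a" "a < 1" and s: "s \<ge> 2" and \<kappa>: "\<kappa> \<ge> 1" and \<tau>: "\<tau> \<ge> 1" and M: "M > 0" and Ns: "Ns \<ge> 0"
    and N0: "0 \<le> N0" "N0 \<le> (M + 1)\<^sup>2 * Ns"
    and V: "V \<le> C * (\<kappa> powr ((4 + a) * (s + a + 2)) * \<tau> powr (s + a - 1) * M powr (s - 2) * (M + 1) powr (s + 2)) * N0"
    and C: "C \<ge> 0"
  shows "V \<le> C * (if s = 2 then
             \<kappa> powr ((4 + a)\<^sup>2) * \<tau> powr (1 + a) * (M + 1) powr (2 * (3 + a)) *
             (M powr a * (M + 1) powr (2 + a) * Ns + N0)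
           else if s \<le> 4 - a then
             \<kappa> powr ((4 + a) * (s + a + 2)) * \<tau> powr (s + a - 1) *
             M powr (s - 2) * (M + 1) powr (3 * s + 4 * a + 2) * Ns
           else if s \<le> 4 then
             \<kappa> powr ((4 + a) * (s + a + 4)) * \<tau> powr (s + a + 1) *
             M powr (s - 2) * (M + 1) powr (3 * s + 4 * a + 10) * Ns
           else
             \<kappa> powr ((4 + a) * (s + a + 4)) * \<tau> powr (s + a + 1) *
             M\<^sup>2 * (M + 1) powr (4 * s + 4 * a + 6) * Ns)" (is "V \<le> C * ?R")
    and "V \<le> C * (\<kappa> powr ((4 + a) * (s + a + 4)) * \<tau> powr (s + a + 1) * (M + 1) powr (4 * (s + a + 2)) * Ns)"
proof -
  define n where "n = M + 1"
  have n: "n \<ge> 1" "M \<le> n" using M by (auto simp: n_def)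
  have le: "\<kappa> powr r1 * \<tau> powr r2 * y * n powr r3 * Ns \<le> \<kappa> powr r1' * \<tau> powr r2' * y' * n powr r3' * Ns"
    if "r1 \<le> r1'" "r2 \<le> r2'" "r3 \<le> r3'" "0 \<le> y" "y \<le> y'" for r1 r2 r3 r1' r2' r3' y y'
    using that \<kappa> \<tau> n Ns by (intro mult_mono powr_mono mult_nonneg_nonneg) auto
  have e: "(4 + a) * (s + a + 2) \<le> (4 + a) * (s + a + 4)" using a by (intro mult_left_mono) auto
  \<comment> \<open>Replacing \<open>N0\<close> by \<open>Ns\<close> costs two powers of
    \<open>M + 1\<close>. The case \<open>s = 2\<close> starts from \<open>V\<close> itself, since
    its bound retains \<open>N0\<close>.\<close>
  have VN: "V \<le> C * (\<kappa> powr ((4 + a) * (s + a + 2)) * \<tau> powr (s + a - 1) * M powr (s - 2) * n powr (s + 4) * Ns)"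
  proof -
    have n2: "n powr 2 = n\<^sup>2" using n by (simp add: powr_numeral)
    have nn: "n powr (s + 4) = n powr (s + 2) * n\<^sup>2" unfolding n2[symmetric] by (simp only: powr_add[symmetric] add.assoc) simp
    have "V \<le> C * (\<kappa> powr ((4 + a) * (s + a + 2)) * \<tau> powr (s + a - 1) * M powr (s - 2) * n powr (s + 2)) * (n\<^sup>2 * Ns)"
      using N0 C by (intro order_trans[OF V[folded n_def]] mult_left_mono) (auto simp: n_def)
    then show ?thesis by (simp only: nn mult_ac)
  qed
  have Mn: "M powr (s - 2) \<le> n powr (s - 2)" using M n s by (intro powr_mono2) auto
  show "V \<le> C * ?R"
  proof (cases "s = 2")
    case True
    \<comment> \<open>At \<open>s = 2\<close> the exponents coincide with those displayed, and
      \<open>M powr (s - 2)\<close> is 1 because \<open>M > 0\<close>.\<close>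
    have e1: "(4 + a) * (s + a + 2) = (4 + a)\<^sup>2" "s + a - 1 = 1 + a" using True by (simp_all add: power2_eq_square algebra_simps)
    have "V \<le> C * (\<kappa> powr ((4 + a)\<^sup>2) * \<tau> powr (1 + a) * n powr (s + 2) * N0)"
      using V M True unfolding e1 by (simp add: n_def mult.assoc)
    also have "\<dots> \<le> C * (\<kappa> powr ((4 + a)\<^sup>2) * \<tau> powr (1 + a) * n powr (2 * (3 + a)) * (M powr a * n powr (2 + a) * Ns + N0))"
      using N0 Ns C n True a by (intro mult_left_mono[OF mult_mono[OF mult_left_mono[OF powr_mono]] C]) auto
    finally show ?thesis using True by (simp add: n_def)
  next
    case False
    consider "s \<le> 4 - a" | "\<not> s \<le> 4 - a" "s \<le> 4" | "\<not> s \<le> 4 - a" "\<not> s \<le> 4" by blast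
    then show ?thesis
    proof cases
      case 1
      have "V \<le> C * (\<kappa> powr ((4 + a) * (s + a + 2)) * \<tau> powr (s + a - 1) * M powr (s - 2) * n powr (3 * s + 4 * a + 2) * Ns)"
        using s a by (intro order_trans[OF VN] mult_left_mono[OF le C]) auto
      then show ?thesis using False 1 by (simp add: n_def)
    next
      case 2
      have "V \<le> C * (\<kappa> powr ((4 + a) * (s + a + 4)) * \<tau> powr (s + a + 1) * M powr (s - 2) * n powr (3 * s + 4 * a + 10) * Ns)"
        using s a e by (intro order_trans[OF VN] mult_left_mono[OF le C]) auto
      then show ?thesis using False 2 by (simp add: n_def)
    next
      case 3
      \<comment> \<open>Only two powers of \<open>M\<close> are to remain for \<open>s > 4\<close>;
        the surplus \<open>s - 4\<close>, now positive, goes into \<open>n\<close>.\<close>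
      have M2: "M powr (s - 2) \<le> M\<^sup>2 * n powr (s - 4)"
      proof -
        have "M powr (s - 2) = M powr 2 * M powr (s - 4)" by (simp only: powr_add[symmetric]) simp
        also have "\<dots> \<le> M powr 2 * n powr (s - 4)" using M n 3 by (intro mult_left_mono powr_mono2) auto
        finally show ?thesis using M by (simp add: powr_numeral)
      qed
      have nn: "n powr (s - 4) * n powr (s + 4) = n powr (2 * s)" by (simp only: powr_add[symmetric]) simp
      have "V \<le> C * (\<kappa> powr ((4 + a) * (s + a + 2)) * \<tau> powr (s + a - 1) * (M\<^sup>2 * n powr (s - 4)) * n powr (s + 4) * Ns)"
        using M2 by (intro order_trans[OF VN] mult_left_mono[OF le C]) auto
      also have "\<dots> = C * (\<kappa> powr ((4 + a) * (s + a + 2)) * \<tau> powr (s + a - 1) * M\<^sup>2 * (n powr (s - 4) * n powr (s + 4)) * Ns)"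
        by (simp only: mult_ac)
      also have "\<dots> \<le> C * (\<kappa> powr ((4 + a) * (s + a + 4)) * \<tau> powr (s + a + 1) * M\<^sup>2 * n powr (4 * s + 4 * a + 6) * Ns)"
        unfolding nn using s a e by (intro mult_left_mono[OF le C]) auto
      finally show ?thesis using False 3 by (simp add: n_def)
    qed
  qed
  have nn: "n powr (s - 2) * n powr (s + 4) = n powr (2 * s + 2)" by (simp only: powr_add[symmetric]) simp
  have "V \<le> C * (\<kappa> powr ((4 + a) * (s + a + 2)) * \<tau> powr (s + a - 1) * n powr (s - 2) * n powr (s + 4) * Ns)"
    using Mn by (intro order_trans[OF VN] mult_left_mono[OF le C]) auto
  also have "\<dots> = C * (\<kappa> powr ((4 + a) * (s + a + 2)) * \<tau> powr (s + a - 1) * 1 * (n powr (s - 2) * n powr (s + 4)) * Ns)"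
    by (simp only: mult_ac mult_1_left)
  also have "\<dots> \<le> C * (\<kappa> powr ((4 + a) * (s + a + 4)) * \<tau> powr (s + a + 1) * 1 * n powr (4 * (s + a + 2)) * Ns)"
    unfolding nn using s a e by (intro mult_left_mono[OF le C]) auto
  finally show "V \<le> C * (\<kappa> powr ((4 + a) * (s + a + 4)) * \<tau> powr (s + a + 1) * (M + 1) powr (4 * (s + a + 2)) * Ns)"
    by (simp add: n_def)
qed

subsection \<open>Solutions of the initial boundary value problem\<close>

lemma grad_eqI:
  assumes "(f has_derivative (\<lambda>h. p \<bullet> h)) (at x)"
  shows "grad f x = p"
  by (simp add: grad_def frechet_derivative_at[OF assms, symmetric] vec_eq_iff inner_axis)

lemma sum_Basis_axis:
  fixes f :: "real^3 \<Rightarrow> real^3"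
  shows "(\<Sum>b\<in>Basis. f b \<bullet> b) = (\<Sum>i\<in>UNIV. f (axis i 1) $ i)"
proof -
  have B: "(Basis :: (real^3) set) = (\<lambda>i. axis i 1) ` UNIV" by (auto simp: Basis_vec_def)
  have "inj (\<lambda>i. axis i 1 :: real^3)" by (auto simp: inj_on_def axis_eq_axis)
  then show ?thesis unfolding B by (subst sum.reindex) (simp_all add: inner_axis)
qed

text \<open>The derivative within \<open>I\<close> is unique because \<open>t\<close> is a limit
  point of \<open>I\<close>: a connected set with a second point has no isolated points. This covers
  one-sided derivatives at the end points.\<close>

lemma time_deriv_eqI:
  assumes "(f x has_real_derivative q) (at t within I)" "connected I" "t \<in> I" "s \<in> I" "s \<noteq> t"
  shows "time_deriv I f x t = q"
proof -
  have "t islimpt I" using assms by (intro connected_imp_perfect) auto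
  then show ?thesis
    using assms(1) unfolding time_deriv_def
    by (intro vector_derivative_within) (auto simp: trivial_limit_within has_real_derivative_iff_has_vector_derivative)
qed

text \<open>With \<open>q = sqrt (G / r)\<close> and \<open>w\<close> the value of
  \<open>Omega_star\<close>, one has \<open>q * w = \<Omega>\<close>. Each entry of the maximum in
  \<open>d_star\<close> serves one bound: \<open>2 * \<rho> / \<phi>\<close> the rotation
  coefficient, \<open>2 powr (1/4)\<close>, which is at least 1, the bound for
  \<open>\<Omega>\<close>, and \<open>sqrt r\<close> the bound for \<open>Z\<close>.\<close>

lemma chi_star_bounds:
  assumes U: "U \<noteq> {}" "open U" "bounded U"
    and par: "\<phi> > 0" "G > 0" "\<Omega> \<ge> 0" "\<rho> \<ge> 0" and k: "norm k = 1" and e0: "\<And>t. norm (e0 t) = 1"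
  defines "chi \<equiv> chi_star U \<phi> G \<Omega> \<rho>"
  shows "chi \<ge> 1" and "rot_R \<phi> \<Omega> \<rho> \<le> chi" and "\<Omega>\<^sup>2 \<le> chi\<^sup>2"
    and "x \<in> closure U \<Longrightarrow> norm (accel_Z G \<Omega> k e0 x t) \<le> chi\<^sup>2"
    and "norm (\<Omega>\<^sup>2 *\<^sub>R ((rot_J k ** rot_J k) *v h)) \<le> \<Omega>\<^sup>2 * norm h"
proof -
  define r where "r = r_zero U"
  have bdd: "bdd_above (norm ` closure U)"
  proof (rule bounded_imp_bdd_above)
    show "bounded (norm ` closure U)"
      using bounded_norm_comp[of "\<lambda>x. x" "closure U"] bounded_closure[OF U(3)] by simp
  qed
  have le_r: "norm x \<le> r" if "x \<in> closure U" for x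
    unfolding r_def r_zero_def using that by (intro cSUP_upper bdd)
  \<comment> \<open>A nonempty open set is not contained in the single point 0; without this the
    quotients by \<open>r\<close> would be meaningless.\<close>
  have r0: "r > 0"
  proof -
    have "\<not> U \<subseteq> {0}"
    proof
      assume "U \<subseteq> {0}"
      then have "U = {0}" using U(1) by auto
      then show False using U(2) not_open_singleton by metis
    qed
    then obtain x where x: "x \<in> U" "x \<noteq> 0" by auto
    then have "0 < norm x" by simp
    also have "\<dots> \<le> r" using x closure_subset by (intro le_r) auto
    finally show ?thesis .
  qed
  define q where "q = sqrt (G / r)"
  define w where "w = \<Omega> * sqrt (r / G)"
  have q0: "q > 0" using par r0 by (simp add: q_def)
  have w0: "w \<ge> 0" using par r0 by (simp add: w_def)
  have qw: "q * w = \<Omega>" using par r0 by (simp add: q_def w_def real_sqrt_mult[symmetric])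
  define d where "d = d_star U \<phi> G \<rho>"
  have d: "q * (2 * \<rho> / \<phi>) \<le> d" "q * sqrt r \<le> d" "q * 2 powr (1/4) \<le> d"
    unfolding d_def d_star_def q_def[unfolded r_def, symmetric] using q0 r_def by (intro mult_left_mono; simp)+
  have chi: "chi \<ge> 1" "d * (1 + w) \<le> chi" by (simp_all add: chi_def chi_star_def d_def w_def Omega_star_def r_def)
  have d0: "d \<ge> 0" using d(2) q0 r0 by (smt (verit) mult_nonneg_nonneg real_sqrt_ge_zero)
  have dw: "d * w \<le> chi" using chi d0 by (simp add: distrib_left)
  show "chi \<ge> 1" by (rule chi)
  have "rot_R \<phi> \<Omega> \<rho> = q * (2 * \<rho> / \<phi>) * w" by (simp add: rot_R_def qw[symmetric])
  also have "\<dots> \<le> d * w" using d w0 by (intro mult_right_mono) auto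
  finally show "rot_R \<phi> \<Omega> \<rho> \<le> chi" using dw by linarith
  have "\<Omega> * 1 \<le> \<Omega> * 2 powr (1/4)" using par by (intro mult_left_mono ge_one_powr_ge_zero) auto
  also have "\<dots> = q * 2 powr (1/4) * w" by (simp add: qw[symmetric])
  also have "\<dots> \<le> d * w" using d w0 by (intro mult_right_mono) auto
  finally have "\<Omega> \<le> chi" using dw by simp
  then show "\<Omega>\<^sup>2 \<le> chi\<^sup>2" using par by (intro power_mono) auto
  have JJ: "norm ((rot_J k ** rot_J k) *v h) \<le> norm h" for h
    using order_trans[OF norm_cross3_le[OF k, of "cross3 k h"] norm_cross3_le[OF k, of h]]
    by (simp add: matrix_vector_mul_assoc[symmetric] rot_J_mult)
  show "norm (\<Omega>\<^sup>2 *\<^sub>R ((rot_J k ** rot_J k) *v h)) \<le> \<Omega>\<^sup>2 * norm h"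
    using JJ[of h] by (simp add: mult_left_mono)
  assume x: "x \<in> closure U"
  have "norm (accel_Z G \<Omega> k e0 x t) \<le> norm (G *\<^sub>R e0 t) + norm (\<Omega>\<^sup>2 *\<^sub>R ((rot_J k ** rot_J k) *v x))"
    unfolding accel_Z_def by (metis norm_minus_cancel norm_triangle_ineq)
  also have "\<dots> \<le> G + \<Omega>\<^sup>2 * r"
    using par e0 order_trans[OF JJ[of x] le_r[OF x]] by (simp add: mult_left_mono)
  \<comment> \<open>\<open>\<Omega>\<^sup>2 * r\<close> is \<open>G * w\<^sup>2\<close> by the
    choice of \<open>w\<close>, and below \<open>G\<close> itself is the square of
    \<open>q * sqrt r\<close>.\<close>
  also have "\<dots> = G * (1 + w\<^sup>2)" using par r0 by (simp add: w_def power_mult_distrib distrib_left)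
  also have "\<dots> \<le> G * (1 + w)\<^sup>2" using par w0 by (intro mult_left_mono) (auto simp: power2_sum)
  also have "\<dots> = (q * sqrt r * (1 + w))\<^sup>2" using par r0 by (simp add: q_def power_mult_distrib)
  also have "\<dots> \<le> (d * (1 + w))\<^sup>2" using d q0 r0 w0 by (intro power_mono mult_right_mono) auto
  also have "\<dots> \<le> chi\<^sup>2" using chi d0 w0 by (intro power_mono) auto
  finally show "norm (accel_Z G \<Omega> k e0 x t) \<le> chi\<^sup>2" .
qed

lemma M_star_bounds:
  assumes U: "U \<noteq> {}" "bounded U" and T: "T > 0"
    and u: "continuous_on (closure U \<times> {0..T}) (\<lambda>(x, t). u x t)"
  shows "x \<in> U \<Longrightarrow> t \<in> {0..T} \<Longrightarrow> \<bar>u x t\<bar> \<le> M_star U T u" and "0 \<le> M_star U T u"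
proof -
  have "compact (closure U \<times> {0..T})" using U by (intro compact_Times) auto
  then have "compact ((\<lambda>(x, t). u x t) ` (closure U \<times> {0..T}))" using u by (intro compact_continuous_image)
  then obtain B where "\<forall>y\<in>(\<lambda>(x, t). u x t) ` (closure U \<times> {0..T}). norm y \<le> B"
    using compact_imp_bounded bounded_iff by metis
  then have bdd: "bdd_above ((\<lambda>(x, t). \<bar>u x t\<bar>) ` (U \<times> {0..T}))"
    using closure_subset[of U] by (intro bdd_aboveI[of _ B]) fastforce
  show *: "\<bar>u x t\<bar> \<le> M_star U T u" if "x \<in> U" "t \<in> {0..T}" for x t
    unfolding M_star_def using cSUP_upper[OF _ bdd, of "(x, t)"] that by auto
  obtain x where "x \<in> U" using U by auto
  from *[OF this, of 0] show "0 \<le> M_star U T u" using T by simp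
qed

section \<open>From the boundary value problem to the abstract flow\<close>

lemma cutoff_weight:
  fixes \<eta> :: "'a::euclidean_space \<Rightarrow> real"
  assumes "compact S" "S \<subseteq> U" "\<And>x. (\<eta> has_derivative (\<lambda>h. n x \<bullet> h)) (at x)" "continuous_on UNIV n" "\<And>x. x \<notin> S \<Longrightarrow> \<eta> x = 0"
  shows "C1_weight U \<eta> n S"
  unfolding C1_weight_def
proof (intro conjI allI impI assms)
  fix x assume x: "x \<notin> S"
  have "open (- S)" using compact_imp_closed[OF assms(1)] by (simp add: open_Compl)
  then have "(\<eta> has_derivative (\<lambda>h. 0)) (at x)"
    by (rule has_derivative_transform_within_open[OF has_derivative_const]) (use x assms(5) in auto)
  then have "(\<lambda>h. n x \<bullet> h) = (\<lambda>h. 0)" by (rule has_derivative_unique[OF assms(3)])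
  then have "n x \<bullet> n x = 0" by metis
  then show "n x = 0" by simp
qed

text \<open>The classical regularity provides the derivatives, the constitutive law the structure
  bounds. As \<open>1 + R\<close> is at most \<open>2 * chi\<close>, the factor
  \<open>(1 + R)\<^sup>2\<close> becomes \<open>4 * chi\<^sup>2\<close> and
  \<open>(1 + R) powr a\<close> at most \<open>4 * chi powr a\<close>, which explains the constant
  \<open>4 * C\<close>.\<close>

lemma ibvp_flow:
  assumes U: "U \<noteq> {}" "open U" "bounded U" "C1_boundary U" and a: "0 < a" "a < 1"
    and par: "0 < \<phi>" "\<phi> \<le> 1" "G > 0" "\<Omega> \<ge> 0" "\<rho> \<ge> 0" and k: "norm k = 1" and e0: "\<And>t. norm (e0 t) = 1" and T: "T > 0"
    and C: "C \<ge> 1" and law: "degenerate_law a C (rot_R \<phi> \<Omega> \<rho>) X DX"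
    and sol: "solves_ibvp U T \<phi> X (accel_Z G \<Omega> k e0) u0 \<psi> u" and M: "M_star U T u > 0"
  obtains P H qt where
    "flow U a (4 * C) (chi_star U \<phi> G \<Omega> \<rho>) (M_star U T u) \<phi> T X DX u P H qt (accel_Z G \<Omega> k e0)
      (\<lambda>h. \<Omega>\<^sup>2 *\<^sub>R ((rot_J k ** rot_J k) *v h))"
    "\<And>x t. x \<in> U \<Longrightarrow> t \<in> {0<..T} \<Longrightarrow> grad (\<lambda>y. u y t) x = P x t"
proof -
  have X_der: "\<And>y. (X has_derivative DX y) (at y)" and DX_cont: "\<And>h. continuous_on UNIV (\<lambda>y. DX y h)"
    using law by (simp_all add: degenerate_law_def)
  define chi where "chi = chi_star U \<phi> G \<Omega> \<rho>"
  define R where "R = rot_R \<phi> \<Omega> \<rho>"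
  define Z where "Z = accel_Z G \<Omega> k e0"
  define J where "J h = \<Omega>\<^sup>2 *\<^sub>R ((rot_J k ** rot_J k) *v h)" for h
  note chi = chi_star_bounds[OF U(1-3) par(1,3,4,5) k e0, folded chi_def]
  have R: "0 \<le> R" "R \<le> chi" using chi(2) par by (simp_all add: R_def) (simp add: rot_R_def)
  have C21: "C21_closure U {0<..T} u" and cu: "continuous_on (closure U \<times> {0..T}) (\<lambda>(x, t). u x t)"
    and pde: "\<forall>x\<in>U. \<forall>t\<in>{0<..T}. \<phi> * time_deriv {0<..T} u x t =
        divergence (\<lambda>y. X (grad (\<lambda>z. u z t) y + (u y t)\<^sup>2 *\<^sub>R Z y t)) x"
    using sol unfolding solves_ibvp_def Z_def by simp_all
  obtain P H qt where
    c: "continuous_on (closure U \<times> {0<..T}) (\<lambda>(x, t). P x t)"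
        "continuous_on (closure U \<times> {0<..T}) (\<lambda>(x, t). (H x t :: real^3^3))"
        "continuous_on (closure U \<times> {0<..T}) (\<lambda>(x, t). qt x t)"
    and dd: "\<forall>x\<in>U. \<forall>t\<in>{0<..T}.
           ((\<lambda>y. u y t) has_derivative (\<lambda>h. P x t \<bullet> h)) (at x) \<and>
           ((\<lambda>y. P y t) has_derivative (\<lambda>h. H x t *v h)) (at x) \<and>
           ((\<lambda>\<tau>. u x \<tau>) has_real_derivative qt x t) (at t within {0<..T})"
    using C21[unfolded C21_closure_def, THEN conjunct2] by (elim exE conjE) (rule that, (assumption)+)
  have du: "((\<lambda>y. u y t) has_derivative (\<lambda>h. P x t \<bullet> h)) (at x)"
    and dP: "((\<lambda>y. P y t) has_derivative (\<lambda>h. H x t *v h)) (at x)"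
    and dt: "(u x has_real_derivative qt x t) (at t within {0<..T})"
    if "x \<in> U" "t \<in> {0<..T}" for x t
    using bspec[OF bspec[OF dd that(1)] that(2)] by simp_all
  have gr: "grad (\<lambda>y. u y t) x = P x t" if "x \<in> U" "t \<in> {0<..T}" for x t
    by (rule grad_eqI[OF du[OF that]])
  have linH: "linear (\<lambda>A :: real^3^3. A *v h)" for h :: "real^3"
    by (rule linearI) (simp_all add: matrix_vector_mult_add_rdistrib scaleR_matrix_vector_assoc)
  have cH: "continuous_on (closure U \<times> {0<..T}) (\<lambda>(x, t). H x t *v h)" for h
    using bounded_linear.continuous_on[OF linear_conv_bounded_linear[THEN iffD1, OF linH] c(2)]
    by (simp add: case_prod_unfold)
  have linJ: "linear J"
    unfolding J_def[abs_def] by (rule linearI) (simp_all add: matrix_vector_right_distrib scaleR_add_right matrix_vector_mult_scaleR)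
  have dZ: "((\<lambda>x. Z x t) has_derivative J) (at x)" for x t
  proof -
    have "(J has_derivative J) (at x)" by (rule linear_imp_has_derivative[OF linJ])
    then have "((\<lambda>x. - (G *\<^sub>R e0 t) + J x) has_derivative (\<lambda>h. 0 + J h)) (at x)"
      by (intro has_derivative_add has_derivative_const)
    then show ?thesis by (simp add: Z_def accel_Z_def J_def[abs_def])
  qed
  have cZ: "continuous_on (closure U) (\<lambda>x. Z x t)" for t
    by (intro continuous_at_imp_continuous_on ballI has_derivative_continuous[OF dZ])
  have M1: "\<bar>u x t\<bar> \<le> M_star U T u" if "x \<in> U" "t \<in> {0..T}" for x t
    by (rule M_star_bounds(1)[OF U(1,3) T cu that])
  have k1: "C * (1 + R)\<^sup>2 \<le> 4 * C * chi\<^sup>2"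
  proof -
    have "C * (1 + R)\<^sup>2 \<le> C * (2 * chi)\<^sup>2" using C R chi(1) by (intro mult_left_mono power_mono) auto
    then show ?thesis by (simp add: power_mult_distrib)
  qed
  have k2: "C * (1 + R) powr a \<le> 4 * C * chi powr a"
  proof -
    have "C * (1 + R) powr a \<le> C * (2 * chi) powr a" using C R chi(1) a by (intro mult_left_mono powr_mono2) auto
    also have "\<dots> = 2 powr a * (C * chi powr a)" using chi(1) by (simp add: powr_mult)
    also have "\<dots> \<le> 4 * (C * chi powr a)" using C a powr_mono[of a 1 2] by (intro mult_right_mono) auto
    finally show ?thesis by simp
  qed
  \<comment> \<open>The factor \<open>z\<close> stands for an inner product, and the coefficient may
    be enlarged only once \<open>z \<ge> 0\<close> is known. The sign follows from the bound itself,
    whose left side is nonnegative.\<close>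
  have lower: "y \<le> 4 * C * chi\<^sup>2 * z" if "0 \<le> y" "y \<le> C * (1 + R)\<^sup>2 * z" for y z :: real
  proof -
    have "0 < C * (1 + R)\<^sup>2" using C R by simp
    then have "z \<ge> 0" using that by (smt (verit) mult_pos_neg)
    then show ?thesis using that mult_right_mono[OF k1] by (meson order_trans)
  qed
  have upper: "y \<le> 4 * C * chi powr a * z1 * z2" if "y \<le> C * (1 + R) powr a * z1 * z2" "0 \<le> z1" "0 \<le> z2" for y z1 z2 :: real
    using that(1) mult_right_mono[OF mult_right_mono[OF k2 that(2)] that(3)] by linarith
  note e = law[unfolded degenerate_law_def, folded R_def, THEN conjunct2, THEN conjunct2, rule_format]
  have X1: "(1 + norm y) powr (- a) * (norm y)\<^sup>2 \<le> 4 * C * chi\<^sup>2 * (X y \<bullet> y)" for y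
    using e[of y 0] by (intro lower) auto
  have X2: "norm (X y) \<le> 4 * C * chi powr a * (1 + norm y) powr (- a) * norm y" for y
    using e[of y 0] by (intro upper) auto
  have DX1: "(1 + norm y) powr (- a) * (norm h)\<^sup>2 \<le> 4 * C * chi\<^sup>2 * (DX y h \<bullet> h)" for y h
    using e[of y h] by (intro lower) auto
  have DX2: "norm (DX y h) \<le> 4 * C * chi powr a * (1 + norm y) powr (- a) * norm h" for y h
    using e[of y h] by (intro upper) auto
  have dom: "bounded_domain U"
    by (rule bounded_domain.intro) (use U negligible_frontier_C1_boundary[OF U(2,4)] in auto)
  have Zb: "norm (Z x t) \<le> chi\<^sup>2" if "x \<in> U" for x t
    unfolding Z_def by (rule chi(4)) (use that closure_subset in auto)
  have Jb: "norm (J h) \<le> chi\<^sup>2 * norm h" for h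
    unfolding J_def by (rule order_trans[OF chi(5) mult_right_mono[OF chi(3) norm_ge_zero]])
  have sl: "slice U a (4 * C) chi (M_star U T u) X DX (\<lambda>x. u x t) (\<lambda>x. P x t) (\<lambda>x h. H x t *v h) (\<lambda>x. Z x t) J"
    if t: "t \<in> {0<..T}" for t
  proof (rule slice.intro[OF dom], rule slice_axioms.intro)
    have t': "t \<in> {0..T}" using t by auto
    show "continuous_on (closure U) (\<lambda>x. u x t)" by (rule continuous_on_time_slice[OF cu t'])
    show "continuous_on (closure U) (\<lambda>x. H x t *v h)" for h by (rule continuous_on_time_slice[OF cH t])
    show "4 * C \<ge> 1" using C by simp
    show "\<bar>u x t\<bar> \<le> M_star U T u" if "x \<in> U" for x by (rule M1[OF that t'])
  qed (assumption | rule a chi(1) M X_der DX_cont X1 X2 DX1 DX2 cZ linJ dZ Zb Jb du[OF _ t] dP[OF _ t]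
      continuous_on_time_slice[OF c(1) t] matrix_vector_mul_linear)+
  have pde': "\<phi> * qt x t = slice.divV DX (\<lambda>x. u x t) (\<lambda>x. P x t) (\<lambda>x h. H x t *v h) (\<lambda>x. Z x t) J x"
    if x: "x \<in> U" and t: "t \<in> {0<..T}" for x t
  proof -
    interpret s: slice U a "4 * C" chi "M_star U T u" X DX "\<lambda>x. u x t" "\<lambda>x. P x t" "\<lambda>x h. H x t *v h" "\<lambda>x. Z x t" J
      by (rule sl[OF t])
    have "(s.V has_derivative s.DV x) (at x)" by (rule s.V_der[OF x])
    \<comment> \<open>\<open>grad\<close> agrees with \<open>P\<close> throughout the open set
      \<open>U\<close>, not merely at \<open>x\<close>, so the flux of the equation has the same
      derivative as \<open>s.V\<close>.\<close>
    then have "((\<lambda>y. X (grad (\<lambda>z. u z t) y + (u y t)\<^sup>2 *\<^sub>R Z y t)) has_derivative s.DV x) (at x)"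
      by (rule has_derivative_transform_within_open[OF _ U(2) x]) (simp add: s.V_def s.\<Phi>_def gr[OF _ t])
    from frechet_derivative_at[OF this]
    have "divergence (\<lambda>y. X (grad (\<lambda>z. u z t) y + (u y t)\<^sup>2 *\<^sub>R Z y t)) x = s.divV x"
      by (simp add: divergence_def s.divV_def sum_Basis_axis)
    \<comment> \<open>The witness for \<open>s\<close> is any other time of the interval; at
      \<open>t = T\<close> it must lie to the left.\<close>
    moreover have "time_deriv {0<..T} u x t = qt x t"
      by (rule time_deriv_eqI[where s = "if t = T then T / 2 else T", OF _ connected_Ioc]) (use dt[OF x t] t T in auto)
    ultimately show ?thesis using bspec[OF bspec[OF pde x] t] by simp
  qed
  have "flow U a (4 * C) chi (M_star U T u) \<phi> T X DX u P (\<lambda>x t h. H x t *v h) qt Z J"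
  proof (rule flow.intro[OF dom], rule flow_axioms.intro)
    show "4 * C \<ge> 1" using C by simp
  qed (assumption | rule a par chi(1) M T X_der DX_cont X1 X2 DX1 DX2 cu c cH cZ linJ dZ Zb Jb du dP dt M1 pde' matrix_vector_mul_linear)+
  then show ?thesis by (intro that[OF _ gr]) (simp_all add: chi_def Z_def J_def[abs_def])
qed

text \<open>The cutoff, the power \<open>m\<close> and the constant are fixed by \<open>U\<close>,
  \<open>U'\<close>, \<open>a\<close>, \<open>p\<close> and \<open>C\<close> before the physical
  data, the time horizon and the solution are introduced; this order makes the constant uniform. The
  result is a single bound for every \<open>p\<close>, in terms of \<open>N_zero\<close>.\<close>

lemma gradient_bound:
  assumes U: "U \<noteq> {}" "open U" "bounded U" "C1_boundary U"
    and U': "open U'" "compact (closure U')" "closure U' \<subseteq> U"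
    and a: "0 < a" "a < 1" and p: "p \<ge> 2" and C: "C \<ge> 1"
  shows "\<exists>C0>0. \<forall>k \<phi> G \<Omega> \<rho> e0 T T0 u0 \<psi> \<Psi> u X DX.
      norm (k :: real^3) = 1 \<longrightarrow> 0 < \<phi> \<longrightarrow> \<phi> \<le> 1 \<longrightarrow> G > 0 \<longrightarrow> \<Omega> \<ge> 0 \<longrightarrow> \<rho> \<ge> 0 \<longrightarrow> (\<forall>t. norm (e0 t) = 1) \<longrightarrow>
      0 < T0 \<longrightarrow> T0 < T \<longrightarrow> degenerate_law a C (rot_R \<phi> \<Omega> \<rho>) X DX \<longrightarrow>
      solves_ibvp U T \<phi> X (accel_Z G \<Omega> k e0) u0 \<psi> u \<longrightarrow>
      C1_closure U {0..T} \<Psi> \<longrightarrow> (\<forall>x\<in>frontier U. \<forall>t\<in>{0<..T}. \<Psi> x t = \<psi> x t) \<longrightarrow>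
      M_star U T u > 0 \<longrightarrow> (\<forall>t\<in>{T0..T}.
      \<phi> * (LINT x:U'|lborel. norm (grad (\<lambda>y. u y t) x) powr p) \<le>
        C0 * (chi_star U \<phi> G \<Omega> \<rho> powr ((4 + a) * (p + a + 2)) * (1 + inverse T0) powr (p + a - 1) *
          M_star U T u powr (p - 2) * (M_star U T u + 1) powr (p + 2)) * N_zero U T \<phi> u0 \<Psi> u)"
proof -
  obtain \<eta> n0 S Cn where \<eta>: "compact S" "S \<subseteq> U" "Cn \<ge> 0" "\<And>x. (\<eta> has_derivative (\<lambda>h. n0 x \<bullet> h)) (at x)"
    "continuous_on UNIV n0" "\<And>x. norm (n0 x) \<le> Cn" "\<And>x. 0 \<le> \<eta> x" "\<And>x. \<eta> x \<le> 1"
    "\<And>x. x \<in> closure U' \<Longrightarrow> \<eta> x = 1" "\<And>x. x \<notin> S \<Longrightarrow> \<eta> x = 0"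
    by (rule C1_cutoff[OF U'(2) U(2) U'(3)]) (rule that; assumption)
  have weight: "C1_weight U \<eta> n0 S" by (rule cutoff_weight) (fact \<eta>)+
  \<comment> \<open>An integer power at least \<open>p + 1\<close>: ordinary powers of the cutoff
    are easier to differentiate where it vanishes.\<close>
  define m where "m = nat \<lceil>p + 1\<rceil>"
  have m: "real m \<ge> p + 1" using p unfolding m_def by linarith
  have "4 * C \<ge> 1" using C by simp
  note final = total_constant_le[OF a p this of_nat_0_le_iff[of m] measure_nonneg[of lborel U], of Cn]
  obtain C0 where C0: "C0 > 0" "\<And>\<kappa> M \<tau> B2 Y ED T N0. \<kappa> \<ge> 1 \<Longrightarrow> M > 0 \<Longrightarrow> \<tau> \<ge> 1 \<Longrightarrow> 0 \<le> B2 \<Longrightarrow> B2 \<le> 2 * real m * \<tau> \<Longrightarrow>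
      0 \<le> Y \<Longrightarrow> 0 \<le> ED \<Longrightarrow> 0 \<le> T \<Longrightarrow> N0 = Y + T * M\<^sup>2 + ED \<Longrightarrow>
      4 * (4 * C) * \<kappa>\<^sup>2 * absorb_const a p (M\<^sup>2 * \<kappa>\<^sup>2) (1 / (16 * (1 + p)\<^sup>2 * (4 * C) * \<kappa>\<^sup>2 * M\<^sup>2))
          ((p + 3) * (4 * C) ^ 3 * \<kappa> powr (2 + 2 * a) * (10 * M\<^sup>2 * \<kappa> ^ 4 + (real m * Cn)\<^sup>2)) B2 *
        (Y / 2 + 2 * (4 * C) ^ 3 * \<kappa> powr (6 + 2 * a) * ((1 + M\<^sup>2) * M\<^sup>2 * measure lborel U * T + ED))
      + 2 * ((p + 3) * (4 * C) ^ 3 * \<kappa> powr (2 + 2 * a)) * \<kappa> ^ 4 * M powr (p + 2) * measure lborel U * T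
      \<le> C0 * (\<kappa> powr ((4 + a) * (p + a + 2)) * \<tau> powr (p + a - 1) * M powr (p - 2) * (M + 1) powr (p + 2)) * N0"
    by (rule final) (rule that; assumption)
  show ?thesis
  proof (rule exI[of _ "p * C0"], intro conjI allI impI ballI)
    show "p * C0 > 0" using p C0 by simp
    fix k :: "real^3" and \<phi> G \<Omega> \<rho> e0 T T0 u0 \<psi> \<Psi> u X DX t
    assume k: "norm k = 1" and par: "0 < \<phi>" "\<phi> \<le> 1" "G > 0" "\<Omega> \<ge> 0" "\<rho> \<ge> 0" and e0: "\<forall>t. norm (e0 t) = 1"
      and TT: "0 < T0" "T0 < T" and law: "degenerate_law a C (rot_R \<phi> \<Omega> \<rho>) X DX"
      and sol: "solves_ibvp U T \<phi> X (accel_Z G \<Omega> k e0) u0 \<psi> u"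
      and \<Psi>: "C1_closure U {0..T} \<Psi>" "\<forall>x\<in>frontier U. \<forall>t\<in>{0<..T}. \<Psi> x t = \<psi> x t"
      and M: "M_star U T u > 0" and t: "t \<in> {T0..T}"
    have T': "T > 0" using TT by simp
    obtain P H qt where fl: "flow U a (4 * C) (chi_star U \<phi> G \<Omega> \<rho>) (M_star U T u) \<phi> T X DX u P H qt (accel_Z G \<Omega> k e0)
        (\<lambda>h. \<Omega>\<^sup>2 *\<^sub>R ((rot_J k ** rot_J k) *v h))"
      and gr: "\<And>x t. x \<in> U \<Longrightarrow> t \<in> {0<..T} \<Longrightarrow> grad (\<lambda>y. u y t) x = P x t"
      by (rule ibvp_flow[OF U a par k e0[rule_format] T' C law sol M]) (rule that; assumption)
    interpret flow U a "4 * C" "chi_star U \<phi> G \<Omega> \<rho>" "M_star U T u" \<phi> T X DX u P H qt "accel_Z G \<Omega> k e0"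
      "\<lambda>h. \<Omega>\<^sup>2 *\<^sub>R ((rot_J k ** rot_J k) *v h)" by (rule fl)
    obtain g q where c\<Psi>: "continuous_on (closure U \<times> {0..T}) (\<lambda>(x, t). g x t)" "continuous_on (closure U \<times> {0..T}) (\<lambda>(x, t). q x t)"
      and dd: "\<forall>x\<in>U. \<forall>t\<in>{0..T}. ((\<lambda>y. \<Psi> y t) has_derivative (\<lambda>h. g x t \<bullet> h)) (at x) \<and>
           ((\<lambda>\<tau>. \<Psi> x \<tau>) has_real_derivative q x t) (at t within {0..T})"
      using \<Psi>(1)[unfolded C1_closure_def, THEN conjunct2] by (elim exE conjE) (rule that, (assumption)+)
    have c\<Psi>0: "continuous_on (closure U \<times> {0..T}) (\<lambda>(x, t). \<Psi> x t)" using \<Psi>(1) by (simp add: C1_closure_def)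
    have d\<Psi>: "((\<lambda>x. \<Psi> x t) has_derivative (\<lambda>h. g x t \<bullet> h)) (at x)" "(\<Psi> x has_real_derivative q x t) (at t within {0..T})"
      if "x \<in> U" "t \<in> {0..T}" for x t
      using bspec[OF bspec[OF dd that(1)] that(2)] by simp_all
    have fr: "\<Psi> x t = u x t" if "x \<in> frontier U" "t \<in> {0<..T}" for x t
      using \<Psi>(2) sol that by (simp add: solves_ibvp_def)
    define D where "D t = I (\<lambda>x. (norm (g x t))\<^sup>2 + \<phi> * \<bar>q x t\<bar>\<^sup>2 + \<phi> * (\<Psi> x t)\<^sup>2)" for t
    \<comment> \<open>With \<open>\<delta> = T0 / 2\<close> the time cutoff has slope at most
      \<open>2 / T0\<close> for every \<open>t \<ge> T0\<close>; this is the origin of the factor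
      \<open>2 * real m\<close> in \<open>B2\<close>.\<close>
    have \<delta>: "0 < T0 / 2" "T0 / 2 < t" "t \<le> T" using TT t by auto
    note est = flow_estimate[OF p m weight \<eta>(7,8,6) c\<Psi>0 c\<Psi> d\<Psi> fr \<delta>, folded D_def]
    have D0: "D t \<ge> 0" for t unfolding D_def using par by (intro I_nonneg) auto
    have E: "E_star U T \<phi> \<Psi> = integral {0..T} D"
    proof -
      have "E_star U T \<phi> \<Psi> = (LINT t:{0..T}|lborel. D t)"
        unfolding E_star_def D_def
      proof (rule set_lebesgue_integral_cong, simp, intro allI impI I_cong)
        fix t x assume "t \<in> {0..T}" and x: "x \<in> U"
        moreover from this have "time_deriv {0..T} \<Psi> x t = q x t"
          by (intro time_deriv_eqI[where s = "if t = T then 0 else T"] d\<Psi> connected_Icc) (use T' in auto)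
        ultimately show "(norm (grad (\<lambda>y. \<Psi> y t) x))\<^sup>2 + \<phi> * \<bar>time_deriv {0..T} \<Psi> x t\<bar>\<^sup>2 + \<phi> * (\<Psi> x t)\<^sup>2 =
          (norm (g x t))\<^sup>2 + \<phi> * \<bar>q x t\<bar>\<^sup>2 + \<phi> * (\<Psi> x t)\<^sup>2"
          by (simp add: grad_eqI[OF d\<Psi>(1)])
      qed
      \<comment> \<open>\<open>D\<close> is continuous, so the Lebesgue integral in
        \<open>E_star\<close> equals the gauge integral in \<open>flow_estimate\<close>.\<close>
      also have "\<dots> = integral {0..T} D"
        by (rule set_borel_integral_eq_integral(2)) (rule borel_integrable_compact[OF compact_Icc est(1), folded set_integrable_def])
      finally show ?thesis .
    qed
    define Y where "Y = \<phi> * I (\<lambda>x. (u x 0 - \<Psi> x 0)\<^sup>2)"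
    have Y0: "Y \<ge> 0" unfolding Y_def using par by (intro mult_nonneg_nonneg I_nonneg) auto
    have L2: "\<phi> * (L2_norm_on U (\<lambda>x. u0 x - \<Psi> x 0))\<^sup>2 = Y"
    proof -
      have "(L2_norm_on U (\<lambda>x. u0 x - \<Psi> x 0))\<^sup>2 = I (\<lambda>x. \<bar>u0 x - \<Psi> x 0\<bar>\<^sup>2)"
        unfolding L2_norm_on_def by (intro real_sqrt_pow2 I_nonneg) auto
      also have "\<dots> = I (\<lambda>x. (u x 0 - \<Psi> x 0)\<^sup>2)"
        by (rule I_cong) (use sol in \<open>simp add: solves_ibvp_def\<close>)
      finally show ?thesis by (simp add: Y_def)
    qed
    have N0: "N_zero U T \<phi> u0 \<Psi> u = Y + T * (M_star U T u)\<^sup>2 + integral {0..T} D"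
      by (simp add: N_zero_def L2 E)
    have ED: "0 \<le> integral {0..T} D"
      by (rule integral_nonneg[OF integrable_continuous_interval[OF est(1)] D0])
    have tau: "1 + inverse T0 \<ge> 1" using TT by simp
    have B2: "0 \<le> real m / (t - T0 / 2)" "real m / (t - T0 / 2) \<le> 2 * real m * (1 + inverse T0)"
    proof -
      have "real m / (t - T0 / 2) \<le> real m / (T0 / 2)" using TT t by (intro divide_left_mono) auto
      also have "\<dots> = 2 * real m * inverse T0" using TT by (simp add: field_simps)
      also have "\<dots> \<le> 2 * real m * (1 + inverse T0)" by (intro mult_left_mono) auto
      finally show "real m / (t - T0 / 2) \<le> 2 * real m * (1 + inverse T0)" .
    qed (use TT t in auto)
    let ?R = "chi_star U \<phi> G \<Omega> \<rho> powr ((4 + a) * (p + a + 2)) * (1 + inverse T0) powr (p + a - 1) *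
          M_star U T u powr (p - 2) * (M_star U T u + 1) powr (p + 2)"
    have main: "\<phi> / p * I (\<lambda>x. norm (P x t) powr p * \<eta> x ^ m) \<le> C0 * ?R * N_zero U T \<phi> u0 \<Psi> u"
    proof -
      have Y2: "\<phi> / 2 * I (\<lambda>x. (u x 0 - \<Psi> x 0)\<^sup>2) = Y / 2" by (simp add: Y_def)
      show ?thesis
        by (rule order_trans[OF est(2)[unfolded Y2] C0(2)[OF \<kappa> M tau B2 Y0 ED less_imp_le[OF T'] N0]])
    qed
    have tT: "t \<in> {0<..T}" using t TT by auto
    \<comment> \<open>The cutoff equals 1 on \<open>U'\<close> and the integrand on the right is
      nonnegative. The comparison asks for integrability of the right side only.\<close>
    have "(LINT x:U'|lborel. norm (grad (\<lambda>y. u y t) x) powr p) \<le> I (\<lambda>x. norm (P x t) powr p * \<eta> x ^ m)"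
      unfolding set_lebesgue_integral_def
    proof (rule integral_mono')
      interpret s: slice U a "4 * C" "chi_star U \<phi> G \<Omega> \<rho>" "M_star U T u" X DX "\<lambda>x. u x t" "\<lambda>x. P x t" "\<lambda>x. H x t" "\<lambda>x. accel_Z G \<Omega> k e0 x t"
        "\<lambda>h. \<Omega>\<^sup>2 *\<^sub>R ((rot_J k ** rot_J k) *v h)" by (rule slice_at[OF tT])
      have c1: "continuous_on (closure U) \<eta>"
        by (intro continuous_at_imp_continuous_on ballI has_derivative_continuous[OF \<eta>(4)])
      have c2: "continuous_on (closure U) (\<lambda>x. norm (P x t) powr p)"
      proof -
        have "continuous_on (closure U) (\<lambda>x. fpow p (norm (P x t)) * (norm (P x t))\<^sup>2)"
          by (intro continuous_intros continuous_on_compose2[OF fpow_cont[OF p]] s.cont_q) auto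
        then show ?thesis by (simp add: fpow_square)
      qed
      have "continuous_on (closure U) (\<lambda>x. norm (P x t) powr p * \<eta> x ^ m)"
        by (rule continuous_on_mult[OF c2 continuous_on_power[OF c1]])
      from int_ok[OF this] show "integrable lborel (\<lambda>x. indicat_real U x *\<^sub>R (norm (P x t) powr p * \<eta> x ^ m))"
        by (simp only: set_integrable_def)
      fix x
      show "0 \<le> indicat_real U x *\<^sub>R (norm (P x t) powr p * \<eta> x ^ m)" using \<eta>(7)[of x] by simp
      show "indicat_real U' x *\<^sub>R norm (grad (\<lambda>y. u y t) x) powr p \<le> indicat_real U x *\<^sub>R (norm (P x t) powr p * \<eta> x ^ m)"
      proof (cases "x \<in> U'")
        case True
        then have xc: "x \<in> closure U'" using closure_subset by auto
        then have "x \<in> U" using U'(3) by auto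
        then show ?thesis using True \<eta>(9)[OF xc] gr[OF _ tT] by simp
      next
        case False
        then show ?thesis using \<eta>(7)[of x] by simp
      qed
    qed
    then have "\<phi> * (LINT x:U'|lborel. norm (grad (\<lambda>y. u y t) x) powr p) \<le> \<phi> * I (\<lambda>x. norm (P x t) powr p * \<eta> x ^ m)"
      using par by (intro mult_left_mono) auto
    also have "\<dots> = p * (\<phi> / p * I (\<lambda>x. norm (P x t) powr p * \<eta> x ^ m))" using p by simp
    also have "\<dots> \<le> p * (C0 * ?R * N_zero U T \<phi> u0 \<Psi> u)" using main p by (intro mult_left_mono) auto
    finally show "\<phi> * (LINT x:U'|lborel. norm (grad (\<lambda>y. u y t) x) powr p) \<le> p * C0 * ?R * N_zero U T \<phi> u0 \<Psi> u"
      by (simp only: mult.assoc)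
  qed
qed

section \<open>Assembly, with the vanishing solution treated apart\<close>

theorem theorem7p2:
  fixes N :: nat and A \<alpha> :: "nat \<Rightarrow> real" and a s :: real and U U' :: "(real^3) set"
  assumes N: "N \<ge> 1"
    and \<alpha>: "\<alpha> 0 = 0" "\<And>i. i < N \<Longrightarrow> \<alpha> i < \<alpha> (Suc i)"
    and A: "\<And>i. i \<le> N \<Longrightarrow> A i > 0"
    and a: "a = \<alpha> N / (1 + \<alpha> N)"
    and U: "U \<noteq> {}" "open U" "bounded U" "C1_boundary U"
    and U': "open U'" "compact (closure U')" "closure U' \<subseteq> U"
    and s: "s \<ge> 2"
  shows "\<exists>C>0. \<forall>(k :: real^3) \<phi> G \<Omega> \<rho> (e0 :: real \<Rightarrow> real^3) T T0
           (u0 :: real^3 \<Rightarrow> real) (\<psi> :: real^3 \<Rightarrow> real \<Rightarrow> real)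
           (\<Psi> :: real^3 \<Rightarrow> real \<Rightarrow> real) (u :: real^3 \<Rightarrow> real \<Rightarrow> real).
     norm k = 1 \<longrightarrow> 0 < \<phi> \<and> \<phi> \<le> 1 \<longrightarrow> G > 0 \<longrightarrow> \<Omega> \<ge> 0 \<longrightarrow> \<rho> \<ge> 0 \<longrightarrow>
     smooth_curve e0 \<and> (\<forall>t. norm (e0 t) = 1) \<longrightarrow>
     0 < T0 \<and> T0 < T \<longrightarrow>
     solves_ibvp U T \<phi> (flow_X N A \<alpha> (rot_R \<phi> \<Omega> \<rho>) k) (accel_Z G \<Omega> k e0) u0 \<psi> u \<longrightarrow>
     C1_closure U {0..T} \<Psi> \<and> (\<forall>x\<in>frontier U. \<forall>t\<in>{0<..T}. \<Psi> x t = \<psi> x t) \<longrightarrow>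
     (let chi = chi_star U \<phi> G \<Omega> \<rho>; M = M_star U T u;
          N0 = N_zero U T \<phi> u0 \<Psi> u; Ns = N_star U T \<phi> u0 \<Psi>; \<tau> = 1 + inverse T0
      in \<forall>t\<in>{T0..T}.
        \<phi> * (LINT x:U'|lborel. norm (grad (\<lambda>y. u y t) x) powr s) \<le> C *
          (if s = 2 then
             chi powr ((4 + a)\<^sup>2) * \<tau> powr (1 + a) * (M + 1) powr (2 * (3 + a)) *
             (M powr a * (M + 1) powr (2 + a) * Ns + N0)
           else if s \<le> 4 - a then
             chi powr ((4 + a) * (s + a + 2)) * \<tau> powr (s + a - 1) *
             M powr (s - 2) * (M + 1) powr (3 * s + 4 * a + 2) * Ns
           else if s \<le> 4 then
             chi powr ((4 + a) * (s + a + 4)) * \<tau> powr (s + a + 1) *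
             M powr (s - 2) * (M + 1) powr (3 * s + 4 * a + 10) * Ns
           else
             chi powr ((4 + a) * (s + a + 4)) * \<tau> powr (s + a + 1) *
             M\<^sup>2 * (M + 1) powr (4 * s + 4 * a + 6) * Ns) \<and>
        \<phi> * (LINT x:U'|lborel. norm (grad (\<lambda>y. u y t) x) powr s) \<le> C *
          (chi powr ((4 + a) * (s + a + 4)) * \<tau> powr (s + a + 1) *
           (M + 1) powr (4 * (s + a + 2)) * Ns))"
proof -
  interpret forchheimer N A \<alpha> a by (rule forchheimer.intro) (fact N \<alpha> A a)+
  obtain C where C: "C \<ge> 1"
    and law: "\<forall>R\<ge>0. \<forall>k. norm k = 1 \<longrightarrow> (\<exists>DX. degenerate_law a C R (flow_X N A \<alpha> R k) DX)"
    using flow_X_estimates by (elim exE conjE)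
  from gradient_bound[OF U U' a_pos a_less_1 s C]
  obtain C0 where C0: "C0 > 0" and bound: "\<forall>k \<phi> G \<Omega> \<rho> e0 T T0 u0 \<psi> \<Psi> u X DX.
      norm (k :: real^3) = 1 \<longrightarrow> 0 < \<phi> \<longrightarrow> \<phi> \<le> 1 \<longrightarrow> G > 0 \<longrightarrow> \<Omega> \<ge> 0 \<longrightarrow> \<rho> \<ge> 0 \<longrightarrow> (\<forall>t. norm (e0 t) = 1) \<longrightarrow>
      0 < T0 \<longrightarrow> T0 < T \<longrightarrow> degenerate_law a C (rot_R \<phi> \<Omega> \<rho>) X DX \<longrightarrow>
      solves_ibvp U T \<phi> X (accel_Z G \<Omega> k e0) u0 \<psi> u \<longrightarrow>
      C1_closure U {0..T} \<Psi> \<longrightarrow> (\<forall>x\<in>frontier U. \<forall>t\<in>{0<..T}. \<Psi> x t = \<psi> x t) \<longrightarrow>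
      M_star U T u > 0 \<longrightarrow> (\<forall>t\<in>{T0..T}.
      \<phi> * (LINT x:U'|lborel. norm (grad (\<lambda>y. u y t) x) powr s) \<le>
        C0 * (chi_star U \<phi> G \<Omega> \<rho> powr ((4 + a) * (s + a + 2)) * (1 + inverse T0) powr (s + a - 1) *
          M_star U T u powr (s - 2) * (M_star U T u + 1) powr (s + 2)) * N_zero U T \<phi> u0 \<Psi> u)"
    by (elim exE conjE)
  show ?thesis
  proof (rule exI[of _ C0], intro conjI allI impI C0)
    fix k :: "real^3" and \<phi> G \<Omega> \<rho> and e0 :: "real \<Rightarrow> real^3" and T T0
      and u0 :: "real^3 \<Rightarrow> real" and \<psi> \<Psi> u :: "real^3 \<Rightarrow> real \<Rightarrow> real"
    assume k: "norm k = 1" and \<phi>: "0 < \<phi> \<and> \<phi> \<le> 1" and par: "G > 0" "\<Omega> \<ge> 0" "\<rho> \<ge> 0"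
      and e0: "smooth_curve e0 \<and> (\<forall>t. norm (e0 t) = 1)" and T: "0 < T0 \<and> T0 < T"
      and sol: "solves_ibvp U T \<phi> (flow_X N A \<alpha> (rot_R \<phi> \<Omega> \<rho>) k) (accel_Z G \<Omega> k e0) u0 \<psi> u"
      and \<Psi>: "C1_closure U {0..T} \<Psi> \<and> (\<forall>x\<in>frontier U. \<forall>t\<in>{0<..T}. \<Psi> x t = \<psi> x t)"
    define chi where "chi = chi_star U \<phi> G \<Omega> \<rho>"
    define M where "M = M_star U T u"
    define N0 where "N0 = N_zero U T \<phi> u0 \<Psi> u"
    define Ns where "Ns = N_star U T \<phi> u0 \<Psi>"
    define \<tau> where "\<tau> = 1 + inverse T0"
    have cu: "continuous_on (closure U \<times> {0..T}) (\<lambda>(x, t). u x t)" using sol by (simp add: solves_ibvp_def)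
    have T': "T > 0" using T by simp
    have e0': "norm (e0 t) = 1" for t using e0 by blast
    have M0: "M \<ge> 0" unfolding M_def by (rule M_star_bounds(2)[OF U(1,3) T' cu])
    have chi: "chi \<ge> 1" unfolding chi_def using \<phi> by (intro chi_star_bounds(1)[OF U(1-3) _ par k e0']) auto
    have tau: "\<tau> \<ge> 1" using T by (simp add: \<tau>_def)
    define L where "L = \<phi> * (L2_norm_on U (\<lambda>x. u0 x - \<Psi> x 0))\<^sup>2"
    define E where "E = E_star U T \<phi> \<Psi>"
    have LE: "L \<ge> 0" "E \<ge> 0"
      unfolding L_def E_def E_star_def set_lebesgue_integral_def using \<phi>
      by (auto intro!: mult_nonneg_nonneg integral_nonneg_AE Bochner_Integration.integral_nonneg)
    have NN: "N0 = L + T * M\<^sup>2 + E" "Ns = L + T + E"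
      by (simp_all add: N0_def Ns_def N_zero_def N_star_def L_def E_def M_def)
    have Ns: "Ns \<ge> 0" and N0: "0 \<le> N0" using LE T' by (simp_all add: NN)
    \<comment> \<open>The summand \<open>T * M\<^sup>2\<close> is compared with
      \<open>(M + 1)\<^sup>2 * T\<close>, the other two with themselves times a factor that is at
      least 1.\<close>
    have N0s: "N0 \<le> (M + 1)\<^sup>2 * Ns"
    proof -
      have "1 \<le> (M + 1)\<^sup>2" "M\<^sup>2 \<le> (M + 1)\<^sup>2" using M0 by (auto intro: power_mono)
      then have "1 * (L + E) \<le> (M + 1)\<^sup>2 * (L + E)" "T * M\<^sup>2 \<le> T * (M + 1)\<^sup>2"
        using LE T' by (intro mult_right_mono mult_left_mono; simp)+
      then show ?thesis by (simp add: NN algebra_simps)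
    qed
    show "let chi = chi_star U \<phi> G \<Omega> \<rho>; M = M_star U T u;
          N0 = N_zero U T \<phi> u0 \<Psi> u; Ns = N_star U T \<phi> u0 \<Psi>; \<tau> = 1 + inverse T0
      in \<forall>t\<in>{T0..T}.
        \<phi> * (LINT x:U'|lborel. norm (grad (\<lambda>y. u y t) x) powr s) \<le> C0 *
          (if s = 2 then
             chi powr ((4 + a)\<^sup>2) * \<tau> powr (1 + a) * (M + 1) powr (2 * (3 + a)) *
             (M powr a * (M + 1) powr (2 + a) * Ns + N0)
           else if s \<le> 4 - a then
             chi powr ((4 + a) * (s + a + 2)) * \<tau> powr (s + a - 1) *
             M powr (s - 2) * (M + 1) powr (3 * s + 4 * a + 2) * Ns
           else if s \<le> 4 then
             chi powr ((4 + a) * (s + a + 4)) * \<tau> powr (s + a + 1) *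
             M powr (s - 2) * (M + 1) powr (3 * s + 4 * a + 10) * Ns
           else
             chi powr ((4 + a) * (s + a + 4)) * \<tau> powr (s + a + 1) *
             M\<^sup>2 * (M + 1) powr (4 * s + 4 * a + 6) * Ns) \<and>
        \<phi> * (LINT x:U'|lborel. norm (grad (\<lambda>y. u y t) x) powr s) \<le> C0 *
          (chi powr ((4 + a) * (s + a + 4)) * \<tau> powr (s + a + 1) *
           (M + 1) powr (4 * (s + a + 2)) * Ns)"
      unfolding Let_def chi_def[symmetric] M_def[symmetric] N0_def[symmetric] Ns_def[symmetric] \<tau>_def[symmetric]
    proof (intro ballI)
      fix t assume t: "t \<in> {T0..T}"
      define V where "V = \<phi> * (LINT x:U'|lborel. norm (grad (\<lambda>y. u y t) x) powr s)"
      show "V \<le> C0 *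
          (if s = 2 then
             chi powr ((4 + a)\<^sup>2) * \<tau> powr (1 + a) * (M + 1) powr (2 * (3 + a)) *
             (M powr a * (M + 1) powr (2 + a) * Ns + N0)
           else if s \<le> 4 - a then
             chi powr ((4 + a) * (s + a + 2)) * \<tau> powr (s + a - 1) *
             M powr (s - 2) * (M + 1) powr (3 * s + 4 * a + 2) * Ns
           else if s \<le> 4 then
             chi powr ((4 + a) * (s + a + 4)) * \<tau> powr (s + a + 1) *
             M powr (s - 2) * (M + 1) powr (3 * s + 4 * a + 10) * Ns
           else
             chi powr ((4 + a) * (s + a + 4)) * \<tau> powr (s + a + 1) *
             M\<^sup>2 * (M + 1) powr (4 * s + 4 * a + 6) * Ns) \<and>
        V \<le> C0 *
          (chi powr ((4 + a) * (s + a + 4)) * \<tau> powr (s + a + 1) *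
           (M + 1) powr (4 * (s + a + 2)) * Ns)"
      proof (cases "M = 0")
        \<comment> \<open>Here \<open>u\<close> vanishes on \<open>U\<close> at all times
          considered, so the left side is 0 while all terms on the right are nonnegative.\<close>
        case True
        have "grad (\<lambda>y. u y t) x = 0" if x: "x \<in> U" for x
        proof (rule grad_eqI)
          have "((\<lambda>y. u y t) has_derivative (\<lambda>h. 0)) (at x)"
          proof (rule has_derivative_transform_within_open[OF has_derivative_const U(2) x])
            fix y assume "y \<in> U"
            with M_star_bounds(1)[OF U(1,3) T' cu, of y t] t T True show "0 = u y t" by (simp add: M_def)
          qed
          then show "((\<lambda>y. u y t) has_derivative (\<lambda>h. 0 \<bullet> h)) (at x)" by simp
        qed
        moreover have "x \<in> U" if "x \<in> U'" for x using that U'(3) closure_subset by blast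
        ultimately have "(LINT x:U'|lborel. norm (grad (\<lambda>y. u y t) x) powr s) = (LINT x:U'|lborel. 0)"
          by (intro set_lebesgue_integral_cong) (use U' in auto)
        then have "V = 0" by (simp add: V_def set_lebesgue_integral_def)
        then show ?thesis using C0 Ns N0 M0 by auto
      next
        case False
        then have M: "M > 0" using M0 by simp
        have R: "rot_R \<phi> \<Omega> \<rho> \<ge> 0" using \<phi> par by (simp add: rot_R_def)
        from law[rule_format, OF R k] obtain DX where DX: "degenerate_law a C (rot_R \<phi> \<Omega> \<rho>) (flow_X N A \<alpha> (rot_R \<phi> \<Omega> \<rho>) k) DX" ..
        note V = bound[rule_format, OF k \<phi>[THEN conjunct1] \<phi>[THEN conjunct2] par e0' T[THEN conjunct1] T[THEN conjunct2]
            DX sol \<Psi>[THEN conjunct1] \<Psi>[THEN conjunct2, rule_format] M[unfolded M_def] t,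
            folded chi_def M_def N0_def \<tau>_def V_def]
        show ?thesis
          using exponent_cases[OF a_pos a_less_1 s chi tau M Ns N0 N0s V] C0 by (intro conjI) simp_all
      qed
    qed
  qed
qed

end
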